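(* Let $\Omega$, $W$, $m$ satisfy the standing assumptions listed in the context and let $r_0:=(1-m)/2$. Let $E_0\subset\Omega$ be a volume-constrained global perimeter minimizer with $\mathcal{L}^n(E_0)=r_0$, i.e. $\mathcal{L}^n(E_0)=r_0$ and $P(E_0;\Omega)=\mathcal{I}_\Omega(r_0)$. Suppose that $\mathcal{I}_\Omega$ admits a Taylor expansion of order two at $r_0$. For all sufficiently small $\varepsilon>0$ let $u_{0,\varepsilon}\in L^\infty(\Omega)$ with $\int_\Omega u_{0,\varepsilon}\,dx=m$ be such that $$u_{0,\varepsilon}\to u_{E_0}\ \text{ in } L^1(\Omega)\ \text{ as }\varepsilon\to0^+,\qquad \mathcal{G}_\varepsilon[u_{0,\varepsilon}]\le \mathcal{G}_0[u_{E_0}]+C\varepsilon$$ for some constant $C>0$ independent of $\varepsilon$. Let $u_\varepsilon$ be a solution of the nonlocal Allen--Cahn problem with initial datum $u_{0,\varepsilon}$. Then for every $M>0$ $$\sup_{0\le t\le M\varepsilon^{-1}}\|u_\varepsilon(t)-u_{E_0}\|_{L^2(\Omega)}\to0\quad\text{as }\varepsilon\to0^+.$$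
   Context: Standing assumptions. $2\le n\le 7$; $\Omega\subset\mathbb{R}^n$ is open, bounded, connected, $\mathcal{L}^n(\Omega)=1$, and $\partial\Omega$ is of class $C^{4,\sigma}$ for some $\sigma\in(0,1]$. The potential $W:\mathbb{R}\to[0,\infty)$ is of class $C^2$, has exactly two zeros, $-1$ and $1$; $W''(-1)=W''(1)>0$; $W'$ has exactly three zeros $-1<c<1$, and $W''(c)<0$; $\liminf_{|s|\to\infty}|W'(s)|=\infty$. The mass satisfies $m\in(-1,1)$. Notation. $P(E;\Omega)$ is the relative perimeter of $E$ in $\Omega$. For a Borel set $E_0\subset\Omega$, $u_{E_0}:=-\chi_{E_0}+\chi_{\Omega\setminus E_0}$. The isoperimetric function is $\mathcal{I}_\Omega(r):=\inf\{P(E;\Omega): E\subset\Omega\text{ Borel},\ \mathcal{L}^n(E)=r\}$, $r\in[0,1]$. A function $\mathcal{I}$ admits a Taylor expansion of order two at $r_0$ if it is differentiable at $r_0$ and there are $\varsigma\in(0,1]$ and a neighborhood $U$ of $r_0$ with $\mathcal{I}(r)=\mathcal{I}(r_0)+\mathcal{I}'(r_0)(r-r_0)+O(|r-r_0|^{1+\varsigma})$ for all $r\in U$. Energies. For $u\in L^1(\Omega)$, $\mathcal{G}_\varepsilon[u]:=\int_\Omega\big(\frac1\varepsilon W(u)+\frac\varepsilon2|\nabla u|^2\big)dx$ if $u\in H^1(\Omega)$ and $\int_\Omega u\,dx=m$, and $\mathcal{G}_\varepsilon[u]:=\infty$ otherwise. $\mathcal{G}_0[u]:=\sqrt2\,c_W\,P(\{u=-1\};\Omega)$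 if $u\in BV(\Omega;\{-1,1\})$ and $\int_\Omega u\,dx=m$, and $\mathcal{G}_0[u]:=\infty$ otherwise, where $c_W:=\int_{-1}^1W^{1/2}(s)\,ds$. Nonlocal Allen--Cahn problem: $\partial_tu_\varepsilon=\varepsilon^2\Delta u_\varepsilon-W'(u_\varepsilon)+\varepsilon\lambda_\varepsilon$ in $\Omega\times(0,\infty)$, $\partial u_\varepsilon/\partial\nu=0$ on $\partial\Omega\times(0,\infty)$, $u_\varepsilon(\cdot,0)=u_{0,\varepsilon}$, with $\lambda_\varepsilon(t)=\frac{1}{\varepsilon\mathcal{L}^n(\Omega)}\int_\Omega W'(u_\varepsilon(x,t))\,dx$. A solution is a (weak) solution $u_\varepsilon\in C([0,\infty);L^2(\Omega))$ such that for every $T>0$, $u_\varepsilon\in L^\infty(\Omega\times(0,T))\cap L^2(0,T;H^1(\Omega))$ and $\partial_tu_\varepsilon\in L^2(0,T;(H^1(\Omega))')$. *)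

theory Defs
  imports "HOL-Analysis.Analysis"
begin

section \<open>Classical smoothness and domains with Hoelder boundary\<close>

definition partial_deriv :: "'a::euclidean_space \<Rightarrow> ('a \<Rightarrow> real) \<Rightarrow> 'a \<Rightarrow> real" where
  "partial_deriv b f x = frechet_derivative f (at x) b"

text \<open>The following two predicates are meant for open sets \<open>S\<close>.\<close>

primrec C_k_on :: "nat \<Rightarrow> ('a::euclidean_space \<Rightarrow> real) \<Rightarrow> 'a set \<Rightarrow> bool" where
  "C_k_on 0 f S \<longleftrightarrow> continuous_on S f"
| "C_k_on (Suc k) f S \<longleftrightarrow>
     (\<forall>x\<in>S. f differentiable (at x)) \<and> (\<forall>b\<in>Basis. C_k_on k (partial_deriv b f) S)"

primrec C_holder_on :: "nat \<Rightarrow> real \<Rightarrow> ('a::euclidean_space \<Rightarrow> real) \<Rightarrow> 'a set \<Rightarrow> bool" where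
  "C_holder_on 0 \<sigma> f S \<longleftrightarrow>
     (\<exists>L. \<forall>x\<in>S. \<forall>y\<in>S. \<bar>f x - f y\<bar> \<le> L * dist x y powr \<sigma>)"
| "C_holder_on (Suc k) \<sigma> f S \<longleftrightarrow>
     (\<forall>x\<in>S. f differentiable (at x)) \<and> (\<forall>b\<in>Basis. C_holder_on k \<sigma> (partial_deriv b f) S)"

text \<open>Near each boundary point, after a rigid motion, \<open>\<Omega>\<close> is the region strictly above the graph
  of a function of \<open>n - 1\<close> variables. The rigid motion is encoded by the unit vector \<open>\<nu>\<close> of the
  vertical direction, and a function on the hyperplane orthogonal to \<open>\<nu>\<close> by a function on the
  whole space that is constant in direction \<open>\<nu>\<close>.\<close>

definition C_holder_boundary :: "nat \<Rightarrow> real \<Rightarrow> 'a::euclidean_space set \<Rightarrow> bool" where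
  "C_holder_boundary k \<sigma> \<Omega> \<longleftrightarrow>
     (\<forall>x0\<in>frontier \<Omega>. \<exists>r>0. \<exists>\<nu> \<gamma>. norm \<nu> = 1 \<and>
        (\<forall>x t. \<gamma> (x + t *\<^sub>R \<nu>) = \<gamma> x) \<and> C_holder_on k \<sigma> \<gamma> UNIV \<and>
        \<Omega> \<inter> ball x0 r = {x \<in> ball x0 r. \<gamma> x < x \<bullet> \<nu>})"

text \<open>Compactly supported functions on \<open>\<Omega>\<close> are identified with their extensions by zero.\<close>

definition compactly_supported_in :: "'a::euclidean_space set \<Rightarrow> ('a \<Rightarrow> 'b::zero) \<Rightarrow> bool" where
  "compactly_supported_in \<Omega> \<phi> \<longleftrightarrow>
     compact (closure {x. \<phi> x \<noteq> 0}) \<and> closure {x. \<phi> x \<noteq> 0} \<subseteq> \<Omega>"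

definition test_functions :: "'a::euclidean_space set \<Rightarrow> ('a \<Rightarrow> real) set" where
  "test_functions \<Omega> = {\<phi>. (\<forall>k. C_k_on k \<phi> UNIV) \<and> compactly_supported_in \<Omega> \<phi>}"

section \<open>Perimeter, functions of bounded variation, isoperimetric function\<close>

definition divergence :: "('a::euclidean_space \<Rightarrow> 'a) \<Rightarrow> 'a \<Rightarrow> real" where
  "divergence \<phi> x = (\<Sum>b\<in>Basis. partial_deriv b (\<lambda>y. \<phi> y \<bullet> b) x)"

definition test_fields :: "'a::euclidean_space set \<Rightarrow> ('a \<Rightarrow> 'a) set" where
  "test_fields \<Omega> = {\<phi>. (\<forall>b\<in>Basis. C_k_on 1 (\<lambda>x. \<phi> x \<bullet> b) UNIV) \<and>
     compactly_supported_in \<Omega> \<phi> \<and> (\<forall>x. norm (\<phi> x) \<le> 1)}"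

text \<open>In the two suprema below, negative integrals are truncated to 0. This does not change the
  supremum, because the zero field is admissible.\<close>

definition rel_perimeter :: "'a::euclidean_space set \<Rightarrow> 'a set \<Rightarrow> ennreal" where
  "rel_perimeter E \<Omega> =
     (SUP \<phi>\<in>test_fields \<Omega>. ennreal (\<integral>x. divergence \<phi> x \<partial>lebesgue_on (E \<inter> \<Omega>)))"

definition variation :: "('a::euclidean_space \<Rightarrow> real) \<Rightarrow> 'a set \<Rightarrow> ennreal" where
  "variation u \<Omega> =
     (SUP \<phi>\<in>test_fields \<Omega>. ennreal (\<integral>x. u x * divergence \<phi> x \<partial>lebesgue_on \<Omega>))"

definition BV :: "'a::euclidean_space set \<Rightarrow> ('a \<Rightarrow> real) set" where
  "BV \<Omega> = {u. integrable (lebesgue_on \<Omega>) u \<and> variation u \<Omega> < \<infinity>}"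

definition isoperimetric :: "'a::euclidean_space set \<Rightarrow> real \<Rightarrow> ennreal" where
  "isoperimetric \<Omega> r =
     (INF E\<in>{E. E \<in> sets borel \<and> E \<subseteq> \<Omega> \<and> measure lebesgue E = r}. rel_perimeter E \<Omega>)"

definition taylor_order_two :: "(real \<Rightarrow> real) \<Rightarrow> real \<Rightarrow> bool" where
  "taylor_order_two f r0 \<longleftrightarrow> f differentiable (at r0) \<and>
     (\<exists>\<tau>\<in>{0<..1}. \<exists>U K. open U \<and> r0 \<in> U \<and>
        (\<forall>r\<in>U. \<bar>f r - (f r0 + deriv f r0 * (r - r0))\<bar> \<le> K * \<bar>r - r0\<bar> powr (1 + \<tau>)))"

definition phase_function :: "'a set \<Rightarrow> 'a set \<Rightarrow> 'a \<Rightarrow> real" where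
  "phase_function \<Omega> E x = - indicator E x + indicator (\<Omega> - E) x"

section \<open>Lebesgue and Sobolev spaces\<close>

text \<open>Elements of these spaces are represented by functions, not by classes modulo null sets.\<close>

definition L2_space :: "'a::euclidean_space set \<Rightarrow> ('a \<Rightarrow> 'b::euclidean_space) set" where
  "L2_space \<Omega> = {u. u \<in> borel_measurable (lebesgue_on \<Omega>) \<and>
     integrable (lebesgue_on \<Omega>) (\<lambda>x. (norm (u x))\<^sup>2)}"

definition L2_norm :: "'a::euclidean_space set \<Rightarrow> ('a \<Rightarrow> 'b::euclidean_space) \<Rightarrow> real" where
  "L2_norm \<Omega> u = sqrt (\<integral>x. (norm (u x))\<^sup>2 \<partial>lebesgue_on \<Omega>)"

definition Linf_space :: "'a::euclidean_space set \<Rightarrow> ('a \<Rightarrow> real) set" where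
  "Linf_space \<Omega> = {u. u \<in> borel_measurable (lebesgue_on \<Omega>) \<and>
     (\<exists>K. AE x in lebesgue_on \<Omega>. \<bar>u x\<bar> \<le> K)}"

definition has_weak_gradient ::
  "'a::euclidean_space set \<Rightarrow> ('a \<Rightarrow> real) \<Rightarrow> ('a \<Rightarrow> 'a) \<Rightarrow> bool" where
  "has_weak_gradient \<Omega> u g \<longleftrightarrow> g \<in> L2_space \<Omega> \<and>
     (\<forall>\<phi>\<in>test_functions \<Omega>. \<forall>b\<in>Basis.
        (\<integral>x. u x * partial_deriv b \<phi> x \<partial>lebesgue_on \<Omega>) =
          - (\<integral>x. (g x \<bullet> b) * \<phi> x \<partial>lebesgue_on \<Omega>))"

definition H1_space :: "'a::euclidean_space set \<Rightarrow> ('a \<Rightarrow> real) set" where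
  "H1_space \<Omega> = {u \<in> L2_space \<Omega>. \<exists>g. has_weak_gradient \<Omega> u g}"

text \<open>For \<open>u\<close> in \<open>H1_space \<Omega>\<close>, \<open>\<Omega>\<close> open, the weak gradient is unique up to null sets.\<close>

definition weak_gradient :: "'a::euclidean_space set \<Rightarrow> ('a \<Rightarrow> real) \<Rightarrow> 'a \<Rightarrow> 'a" where
  "weak_gradient \<Omega> u = (SOME g. has_weak_gradient \<Omega> u g)"

definition H1_norm :: "'a::euclidean_space set \<Rightarrow> ('a \<Rightarrow> real) \<Rightarrow> real" where
  "H1_norm \<Omega> u = sqrt ((L2_norm \<Omega> u)\<^sup>2 + (L2_norm \<Omega> (weak_gradient \<Omega> u))\<^sup>2)"

text \<open>Bounded linear functionals on \<open>H1_space \<Omega>\<close>; their values off \<open>H1_space \<Omega>\<close> are irrelevant.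
  Linearity and boundedness force them to respect equality almost everywhere.\<close>

definition H1_dual :: "'a::euclidean_space set \<Rightarrow> (('a \<Rightarrow> real) \<Rightarrow> real) set" where
  "H1_dual \<Omega> = {F.
     (\<forall>f\<in>H1_space \<Omega>. \<forall>g\<in>H1_space \<Omega>. F (\<lambda>x. f x + g x) = F f + F g) \<and>
     (\<forall>f\<in>H1_space \<Omega>. \<forall>c. F (\<lambda>x. c * f x) = c * F f) \<and>
     (\<exists>K. \<forall>f\<in>H1_space \<Omega>. \<bar>F f\<bar> \<le> K * H1_norm \<Omega> f)}"

definition H1_dual_norm :: "'a::euclidean_space set \<Rightarrow> (('a \<Rightarrow> real) \<Rightarrow> real) \<Rightarrow> real" where
  "H1_dual_norm \<Omega> F = (SUP f\<in>{f \<in> H1_space \<Omega>. H1_norm \<Omega> f \<le> 1}. \<bar>F f\<bar>)"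

text \<open>The Bochner space \<open>L\<^sup>2(0,T;V)\<close> for a space \<open>V\<close> of real-valued functions with
  (semi)norm \<open>N\<close>: almost everywhere limits of simple functions, with square-integrable norm.
  Used with \<open>V\<close> being \<open>H1_space \<Omega>\<close> or \<open>H1_dual \<Omega>\<close>.\<close>

definition bochner_L2 ::
  "real \<Rightarrow> ('b \<Rightarrow> real) set \<Rightarrow> (('b \<Rightarrow> real) \<Rightarrow> real) \<Rightarrow> (real \<Rightarrow> 'b \<Rightarrow> real) \<Rightarrow> bool" where
  "bochner_L2 T V N f \<longleftrightarrow>
     (\<exists>s :: nat \<Rightarrow> real \<Rightarrow> 'b \<Rightarrow> real.
        (\<forall>k. finite (s k ` {0<..<T}) \<and> s k ` {0<..<T} \<subseteq> V \<and>
           (\<forall>v. {t\<in>{0<..<T}. s k t = v} \<in> sets lebesgue)) \<and>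
        (AE t in lebesgue_on {0<..<T}. (\<lambda>k. N (\<lambda>x. s k t x - f t x)) \<longlonglongrightarrow> 0)) \<and>
     (AE t in lebesgue_on {0<..<T}. f t \<in> V) \<and>
     (\<integral>\<^sup>+ t. ennreal ((N (f t))\<^sup>2) \<partial>lebesgue_on {0<..<T}) < \<infinity>"

section \<open>Potential and energies\<close>

definition admissible_potential :: "(real \<Rightarrow> real) \<Rightarrow> bool" where
  "admissible_potential W \<longleftrightarrow>
     (\<forall>s. W s \<ge> 0) \<and>
     (\<forall>s. W differentiable (at s)) \<and> (\<forall>s. deriv W differentiable (at s)) \<and>
     continuous_on UNIV (deriv (deriv W)) \<and>
     {s. W s = 0} = {-1, 1} \<and>
     deriv (deriv W) (-1) = deriv (deriv W) 1 \<and> deriv (deriv W) 1 > 0 \<and>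
     (\<exists>c. -1 < c \<and> c < 1 \<and> {s. deriv W s = 0} = {-1, c, 1} \<and> deriv (deriv W) c < 0) \<and>
     Liminf at_infinity (\<lambda>s. ereal \<bar>deriv W s\<bar>) = \<infinity>"

definition G_eps ::
  "'a::euclidean_space set \<Rightarrow> (real \<Rightarrow> real) \<Rightarrow> real \<Rightarrow> real \<Rightarrow> ('a \<Rightarrow> real) \<Rightarrow> ennreal" where
  "G_eps \<Omega> W m \<epsilon> u =
     (if u \<in> H1_space \<Omega> \<and> (\<integral>x. u x \<partial>lebesgue_on \<Omega>) = m
      then \<integral>\<^sup>+ x. ennreal (W (u x) / \<epsilon> + \<epsilon> / 2 * (norm (weak_gradient \<Omega> u x))\<^sup>2) \<partial>lebesgue_on \<Omega>
      else \<infinity>)"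

definition c_W :: "(real \<Rightarrow> real) \<Rightarrow> real" where
  "c_W W = integral {-1..1} (\<lambda>s. sqrt (W s))"

definition G_zero ::
  "'a::euclidean_space set \<Rightarrow> (real \<Rightarrow> real) \<Rightarrow> real \<Rightarrow> ('a \<Rightarrow> real) \<Rightarrow> ennreal" where
  "G_zero \<Omega> W m u =
     (if u \<in> BV \<Omega> \<and> (AE x in lebesgue_on \<Omega>. u x \<in> {-1, 1}) \<and> (\<integral>x. u x \<partial>lebesgue_on \<Omega>) = m
      then ennreal (sqrt 2 * c_W W) * rel_perimeter {x\<in>\<Omega>. u x = -1} \<Omega>
      else \<infinity>)"

section \<open>The nonlocal Allen--Cahn problem\<close>

definition lagrange_multiplier ::
  "'a::euclidean_space set \<Rightarrow> (real \<Rightarrow> real) \<Rightarrow> real \<Rightarrow> ('a \<Rightarrow> real) \<Rightarrow> real" where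
  "lagrange_multiplier \<Omega> W \<epsilon> v =
     1 / (\<epsilon> * measure lebesgue \<Omega>) * (\<integral>x. deriv W (v x) \<partial>lebesgue_on \<Omega>)"

text \<open>\<open>F\<close> is the distributional derivative of \<open>u\<close> on \<open>(0,T)\<close> with values in \<open>(H\<^sup>1)'\<close>, where
  \<open>u t\<close> acts on \<open>H\<^sup>1\<close> through the \<open>L\<^sup>2\<close> inner product.\<close>

definition has_time_derivative ::
  "'a::euclidean_space set \<Rightarrow> real \<Rightarrow> (real \<Rightarrow> 'a \<Rightarrow> real) \<Rightarrow>
     (real \<Rightarrow> ('a \<Rightarrow> real) \<Rightarrow> real) \<Rightarrow> bool" where
  "has_time_derivative \<Omega> T u F \<longleftrightarrow>
     (\<forall>\<psi>\<in>test_functions {0<..<T}. \<forall>\<phi>\<in>H1_space \<Omega>.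
        (\<integral>t. deriv \<psi> t * (\<integral>x. u t x * \<phi> x \<partial>lebesgue_on \<Omega>) \<partial>lebesgue_on {0<..<T}) =
          - (\<integral>t. \<psi> t * F t \<phi> \<partial>lebesgue_on {0<..<T}))"

text \<open>Testing with all of \<open>H\<^sup>1\<close>, not only with functions vanishing on the boundary, encodes the
  homogeneous Neumann condition.\<close>

definition nonlocal_AC_solution ::
  "'a::euclidean_space set \<Rightarrow> (real \<Rightarrow> real) \<Rightarrow> real \<Rightarrow> ('a \<Rightarrow> real) \<Rightarrow>
     (real \<Rightarrow> 'a \<Rightarrow> real) \<Rightarrow> bool" where
  "nonlocal_AC_solution \<Omega> W \<epsilon> u0 u \<longleftrightarrow>
     (\<forall>t\<ge>0. u t \<in> L2_space \<Omega>) \<and>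
     (\<forall>t0\<ge>0. ((\<lambda>t. L2_norm \<Omega> (\<lambda>x. u t x - u t0 x)) \<longlongrightarrow> 0) (at t0 within {0..})) \<and>
     (AE x in lebesgue_on \<Omega>. u 0 x = u0 x) \<and>
     (\<forall>T>0.
        (\<lambda>(t, x). u t x) \<in> Linf_space ({0<..<T} \<times> \<Omega>) \<and>
        bochner_L2 T (H1_space \<Omega>) (H1_norm \<Omega>) u \<and>
        (\<exists>F. bochner_L2 T (H1_dual \<Omega>) (H1_dual_norm \<Omega>) F \<and>
           has_time_derivative \<Omega> T u F \<and>
           (AE t in lebesgue_on {0<..<T}. \<forall>\<phi>\<in>H1_space \<Omega>.
              F t \<phi> =
                - \<epsilon>\<^sup>2 * (\<integral>x. weak_gradient \<Omega> (u t) x \<bullet> weak_gradient \<Omega> \<phi> x \<partial>lebesgue_on \<Omega>)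
                - (\<integral>x. deriv W (u t x) * \<phi> x \<partial>lebesgue_on \<Omega>)
                + \<epsilon> * lagrange_multiplier \<Omega> W \<epsilon> (u t) * (\<integral>x. \<phi> x \<partial>lebesgue_on \<Omega>))))"

end

theory Submission
  imports Defs
begin

text \<open>The proof is energetic and avoids spectral estimates. Multiply the Ginzburg--Landau energy by
\<open>\<epsilon>\<close>, which turns the equation into the mass constrained \<open>L\<^sup>2\<close> gradient flow of
\<open>E(v) = \<integral> (\<epsilon>\<^sup>2/2) |\<nabla>v|\<^sup>2 + W(v)\<close>. On the range of a bounded solution \<open>W\<close> is semiconvex, so the
flow satisfies an evolution variational inequality, and this inequality gives
\<open>|u(t) - u(0)|\<^sup>2 \<le> t (E(u(0)) - inf E)\<close>
with no loss depending on the semiconvexity constant: that constant enters only through increments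
of length \<open>h\<close>, and \<open>h\<close> tends to 0.

The infimum over functions of mass \<open>m\<close> is bounded below by \<open>\<epsilon> (G\<^sub>0 - C \<epsilon>)\<close>. By the coarea inequality
and the Modica--Mortola trick the energy dominates a weighted integral of \<open>I(|{v \<le> s}|)\<close> over the
levels \<open>s\<close>; since the isoperimetric function is differentiable at \<open>r0\<close> it lies above
\<open>I(r0) - L |r - r0|\<close>, and the deviation of the sublevel volumes from \<open>r0\<close> is controlled by
\<open>\<integral> ||v| - 1|\<close>, which the potential absorbs at cost \<open>O(\<epsilon>)\<close>. The initial energy exceeds \<open>\<epsilon> G\<^sub>0\<close> by at
most \<open>C \<epsilon>\<^sup>2\<close>, so for \<open>t \<le> M/\<epsilon>\<close> the displacement is \<open>|u(t) - u(0)|\<^sup>2 \<le> (M/\<epsilon>) O(\<epsilon>\<^sup>2) = O(\<epsilon>)\<close>.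

It remains to upgrade the \<open>L\<^sup>1\<close> convergence of the initial data to \<open>L\<^sup>2\<close>. The lower bound keeps the
part of the Dirichlet energy where \<open>|v| > 1\<close>, so that part is bounded uniformly in \<open>\<epsilon>\<close>, and an Ehrling
inequality on the domain, applied to a \<open>C\<^sup>1\<close> truncation of \<open>|v| - 1\<close>, excludes concentration.\<close>

abbreviation (input) leb :: "'a::euclidean_space set => 'a measure" where "leb == lebesgue_on"

section \<open>Smooth bump functions\<close>

lemma partial_deriv_eq:
 "(f has_derivative f') (at x) ==> partial_deriv b f x = f' b"
 unfolding partial_deriv_def using frechet_derivative_at by metis

lemma C_k_on_SucD: "C_k_on (Suc k) f UNIV ==> C_k_on k f UNIV"
proof (induction k arbitrary: f)
 case 0
 then show ?case
  by (auto intro!: differentiable_imp_continuous_on simp: differentiable_on_def)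
next
 case (Suc k)
 then show ?case
  by (metis C_k_on.simps(2))
qed

lemma C_k_on_continuous: "C_k_on k f UNIV ==> continuous_on UNIV f"
 by (induction k) (auto dest: C_k_on_SucD simp del: C_k_on.simps(2))

lemma C_k_on_const [simp]: "C_k_on k (%x. c) UNIV"
proof (induction k arbitrary: c)
 case (Suc k)
 have "partial_deriv b (%x. c) = (%x. 0)" for b :: 'a
  by (rule ext) (simp add: partial_deriv_eq[OF has_derivative_const])
 with Suc[of 0] show ?case by simp
qed simp

lemma C_k_on_add:
 "C_k_on k f UNIV ==> C_k_on k g UNIV ==> C_k_on k (%x. f x + g x) UNIV"
proof (induction k arbitrary: f g)
 case 0
 then show ?case by (auto intro: continuous_on_add)
next
 case (Suc k)
 have "partial_deriv b (%x. f x + g x) = (%x. partial_deriv b f x + partial_deriv b g x)" for b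
  using Suc.prems
  by (intro ext partial_deriv_eq[OF has_derivative_add, THEN trans])
   (auto simp: partial_deriv_def frechet_derivative_works[symmetric])
 with Suc show ?case by simp
qed

lemma C_k_on_mult:
 "C_k_on k f UNIV ==> C_k_on k g UNIV ==> C_k_on k (%x. f x * g x) UNIV"
proof (induction k arbitrary: f g)
 case 0
 then show ?case by (auto intro: continuous_on_mult)
next
 case (Suc k)
 have "partial_deriv b (%x. f x * g x) = (%x. f x * partial_deriv b g x + partial_deriv b f x * g x)" for b
  using Suc.prems
  by (intro ext partial_deriv_eq[OF has_derivative_mult, THEN trans])
   (auto simp: partial_deriv_def frechet_derivative_works[symmetric])
 moreover have "C_k_on k f UNIV" "C_k_on k g UNIV"
  using Suc.prems C_k_on_SucD by blast+
 ultimately show ?case using Suc by (auto intro!: C_k_on_add Suc.IH)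
qed

lemma C_k_on_prod:
 assumes "finite I" "!!i. i : I ==> C_k_on k (f i) UNIV"
 shows "C_k_on k (%x. \<Prod>i\<in>I. f i x) UNIV"
 using assms by (induction I rule: finite_induct) (auto intro!: C_k_on_mult)

text \<open>The family is closed under differentiation up to sums, so smoothness of the case \<open>k = 0\<close> follows
by induction on the order of the derivative. \<open>exp_bump 0\<close> is the usual flat function \<open>exp (- 1 / t)\<close>.\<close>

definition exp_bump :: "nat => real => real" where
 "exp_bump k t = (if t <= 0 then 0 else (1 / t) ^ k * exp (- (1 / t)))"

lemma exp_bump_limit: "((%t. exp_bump k t) \<longlongrightarrow> 0) (at 0)"
proof -
 have "((%x::real. x ^ k / exp x) \<longlongrightarrow> 0) at_top"
  by (rule tendsto_power_div_exp_0)
 then have "((%t. inverse t ^ k / exp (inverse t)) \<longlongrightarrow> 0) (at_right (0::real))"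
  by (rule filterlim_compose[OF _ filterlim_inverse_at_top_right])
 moreover have "eventually (%t. inverse t ^ k / exp (inverse t) = exp_bump k t) (at_right 0)"
  unfolding eventually_at_right_field
  by (intro exI[of _ 1]) (auto simp: exp_bump_def exp_minus field_simps)
 ultimately have "((%t. exp_bump k t) \<longlongrightarrow> 0) (at_right 0)"
  by (rule Lim_transform_eventually)
 moreover have "((%t. exp_bump k t) \<longlongrightarrow> 0) (at_left 0)"
  by (rule Lim_transform_eventually[OF tendsto_const])
   (auto simp: eventually_at_left_field exp_bump_def intro!: exI[of _ "-1"])
 ultimately show ?thesis by (simp add: filterlim_split_at_real)
qed

lemma exp_bump_has_derivative:
 "(exp_bump k has_real_derivative exp_bump (k + 2) t - real k * exp_bump (k + 1) t) (at t)"
proof -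
 consider "t < 0" | "t = 0" | "t > 0" by linarith
 then show ?thesis
 proof cases
  case 1
  have "((%t. 0) has_real_derivative 0) (at t)" by simp
  then have "(exp_bump k has_real_derivative 0) (at t)"
   by (rule has_field_derivative_transform_within_open[where S = "{..<0}"])
    (use 1 in \<open>auto simp: exp_bump_def\<close>)
  with 1 show ?thesis by (simp add: exp_bump_def)
 next
  case 2
  have "((%h. (exp_bump k (0 + h) - exp_bump k 0) / h) \<longlongrightarrow> 0) (at 0)"
  proof (rule Lim_transform_eventually[OF exp_bump_limit[of "k + 1"]])
   show "eventually (%x. exp_bump (k + 1) x = (exp_bump k (0 + x) - exp_bump k 0) / x) (at 0)"
    unfolding eventually_at_filter
    by (intro always_eventually) (auto simp: exp_bump_def)
  qed
  with 2 show ?thesis by (simp add: DERIV_def) (simp add: exp_bump_def)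
 next
  case 3
  have "((%t. (1 / t) ^ k * exp (- (1 / t))) has_real_derivative
    exp_bump (k + 2) t - real k * exp_bump (k + 1) t) (at t)"
   using 3
   by (auto intro!: derivative_eq_intros simp: exp_bump_def)
    (cases k; simp add: field_simps power2_eq_square)
  then show ?thesis
   by (rule has_field_derivative_transform_within_open[where S = "{0<..}"])
    (use 3 in \<open>auto simp: exp_bump_def\<close>)
 qed
qed

lemma C_k_on_exp_bump: "C_k_on j (%x. c * exp_bump k (\<alpha> * (x \<bullet> b) + \<beta>)) UNIV"
proof (induction j arbitrary: c k)
 case 0
 have "continuous_on UNIV (exp_bump k)"
  using exp_bump_has_derivative
  by (metis DERIV_continuous continuous_at_imp_continuous_on)
 then have "continuous_on UNIV (%x. exp_bump k (\<alpha> * (x \<bullet> b) + \<beta>))"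
  by (rule continuous_on_compose2) (auto intro!: continuous_intros)
 then show ?case
  by (simp add: continuous_on_mult_left)
next
 case (Suc j)
 let ?f = "%x. c * exp_bump k (\<alpha> * (x \<bullet> b) + \<beta>)"
 have *: "(?f has_derivative (%h. c * ((\<alpha> * (h \<bullet> b)) *
   (exp_bump (k + 2) (\<alpha> * (x \<bullet> b) + \<beta>) - real k * exp_bump (k + 1) (\<alpha> * (x \<bullet> b) + \<beta>))))) (at x)" for x
 proof -
  have "((%x. \<alpha> * (x \<bullet> b) + \<beta>) has_derivative (%h. \<alpha> * (h \<bullet> b) + 0)) (at x)"
   by (intro has_derivative_add has_derivative_mult_right has_derivative_inner_left has_derivative_ident has_derivative_const)
  then have 1: "((%x. \<alpha> * (x \<bullet> b) + \<beta>) has_derivative (%h. \<alpha> * (h \<bullet> b))) (at x)"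
   by simp
  have 2: "((%x. exp_bump k (\<alpha> * (x \<bullet> b) + \<beta>)) has_derivative (%h. (\<alpha> * (h \<bullet> b)) *
   (exp_bump (k + 2) (\<alpha> * (x \<bullet> b) + \<beta>) - real k * exp_bump (k + 1) (\<alpha> * (x \<bullet> b) + \<beta>)))) (at x)"
   by (rule DERIV_compose_FDERIV[where f = "exp_bump k" and g = "%x. \<alpha> * (x \<bullet> b) + \<beta>"
      and g' = "%h. \<alpha> * (h \<bullet> b)", OF exp_bump_has_derivative 1])
  show ?thesis
   by (rule has_derivative_mult_right[OF 2])
 qed
 have "partial_deriv b' ?f = (%x. (c * \<alpha> * (b' \<bullet> b)) * exp_bump (k + 2) (\<alpha> * (x \<bullet> b) + \<beta>)
   + (- (c * \<alpha> * (b' \<bullet> b)) * real k) * exp_bump (k + 1) (\<alpha> * (x \<bullet> b) + \<beta>))" for b'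
 proof
  fix x show "partial_deriv b' ?f x = (c * \<alpha> * (b' \<bullet> b)) * exp_bump (k + 2) (\<alpha> * (x \<bullet> b) + \<beta>)
   + (- (c * \<alpha> * (b' \<bullet> b)) * real k) * exp_bump (k + 1) (\<alpha> * (x \<bullet> b) + \<beta>)"
   unfolding partial_deriv_eq[OF *[of x]] by (simp add: algebra_simps)
 qed
 moreover have "?f differentiable (at x)" for x
  using * differentiable_def by blast
 ultimately show ?case
  by (simp only: C_k_on.simps(2)) (intro conjI ballI C_k_on_add Suc.IH; simp)
qed

text \<open>As \<open>j\<close> tends to infinity these test functions increase to the indicator of the open box, which
reduces statements about test functions to statements about boxes.\<close>

definition box_bump :: "'a::euclidean_space => 'a => nat => 'a => real" where
 "box_bump a c j x =
  (\<Prod>i\<in>Basis. exp_bump 0 (real j * ((x - a) \<bullet> i)) * exp_bump 0 (real j * ((c - x) \<bullet> i)))"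

lemma C_k_on_box_bump: "C_k_on k (box_bump a c j) UNIV"
proof -
 have 1: "C_k_on k (%x. exp_bump 0 (real j * ((x - a) \<bullet> i))) UNIV" for i
  using C_k_on_exp_bump[of k 1 0 "real j" i "- real j * (a \<bullet> i)"]
  by (simp add: inner_diff_left algebra_simps)
 have 2: "C_k_on k (%x. exp_bump 0 (real j * ((c - x) \<bullet> i))) UNIV" for i
  using C_k_on_exp_bump[of k 1 0 "- real j" i "real j * (c \<bullet> i)"]
  by (simp add: inner_diff_left algebra_simps)
 show ?thesis unfolding box_bump_def
  by (intro C_k_on_prod C_k_on_mult 1 2) auto
qed

lemma exp_bump_0_bounds: "0 <= exp_bump 0 t" "exp_bump 0 t <= 1"
 by (auto simp: exp_bump_def)

lemma box_bump_bounds: "0 <= box_bump a c j x" "box_bump a c j x <= 1"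
 unfolding box_bump_def
 by (auto intro!: prod_nonneg prod_le_1 mult_nonneg_nonneg mult_le_one simp: exp_bump_0_bounds)

lemma box_bump_outside: "x \<notin> box a c ==> box_bump a c j x = 0"
proof -
 assume "x \<notin> box a c"
 then obtain i where i: "i : Basis" "\<not> (a \<bullet> i < x \<bullet> i \<and> x \<bullet> i < c \<bullet> i)"
  by (auto simp: mem_box)
 then have "exp_bump 0 (real j * ((x - a) \<bullet> i)) * exp_bump 0 (real j * ((c - x) \<bullet> i)) = 0"
  by (auto simp: exp_bump_def inner_diff_left not_less mult_le_0_iff)
 with i show ?thesis unfolding box_bump_def by (auto intro!: prod_zero)
qed

lemma exp_bump_scaled_limit:
 assumes "s > 0" shows "(%j. exp_bump 0 (real j * s)) \<longlonglongrightarrow> 1"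
proof -
 have "(%j. exp (- ((1/s) * (1 / real j)))) \<longlonglongrightarrow> exp (- ((1/s) * 0))"
  by (intro tendsto_intros lim_1_over_n)
 then have "(%j. exp (- ((1/s) * (1 / real j)))) \<longlonglongrightarrow> 1" by simp
 then show ?thesis
 proof (rule Lim_transform_eventually)
  show "\<forall>\<^sub>F j in sequentially. exp (- (1 / s * (1 / real j))) = exp_bump 0 (real j * s)"
   using eventually_gt_at_top[of 0]
   by eventually_elim (use assms in \<open>auto simp: exp_bump_def mult_le_0_iff field_simps\<close>)
 qed
qed

lemma box_bump_limit: "(%j. box_bump a c j x) \<longlonglongrightarrow> indicator (box a c) x"
proof (cases "x : box a c")
 case True
 have "(%j. box_bump a c j x) \<longlonglongrightarrow> (\<Prod>i\<in>(Basis::'a set). 1 * 1)"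
  unfolding box_bump_def using True
  by (intro tendsto_prod tendsto_mult exp_bump_scaled_limit) (auto simp: mem_box inner_diff_left)
 with True show ?thesis by simp
next
 case False
 then show ?thesis by (simp add: box_bump_outside)
qed

lemma box_bump_test_function:
 assumes "cbox a c \<subseteq> V"
 shows "box_bump a c j : test_functions V"
proof -
 have "closure {x. box_bump a c j x ~= 0} \<subseteq> cbox a c"
  by (intro closure_minimal) (use box_bump_outside box_subset_cbox in \<open>blast\<close>, auto)
 moreover from this have "compact (closure {x. box_bump a c j x ~= 0})"
  by (meson bounded_cbox bounded_subset closed_closure compact_eq_bounded_closed)
 ultimately show ?thesis
  using assms C_k_on_box_bump unfolding test_functions_def compactly_supported_in_def by blast
qed

section \<open>The fundamental lemma of the calculus of variations\<close>

lemma lebesgue_on_integral: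
 fixes f :: "'a::euclidean_space => 'b::euclidean_space"
 assumes "S : sets lebesgue"
 shows "(LINT x|leb S. f x) = (LINT x|lebesgue. indicator S x *\<^sub>R f x)"
  and "integrable (leb S) f \<longleftrightarrow> integrable lebesgue (%x. indicator S x *\<^sub>R f x)"
 using assms by (auto simp: integral_restrict_space integrable_restrict_space set_integrable_def)

text \<open>Dominated convergence along the bumps of the box.\<close>

lemma box_integral_zero:
 fixes f :: "'a::euclidean_space => real"
 assumes f: "integrable lebesgue f" and ab: "cbox a b \<subseteq> V"
  and test: "!!ph. ph : test_functions V ==> (LINT x|lebesgue. f x * ph x) = 0"
 shows "(LINT x|lebesgue. f x * indicator (box a b) x) = 0"
proof -
 have "(%j. \<integral>x. f x * box_bump a b j x \<partial>lebesgue) \<longlonglongrightarrow> (LINT x|lebesgue. f x * indicator (box a b) x)"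
 proof (rule integral_dominated_convergence[where w = "%x. \<bar>f x\<bar>"])
  have "box_bump a b j : borel_measurable borel" for j
   by (rule borel_measurable_continuous_onI) (rule C_k_on_continuous[OF C_k_on_box_bump])
  then have "box_bump a b j : borel_measurable lebesgue" for j
   by (simp add: measurable_completion)
  then show "(%x. f x * box_bump a b j x) : borel_measurable lebesgue" for j
   using f by (intro borel_measurable_times) auto
  show "AE x in lebesgue. norm (f x * box_bump a b j x) <= \<bar>f x\<bar>" for j
   by (auto simp: abs_mult box_bump_bounds mult_left_le)
  show "AE x in lebesgue. (%j. f x * box_bump a b j x) \<longlonglongrightarrow> f x * indicator (box a b) x"
   by (auto intro!: tendsto_mult box_bump_limit)
  show "(%x. f x * indicator (box a b) x) : borel_measurable lebesgue"
   using f by (intro borel_measurable_times borel_measurable_indicator) (auto simp: sets_completionI_sets)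
 qed (use f in auto)
 then show ?thesis
  using test[OF box_bump_test_function[OF ab]] LIMSEQ_unique[OF _ tendsto_const] by simp
qed

lemma AE_zero_of_borel_integrals:
 fixes f :: "'a::euclidean_space => real"
 assumes f: "integrable lebesgue f"
  and z: "!!A. A : sets borel ==> (LINT x|lebesgue. f x * indicator A x) = 0"
 shows "AE x in lebesgue. f x = 0"
proof -
 obtain g where g: "g : borel_measurable lborel" "AE x in lborel. f x = g x"
  using completion_ex_borel_measurable_real f by blast
 have fg: "AE x in lebesgue. f x = g x"
  using g(2) by (simp add: AE_completion)
 have gm: "g : borel_measurable lebesgue"
  using g(1) by (simp add: measurable_completion)
 have g_int: "integrable lebesgue g"
  using integrable_cong_AE_imp[OF f gm] fg by (auto simp: eq_commute)
 have 1: "AE x in lebesgue. g x * indicator A x = 0"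
  if A: "A : sets borel" and pos: "!!x. s * (g x * indicator A x) >= 0" and s: "s ~= 0" for A s
 proof -
  have Am: "(indicator A :: 'a => real) : borel_measurable lebesgue"
   using A by (auto intro: borel_measurable_indicator simp: sets_completionI_sets)
  have i: "integrable lebesgue (%x. s * (g x * indicator A x))"
   using g_int A by (intro integrable_mult_right integrable_real_mult_indicator)
    (auto simp: sets_completionI_sets)
  have "(LINT x|lebesgue. g x * indicator A x) = (LINT x|lebesgue. f x * indicator A x)"
   using fg gm Am f by (intro integral_cong_AE) auto
  then have "(LINT x|lebesgue. s * (g x * indicator A x)) = 0"
   using z[OF A] by simp
  then have "AE x in lebesgue. s * (g x * indicator A x) = 0"
   using integral_nonneg_eq_0_iff_AE[OF i] pos by auto
  with s show ?thesis by auto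
 qed
 have p: "{x. g x > 0} \<in> sets borel" "{x. g x < 0} \<in> sets borel"
  using g(1) by (auto simp: measurable_lborel1)
 have "AE x in lebesgue. g x * indicator {x. g x > 0} x = 0"
  by (rule 1[OF p(1), of 1]) (auto simp: indicator_def)
 moreover have "AE x in lebesgue. g x * indicator {x. g x < 0} x = 0"
  by (rule 1[OF p(2), of "-1"]) (auto simp: indicator_def)
 ultimately show ?thesis using fg
  by eventually_elim (auto simp: indicator_def split: if_splits)
qed

text \<open>Boxes inside \<open>V\<close> are tested directly; the boxes form an intersection stable generator of the
Borel sets, so on each compact piece all Borel integrals of the function vanish.\<close>

theorem fundamental_lemma:
 fixes q :: "'a::euclidean_space => real"
 assumes V: "open V" and q: "integrable (leb V) q"
  and test: "!!ph. ph : test_functions V ==> (LINT x|leb V. q x * ph x) = 0"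
 shows "AE x in leb V. q x = 0"
proof -
 have Vs: "V : sets lebesgue" using V by auto
 define f where "f x = indicator V x * q x" for x
 have f: "integrable lebesgue f"
  using q unfolding f_def lebesgue_on_integral(2)[OF Vs] by simp
 have ft: "(LINT x|lebesgue. f x * ph x) = 0" if "ph : test_functions V" for ph
  using test[OF that] unfolding lebesgue_on_integral(1)[OF Vs] f_def by (simp add: mult.assoc)
 have cb: "AE x in lebesgue. x : cbox a b --> f x = 0" if ab: "cbox a b \<subseteq> V" for a b
 proof -
  have fi: "integrable lebesgue (%x. f x * indicator A x)" if "A : sets borel" for A
   using that f by (intro integrable_real_mult_indicator) (auto simp: sets_completionI_sets)
  have "(LINT x|lebesgue. (f x * indicator (box a b) x) * indicator A x) = 0" if "A : sets borel" for A
  proof -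
   have stable: "Int_stable (range (%(a, b). box a b :: 'a set))"
    by (fastforce simp: Int_stable_def box_Int_box)
   have sub: "range (%(a, b). box a b :: 'a set) \<subseteq> Pow UNIV" by simp
   have A: "A : sigma_sets UNIV (range (%(a, b). box a b :: 'a set))"
    using that by (simp add: borel_eq_box)
   from stable sub A show ?thesis
   proof (induction rule: sigma_sets_induct_disjoint)
    case (basic A)
    then obtain c d where A: "A = box c d" by auto
    obtain e g where eg: "box a b \<inter> A = box e g" unfolding A box_Int_box by blast
    have eg': "cbox e g \<subseteq> V \<or> box e g = {}"
    proof (cases "box e g = {}")
     case False
     have "box e g \<subseteq> cbox a b" using eg box_subset_cbox by blast
     then have "closure (box e g) \<subseteq> cbox a b" by (intro closure_minimal) auto
     with False ab show ?thesis by auto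
    qed simp
    have "(LINT x|lebesgue. f x * indicator (box e g) x) = 0"
     using eg' box_integral_zero[OF f _ ft] by (cases "box e g = {}") auto
    then show ?case by (simp add: eg[symmetric] indicator_inter_arith mult.assoc)
   next
    case empty
    show ?case by simp
   next
    case (compl A)
    then have A: "A : sets borel" by (simp add: borel_eq_box)
    have "(LINT x|lebesgue. (f x * indicator (box a b) x) * indicator (UNIV - A) x)
     = (LINT x|lebesgue. (f x * indicator (box a b) x) - (f x * indicator (box a b) x) * indicator A x)"
     by (intro Bochner_Integration.integral_cong) (auto simp: indicator_def)
    also have "... = 0"
     using A compl fi[of "box a b"] box_integral_zero[OF f ab ft]
     by (subst Bochner_Integration.integral_diff)
      (auto intro!: integrable_real_mult_indicator simp: sets_completionI_sets)
    finally show ?case .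
   next
    case (union A)
    then have A: "A i : sets borel" for i by (auto simp: borel_eq_box)
    have "(LINT x:(\<Union>i. A i)|lebesgue. f x * indicator (box a b) x)
      = (\<Sum>i. (LINT x:(A i)|lebesgue. f x * indicator (box a b) x))"
     using A union(1) fi[of "box a b"]
     by (intro lebesgue_integral_countable_add)
      (auto simp: sets_completionI_sets disjoint_family_on_def set_integrable_def mult.commute[of "indicator _ _"]
       intro!: integrable_real_mult_indicator)
    then show ?case
     using union(3) by (simp add: set_lebesgue_integral_def mult.commute mult.left_commute)
   qed
  qed
  then have "AE x in lebesgue. f x * indicator (box a b) x = 0"
   using fi[of "box a b"] by (intro AE_zero_of_borel_integrals) auto
  moreover have "AE x in lebesgue. x \<notin> cbox a b - box a b"
   using negligible_frontier_interval[of a b]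
   by (simp add: AE_iff_null_sets negligible_iff_null_sets AE_not_in)
  ultimately show ?thesis
   by eventually_elim (auto simp: indicator_def split: if_splits)
 qed
 obtain D where D: "countable D" "D \<subseteq> Pow V" "!!X. X : D ==> \<exists>a b. X = cbox a b" "\<Union>D = V"
  using open_countable_Union_open_cbox[OF V] by metis
 have "AE x in lebesgue. \<forall>X\<in>D. x : X --> f x = 0"
  unfolding AE_ball_countable[OF D(1)]
 proof
  fix X assume "X : D"
  with D obtain a b where "X = cbox a b" "cbox a b \<subseteq> V" by (metis Pow_iff subsetD)
  then show "AE x in lebesgue. x : X --> f x = 0" using cb by blast
 qed
 then have "AE x in lebesgue. x : V --> q x = 0"
  by eventually_elim (use D(4) in \<open>force simp: f_def indicator_def split: if_splits\<close>)
 then show ?thesis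
  using Vs by (simp add: AE_restrict_space_iff)
qed

section \<open>Square integrable functions\<close>

lemma L2_measurable: "f : L2_space U ==> f : borel_measurable (leb U)"
 and L2_integrable_square: "f : L2_space U ==> integrable (leb U) (%x. (norm (f x))\<^sup>2)"
 by (auto simp: L2_space_def)

lemma L2_integrable_inner:
 assumes "f : L2_space U" "g : L2_space U"
 shows "integrable (leb U) (%x. f x \<bullet> g x)"
proof (rule Bochner_Integration.integrable_bound)
 show "integrable (leb U) (%x. (norm (f x))\<^sup>2 + (norm (g x))\<^sup>2)"
  using assms by (auto simp: L2_space_def)
 show "(%x. f x \<bullet> g x) : borel_measurable (leb U)"
  using assms by (auto simp: L2_space_def)
 have "\<bar>f x \<bullet> g x\<bar> <= (norm (f x))\<^sup>2 + (norm (g x))\<^sup>2" for x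
  using Cauchy_Schwarz_ineq2[of "f x" "g x"] sum_squares_bound[of "norm (f x)" "norm (g x)"]
   mult_nonneg_nonneg[of "norm (f x)" "norm (g x)"]
  by (auto simp: algebra_simps)
 then show "AE x in leb U. norm (f x \<bullet> g x) <= norm ((norm (f x))\<^sup>2 + (norm (g x))\<^sup>2)"
  by auto
qed

lemma L2_integrable_mult:
 fixes f g :: "'a::euclidean_space => real"
 assumes "f : L2_space U" "g : L2_space U"
 shows "integrable (leb U) (%x. f x * g x)"
 using L2_integrable_inner[OF assms] by simp

lemma L2_add:
 assumes "f : L2_space U" "g : L2_space U"
 shows "(%x. f x + g x) : L2_space U"
proof -
 have "(%x. (norm (f x + g x))\<^sup>2) = (%x. (norm (f x))\<^sup>2 + (norm (g x))\<^sup>2 + 2 * (f x \<bullet> g x))"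
  by (auto simp: power2_norm_eq_inner inner_add inner_commute)
 then show ?thesis
  using assms L2_integrable_inner[OF assms] by (auto simp: L2_space_def)
qed

lemma L2_scaleR:
 assumes "f : L2_space U" shows "(%x. c *\<^sub>R f x) : L2_space U"
 using assms by (auto simp: L2_space_def power_mult_distrib)

lemma L2_mult: "f : L2_space U ==> (%x. c * f x :: real) : L2_space U"
 using L2_scaleR[of f U c] by simp

lemma L2_diff:
 assumes "f : L2_space U" "g : L2_space U"
 shows "(%x. f x - g x) : L2_space U"
 using L2_add[OF assms(1) L2_scaleR[OF assms(2), of "-1"]] by simp

lemma lebesgue_on_finite: "U : lmeasurable ==> finite_measure (leb U)"
 by (rule finite_measure_lebesgue_on)

lemma L2_bounded:
 fixes f :: "'a::euclidean_space => 'b::euclidean_space"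
 assumes U: "U : lmeasurable" and f: "f : borel_measurable (leb U)"
  and B: "AE x in leb U. norm (f x) <= B"
 shows "f : L2_space U"
proof -
 interpret finite_measure "leb U" by (rule lebesgue_on_finite[OF U])
 have "AE x in leb U. norm ((norm (f x))\<^sup>2) <= B\<^sup>2"
  using B by eventually_elim (auto intro: power_mono)
 then have "integrable (leb U) (%x. (norm (f x))\<^sup>2)"
  using f by (intro integrable_const_bound) auto
 with f show ?thesis by (auto simp: L2_space_def)
qed

lemma L2_integrable:
 assumes U: "U : lmeasurable" and f: "f : L2_space U"
 shows "integrable (leb U) f"
proof (rule Bochner_Integration.integrable_bound)
 interpret finite_measure "leb U" by (rule lebesgue_on_finite[OF U])
 show "integrable (leb U) (%x. 1 + (norm (f x))\<^sup>2)"
  using f by (auto simp: L2_space_def)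
 show "f : borel_measurable (leb U)" using f by (auto simp: L2_space_def)
 have "norm y <= 1 + (norm y)\<^sup>2" for y :: 'b
  using sum_squares_bound[of 1 "norm y"] norm_ge_zero[of y] by (simp del: norm_ge_zero)
 then show "AE x in leb U. norm (f x) <= norm (1 + (norm (f x))\<^sup>2)" by auto
qed

lemma L2_bounded_mult:
 fixes f :: "'a::euclidean_space => 'b::euclidean_space"
 assumes f: "f : L2_space U" and c: "c : borel_measurable (leb U)"
  and B: "!!x. \<bar>c x\<bar> <= B"
 shows "(%x. c x *\<^sub>R f x) : L2_space U"
proof -
 have "integrable (leb U) (%x. (norm (c x *\<^sub>R f x))\<^sup>2)"
 proof (rule Bochner_Integration.integrable_bound)
  show "integrable (leb U) (%x. B\<^sup>2 * (norm (f x))\<^sup>2)"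
   using f by (auto simp: L2_space_def)
  show "(%x. (norm (c x *\<^sub>R f x))\<^sup>2) : borel_measurable (leb U)"
   using f c by (auto simp: L2_space_def)
  have "(\<bar>c x\<bar>)\<^sup>2 <= B\<^sup>2" for x using B by (intro power_mono) auto
  then show "AE x in leb U. norm ((norm (c x *\<^sub>R f x))\<^sup>2) <= norm (B\<^sup>2 * (norm (f x))\<^sup>2)"
   by (auto simp: power_mult_distrib intro!: mult_right_mono)
 qed
 then show ?thesis using f c by (auto simp: L2_space_def)
qed

section \<open>Weak gradients\<close>

lemma compact_support_bounded:
 fixes ph :: "'a::euclidean_space => 'b::euclidean_space"
 assumes "continuous_on UNIV ph" "compactly_supported_in U ph"
 obtains B where "!!x. norm (ph x) <= B" "B >= 0"
proof -
 let ?K = "closure {x. ph x ~= 0}"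
 have "compact (ph ` ?K)"
  by (rule compact_continuous_image[OF continuous_on_subset[OF assms(1)]])
   (use assms(2) in \<open>simp_all add: compactly_supported_in_def\<close>)
 then obtain B where B: "!!y. y : ph ` ?K ==> norm y <= B"
  using compact_imp_bounded bounded_iff by metis
 have "norm (ph x) <= max B 0" for x
 proof (cases "ph x = 0")
  case False
  then have "x : ?K" by (intro subsetD[OF closure_subset]) simp
  then have "norm (ph x) <= B" by (intro B imageI)
  then show ?thesis by simp
 qed simp
 then show ?thesis using that[of "max B 0"] by auto
qed

lemma compact_support_zero: "compactly_supported_in U ph ==> x \<notin> U ==> ph x = 0"
 using closure_subset[of "{x. ph x ~= 0}"] unfolding compactly_supported_in_def by blast

lemma test_functionD:
 assumes "ph : test_functions U"
 shows "C_k_on k ph UNIV" "compactly_supported_in U ph" "continuous_on UNIV ph"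
 using assms C_k_on_continuous by (auto simp: test_functions_def)

lemma test_function_bounded:
 assumes "ph : test_functions U"
 obtains B where "!!x. \<bar>ph x\<bar> <= B" "B >= 0"
 using compact_support_bounded[OF test_functionD(3,2)[OF assms]] by force

lemma continuous_measurable_lebesgue_on:
 fixes f :: "'a::euclidean_space => 'b::euclidean_space"
 assumes "continuous_on UNIV f"
 shows "f : borel_measurable (leb U)"
proof -
 have "f : borel_measurable borel" using assms by (rule borel_measurable_continuous_onI)
 then have "f : borel_measurable lebesgue" by (simp add: measurable_completion)
 then show ?thesis by (rule measurable_restrict_space1)
qed

lemma borel_measurable_lebesgue_on:
 "f : borel_measurable borel ==> f : borel_measurable (leb U)"
 by (intro measurable_restrict_space1) (simp add: measurable_completion)

lemma test_function_L2:
 assumes "U : lmeasurable" "ph : test_functions V"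
 shows "ph : L2_space U"
proof -
 obtain B where "!!x. \<bar>ph x\<bar> <= B" using test_function_bounded[OF assms(2)] by blast
 then show ?thesis
  by (intro L2_bounded[OF assms(1), of _ B] continuous_measurable_lebesgue_on test_functionD(3)[OF assms(2)]) auto
qed

lemma partial_deriv_support:
 "closure {x. partial_deriv b ph x ~= 0} \<subseteq> closure {x. ph x ~= 0}"
proof (rule closure_minimal)
 show "{x. partial_deriv b ph x ~= 0} \<subseteq> closure {x. ph x ~= 0}"
 proof
  fix x assume x: "x : {x. partial_deriv b ph x ~= 0}"
  show "x : closure {x. ph x ~= 0}"
  proof (rule ccontr)
   assume n: "x \<notin> closure {x. ph x ~= 0}"
   have z: "ph y = 0" if y: "y : - closure {x. ph x ~= 0}" for y
   proof (rule ccontr)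
    assume "ph y ~= 0"
    then have "y : {x. ph x ~= 0}" by simp
    then have "y : closure {x. ph x ~= 0}" by (rule subsetD[OF closure_subset])
    with y show False by simp
   qed
   have "(ph has_derivative (%h. 0)) (at x)"
   proof (rule has_derivative_transform_within_open[OF has_derivative_const open_Compl[OF closed_closure[of "{x. ph x ~= 0}"]]])
    show "x : - closure {x. ph x ~= 0}" using n by simp
    show "0 = ph y" if "y : - closure {x. ph x ~= 0}" for y
     by (rule z[OF that, symmetric])
   qed
   then show False using x partial_deriv_eq[of ph "%h. 0" x b] by simp
  qed
 qed
qed auto

lemma partial_deriv_compact_support:
 "compactly_supported_in U ph ==> compactly_supported_in U (partial_deriv b ph)"
 unfolding compactly_supported_in_def using partial_deriv_support[of b ph]
 by (meson closed_closure compact_Int_closed compact_eq_bounded_closed bounded_subset subset_trans)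

lemma test_function_partial_deriv:
 "ph : test_functions U ==> b : Basis ==> partial_deriv b ph : test_functions U"
 unfolding test_functions_def using partial_deriv_compact_support C_k_on.simps(2) by blast

section \<open>Weak gradients\<close>

lemma has_weak_gradientD:
 assumes "has_weak_gradient U u g"
 shows "g : L2_space U"
  and "ph : test_functions U ==> b : Basis ==>
   (LINT x|leb U. u x * partial_deriv b ph x) = - (LINT x|leb U. (g x \<bullet> b) * ph x)"
 using assms by (simp_all add: has_weak_gradient_def)

lemma L2_inner_const: "g : L2_space U ==> (%x. g x \<bullet> b) : L2_space U"
proof -
 assume g: "g : L2_space U"
 have "integrable (leb U) (%x. (norm (g x \<bullet> b))\<^sup>2)"
 proof (rule Bochner_Integration.integrable_bound)
  show "integrable (leb U) (%x. (norm b)\<^sup>2 * (norm (g x))\<^sup>2)"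
   using g by (auto simp: L2_space_def)
  have "(norm (g x \<bullet> b))\<^sup>2 <= (norm b)\<^sup>2 * (norm (g x))\<^sup>2" for x
   using power_mono[OF Cauchy_Schwarz_ineq2[of "g x" b] abs_ge_zero, of 2]
   by (simp add: power_mult_distrib mult.commute)
  then show "AE x in leb U. norm ((norm (g x \<bullet> b))\<^sup>2) <= norm ((norm b)\<^sup>2 * (norm (g x))\<^sup>2)"
   by simp
 qed (use g in \<open>auto simp: L2_space_def\<close>)
 then show ?thesis using g by (auto simp: L2_space_def)
qed

text \<open>The difference of two weak gradients is orthogonal to all test functions.\<close>

lemma has_weak_gradient_unique:
 assumes U: "open U" "U : lmeasurable"
  and g: "has_weak_gradient U u g" and h: "has_weak_gradient U u h"
 shows "AE x in leb U. g x = h x"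
proof -
 note gh = has_weak_gradientD(1)[OF g] has_weak_gradientD(1)[OF h]
 have "AE x in leb U. g x \<bullet> b - h x \<bullet> b = 0" if b: "b : Basis" for b
 proof (rule fundamental_lemma[OF U(1)])
  show "integrable (leb U) (%x. g x \<bullet> b - h x \<bullet> b)"
   using gh by (intro Bochner_Integration.integrable_diff L2_integrable[OF U(2)] L2_inner_const)
  fix ph assume ph: "ph : test_functions U"
  note L = L2_integrable_mult[OF L2_inner_const test_function_L2[OF U(2) ph]]
  have "(LINT x|leb U. (g x \<bullet> b) * ph x - (h x \<bullet> b) * ph x) = 0"
   using has_weak_gradientD(2)[OF g ph b] has_weak_gradientD(2)[OF h ph b]
   by (simp add: Bochner_Integration.integral_diff[OF L[OF gh(1)] L[OF gh(2)]])
  then show "(LINT x|leb U. (g x \<bullet> b - h x \<bullet> b) * ph x) = 0"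
   by (simp add: left_diff_distrib)
 qed
 then have "AE x in leb U. \<forall>b\<in>Basis. g x \<bullet> b - h x \<bullet> b = 0"
  by (subst AE_finite_all) auto
 then show ?thesis
  by eventually_elim (auto intro: euclidean_eqI)
qed

lemma has_weak_gradient_lin:
 assumes U: "U : lmeasurable" and L2: "u : L2_space U" "v : L2_space U"
  and g: "has_weak_gradient U u g" and h: "has_weak_gradient U v h"
 shows "has_weak_gradient U (%x. c * u x + d * v x) (%x. c *\<^sub>R g x + d *\<^sub>R h x)"
 unfolding has_weak_gradient_def
proof (intro conjI ballI)
 note gh = has_weak_gradientD(1)[OF g] has_weak_gradientD(1)[OF h]
 show "(%x. c *\<^sub>R g x + d *\<^sub>R h x) : L2_space U"
  using gh by (intro L2_add L2_scaleR)
 fix ph b assume ph: "ph : test_functions U" and b: "b : (Basis :: 'a set)"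
 note P = test_function_L2[OF U test_function_partial_deriv[OF ph b]]
 note L = L2_integrable_mult[OF L2_inner_const test_function_L2[OF U ph]]
 have "(LINT x|leb U. (c * u x + d * v x) * partial_deriv b ph x)
  = c * (LINT x|leb U. u x * partial_deriv b ph x) + d * (LINT x|leb U. v x * partial_deriv b ph x)"
  using L2_integrable_mult[OF L2(1) P] L2_integrable_mult[OF L2(2) P]
  by (simp add: distrib_right mult.assoc)
 also have "... = - (LINT x|leb U. ((c *\<^sub>R g x + d *\<^sub>R h x) \<bullet> b) * ph x)"
  using has_weak_gradientD(2)[OF g ph b] has_weak_gradientD(2)[OF h ph b] L[OF gh(1), of b] L[OF gh(2), of b]
  by (simp add: inner_add_left distrib_right mult.assoc)
 finally show "(LINT x|leb U. (c * u x + d * v x) * partial_deriv b ph x)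
  = - (LINT x|leb U. ((c *\<^sub>R g x + d *\<^sub>R h x) \<bullet> b) * ph x)" .
qed

lemma weak_gradient_works: "u : H1_space U ==> has_weak_gradient U u (weak_gradient U u)"
 unfolding H1_space_def weak_gradient_def using someI[where P = "has_weak_gradient U u"] by blast

lemma H1_L2: "u : H1_space U ==> u : L2_space U"
 by (simp add: H1_space_def)

lemma weak_gradient_L2: "u : H1_space U ==> weak_gradient U u : L2_space U"
 using has_weak_gradientD(1) weak_gradient_works by blast

lemma H1I: "u : L2_space U ==> has_weak_gradient U u g ==> u : H1_space U"
 by (auto simp: H1_space_def)

lemma weak_gradient_AE:
 assumes "open U" "U : lmeasurable" "has_weak_gradient U u g"
 shows "AE x in leb U. weak_gradient U u x = g x"
proof -
 have "has_weak_gradient U u (weak_gradient U u)"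
  unfolding weak_gradient_def using assms(3) by (rule someI[where P = "has_weak_gradient U u"])
 then show ?thesis using has_weak_gradient_unique assms by blast
qed

lemma H1_lin:
 assumes "U : lmeasurable" "u : H1_space U" "v : H1_space U"
 shows "(%x. c * u x + d * v x) : H1_space U"
 using assms by (intro H1I[OF L2_add[OF L2_mult L2_mult] has_weak_gradient_lin])
  (auto intro: H1_L2 weak_gradient_works)

lemma weak_gradient_lin:
 assumes "open U" "U : lmeasurable" "u : H1_space U" "v : H1_space U"
 shows "AE x in leb U. weak_gradient U (%x. c * u x + d * v x) x
   = c *\<^sub>R weak_gradient U u x + d *\<^sub>R weak_gradient U v x"
 using assms by (intro weak_gradient_AE has_weak_gradient_lin) (auto intro: H1_L2 weak_gradient_works)

text \<open>Well defined on \<open>H1_space\<close> although \<open>weak_gradient\<close> is an arbitrary choice, since weak gradients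
agree almost everywhere.\<close>

definition dirichlet_form :: "'a::euclidean_space set => ('a => real) => ('a => real) => real" where
 "dirichlet_form U u v = (LINT x|leb U. weak_gradient U u x \<bullet> weak_gradient U v x)"

lemma dirichlet_form_sym: "dirichlet_form U u v = dirichlet_form U v u"
 by (simp add: dirichlet_form_def inner_commute)

lemma dirichlet_form_nonneg: "dirichlet_form U u u >= 0"
 by (simp add: dirichlet_form_def)

lemma dirichlet_form_lin:
 assumes U: "open U" "U : lmeasurable" and H: "u : H1_space U" "v : H1_space U" "w : H1_space U"
 shows "dirichlet_form U (%x. c * u x + d * v x) w = c * dirichlet_form U u w + d * dirichlet_form U v w"
proof -
 note W = weak_gradient_L2[OF H(1)] weak_gradient_L2[OF H(2)] weak_gradient_L2[OF H(3)]
  weak_gradient_L2[OF H1_lin[OF U(2) H(1,2), of c d]]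
 have "dirichlet_form U (%x. c * u x + d * v x) w
  = (LINT x|leb U. c * (weak_gradient U u x \<bullet> weak_gradient U w x) + d * (weak_gradient U v x \<bullet> weak_gradient U w x))"
  unfolding dirichlet_form_def
 proof (rule integral_cong_AE)
  show "AE x in leb U. weak_gradient U (%x. c * u x + d * v x) x \<bullet> weak_gradient U w x =
   c * (weak_gradient U u x \<bullet> weak_gradient U w x) + d * (weak_gradient U v x \<bullet> weak_gradient U w x)"
   using weak_gradient_lin[OF U H(1,2), of c d] by eventually_elim (simp add: inner_add_left)
 qed (use W in \<open>auto simp: L2_space_def\<close>)
 also have "... = c * dirichlet_form U u w + d * dirichlet_form U v w"
  unfolding dirichlet_form_def
  using L2_integrable_inner[OF W(1) W(3)] L2_integrable_inner[OF W(2) W(3)] by simp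
 finally show ?thesis .
qed

section \<open>Translations\<close>

section \<open>Translations of Sobolev functions\<close>

lemma translate_integral:
 fixes f :: "'a::euclidean_space => real"
 assumes f: "f : borel_measurable borel"
 shows "(LINT x|lborel. f (x + c)) = (LINT x|lborel. f x)"
  and "integrable lborel (%x. f (x + c)) \<longleftrightarrow> integrable lborel f"
proof -
 have e: "(lborel :: 'a measure) = distr lborel borel ((+) c)"
  by (rule lborel_distr_plus[symmetric])
 show "(LINT x|lborel. f (x + c)) = (LINT x|lborel. f x)"
  by (subst (2) e) (use f in \<open>simp add: integral_distr add.commute\<close>)
 show "integrable lborel (%x. f (x + c)) \<longleftrightarrow> integrable lborel f"
  by (subst (2) e) (use f in \<open>simp add: integrable_distr_eq add.commute\<close>)
qed

lemma unit_product_integrable: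
 fixes F :: "real => 'a::euclidean_space => real"
 assumes m: "case_prod F : borel_measurable borel"
  and i: "!!s. integrable lborel (F s)"
  and C: "!!s. s : {0..1} ==> (LINT x|lborel. \<bar>F s x\<bar>) <= C"
  and z: "!!s x. s \<notin> {0..1} ==> F s x = 0"
 shows "integrable (lborel \<Otimes>\<^sub>M lborel) (case_prod F)"
proof (rule lborel_pair.Fubini_integrable)
 show M: "case_prod F : borel_measurable (lborel \<Otimes>\<^sub>M lborel)"
  using m by (simp add: lborel_prod)
 then have m1: "(%s. \<integral>x. norm (case_prod F (s, x)) \<partial>lborel) : borel_measurable lborel"
  by measurable
 have "0 <= (LINT x|lborel. \<bar>F 0 x\<bar>)" by (rule integral_nonneg_AE) simp
 from order_trans[OF this C[of 0]] have C0: "C >= 0" by simp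
 show "integrable lborel (%s. \<integral>x. norm (case_prod F (s, x)) \<partial>lborel)"
 proof (rule Bochner_Integration.integrable_bound[OF _ m1])
  show "integrable lborel (%s. C * indicator {0..1::real} s :: real)"
   by simp
  show "AE s in lborel. norm (LINT x|lborel. norm (case_prod F (s, x))) <= norm (C * indicator {0..1} s)"
   using C z C0 by (intro AE_I2) (auto simp: indicator_def)
 qed
qed (use i in auto)

lemma lborel_integrable_lebesgue_on:
 fixes f :: "'a::euclidean_space => real"
 assumes "integrable lborel f" "A : sets lebesgue"
 shows "integrable (leb A) f"
proof -
 have "f : borel_measurable lborel" using assms(1) by (rule borel_measurable_integrable)
 then have "integrable lebesgue f" using assms(1) by (simp add: integrable_completion)
 then show ?thesis
  unfolding lebesgue_on_integral(2)[OF assms(2)] using assms(2) by (intro integrable_mult_indicator)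
qed

lemma lebesgue_on_lborel:
 fixes f :: "'a::euclidean_space => real"
 assumes "f : borel_measurable borel" "!!x. x \<notin> A ==> f x = 0" "A : sets lebesgue"
 shows "(LINT x|leb A. f x) = (LINT x|lborel. f x)"
  and "integrable (leb A) f \<longleftrightarrow> integrable lborel f"
proof -
 have e: "(%x. indicator A x *\<^sub>R f x) = f"
 proof
  fix x show "indicator A x *\<^sub>R f x = f x" using assms(2)[of x] by (cases "x : A") auto
 qed
 show "(LINT x|leb A. f x) = (LINT x|lborel. f x)"
  unfolding lebesgue_on_integral(1)[OF assms(3)] e using assms(1) by (simp add: integral_completion)
 show "integrable (leb A) f \<longleftrightarrow> integrable lborel f"
  unfolding lebesgue_on_integral(2)[OF assms(3)] e using assms(1) by (simp add: integrable_completion)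
qed

lemma directional_derivative:
 assumes "f differentiable (at z)"
 shows "(f has_derivative (%h. \<Sum>b\<in>Basis. (h \<bullet> b) * partial_deriv b f z)) (at z)"
proof -
 have d: "(f has_derivative frechet_derivative f (at z)) (at z)"
  using assms frechet_derivative_works by blast
 have l: "linear (frechet_derivative f (at z))"
  using d by (rule has_derivative_linear)
 have "frechet_derivative f (at z) = (%h. \<Sum>b\<in>Basis. (h \<bullet> b) * partial_deriv b f z)"
 proof
  fix h
  have "frechet_derivative f (at z) (\<Sum>b\<in>Basis. (h \<bullet> b) *\<^sub>R b) = (\<Sum>b\<in>Basis. (h \<bullet> b) * partial_deriv b f z)"
   by (simp add: linear_sum[OF l] linear_cmul[OF l] partial_deriv_def)
  then show "frechet_derivative f (at z) h = (\<Sum>b\<in>Basis. (h \<bullet> b) * partial_deriv b f z)"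
   by (simp add: euclidean_representation)
 qed
 with d show ?thesis by simp
qed

lemma partial_deriv_translate:
 assumes "f differentiable (at (x - c))"
 shows "partial_deriv b (%x. f (x - c)) x = partial_deriv b f (x - c)"
proof -
 have d: "(f has_derivative frechet_derivative f (at (x - c))) (at (x - c))"
  using assms frechet_derivative_works by blast
 have "((%x. x - c) has_derivative (%h. h)) (at x)"
  by (auto intro!: derivative_eq_intros)
 from has_derivative_compose[OF this d] show ?thesis
  by (simp add: partial_deriv_eq[of "%x. f (x - c)"] partial_deriv_def[symmetric])
qed

lemma C_k_on_translate: "C_k_on k f UNIV ==> C_k_on k (%x. f (x - c)) UNIV"
proof (induction k arbitrary: f)
 case 0
 then have "continuous_on UNIV f" by simp
 then have "continuous_on UNIV (%x. f (x - c))"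
  by (rule continuous_on_compose2) (auto intro: continuous_on_diff continuous_on_id continuous_on_const)
 then show ?case by simp
next
 case (Suc k)
 have "partial_deriv b (%x. f (x - c)) = (%x. partial_deriv b f (x - c))" for b
  using Suc.prems by (intro ext partial_deriv_translate) simp
 moreover have "(%x. f (x - c)) differentiable (at x)" for x
 proof -
  have "f differentiable (at (x - c))" using Suc.prems by simp
  then show ?thesis
   by (intro differentiable_chain_at[of "%x. x - c" x f, unfolded o_def]) (auto intro!: derivative_intros)
 qed
 ultimately show ?case using Suc by simp
qed

lemma compact_support_translate:
 assumes "compactly_supported_in A ph" "!!x. x : A ==> x + c : V"
 shows "compactly_supported_in V (%x. ph (x - c))"
proof -
 have "{x. ph (x - c) ~= 0} = (+) c ` {x. ph x ~= 0}"
 proof (intro equalityI subsetI)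
  fix x assume "x : {x. ph (x - c) ~= 0}"
  then show "x : (+) c ` {x. ph x ~= 0}" by (intro image_eqI[of _ _ "x - c"]) auto
 qed auto
 then have e: "closure {x. ph (x - c) ~= 0} = (+) c ` closure {x. ph x ~= 0}"
  by (simp add: closure_translation)
 show ?thesis
  unfolding compactly_supported_in_def e
 proof
  show "compact ((+) c ` closure {x. ph x ~= 0})"
   using assms(1) by (intro compact_translation) (simp add: compactly_supported_in_def)
  show "(+) c ` closure {x. ph x ~= 0} \<subseteq> V"
   using assms by (auto simp: compactly_supported_in_def add.commute[of c])
 qed
qed

lemma test_function_translate:
 assumes "ph : test_functions A" "!!x. x : A ==> x + c : V"
 shows "(%x. ph (x - c)) : test_functions V"
 using assms C_k_on_translate[of _ ph c] compact_support_translate[of A ph c V]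
 unfolding test_functions_def by blast

lemma lborel_bounded_mult_integrable:
 fixes f h :: "'a::euclidean_space => real"
 assumes f: "integrable lborel f" and h: "h : borel_measurable borel" and B: "!!x. \<bar>h x\<bar> <= B"
 shows "integrable lborel (%x. f x * h x)"
proof (rule Bochner_Integration.integrable_bound)
 show "integrable lborel (%x. B * \<bar>f x\<bar>)" using f by auto
 show "(%x. f x * h x) : borel_measurable lborel" using f h by auto
 have "\<bar>f x * h x\<bar> <= \<bar>B * \<bar>f x\<bar>\<bar>" for x
 proof -
  have "\<bar>f x\<bar> * \<bar>h x\<bar> <= \<bar>f x\<bar> * B" by (intro mult_left_mono B) auto
  also have "... <= \<bar>B * \<bar>f x\<bar>\<bar>" by (simp add: mult.commute abs_le_iff)
  finally show ?thesis by (simp add: abs_mult)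
 qed
 then show "AE x in lborel. norm (f x * h x) <= norm (B * \<bar>f x\<bar>)" by auto
qed

lemma lborel_bounded_mult_integral_le:
 fixes f h :: "'a::euclidean_space => real"
 assumes f: "integrable lborel f" and h: "h : borel_measurable borel" and B: "!!x. \<bar>h x\<bar> <= B"
 shows "(LINT x|lborel. \<bar>f x * h x\<bar>) <= B * (LINT x|lborel. \<bar>f x\<bar>)"
proof -
 have "(LINT x|lborel. \<bar>f x * h x\<bar>) <= (LINT x|lborel. B * \<bar>f x\<bar>)"
 proof (rule integral_mono)
  show "integrable lborel (%x. \<bar>f x * h x\<bar>)"
   using lborel_bounded_mult_integrable[OF assms] by simp
  show "integrable lborel (%x. B * \<bar>f x\<bar>)" using f by simp
  show "\<bar>f x * h x\<bar> <= B * \<bar>f x\<bar>" for x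
   using mult_left_mono[OF B, of "\<bar>f x\<bar>"] by (simp add: abs_mult mult.commute)
 qed
 then show ?thesis by simp
qed

lemma continuous_borel:
 fixes f :: "'a::euclidean_space => 'b::euclidean_space"
 shows "continuous_on UNIV f ==> f : borel_measurable borel"
 by (rule borel_measurable_continuous_onI)

lemma segment_integrable:
 fixes h :: "'a::euclidean_space => real"
 assumes h: "h : borel_measurable borel" "integrable lborel h"
 shows "integrable (lborel \<Otimes>\<^sub>M lborel) (%(s, x). indicator {0..1::real} s * h (x + s *\<^sub>R y))"
proof (rule unit_product_integrable[where C = "\<integral>x. \<bar>h x\<bar> \<partial>lborel"])
 have "(%p::real \<times> 'a. snd p + fst p *\<^sub>R y) : borel_measurable borel"
  by (intro borel_measurable_continuous_onI continuous_on_add continuous_on_scaleR continuous_on_fst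
    continuous_on_snd continuous_on_id continuous_on_const)
 then have m: "(%p::real \<times> 'a. h (snd p + fst p *\<^sub>R y)) : borel_measurable borel"
  by (rule measurable_compose[OF _ h(1)])
 have "(%p::real \<times> 'a. indicator {0..1} (fst p) :: real) : borel_measurable borel"
 proof -
  have "(fst :: real \<times> 'a => real) : borel_measurable borel"
   by (intro borel_measurable_continuous_onI continuous_on_fst continuous_on_id)
  then show ?thesis by (rule measurable_compose) auto
 qed
 then show "(%(s, x). indicator {0..1::real} s * h (x + s *\<^sub>R y)) : borel_measurable borel"
  using m by (simp add: case_prod_beta)
 show "integrable lborel (%x. indicator {0..1} s * h (x + s *\<^sub>R y))" for s :: real
  using translate_integral(2)[OF h(1), of "s *\<^sub>R y"] h(2) by simp
 show "(LINT x|lborel. \<bar>indicator {0..1} s * h (x + s *\<^sub>R y)\<bar>) <= (LINT x|lborel. \<bar>h x\<bar>)" if "s : {0..1}" for s :: real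
  using that translate_integral(1)[of "%x. \<bar>h x\<bar>" "s *\<^sub>R y"] h(1) by simp
qed auto

text \<open>The fundamental theorem of calculus along segments. Both sides are tested against a test function;
Fubini and a translation move the difference onto the test function, where it is classical.\<close>

theorem translation_identity:
 fixes v :: "'a::euclidean_space => real" and g :: "'a => 'a"
 assumes v: "v : borel_measurable borel" "integrable lborel v" "!!x. x \<notin> U ==> v x = 0"
  and g: "g : borel_measurable borel" "integrable lborel g" "!!x. x \<notin> U ==> g x = 0"
  and wg: "has_weak_gradient U v g" and U: "open U"
  and A: "open A" "!!x s. x : A ==> s : {0..1} ==> x + s *\<^sub>R y : U"
 shows "AE x in leb A. v (x + y) - v x = (LINT s|lborel. indicator {0..1} s * (g (x + s *\<^sub>R y) \<bullet> y))"
proof -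
 define h where "h x = g x \<bullet> y" for x
 have h: "h : borel_measurable borel" "integrable lborel h"
  using g(1,2) by (auto simp: h_def[abs_def])
 have As: "A : sets lebesgue" and Us: "U : sets lebesgue" using A U by auto
 define H where "H s x = indicator {0..1::real} s * h (x + s *\<^sub>R y)" for s x
 have Hi: "integrable (lborel \<Otimes>\<^sub>M lborel) (case_prod H)"
  using segment_integrable[OF h, of y] by (simp add: H_def[abs_def])
 define G where "G x = (LINT s|lborel. H s x)" for x
 have Gi: "integrable lborel G"
  unfolding G_def[abs_def] using Hi by (rule lborel_pair.integrable_snd)
 then have Gm: "G : borel_measurable borel" using borel_measurable_integrable by force
 have vy: "(%x. v (x + y)) : borel_measurable borel" "integrable lborel (%x. v (x + y))"
  using v(1,2) translate_integral(2)[OF v(1), of y] by auto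
 have "AE x in leb A. v (x + y) - v x - G x = 0"
 proof (rule fundamental_lemma[OF A(1)])
  have qi: "integrable lborel (%x. v (x + y) - v x - G x)"
   using vy v Gi by auto
  then show "integrable (leb A) (%x. v (x + y) - v x - G x)"
   using As by (rule lborel_integrable_lebesgue_on)
  fix ph assume ph: "ph : test_functions A"
  have phm: "ph : borel_measurable borel" using test_functionD(3)[OF ph] by (rule continuous_borel)
  obtain B where B: "!!x. \<bar>ph x\<bar> <= B" using test_function_bounded[OF ph] by blast
  have phd: "ph differentiable (at x)" for x using test_functionD(1)[OF ph, of "Suc 0"] by simp
  have phz: "ph x = 0" if "x \<notin> A" for x using compact_support_zero[OF test_functionD(2)[OF ph] that] .
  define D where "D z = (\<Sum>b\<in>Basis. (y \<bullet> b) * partial_deriv b ph z)" for z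
  have Dc: "continuous_on UNIV D"
   unfolding D_def[abs_def] using test_functionD(3)[OF test_function_partial_deriv[OF ph]]
   by (intro continuous_on_sum continuous_on_mult_left) auto
  have Dm: "D : borel_measurable borel" using Dc by (rule continuous_borel)
  obtain B' where B': "!!x. \<bar>D x\<bar> <= B'"
  proof -
   have "\<exists>C. \<forall>x. \<bar>partial_deriv b ph x\<bar> <= C" if "b : Basis" for b
    using test_function_bounded[OF test_function_partial_deriv[OF ph that]] by metis
   then obtain C where C: "!!b x. b : Basis ==> \<bar>partial_deriv b ph x\<bar> <= C b" by metis
   have "\<bar>D x\<bar> <= (\<Sum>b\<in>Basis. \<bar>y \<bullet> b\<bar> * C b)" for x
    unfolding D_def by (rule order_trans[OF sum_abs]) (auto simp: abs_mult intro!: sum_mono mult_left_mono C)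
   then show ?thesis using that by blast
  qed
  define K where "K s x = indicator {0..1::real} s * (v x * D (x - s *\<^sub>R y))" for s x
  have Dt: "(%x. D (x - c)) : borel_measurable borel" for c
   by (intro continuous_borel continuous_on_compose2[OF Dc] continuous_on_diff continuous_on_id continuous_on_const) auto
  have Ki: "integrable (lborel \<Otimes>\<^sub>M lborel) (case_prod K)"
  proof (rule unit_product_integrable[where C = "B' * (LINT x|lborel. \<bar>v x\<bar>)"])
   have "(%p::real \<times> 'a. D (snd p - fst p *\<^sub>R y)) : borel_measurable borel"
    by (intro borel_measurable_continuous_onI continuous_on_compose2[OF Dc] continuous_on_diff
      continuous_on_scaleR continuous_on_fst continuous_on_snd continuous_on_id continuous_on_const) auto
   moreover have "(%p::real \<times> 'a. v (snd p)) : borel_measurable borel"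
    by (rule measurable_compose[OF borel_measurable_continuous_onI[OF continuous_on_snd[OF continuous_on_id]] v(1)])
   moreover have "(%p::real \<times> 'a. indicator {0..1} (fst p) :: real) : borel_measurable borel"
    by (rule measurable_compose[OF borel_measurable_continuous_onI[OF continuous_on_fst[OF continuous_on_id]]]) auto
   ultimately show "case_prod K : borel_measurable borel"
    by (simp add: case_prod_beta K_def[abs_def])
   show "integrable lborel (K s)" for s
    unfolding K_def[abs_def] using lborel_bounded_mult_integrable[OF v(2) Dt B'] by simp
   show "(LINT x|lborel. \<bar>K s x\<bar>) <= B' * (LINT x|lborel. \<bar>v x\<bar>)" if "s : {0..1}" for s
    using that lborel_bounded_mult_integral_le[OF v(2) Dt B'] by (simp add: K_def)
  qed (auto simp: K_def)
  have ftc: "(LINT s|lborel. K s x) = v x * (ph x - ph (x - y))" for x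
  proof -
   have "(LINT s|lborel. indicator {0..1} s *\<^sub>R (- D (x - s *\<^sub>R y))) = ph (x - 1 *\<^sub>R y) - ph (x - 0 *\<^sub>R y)"
   proof (rule integral_FTC_Icc)
    fix s :: real assume "0 <= s" "s <= 1"
    have "((%s. x - s *\<^sub>R y) has_derivative (%t. - (t *\<^sub>R y))) (at s within {0..1})"
     by (auto intro!: derivative_eq_intros)
    from has_derivative_compose[OF this directional_derivative[OF phd]]
    have "((%s. ph (x - s *\<^sub>R y)) has_derivative (%t. \<Sum>b\<in>Basis. (- (t *\<^sub>R y) \<bullet> b) * partial_deriv b ph (x - s *\<^sub>R y))) (at s within {0..1})" .
    then show "((%s. ph (x - s *\<^sub>R y)) has_vector_derivative - D (x - s *\<^sub>R y)) (at s within {0..1})"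
     unfolding has_vector_derivative_def D_def
     by (simp add: sum_distrib_left sum_negf mult.assoc)
   next
    show "continuous_on {0..1} (%s. - D (x - s *\<^sub>R y))"
     by (intro continuous_on_minus continuous_on_compose2[OF Dc] continuous_on_diff continuous_on_scaleR
       continuous_on_id continuous_on_const) auto
   qed simp
   then have *: "(LINT s|lborel. indicator {0..1} s * D (x - s *\<^sub>R y)) = ph x - ph (x - y)"
    by simp
   have "(LINT s|lborel. K s x) = (LINT s|lborel. v x * (indicator {0..1} s * D (x - s *\<^sub>R y)))"
    by (simp add: K_def mult.left_commute)
   then show ?thesis using * by simp
  qed
  have slice: "(LINT x|lborel. K s x) = - (LINT x|lborel. H s x * ph x)" for s
  proof (cases "s : {0..1}")
   case True
   define phs where "phs x = ph (x - s *\<^sub>R y)" for x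
   have phs: "phs : test_functions U"
    unfolding phs_def[abs_def] using ph A(2) True by (intro test_function_translate[of _ A]) auto
   have phsm: "phs : borel_measurable borel" using test_functionD(3)[OF phs] by (rule continuous_borel)
   have phsB: "\<bar>phs x\<bar> <= B" for x by (simp add: phs_def B)
   have pd: "partial_deriv b phs x = partial_deriv b ph (x - s *\<^sub>R y)" for b x
    unfolding phs_def[abs_def] using phd by (rule partial_deriv_translate)
   have pm: "partial_deriv b phs : borel_measurable borel" if "b : Basis" for b
    using test_functionD(3)[OF test_function_partial_deriv[OF phs that]] by (rule continuous_borel)
   have pi: "integrable lborel (%x. v x * partial_deriv b phs x)" if b: "b : Basis" for b
   proof -
    obtain C where "!!x. \<bar>partial_deriv b phs x\<bar> <= C"
     using test_function_bounded[OF test_function_partial_deriv[OF phs b]] by blast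
    then show ?thesis using lborel_bounded_mult_integrable[OF v(2) pm[OF b]] by blast
   qed
   have gb: "integrable lborel (%x. (g x \<bullet> b) * phs x)" for b
    using g(2) by (intro lborel_bounded_mult_integrable[OF _ phsm phsB]) auto
   have "(LINT x|lborel. K s x) = (LINT x|lborel. (\<Sum>b\<in>Basis. (y \<bullet> b) * (v x * partial_deriv b phs x)))"
    using True by (simp add: K_def D_def pd sum_distrib_left mult.left_commute)
   also have "... = (\<Sum>b\<in>Basis. (y \<bullet> b) * (LINT x|lborel. v x * partial_deriv b phs x))"
    using pi by (subst Bochner_Integration.integral_sum) auto
   also have "... = (\<Sum>b\<in>Basis. (y \<bullet> b) * - (LINT x|lborel. (g x \<bullet> b) * phs x))"
   proof (rule sum.cong[OF refl])
    fix b :: 'a assume b: "b : Basis"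
    have "(LINT x|lborel. v x * partial_deriv b phs x) = (LINT x|leb U. v x * partial_deriv b phs x)"
     using v pm[OF b] by (intro lebesgue_on_lborel(1)[symmetric] Us) auto
    also have "... = - (LINT x|leb U. (g x \<bullet> b) * phs x)"
     by (rule has_weak_gradientD(2)[OF wg phs b])
    also have "(LINT x|leb U. (g x \<bullet> b) * phs x) = (LINT x|lborel. (g x \<bullet> b) * phs x)"
     using g phsm by (intro lebesgue_on_lborel(1) Us) auto
    finally show "(y \<bullet> b) * (LINT x|lborel. v x * partial_deriv b phs x) = (y \<bullet> b) * - (LINT x|lborel. (g x \<bullet> b) * phs x)"
     by simp
   qed
   also have "... = - (LINT x|lborel. (\<Sum>b\<in>Basis. (y \<bullet> b) * ((g x \<bullet> b) * phs x)))"
    using gb by (subst Bochner_Integration.integral_sum) (auto simp: sum_negf)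
   also have "(%x. \<Sum>b\<in>Basis. (y \<bullet> b) * ((g x \<bullet> b) * phs x)) = (%x. h x * phs x)"
   proof
    fix x show "(\<Sum>b\<in>Basis. (y \<bullet> b) * ((g x \<bullet> b) * phs x)) = h x * phs x"
     unfolding h_def euclidean_inner[of "g x" y] by (simp add: sum_distrib_right sum_distrib_left mult_ac)
   qed
   also have "(LINT x|lborel. h x * phs x) = (LINT x|lborel. h (x + s *\<^sub>R y) * phs (x + s *\<^sub>R y))"
    using h(1) phsm by (intro translate_integral(1)[symmetric]) auto
   finally show ?thesis using True by (simp add: phs_def H_def)
  qed (simp add: K_def H_def)
  have Hph: "integrable (lborel \<Otimes>\<^sub>M lborel) (%(s, x). H s x * ph x)"
  proof (rule Bochner_Integration.integrable_bound)
   show "integrable (lborel \<Otimes>\<^sub>M lborel) (%p. B * \<bar>case_prod H p\<bar>)" using Hi by auto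
   have "(%p. case_prod H p * ph (snd p)) : borel_measurable (lborel \<Otimes>\<^sub>M lborel)"
    using borel_measurable_integrable[OF Hi] phm by (intro borel_measurable_times) auto
   then show "(%(s, x). H s x * ph x) : borel_measurable (lborel \<Otimes>\<^sub>M lborel)"
    by (simp add: case_prod_beta)
   have "\<bar>H s x * ph x\<bar> <= \<bar>B * \<bar>H s x\<bar>\<bar>" for s x
   proof -
    have "\<bar>H s x\<bar> * \<bar>ph x\<bar> <= \<bar>H s x\<bar> * B" by (intro mult_left_mono B) auto
    also have "... <= \<bar>B * \<bar>H s x\<bar>\<bar>" by (simp add: mult.commute abs_le_iff)
    finally show ?thesis by (simp add: abs_mult)
   qed
   then show "AE p in lborel \<Otimes>\<^sub>M lborel. norm (case p of (s, x) => H s x * ph x) <= norm (B * \<bar>case_prod H p\<bar>)"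
    by (intro AE_I2) auto
  qed
  have I1: "integrable lborel (%x. v (x + y) * ph x)" "integrable lborel (%x. v x * ph x)" "integrable lborel (%x. G x * ph x)"
   by (rule lborel_bounded_mult_integrable[OF _ phm B], use vy v Gi in simp)+
  have phym: "(%x. ph (x - y)) : borel_measurable borel" using phm by simp
  have I2: "integrable lborel (%x. v x * ph (x - y))"
   by (rule lborel_bounded_mult_integrable[OF v(2) phym B])
  have "(LINT x|lborel. v (x + y) * ph x) = (LINT x|lborel. v x * ph (x - y))"
   using translate_integral(1)[of "%x. v x * ph (x - y)" y] v(1) phym by simp
  then have "(LINT x|lborel. v (x + y) * ph x) - (LINT x|lborel. v x * ph x) = - (LINT x|lborel. v x * (ph x - ph (x - y)))"
   using I1 I2 by (simp add: right_diff_distrib)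
  also have "... = - (LINT x|lborel. (LINT s|lborel. K s x))" by (simp add: ftc)
  also have "... = - (LINT s|lborel. (LINT x|lborel. K s x))"
   using lborel_pair.Fubini_integral[OF Ki] by simp
  also have "... = (LINT s|lborel. (LINT x|lborel. H s x * ph x))" by (simp add: slice)
  also have "... = (LINT x|lborel. (LINT s|lborel. H s x * ph x))"
   using lborel_pair.Fubini_integral[OF Hph] by simp
  also have "... = (LINT x|lborel. G x * ph x)" by (simp add: G_def)
  finally have "(LINT x|lborel. (v (x + y) - v x - G x) * ph x) = 0"
   using I1 by (simp add: left_diff_distrib)
  moreover have "(LINT x|leb A. (v (x + y) - v x - G x) * ph x) = (LINT x|lborel. (v (x + y) - v x - G x) * ph x)"
   using vy v Gm phm phz by (intro lebesgue_on_lborel(1) As) auto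
  ultimately show "(LINT x|leb A. (v (x + y) - v x - G x) * ph x) = 0" by simp
 qed
 then show ?thesis
  by eventually_elim (simp add: G_def H_def h_def)
qed

lemma borel_representative:
 fixes u :: "'a::euclidean_space => 'b::euclidean_space"
 assumes U: "open U" and u: "u : borel_measurable (leb U)"
 obtains u' where "u' : borel_measurable borel" "!!x. x \<notin> U ==> u' x = 0"
  "AE x in leb U. u x = u' x"
proof -
 have Us: "U : sets lebesgue" using U by auto
 have "\<exists>w. w : borel_measurable lborel \<and> (AE x in lborel. indicator U x * (u x \<bullet> b) = w x)" for b
 proof -
  have "(%x. u x \<bullet> b) : borel_measurable (leb U)" using u by auto
  then have "(%x. indicator U x *\<^sub>R (u x \<bullet> b)) : borel_measurable lebesgue"
   using Us by (subst borel_measurable_restrict_space_iff[symmetric]) auto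
  then show ?thesis
   using completion_ex_borel_measurable_real[of "%x. indicator U x *\<^sub>R (u x \<bullet> b)" lborel] by auto
 qed
 then obtain w where w: "!!b. w b : borel_measurable lborel"
   "!!b. AE x in lborel. indicator U x * (u x \<bullet> b) = w b x" by metis
 define u' where "u' x = indicator U x *\<^sub>R (\<Sum>b\<in>Basis. w b x *\<^sub>R b)" for x
 show thesis
 proof (rule that)
  have "(%x. \<Sum>b\<in>Basis. w b x *\<^sub>R b) : borel_measurable borel"
   using w(1) by (intro borel_measurable_sum borel_measurable_scaleR) (auto simp: measurable_lborel1)
  then show "u' : borel_measurable borel"
   unfolding u'_def[abs_def] using U by (intro borel_measurable_scaleR borel_measurable_indicator) auto
  show "u' x = 0" if "x \<notin> U" for x using that by (simp add: u'_def)
  have "AE x in lborel. \<forall>b\<in>Basis. indicator U x * (u x \<bullet> b) = w b x"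
   using w(2) by (subst AE_finite_all) auto
  then have "AE x in lebesgue. \<forall>b\<in>Basis. indicator U x * (u x \<bullet> b) = w b x"
   by (simp add: AE_completion)
  then have "AE x in lebesgue. x : U --> u x = u' x"
  proof eventually_elim
   fix x assume *: "\<forall>b\<in>Basis. indicator U x * (u x \<bullet> b) = w b x"
   show "x : U --> u x = u' x"
   proof
    assume "x : U"
    then have "w b x = u x \<bullet> b" if "b : Basis" for b using * that by (metis indicator_simps(1) mult_1)
    then have "(\<Sum>b\<in>Basis. w b x *\<^sub>R b) = (\<Sum>b\<in>Basis. (u x \<bullet> b) *\<^sub>R b)"
     by (intro sum.cong) auto
    then show "u x = u' x" using \<open>x : U\<close> by (simp add: u'_def euclidean_representation)
   qed
  qed
  then show "AE x in leb U. u x = u' x"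
   using Us by (simp add: AE_restrict_space_iff)
 qed
qed

lemma L2_cong_AE:
 assumes "u : L2_space U" "AE x in leb U. u x = u' x" "u' : borel_measurable (leb U)"
 shows "u' : L2_space U"
proof -
 have "integrable (leb U) (%x. (norm (u' x))\<^sup>2)"
 proof (rule integrable_cong_AE_imp[of _ "%x. (norm (u x))\<^sup>2"])
  show "AE x in leb U. (norm (u x))\<^sup>2 = (norm (u' x))\<^sup>2"
   using assms(2) by eventually_elim simp
 qed (use assms in \<open>auto simp: L2_space_def\<close>)
 then show ?thesis using assms(3) by (simp add: L2_space_def)
qed

lemma has_weak_gradient_cong_AE:
 assumes w: "has_weak_gradient U u g" and m: "u : borel_measurable (leb U)"
  and u': "AE x in leb U. u x = u' x" "u' : borel_measurable (leb U)"
  and g': "AE x in leb U. g x = g' x" "g' : borel_measurable (leb U)"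
 shows "has_weak_gradient U u' g'"
 unfolding has_weak_gradient_def
proof (intro conjI ballI)
 note g = has_weak_gradientD(1)[OF w]
 show "g' : L2_space U" using g g' by (rule L2_cong_AE)
 fix ph b assume ph: "ph : test_functions U" and b: "b : (Basis :: 'a set)"
 have pm: "partial_deriv b ph : borel_measurable (leb U)" "ph : borel_measurable (leb U)"
  using test_functionD(3)[OF ph] test_functionD(3)[OF test_function_partial_deriv[OF ph b]]
  by (auto intro: continuous_measurable_lebesgue_on)
 have "(LINT x|leb U. u' x * partial_deriv b ph x) = (LINT x|leb U. u x * partial_deriv b ph x)"
 proof (rule integral_cong_AE)
  show "AE x in leb U. u' x * partial_deriv b ph x = u x * partial_deriv b ph x"
   using u'(1) by eventually_elim simp
 qed (use u' m pm in auto)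
 also have "... = - (LINT x|leb U. (g x \<bullet> b) * ph x)" by (rule has_weak_gradientD(2)[OF w ph b])
 also have "(LINT x|leb U. (g x \<bullet> b) * ph x) = (LINT x|leb U. (g' x \<bullet> b) * ph x)"
 proof (rule integral_cong_AE)
  show "AE x in leb U. (g x \<bullet> b) * ph x = (g' x \<bullet> b) * ph x"
   using g'(1) by eventually_elim simp
 qed (use g' L2_measurable[OF g] pm in auto)
 finally show "(LINT x|leb U. u' x * partial_deriv b ph x) = - (LINT x|leb U. (g' x \<bullet> b) * ph x)" .
qed

text \<open>Borel representatives extended by zero live on the whole space, where translations and Fubini
need no restriction to the domain.\<close>

definition borel_H1 :: "'a::euclidean_space set => ('a => real) => ('a => 'a) => bool" where
 "borel_H1 U v g \<longleftrightarrow> v : borel_measurable borel \<and> g : borel_measurable borel \<and>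
  (\<forall>x. x \<notin> U --> v x = 0 \<and> g x = 0) \<and> v : L2_space U \<and> has_weak_gradient U v g"

lemma borel_H1_representative:
 assumes U: "open U" and u: "u : L2_space U" "has_weak_gradient U u g"
 obtains v h where "borel_H1 U v h" "AE x in leb U. u x = v x" "AE x in leb U. g x = h x"
proof -
 note g = has_weak_gradientD(1)[OF u(2)]
 obtain v where v: "v : borel_measurable borel" "!!x. x \<notin> U ==> v x = 0" "AE x in leb U. u x = v x"
  using borel_representative[OF U L2_measurable[OF u(1)]] by blast
 obtain h where h: "h : borel_measurable borel" "!!x. x \<notin> U ==> h x = 0" "AE x in leb U. g x = h x"
  using borel_representative[OF U L2_measurable[OF g]] by blast
 have "v : L2_space U" using u(1) v(3) borel_measurable_lebesgue_on[OF v(1)] by (rule L2_cong_AE)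
 moreover have "has_weak_gradient U v h"
  by (rule has_weak_gradient_cong_AE[OF u(2) L2_measurable[OF u(1)] v(3) borel_measurable_lebesgue_on[OF v(1)]
     h(3) borel_measurable_lebesgue_on[OF h(1)]])
 ultimately show ?thesis using that[of v h] v h by (simp add: borel_H1_def)
qed

lemma borel_L2_lborel:
 fixes f :: "'a::euclidean_space => 'b::euclidean_space"
 assumes "U : lmeasurable" "f : borel_measurable borel" "!!x. x \<notin> U ==> f x = 0" "f : L2_space U"
 shows "integrable lborel (%x. (norm (f x))\<^sup>2)" "integrable lborel f"
  "(LINT x|leb U. (norm (f x))\<^sup>2) = (LINT x|lborel. (norm (f x))\<^sup>2)"
proof -
 have Us: "U : sets lebesgue" using assms(1) by auto
 have n: "(%x. norm (f x)) : borel_measurable borel" "(%x. (norm (f x))\<^sup>2) : borel_measurable borel"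
  using assms(2) by auto
 show "integrable lborel (%x. (norm (f x))\<^sup>2)"
  using lebesgue_on_lborel(2)[OF n(2) _ Us] assms(3) L2_integrable_square[OF assms(4)] by simp
 show "(LINT x|leb U. (norm (f x))\<^sup>2) = (LINT x|lborel. (norm (f x))\<^sup>2)"
  using lebesgue_on_lborel(1)[OF n(2) _ Us] assms(3) by simp
 have "integrable lborel (%x. norm (f x))"
  using lebesgue_on_lborel(2)[OF n(1) _ Us] assms(3) L2_integrable[OF assms(1,4)] by simp
 then show "integrable lborel f"
  using assms(2) by (subst (asm) integrable_norm_iff) auto
qed

lemma borel_H1D:
 assumes "borel_H1 U v g" "U : lmeasurable"
 shows "v : borel_measurable borel" "g : borel_measurable borel" "!!x. x \<notin> U ==> v x = 0" "!!x. x \<notin> U ==> g x = 0"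
  "v : L2_space U" "g : L2_space U" "has_weak_gradient U v g"
  "integrable lborel v" "integrable lborel g" "integrable lborel (%x. (v x)\<^sup>2)" "integrable lborel (%x. (norm (g x))\<^sup>2)"
  "(LINT x|leb U. (norm (g x))\<^sup>2) = (LINT x|lborel. (norm (g x))\<^sup>2)"
proof -
 show 1: "v : borel_measurable borel" "g : borel_measurable borel" "!!x. x \<notin> U ==> v x = 0" "!!x. x \<notin> U ==> g x = 0"
  "v : L2_space U" "has_weak_gradient U v g"
  using assms(1) by (auto simp: borel_H1_def)
 show g: "g : L2_space U" using has_weak_gradientD(1)[OF 1(6)] .
 show "integrable lborel v" by (rule borel_L2_lborel(2)[OF assms(2) 1(1) 1(3) 1(5)])
 show "integrable lborel (%x. (v x)\<^sup>2)" using borel_L2_lborel(1)[OF assms(2) 1(1) 1(3) 1(5)] by simp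
 show "integrable lborel g" by (rule borel_L2_lborel(2)[OF assms(2) 1(2) 1(4) g])
 show "integrable lborel (%x. (norm (g x))\<^sup>2)" by (rule borel_L2_lborel(1)[OF assms(2) 1(2) 1(4) g])
 show "(LINT x|leb U. (norm (g x))\<^sup>2) = (LINT x|lborel. (norm (g x))\<^sup>2)"
  by (rule borel_L2_lborel(3)[OF assms(2) 1(2) 1(4) g])
qed

lemma unit_interval_jensen:
 fixes k :: "real => real"
 assumes "integrable lborel (%s. indicator {0..1} s * k s)" "integrable lborel (%s. indicator {0..1} s * (k s)\<^sup>2)"
 shows "(LINT s|lborel. indicator {0..1} s * k s)\<^sup>2 <= (LINT s|lborel. indicator {0..1} s * (k s)\<^sup>2)"
proof -
 define c where "c = (LINT s|lborel. indicator {0..1} s * k s)"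
 have i: "integrable lborel (%s. indicator {0..1::real} s * c\<^sup>2)" by simp
 have e: "indicator {0..1} s * (k s - c)\<^sup>2 =
   indicator {0..1} s * (k s)\<^sup>2 - (2 * c) * (indicator {0..1} s * k s) + indicator {0..1} s * c\<^sup>2" for s :: real
  by (simp add: power2_diff algebra_simps)
 have "0 <= (LINT s|lborel. indicator {0..1} s * (k s - c)\<^sup>2)" by (rule integral_nonneg_AE) simp
 also have "... = (LINT s|lborel. indicator {0..1} s * (k s)\<^sup>2) - 2 * c * c + c\<^sup>2"
  unfolding e using assms i by (simp add: c_def)
 finally show ?thesis by (simp add: c_def power2_eq_square)
qed

text \<open>Square the translation identity, apply Jensen on the unit interval and integrate.\<close>

theorem translation_estimate:
 assumes b: "borel_H1 U v g" and U: "open U" "U : lmeasurable"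
  and A: "open A" "!!x s. x : A ==> s : {0..1} ==> x + s *\<^sub>R y : U"
 shows "integrable lborel (%x. indicator A x * (v (x + y) - v x)\<^sup>2)" (is ?int)
  and "(LINT x|lborel. indicator A x * (v (x + y) - v x)\<^sup>2) <= (norm y)\<^sup>2 * (LINT x|lborel. (norm (g x))\<^sup>2)" (is ?le)
proof -
 note B = borel_H1D[OF b U(2)]
 have Ab: "A : sets borel" using A by auto
 have s1: "integrable lborel (%x. 2 * (v (x + y))\<^sup>2 + 2 * (v x)\<^sup>2)"
  using B(10) translate_integral(2)[of "%x. (v x)\<^sup>2" y] B(1) by auto
 have vm: "(%x. v (x + y)) : borel_measurable borel" using B(1) by simp
 have im: "(indicator A :: 'a => real) : borel_measurable borel" using Ab by simp
 show ?int
 proof (rule Bochner_Integration.integrable_bound[OF s1])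
  show "(%x. indicator A x * (v (x + y) - v x)\<^sup>2) : borel_measurable lborel"
   using im vm B(1) by simp
  have "(v (x + y) - v x)\<^sup>2 <= 2 * (v (x + y))\<^sup>2 + 2 * (v x)\<^sup>2" for x
   using zero_le_power2[of "v (x + y) + v x"] by (simp add: power2_sum power2_diff)
  then show "AE x in lborel. norm (indicator A x * (v (x + y) - v x)\<^sup>2) <= norm (2 * (v (x + y))\<^sup>2 + 2 * (v x)\<^sup>2)"
   by (intro AE_I2) (auto simp: indicator_def)
 qed
 define h where "h x = g x \<bullet> y" for x
 have hm: "h : borel_measurable borel" using B(2) by (simp add: h_def[abs_def])
 have hi: "integrable lborel h" using B(9) by (simp add: h_def[abs_def])
 have hle: "(h x)\<^sup>2 <= (norm y)\<^sup>2 * (norm (g x))\<^sup>2" for x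
  using power_mono[OF Cauchy_Schwarz_ineq2[of "g x" y] abs_ge_zero, of 2]
  by (simp add: power_mult_distrib mult.commute h_def)
 have h2i: "integrable lborel (%x. (h x)\<^sup>2)"
 proof (rule Bochner_Integration.integrable_bound)
  show "integrable lborel (%x. (norm y)\<^sup>2 * (norm (g x))\<^sup>2)" using B(11) by simp
  show "AE x in lborel. norm ((h x)\<^sup>2) <= norm ((norm y)\<^sup>2 * (norm (g x))\<^sup>2)" using hle by simp
 qed (use hm in simp)
 have P1: "integrable (lborel \<Otimes>\<^sub>M lborel) (%(s, x). indicator {0..1::real} s * h (x + s *\<^sub>R y))"
  by (rule segment_integrable[OF hm hi])
 have P2: "integrable (lborel \<Otimes>\<^sub>M lborel) (%(s, x). indicator {0..1::real} s * (h (x + s *\<^sub>R y))\<^sup>2)"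
  by (rule segment_integrable[of "%x. (h x)\<^sup>2"]) (use hm h2i in auto)
 have id: "AE x in leb A. v (x + y) - v x = (LINT s|lborel. indicator {0..1} s * (g (x + s *\<^sub>R y) \<bullet> y))"
  by (rule translation_identity[OF B(1) B(8) B(3) B(2) B(9) B(4) B(7) U(1) A])
 have As: "A : sets lebesgue" using A by auto
 have "AE x in lebesgue. x : A --> v (x + y) - v x = (LINT s|lborel. indicator {0..1} s * h (x + s *\<^sub>R y))"
  using id As by (simp add: AE_restrict_space_iff h_def)
 moreover have "{x \<in> space lborel. x : A --> v (x + y) - v x = (LINT s|lborel. indicator {0..1} s * h (x + s *\<^sub>R y))} \<in> sets lborel"
 proof -
  have "(%x. \<integral>s. indicator {0..1} s * h (x + s *\<^sub>R y) \<partial>lborel) : borel_measurable borel"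
   using borel_measurable_integrable[OF lborel_pair.integrable_snd[OF P1]] by simp
  then have e: "(%x. v (x + y) - v x - (LINT s|lborel. indicator {0..1} s * h (x + s *\<^sub>R y))) : borel_measurable borel"
   using vm B(1) by simp
  have "{x \<in> space lborel. x : A --> v (x + y) - v x = (LINT s|lborel. indicator {0..1} s * h (x + s *\<^sub>R y))}
   = - A \<union> (%x. v (x + y) - v x - (LINT s|lborel. indicator {0..1} s * h (x + s *\<^sub>R y))) -` {0}"
   by auto
  also have "... \<in> sets lborel"
   using Ab measurable_sets[OF e, of "{0}"] by (intro sets.Un) auto
  finally show ?thesis .
 qed
 ultimately have id': "AE x in lborel. x : A --> v (x + y) - v x = (LINT s|lborel. indicator {0..1} s * h (x + s *\<^sub>R y))"
  by (subst (asm) AE_completion_iff) auto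
 have "(LINT x|lborel. indicator A x * (v (x + y) - v x)\<^sup>2)
   <= (LINT x|lborel. (LINT s|lborel. indicator {0..1} s * (h (x + s *\<^sub>R y))\<^sup>2))"
 proof (rule integral_mono_AE[OF \<open>?int\<close> lborel_pair.integrable_snd[OF P2]])
  show "AE x in lborel. indicator A x * (v (x + y) - v x)\<^sup>2 <= (LINT s|lborel. indicator {0..1} s * (h (x + s *\<^sub>R y))\<^sup>2)"
   using id' lborel_pair.AE_integrable_snd[OF P1] lborel_pair.AE_integrable_snd[OF P2]
  proof eventually_elim
   case (elim x)
   show ?case
   proof (cases "x : A")
    case True
    then show ?thesis using elim unit_interval_jensen[OF elim(2,3)] by simp
   next
    case False
    have "0 <= (LINT s|lborel. indicator {0..1} s * (h (x + s *\<^sub>R y))\<^sup>2)" by (rule integral_nonneg_AE) simp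
    with False show ?thesis by simp
   qed
  qed
 qed
 also have "... = (LINT s|lborel. (LINT x|lborel. indicator {0..1} s * (h (x + s *\<^sub>R y))\<^sup>2))"
  by (rule lborel_pair.Fubini_integral[OF P2])
 also have "... = (LINT s|lborel. indicator {0..1::real} s * (LINT x|lborel. (h x)\<^sup>2))"
  using translate_integral(1)[of "%x. (h x)\<^sup>2"] hm by simp
 also have "... = (LINT x|lborel. (h x)\<^sup>2)" by simp
 also have "... <= (LINT x|lborel. (norm y)\<^sup>2 * (norm (g x))\<^sup>2)"
  using h2i B(11) hle by (intro integral_mono) auto
 also have "... = (norm y)\<^sup>2 * (LINT x|lborel. (norm (g x))\<^sup>2)" by simp
 finally show ?le .
qed

section \<open>The chain rule for weak gradients\<close>

lemma partial_deriv_line: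
 assumes "f differentiable (at (x + t *\<^sub>R b))"
 shows "((%t. f (x + t *\<^sub>R b)) has_real_derivative partial_deriv b f (x + t *\<^sub>R b)) (at t)"
proof -
 have d: "(f has_derivative frechet_derivative f (at (x + t *\<^sub>R b))) (at (x + t *\<^sub>R b))"
  using assms frechet_derivative_works by blast
 have l: "linear (frechet_derivative f (at (x + t *\<^sub>R b)))"
  using d by (rule has_derivative_linear)
 have "((%t. x + t *\<^sub>R b) has_derivative (%t. t *\<^sub>R b)) (at t)"
  by (auto intro!: derivative_eq_intros)
 from has_derivative_compose[OF this d]
 have "((%t. f (x + t *\<^sub>R b)) has_derivative (%s. frechet_derivative f (at (x + t *\<^sub>R b)) (s *\<^sub>R b))) (at t)" .
 moreover have "(%s. frechet_derivative f (at (x + t *\<^sub>R b)) (s *\<^sub>R b)) = (*) (partial_deriv b f (x + t *\<^sub>R b))"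
  by (rule ext) (simp add: partial_deriv_def linear_cmul[OF l])
 ultimately show ?thesis
  by (simp add: has_field_derivative_def)
qed

lemma difference_quotient_bound:
 assumes d: "!!x. f differentiable (at x)" and M: "!!x. \<bar>partial_deriv b f x\<bar> <= M"
 shows "\<bar>f x - f (x - h *\<^sub>R b)\<bar> <= M * \<bar>h\<bar>"
proof -
 have D: "((%t. f (x + t *\<^sub>R b)) has_real_derivative partial_deriv b f (x + t *\<^sub>R b)) (at t within UNIV)" for t
  using partial_deriv_line[OF d] by blast
 have "norm (f (x + 0 *\<^sub>R b) - f (x + (- h) *\<^sub>R b)) <= M * norm (0 - (- h))"
  by (rule field_differentiable_bound[OF convex_UNIV D]) (use M in auto)
 then show ?thesis by simp
qed

lemma difference_quotient_limit:
 assumes d: "f differentiable (at x)" and h: "h \<longlonglongrightarrow> 0" "!!n. h n ~= (0::real)"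
 shows "(%n. (f x - f (x - h n *\<^sub>R b)) / h n) \<longlonglongrightarrow> partial_deriv b f x"
proof -
 have "((%t. f (x + t *\<^sub>R b)) has_real_derivative partial_deriv b f x) (at 0)"
  using partial_deriv_line[of f x 0 b] d by simp
 then have l: "((%t. (f (x + t *\<^sub>R b) - f x) / t) \<longlongrightarrow> partial_deriv b f x) (at 0)"
  by (simp add: DERIV_def)
 have "filterlim (%n. - h n) (at 0) sequentially"
  using h tendsto_minus[OF h(1)] by (auto simp: filterlim_at)
 from filterlim_compose[OF l this]
 have "(%n. (f (x + (- h n) *\<^sub>R b) - f x) / (- h n)) \<longlonglongrightarrow> partial_deriv b f x" .
 moreover have "(f (x + (- h n) *\<^sub>R b) - f x) / (- h n) = (f x - f (x - h n *\<^sub>R b)) / h n" for n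
  by (metis (no_types) add_uminus_conv_diff minus_diff_eq minus_divide_divide scaleR_minus_left)
 ultimately show ?thesis by simp
qed

lemma compact_support_bounded_real:
 fixes ph :: "'a::euclidean_space => real"
 assumes "continuous_on UNIV ph" "compactly_supported_in U ph"
 obtains B where "!!x. \<bar>ph x\<bar> <= B" "B >= 0"
 using compact_support_bounded[OF assms] by (metis real_norm_def)

lemma integral_difference_quotient_limit:
 fixes f ph :: "'a::euclidean_space => real"
 assumes f: "integrable lborel f" and ph: "C_k_on 1 ph UNIV" "compactly_supported_in U ph"
  and b: "b : Basis" and h: "h \<longlonglongrightarrow> 0" "!!n. h n ~= (0::real)"
 shows "(%n. (LINT x|lborel. (f x - f (x + h n *\<^sub>R b)) * ph x) / h n)
  \<longlonglongrightarrow> (LINT x|lborel. f x * partial_deriv b ph x)"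
proof -
 have d: "ph differentiable (at x)" for x using ph(1) by simp
 have phc: "continuous_on UNIV ph" using C_k_on_continuous[OF ph(1)] .
 have pc: "continuous_on UNIV (partial_deriv b ph)" using ph(1) b by simp
 note m = continuous_borel[OF phc] continuous_borel[OF pc] borel_measurable_integrable[OF f]
 obtain M where M: "!!x. \<bar>partial_deriv b ph x\<bar> <= M"
  using compact_support_bounded_real[OF pc partial_deriv_compact_support[OF ph(2)]] by metis
 obtain B where B: "!!x. \<bar>ph x\<bar> <= B"
  using compact_support_bounded_real[OF phc ph(2)] by metis
 have fm: "f : borel_measurable borel" using m(3) by simp
 have pht: "(%x. ph (x - c)) : borel_measurable borel" for c using m(1) by simp
 have ft: "integrable lborel (%x. f (x + c))" for c using translate_integral(2)[OF fm] f by simp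
 have lim: "(%n. \<integral>x. f x * ((ph x - ph (x - h n *\<^sub>R b)) / h n) \<partial>lborel) \<longlonglongrightarrow> (LINT x|lborel. f x * partial_deriv b ph x)"
 proof (rule integral_dominated_convergence[where w = "%x. M * \<bar>f x\<bar>"])
  show "integrable lborel (%x. M * \<bar>f x\<bar>)" using f by simp
  show "(%x. f x * partial_deriv b ph x) : borel_measurable lborel" using fm m(2) by simp
  show "(%x. f x * ((ph x - ph (x - h n *\<^sub>R b)) / h n)) : borel_measurable lborel" for n
   using fm m(1) pht by simp
  show "AE x in lborel. (%n. f x * ((ph x - ph (x - h n *\<^sub>R b)) / h n)) \<longlonglongrightarrow> f x * partial_deriv b ph x"
   by (intro AE_I2 tendsto_mult_left difference_quotient_limit d h)
  show "AE x in lborel. norm (f x * ((ph x - ph (x - h n *\<^sub>R b)) / h n)) <= M * \<bar>f x\<bar>" for n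
  proof (intro AE_I2)
   fix x
   have "\<bar>(ph x - ph (x - h n *\<^sub>R b)) / h n\<bar> <= M"
    using difference_quotient_bound[OF d M, of x "h n"] h(2)[of n] by (simp add: field_simps)
   from mult_left_mono[OF this, of "\<bar>f x\<bar>"]
   show "norm (f x * ((ph x - ph (x - h n *\<^sub>R b)) / h n)) <= M * \<bar>f x\<bar>"
    by (simp add: abs_mult mult.commute)
  qed
 qed
 have eq: "(LINT x|lborel. f x * ((ph x - ph (x - c)) / e)) = (LINT x|lborel. (f x - f (x + c)) * ph x) / e" for c e
 proof -
  have i: "integrable lborel (%x. f x * ph x)" "integrable lborel (%x. f x * ph (x - c))" "integrable lborel (%x. f (x + c) * ph x)"
   by (rule lborel_bounded_mult_integrable[OF f m(1) B], rule lborel_bounded_mult_integrable[OF f pht B],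
     rule lborel_bounded_mult_integrable[OF ft m(1) B])
  have "(LINT x|lborel. f x * ph (x - c)) = (LINT x|lborel. f (x + c) * ph x)"
   using translate_integral(1)[of "%x. f x * ph (x - c)" c] fm pht by simp
  then show ?thesis
   using i by (simp add: right_diff_distrib left_diff_distrib)
 qed
 from lim show ?thesis unfolding eq .
qed

lemma compact_support_room:
 fixes ph :: "'a::euclidean_space => 'b::zero"
 assumes "compactly_supported_in U ph" "open U"
 obtains A de where "open A" "de > 0" "!!x. ph x ~= 0 ==> x : A"
  "!!x y. x : A ==> norm y <= de ==> x + y : U"
proof -
 let ?K = "closure {x. ph x ~= 0}"
 have K: "compact ?K" "?K \<subseteq> U" using assms(1) by (auto simp: compactly_supported_in_def)
 obtain e where e: "e > 0" "(\<Union>x\<in>?K. ball x e) \<subseteq> U"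
  using compact_subset_open_imp_ball_epsilon_subset[OF K(1) assms(2) K(2)] by blast
 let ?A = "\<Union>x\<in>?K. ball x (e / 2)"
 show thesis
 proof (rule that[of ?A "e / 4"])
  show "x : ?A" if "ph x ~= 0" for x
  proof -
   from that have "x : {x. ph x ~= 0}" by simp
   then have "x : ?K" by (rule subsetD[OF closure_subset])
   then show ?thesis using e(1) by (intro UN_I[of x]) auto
  qed
  show "x + y : U" if x: "x : ?A" and y: "norm y <= e / 4" for x y
  proof -
   from x obtain z where z: "z : ?K" "dist z x < e / 2" by auto
   have "dist z (x + y) <= dist z x + norm y"
    using dist_triangle[of z "x + y" x] by (simp add: dist_norm)
   also have "... < e" using z y e(1) by linarith
   finally have "x + y : ball z e" by simp
   with z(1) e(2) show ?thesis by blast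
  qed
 qed (use e in auto)
qed

text \<open>Mean value inequality for the function minus its tangent at \<open>t\<close>.\<close>

lemma lipschitz_taylor:
 fixes et ka :: "real => real"
 assumes et: "!!s. (et has_real_derivative ka s) (at s)" and L': "!!s t. \<bar>ka s - ka t\<bar> <= L' * \<bar>s - t\<bar>"
 shows "\<bar>et s - et t - ka t * (s - t)\<bar> <= L' * (s - t)\<^sup>2"
proof -
 have L0: "L' >= 0" using order_trans[OF abs_ge_zero L'[of 0 1]] by simp
 have D: "((%r. et r - ka t * r) has_real_derivative ka r - ka t) (at r within closed_segment t s)" for r
  by (rule DERIV_subset[OF _ subset_UNIV]) (auto intro!: derivative_eq_intros et)
 have "norm ((et s - ka t * s) - (et t - ka t * t)) <= (L' * \<bar>s - t\<bar>) * norm (s - t)"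
 proof (rule field_differentiable_bound[OF convex_closed_segment D])
  fix r assume "r : closed_segment t s"
  then have "\<bar>r - t\<bar> <= \<bar>s - t\<bar>" by (auto simp: closed_segment_eq_real_ivl split: if_splits)
  then have "L' * \<bar>r - t\<bar> <= L' * \<bar>s - t\<bar>" using L0 by (rule mult_left_mono)
  with L'[of r t] show "norm (ka r - ka t) <= L' * \<bar>s - t\<bar>" by simp
 qed auto
 then show ?thesis by (simp add: algebra_simps power2_eq_square abs_mult_self_eq flip: abs_mult)
qed

text \<open>Integration by parts for \<open>et v\<close> against a \<open>C\<^sup>1\<close> function with compact support. The derivative is replaced by a difference
quotient, which a translation moves onto \<open>et v\<close>; Taylor's formula for \<open>et\<close> then
leaves the slope of \<open>et\<close> times a difference quotient of \<open>v\<close>, and the quadratic remainder is \<open>O(h)\<close> by the translation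
estimate.\<close>

theorem borel_chain_rule:
 fixes v :: "'a::euclidean_space => real" and et ka :: "real => real"
 assumes bv: "borel_H1 U v g" and U: "open U" "U : lmeasurable"
  and et: "!!s. (et has_real_derivative ka s) (at s)"
  and L: "!!s. \<bar>ka s\<bar> <= L" and L': "!!s t. \<bar>ka s - ka t\<bar> <= L' * \<bar>s - t\<bar>"
  and ph: "C_k_on 1 ph UNIV" "compactly_supported_in U ph" and b: "b : Basis"
 shows "(LINT x|lborel. indicator U x * et (v x) * partial_deriv b ph x) = - (LINT x|lborel. ka (v x) * (g x \<bullet> b) * ph x)"
proof -
 note B = borel_H1D[OF bv U(2)]
 have Ub: "U : sets borel" using U by auto
 have L0: "L >= 0" "L' >= 0" using order_trans[OF abs_ge_zero L[of 0]] order_trans[OF abs_ge_zero L'[of 0 1]] by simp_all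
 have etc: "continuous_on UNIV et" using et by (meson DERIV_isCont continuous_at_imp_continuous_on)
 have etm: "et : borel_measurable borel" using etc by (rule borel_measurable_continuous_onI)
 have kac: "continuous_on UNIV ka"
 proof (rule lipschitz_on_continuous_on)
  show "L'-lipschitz_on UNIV ka" using L' L0 by (auto intro!: lipschitz_onI simp: dist_real_def)
 qed
 have kam: "ka : borel_measurable borel" using kac by (rule borel_measurable_continuous_onI)
 define f where "f x = indicator U x * et (v x)" for x
 have fm: "f : borel_measurable borel"
  unfolding f_def[abs_def] using Ub measurable_compose[OF B(1) etm] by simp
 have fi: "integrable lborel f"
 proof (rule Bochner_Integration.integrable_bound)
  have "emeasure lebesgue U = emeasure lborel U" using Ub by simp
  then have "emeasure lborel U < \<infinity>"
   using fmeasurableD2[OF U(2)] by (simp add: less_top)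
  then have "integrable lborel (%x. indicator U x :: real)"
   using Ub by (intro integrable_real_indicator) auto
  then show "integrable lborel (%x. \<bar>et 0\<bar> * indicator U x + L * \<bar>v x\<bar>)" using B(8) by simp
  have "\<bar>et s - et 0\<bar> <= L * \<bar>s - 0\<bar>" for s
   using field_differentiable_bound[of UNIV et ka L s 0] et L by auto
  then have *: "\<bar>et s\<bar> <= \<bar>et 0\<bar> + L * \<bar>s\<bar>" for s
   by (smt (verit))
  show "AE x in lborel. norm (f x) <= norm (\<bar>et 0\<bar> * indicator U x + L * \<bar>v x\<bar>)"
  proof (intro AE_I2)
   fix x have "0 <= L * \<bar>v x\<bar>" using L0 by simp
   then show "norm (f x) <= norm (\<bar>et 0\<bar> * indicator U x + L * \<bar>v x\<bar>)"
    using *[of "v x"] by (cases "x : U") (auto simp: f_def)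
  qed
 qed (use fm in simp)
 obtain A de where A: "open A" "de > 0" "!!x. ph x ~= 0 ==> x : A" "!!x y. x : A ==> norm y <= de ==> x + y : U"
  using compact_support_room[OF ph(2) U(1)] by blast
 have AU: "x : U" if "x : A" for x using A(4)[OF that, of 0] A(2) by simp
 have Ab: "(indicator A :: 'a => real) : borel_measurable borel" using A(1) by simp
 have nb: "norm b = 1" using b by simp
 have phc: "continuous_on UNIV ph" using C_k_on_continuous[OF ph(1)] .
 have pc: "continuous_on UNIV (partial_deriv b ph)" using ph(1) b by simp
 have phd: "ph differentiable (at x)" for x using ph(1) by simp
 note phm = continuous_borel[OF phc]
 obtain M where M: "!!x. \<bar>partial_deriv b ph x\<bar> <= M"
  using compact_support_bounded_real[OF pc partial_deriv_compact_support[OF ph(2)]] by metis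
 obtain P where P: "!!x. \<bar>ph x\<bar> <= P" "P >= 0"
  using compact_support_bounded_real[OF phc ph(2)] by metis
 define k where "k x = g x \<bullet> b" for x
 have km: "k : borel_measurable borel" and ki: "integrable lborel k"
  using B(2,9) by (auto simp: k_def[abs_def])
 have kle: "(k x)\<^sup>2 <= (norm (g x))\<^sup>2" for x
  using power_mono[OF Cauchy_Schwarz_ineq2[of "g x" b] abs_ge_zero, of 2] nb
  by (simp add: power_mult_distrib k_def)
 have k2i: "integrable lborel (%x. (k x)\<^sup>2)"
  by (rule Bochner_Integration.integrable_bound[OF B(11)]) (use km kle in auto)
 define E where "E = (LINT x|lborel. (norm (g x))\<^sup>2)"
 have kE: "(LINT x|lborel. (k x)\<^sup>2) <= E"
  unfolding E_def using k2i B(11) kle by (intro integral_mono) auto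
 have E0: "E >= 0" unfolding E_def by (rule integral_nonneg_AE) simp
 define ps where "ps x = ph x * ka (v x)" for x
 have psm: "ps : borel_measurable borel"
  unfolding ps_def[abs_def] using phm measurable_compose[OF B(1) kam] by simp
 have psB: "\<bar>ps x\<bar> <= P * L" for x
  unfolding ps_def abs_mult by (intro mult_mono P L) auto
 define C where "C = P * L' * E + L * M * (LINT x|lborel. \<bar>k x\<bar>)"
 have seg: "x + s *\<^sub>R (t *\<^sub>R b) : U" if "x : A" "s : {0..1}" "\<bar>t\<bar> <= de" for x s t
 proof (rule A(4)[OF that(1)])
  have "\<bar>s\<bar> * \<bar>t\<bar> <= 1 * de" using that by (intro mult_mono) auto
  then show "norm (s *\<^sub>R (t *\<^sub>R b)) <= de" by (simp add: nb abs_mult)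
 qed
 have te: "integrable lborel (%x. indicator A x * (v (x + t *\<^sub>R b) - v x)\<^sup>2)"
  "(LINT x|lborel. indicator A x * (v (x + t *\<^sub>R b) - v x)\<^sup>2) <= t\<^sup>2 * E" if "\<bar>t\<bar> <= de" for t
  using translation_estimate[OF bv U A(1) seg[OF _ _ that]] by (auto simp: nb E_def)
 have kt: "integrable lborel (%x. k (x + t *\<^sub>R b))" "integrable lborel (%x. (k (x + t *\<^sub>R b))\<^sup>2)"
  "(%x. k (x + t *\<^sub>R b)) : borel_measurable borel" "(LINT x|lborel. (k (x + t *\<^sub>R b))\<^sup>2) <= E" for t
  using translate_integral[OF km, of "t *\<^sub>R b"] translate_integral[of "%x. (k x)\<^sup>2" "t *\<^sub>R b"] ki k2i km kE by auto
 have vt: "(%x. v (x + y)) : borel_measurable borel" for y using B(1) by simp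
 have psk: "\<bar>(LINT x|lborel. ps x * k (x + t *\<^sub>R b)) - (LINT x|lborel. ps x * k x)\<bar> <= C * t" if t: "0 < t" "t <= de" for t
 proof -
  define ta where "ta = t *\<^sub>R b"
  note te' = te[of t, folded ta_def] and kt' = kt[of t, folded ta_def]
  define r1 where "r1 x = ph x * (ka (v x) - ka (v (x + ta))) * k (x + ta)" for x
  define r2 where "r2 x = (ph x - ph (x - ta)) * ka (v x) * k x" for x
  define w where "w x = P * L' * (indicator A x * (v (x + ta) - v x)\<^sup>2 / (2 * t) + t / 2 * (k (x + ta))\<^sup>2)" for x
  have wi: "integrable lborel w"
   unfolding w_def[abs_def] using te'(1) kt'(2) t by simp
  have r1w: "\<bar>r1 x\<bar> <= w x" for x
  proof (cases "ph x = 0")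
   case True
   then show ?thesis using P(2) L0 t by (simp add: r1_def w_def)
  next
   case False
   then have x: "x : A" by (rule A(3))
   have "\<bar>v (x + ta) - v x\<bar> * \<bar>k (x + ta)\<bar> <= (v (x + ta) - v x)\<^sup>2 / (2 * t) + t / 2 * (k (x + ta))\<^sup>2"
   proof -
    have "0 <= (\<bar>v (x + ta) - v x\<bar> - t * \<bar>k (x + ta)\<bar>)\<^sup>2 / (2 * t)" using t by simp
    also have "... = (v (x + ta) - v x)\<^sup>2 / (2 * t) + t / 2 * (k (x + ta))\<^sup>2 - \<bar>v (x + ta) - v x\<bar> * \<bar>k (x + ta)\<bar>"
     using t by (simp add: power2_diff power_mult_distrib field_simps power2_eq_square)
    finally show ?thesis by simp
   qed
   then have "P * L' * (\<bar>v (x + ta) - v x\<bar> * \<bar>k (x + ta)\<bar>) <= w x"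
    unfolding w_def using x P(2) L0 by (intro mult_left_mono) auto
   moreover have "\<bar>r1 x\<bar> <= P * (L' * \<bar>v x - v (x + ta)\<bar>) * \<bar>k (x + ta)\<bar>"
    unfolding r1_def abs_mult by (intro mult_mono P L' mult_nonneg_nonneg L0) auto
   ultimately show ?thesis by (simp add: mult_ac abs_minus_commute)
  qed
  have r1m: "r1 : borel_measurable borel"
   unfolding r1_def[abs_def]
   using phm measurable_compose[OF B(1) kam] measurable_compose[OF vt kam] kt'(3) by simp
  have r1i: "integrable lborel r1"
   by (rule Bochner_Integration.integrable_bound[OF wi]) (use r1m r1w order_trans[OF r1w abs_ge_self] in auto)
  have Iw: "(LINT x|lborel. w x) <= P * L' * (t * E)"
  proof -
   have "(LINT x|lborel. w x) = P * L' * ((LINT x|lborel. indicator A x * (v (x + ta) - v x)\<^sup>2) / (2 * t) + t / 2 * (LINT x|lborel. (k (x + ta))\<^sup>2))"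
    unfolding w_def[abs_def] using te'(1) kt'(2) t by simp
   also have "... <= P * L' * (t\<^sup>2 * E / (2 * t) + t / 2 * E)"
    using te'(2) kt'(4) t P(2) L0 by (intro mult_left_mono add_mono divide_right_mono) auto
   also have "... = P * L' * (t * E)" using t by (simp add: power2_eq_square field_simps)
   finally show ?thesis .
  qed
  have I1: "\<bar>\<integral>x. r1 x \<partial>lborel\<bar> <= P * L' * (t * E)"
  proof -
   have "\<bar>\<integral>x. r1 x \<partial>lborel\<bar> <= (LINT x|lborel. \<bar>r1 x\<bar>)" using integral_norm_bound[of lborel r1] by simp
   also have "... <= (LINT x|lborel. w x)" using r1i wi r1w by (intro integral_mono) auto
   finally show ?thesis using Iw by simp
  qed
  have r2le: "\<bar>(ph x - ph (x - ta)) * ka (v x)\<bar> <= M * t * L" for x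
   unfolding abs_mult using difference_quotient_bound[OF phd M, of x t] t
   by (intro mult_mono L) (auto simp: ta_def)
  have r2m: "(%x. (ph x - ph (x - ta)) * ka (v x)) : borel_measurable borel"
  proof -
   have "(%x. ph (x - ta)) : borel_measurable borel" using phm by simp
   then show ?thesis using phm measurable_compose[OF B(1) kam] by simp
  qed
  have r2i: "integrable lborel r2"
   using lborel_bounded_mult_integrable[OF ki r2m r2le] by (simp add: r2_def[abs_def] mult_ac)
  have I2: "\<bar>\<integral>x. r2 x \<partial>lborel\<bar> <= M * t * L * (LINT x|lborel. \<bar>k x\<bar>)"
  proof -
   have "\<bar>\<integral>x. r2 x \<partial>lborel\<bar> <= (LINT x|lborel. \<bar>r2 x\<bar>)" using integral_norm_bound[of lborel r2] by simp
   also have "... <= M * t * L * (LINT x|lborel. \<bar>k x\<bar>)"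
    using lborel_bounded_mult_integral_le[OF ki r2m r2le] by (simp add: r2_def[abs_def] mult_ac)
   finally show ?thesis .
  qed
  have i1: "integrable lborel (%x. ps x * k (x + ta))" "integrable lborel (%x. ps x * k x)"
   using lborel_bounded_mult_integrable[OF kt'(1) psm psB] lborel_bounded_mult_integrable[OF ki psm psB]
   by (simp_all add: mult.commute)
  have tm: "(%x. ph x * ka (v (x + ta)) * k (x + ta)) : borel_measurable borel"
   using phm measurable_compose[OF vt kam] kt'(3) by simp
  have i3: "integrable lborel (%x. ph x * ka (v (x + ta)) * k (x + ta))"
   using Bochner_Integration.integrable_diff[OF i1(1) r1i] by (simp add: r1_def ps_def algebra_simps)
  have m4: "(%x. ph (x - ta) * ka (v x) * k x) : borel_measurable borel"
  proof -
   have "(%x. ph (x - ta)) : borel_measurable borel" using phm by simp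
   then show ?thesis using measurable_compose[OF B(1) kam] km by simp
  qed
  have sh: "(LINT x|lborel. ph x * ka (v (x + ta)) * k (x + ta)) = (LINT x|lborel. ph (x - ta) * ka (v x) * k x)"
   using translate_integral(1)[OF m4, of ta] by simp
  have i4: "integrable lborel (%x. ph (x - ta) * ka (v x) * k x)"
   using translate_integral(2)[OF m4, of ta] i3 by simp
  have "(LINT x|lborel. ps x * k (x + ta)) = (LINT x|lborel. r1 x + ph x * ka (v (x + ta)) * k (x + ta))"
   by (rule Bochner_Integration.integral_cong) (simp_all add: r1_def ps_def algebra_simps)
  also have "... = (LINT x|lborel. r1 x) + (LINT x|lborel. ph (x - ta) * ka (v x) * k x)"
   using r1i i3 sh by simp
  finally have e1: "(LINT x|lborel. ps x * k (x + ta)) = (LINT x|lborel. r1 x) + (LINT x|lborel. ph (x - ta) * ka (v x) * k x)" .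
  have "(LINT x|lborel. ps x * k x) = (LINT x|lborel. r2 x + ph (x - ta) * ka (v x) * k x)"
   by (rule Bochner_Integration.integral_cong) (simp_all add: r2_def ps_def algebra_simps)
  also have "... = (LINT x|lborel. r2 x) + (LINT x|lborel. ph (x - ta) * ka (v x) * k x)"
   using r2i i4 by simp
  finally have "(LINT x|lborel. ps x * k (x + ta)) - (LINT x|lborel. ps x * k x) = (LINT x|lborel. r1 x) - (LINT x|lborel. r2 x)"
   using e1 by simp
  then have "\<bar>(LINT x|lborel. ps x * k (x + ta)) - (LINT x|lborel. ps x * k x)\<bar>
    <= P * L' * (t * E) + M * t * L * (LINT x|lborel. \<bar>k x\<bar>)"
   using I1 I2 by linarith
  also have "... = C * t" by (simp add: C_def algebra_simps)
  finally show ?thesis by (simp add: ta_def)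
 qed
 have C0: "C >= 0"
 proof -
  have "0 <= C * de" using psk[of de] A(2) by linarith
  then show ?thesis using A(2) by (simp add: zero_le_mult_iff)
 qed
 have main: "\<bar>(LINT x|lborel. (f x - f (x + t *\<^sub>R b)) * ph x) / t + (LINT x|lborel. ps x * k x)\<bar> <= (C + P * L' * E) * t"
  if t: "0 < t" "t <= de" for t
 proof -
  define ta where "ta = t *\<^sub>R b"
  have det: "\<bar>t\<bar> <= de" using t by simp
  note te' = te[OF det, folded ta_def]
  have vta: "integrable lborel (%x. v (x + ta))" using translate_integral(2)[OF B(1)] B(8) by simp
  define R where "R x = ph x * (et (v (x + ta)) - et (v x) - ka (v x) * (v (x + ta) - v x))" for x
  define w where "w x = P * L' * (indicator A x * (v (x + ta) - v x)\<^sup>2)" for x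
  have wi: "integrable lborel w" using te'(1) by (simp add: w_def[abs_def])
  have Rw: "\<bar>R x\<bar> <= w x" for x
  proof (cases "ph x = 0")
   case False
   then have x: "x : A" by (rule A(3))
   have "\<bar>R x\<bar> <= P * (L' * (v (x + ta) - v x)\<^sup>2)"
    unfolding R_def abs_mult by (intro mult_mono P lipschitz_taylor[OF et L']) auto
   then show ?thesis using x by (simp add: w_def mult.assoc)
  qed (use P(2) L0 in \<open>simp add: R_def w_def\<close>)
  have Rm: "R : borel_measurable borel"
   unfolding R_def[abs_def] using phm measurable_compose[OF B(1) kam] measurable_compose[OF vt etm]
    measurable_compose[OF B(1) etm] B(1) vt by simp
  have Ri: "integrable lborel R"
   by (rule Bochner_Integration.integrable_bound[OF wi]) (use Rm order_trans[OF Rw abs_ge_self] in auto)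
  have IR: "\<bar>\<integral>x. R x \<partial>lborel\<bar> <= P * L' * (t\<^sup>2 * E)"
  proof -
   have "\<bar>\<integral>x. R x \<partial>lborel\<bar> <= (LINT x|lborel. \<bar>R x\<bar>)" using integral_norm_bound[of lborel R] by simp
   also have "... <= (LINT x|lborel. w x)" using Ri wi Rw by (intro integral_mono) auto
   also have "... <= P * L' * (t\<^sup>2 * E)"
    unfolding w_def[abs_def] using te' P(2) L0 by (simp add: mult_left_mono)
   finally show ?thesis .
  qed
  have psv: "integrable lborel (%x. ps x * (v (x + ta) - v x))"
   using lborel_bounded_mult_integrable[OF Bochner_Integration.integrable_diff[OF vta B(8)] psm psB]
   by (simp add: mult.commute)
  have e0: "(f x - f (x + ta)) * ph x = - (R x + ps x * (v (x + ta) - v x))" for x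
  proof (cases "ph x = 0")
   case False
   then have x: "x : A" by (rule A(3))
   have "x : U" "x + ta : U" using AU[OF x] A(4)[OF x, of ta] det nb by (auto simp: ta_def)
   then show ?thesis by (simp add: f_def R_def ps_def algebra_simps)
  qed (simp add: R_def ps_def)
  have e1: "(LINT x|lborel. (f x - f (x + ta)) * ph x) = - (LINT x|lborel. R x) - (LINT x|lborel. ps x * (v (x + ta) - v x))"
   unfolding e0 using Ri psv by simp
  have H1: "integrable (lborel \<Otimes>\<^sub>M lborel) (%(s, x). indicator {0..1::real} s * (t * k (x + s *\<^sub>R ta)))"
   by (rule segment_integrable[of "%x. t * k x"]) (use km ki in auto)
  have H2: "integrable (lborel \<Otimes>\<^sub>M lborel) (%(s, x). ps x * (indicator {0..1::real} s * (t * k (x + s *\<^sub>R ta))))"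
  proof (rule Bochner_Integration.integrable_bound)
   let ?H = "%(s, x). indicator {0..1::real} s * (t * k (x + s *\<^sub>R ta))"
   show "integrable (lborel \<Otimes>\<^sub>M lborel) (%p. (P * L) * ?H p)"
    using H1 by (rule integrable_mult_right)
   have "(%p. ps (snd p) * ?H p) : borel_measurable (lborel \<Otimes>\<^sub>M lborel)"
    using borel_measurable_integrable[OF H1] psm by (intro borel_measurable_times) auto
   then show "(%(s, x). ps x * (indicator {0..1::real} s * (t * k (x + s *\<^sub>R ta)))) : borel_measurable (lborel \<Otimes>\<^sub>M lborel)"
    by (simp add: case_prod_beta)
   have "\<bar>ps x * c\<bar> <= \<bar>(P * L) * c\<bar>" for x c
    using mult_right_mono[OF psB[of x], of "\<bar>c\<bar>"] P(2) L0 by (simp add: abs_mult)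
   then show "AE p in lborel \<Otimes>\<^sub>M lborel. norm (case p of (s, x) => ps x * (indicator {0..1::real} s * (t * k (x + s *\<^sub>R ta)))) <= norm ((P * L) * ?H p)"
    by (intro AE_I2) (auto simp: case_prod_beta)
  qed
  have As: "A : sets lebesgue" using A(1) by auto
  have id: "AE x in leb A. v (x + ta) - v x = (LINT s|lborel. indicator {0..1} s * (g (x + s *\<^sub>R ta) \<bullet> ta))"
   by (rule translation_identity[OF B(1) B(8) B(3) B(2) B(9) B(4) B(7) U(1) A(1)])
    (use seg[OF _ _ det] in \<open>auto simp: ta_def\<close>)
  have gk: "g x \<bullet> ta = t * k x" for x by (simp add: ta_def k_def)
  have id': "AE x in lebesgue. ps x * (v (x + ta) - v x) = (LINT s|lborel. ps x * (indicator {0..1} s * (t * k (x + s *\<^sub>R ta))))"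
  proof -
   have "AE x in lebesgue. x : A --> v (x + ta) - v x = (LINT s|lborel. indicator {0..1} s * (t * k (x + s *\<^sub>R ta)))"
    using id As by (simp add: AE_restrict_space_iff gk)
   then show ?thesis
   proof eventually_elim
    case (elim x)
    then show ?case using A(3)[of x] by (cases "ph x = 0") (auto simp: ps_def)
   qed
  qed
  have m1: "(%x. ps x * (v (x + ta) - v x)) : borel_measurable borel" using psm vt B(1) by simp
  have m2: "(%x. \<integral>s. ps x * (indicator {0..1} s * (t * k (x + s *\<^sub>R ta))) \<partial>lborel) : borel_measurable borel"
   using borel_measurable_integrable[OF lborel_pair.integrable_snd[OF H2]] by simp
  have "(LINT x|lborel. ps x * (v (x + ta) - v x)) = (LINT x|lebesgue. ps x * (v (x + ta) - v x))"
   using m1 by (simp add: integral_completion)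
  also have "... = (LINT x|lebesgue. (LINT s|lborel. ps x * (indicator {0..1} s * (t * k (x + s *\<^sub>R ta)))))"
   using id' m1 m2 by (intro integral_cong_AE) (auto intro: measurable_completion)
  also have "... = (LINT x|lborel. (LINT s|lborel. ps x * (indicator {0..1} s * (t * k (x + s *\<^sub>R ta)))))"
   using m2 by (simp add: integral_completion)
  also have "... = (LINT s|lborel. (LINT x|lborel. ps x * (indicator {0..1} s * (t * k (x + s *\<^sub>R ta)))))"
   by (rule lborel_pair.Fubini_integral[OF H2])
  also have "... = (LINT s|lborel. t * (indicator {0..1} s * (LINT x|lborel. ps x * k (x + s *\<^sub>R ta))))"
   by (rule Bochner_Integration.integral_cong[OF refl]) (auto simp: indicator_def mult.left_commute[of _ t])
  finally have e2: "(LINT x|lborel. ps x * (v (x + ta) - v x))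
    = t * (LINT s|lborel. indicator {0..1} s * (LINT x|lborel. ps x * k (x + s *\<^sub>R ta)))"
   by simp
  have q_int: "integrable lborel (%s. indicator {0..1} s * (LINT x|lborel. ps x * k (x + s *\<^sub>R ta)))"
  proof -
   have "(%s. \<integral>x. ps x * (indicator {0..1} s * (t * k (x + s *\<^sub>R ta))) \<partial>lborel)
    = (%s. t * (indicator {0..1} s * (LINT x|lborel. ps x * k (x + s *\<^sub>R ta))))"
    by (rule ext) (auto simp: indicator_def mult.left_commute[of _ t])
   then have "integrable lborel (%s. t * (indicator {0..1} s * (LINT x|lborel. ps x * k (x + s *\<^sub>R ta))))"
    using lborel_pair.integrable_fst[OF H2] by simp
   then show ?thesis using t by simp
  qed
  define Q where "Q = (LINT x|lborel. ps x * k x)"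
  have "\<bar>(LINT s|lborel. indicator {0..1} s * (LINT x|lborel. ps x * k (x + s *\<^sub>R ta))) - Q\<bar> <= C * t"
  proof -
   have "(LINT s|lborel. indicator {0..1} s * (LINT x|lborel. ps x * k (x + s *\<^sub>R ta))) - Q
    = (LINT s|lborel. indicator {0..1} s * (LINT x|lborel. ps x * k (x + s *\<^sub>R ta)) - indicator {0..1::real} s * Q)"
    using q_int by simp
   also have "\<bar>...\<bar> <= (LINT s|lborel. \<bar>indicator {0..1} s * (LINT x|lborel. ps x * k (x + s *\<^sub>R ta)) - indicator {0..1::real} s * Q\<bar>)"
    using integral_norm_bound[of lborel "%s. indicator {0..1} s * (LINT x|lborel. ps x * k (x + s *\<^sub>R ta)) - indicator {0..1::real} s * Q"] by simp
   also have "... <= (LINT s|lborel. C * t * indicator {0..1::real} s)"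
   proof (rule integral_mono)
    show "integrable lborel (%s. \<bar>indicator {0..1} s * (LINT x|lborel. ps x * k (x + s *\<^sub>R ta)) - indicator {0..1::real} s * Q\<bar>)"
     using q_int by simp
    fix s :: real
    show "\<bar>indicator {0..1} s * (LINT x|lborel. ps x * k (x + s *\<^sub>R ta)) - indicator {0..1::real} s * Q\<bar> <= C * t * indicator {0..1::real} s"
    proof (cases "s : {0..1} \<and> s ~= 0")
     case True
     have st: "0 < s * t" "s * t <= t" using True t by (auto simp: mult_left_le_one_le)
     have "s * t <= de" using st(2) t(2) by (rule order_trans)
     then have "\<bar>(LINT x|lborel. ps x * k (x + (s * t) *\<^sub>R b)) - Q\<bar> <= C * (s * t)"
      unfolding Q_def using st(1) by (intro psk)
     also have "... <= C * t" using st C0 by (intro mult_left_mono) auto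
     finally show ?thesis using True by (simp add: ta_def)
    next
     case False
     then show ?thesis using C0 t by (auto simp: indicator_def Q_def)
    qed
   qed simp
   also have "... = C * t" by simp
   finally show ?thesis .
  qed
  moreover have "(LINT x|lborel. (f x - f (x + ta)) * ph x) / t
    = - (LINT x|lborel. R x) / t - (LINT s|lborel. indicator {0..1} s * (LINT x|lborel. ps x * k (x + s *\<^sub>R ta)))"
   unfolding e1 e2 using t by (simp add: diff_divide_distrib)
  moreover have "\<bar>- (LINT x|lborel. R x) / t\<bar> <= P * L' * E * t"
   using IR t by (simp add: field_simps power2_eq_square)
  ultimately have "\<bar>(LINT x|lborel. (f x - f (x + ta)) * ph x) / t + Q\<bar> <= C * t + P * L' * E * t"
   by linarith
  then show ?thesis by (simp add: ta_def Q_def algebra_simps)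
 qed
 define h where "h n = de / real (Suc n)" for n
 have h: "h \<longlonglongrightarrow> 0" "!!n. h n ~= 0" "!!n. 0 < h n" "!!n. h n <= de"
 proof -
  have "(%n. de * (1 / real (Suc n))) \<longlonglongrightarrow> de * 0"
   by (intro tendsto_mult_left) (use LIMSEQ_inverse_real_of_nat in \<open>simp add: inverse_eq_divide\<close>)
  then show "h \<longlonglongrightarrow> 0" by (simp add: h_def[abs_def])
  show "0 < h n" for n using A(2) by (simp add: h_def)
  then show "h n ~= 0" for n by (metis less_irrefl)
  show "h n <= de" for n using A(2) by (simp add: h_def field_simps)
 qed
 have lim1: "(%n. (LINT x|lborel. (f x - f (x + h n *\<^sub>R b)) * ph x) / h n) \<longlonglongrightarrow> (LINT x|lborel. f x * partial_deriv b ph x)"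
  by (rule integral_difference_quotient_limit[OF fi ph b h(1,2)])
 have "(%n. (LINT x|lborel. (f x - f (x + h n *\<^sub>R b)) * ph x) / h n + (LINT x|lborel. ps x * k x)) \<longlonglongrightarrow> 0"
 proof (rule Lim_null_comparison)
  show "\<forall>\<^sub>F n in sequentially. norm ((LINT x|lborel. (f x - f (x + h n *\<^sub>R b)) * ph x) / h n + (LINT x|lborel. ps x * k x)) <= (C + P * L' * E) * h n"
   using main[OF h(3,4)] by (intro always_eventually) simp
  show "(%n. (C + P * L' * E) * h n) \<longlonglongrightarrow> 0" using tendsto_mult_left[OF h(1), of "C + P * L' * E"] by simp
 qed
 moreover have "(%n. (LINT x|lborel. (f x - f (x + h n *\<^sub>R b)) * ph x) / h n + (LINT x|lborel. ps x * k x))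
   \<longlonglongrightarrow> (LINT x|lborel. f x * partial_deriv b ph x) + (LINT x|lborel. ps x * k x)"
  by (intro tendsto_add lim1 tendsto_const)
 ultimately have "(LINT x|lborel. f x * partial_deriv b ph x) + (LINT x|lborel. ps x * k x) = 0"
  using LIMSEQ_unique by blast
 then show ?thesis by (simp add: f_def ps_def k_def mult_ac)
qed

lemma test_fieldD:
 assumes ph: "ph : test_fields U"
 shows "b : Basis ==> C_k_on 1 (%x. ph x \<bullet> b) UNIV"
  and "compactly_supported_in U (%x. ph x \<bullet> b)"
  and "norm (ph x) <= 1" and "ph : borel_measurable borel"
proof -
 show C: "b : Basis ==> C_k_on 1 (%x. ph x \<bullet> b) UNIV" for b
  using ph unfolding test_fields_def by blast
 show "norm (ph x) <= 1" using ph unfolding test_fields_def by blast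
 have K: "compact (closure {x. ph x ~= 0})" "closure {x. ph x ~= 0} \<subseteq> U"
  using ph unfolding test_fields_def compactly_supported_in_def by blast+
 have "closure {x. ph x \<bullet> b ~= 0} \<subseteq> closure {x. ph x ~= 0}" by (rule closure_mono) auto
 with K show "compactly_supported_in U (%x. ph x \<bullet> b)"
  unfolding compactly_supported_in_def
  by (meson bounded_subset closed_closure compact_eq_bounded_closed subset_trans)
 have "(%x. \<Sum>b\<in>Basis. (ph x \<bullet> b) *\<^sub>R b) : borel_measurable borel"
  using C_k_on_continuous[OF C] by (intro borel_measurable_sum borel_measurable_scaleR continuous_borel) auto
 then show "ph : borel_measurable borel" by (simp add: euclidean_representation)
qed

lemma test_field_divergence:
 fixes ph :: "'a::euclidean_space => 'a"
 assumes ph: "ph : test_fields U"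
 obtains M where "!!x. \<bar>divergence ph x\<bar> <= M" "M >= 0" "divergence ph : borel_measurable borel"
proof -
 have pc: "continuous_on UNIV (partial_deriv b (%y. ph y \<bullet> b))" if "b : Basis" for b
  using test_fieldD(1)[OF ph that] that by simp
 have "\<exists>M. \<forall>x. \<bar>partial_deriv b (%y. ph y \<bullet> b) x\<bar> <= M" if "b : Basis" for b
  using compact_support_bounded_real[OF pc[OF that] partial_deriv_compact_support[OF test_fieldD(2)[OF ph]]] by metis
 then obtain M where M: "!!b x. b : Basis ==> \<bar>partial_deriv b (%y. ph y \<bullet> b) x\<bar> <= M b" by metis
 show thesis
 proof (rule that[of "\<Sum>b\<in>Basis. M b"])
  show le: "\<bar>divergence ph x\<bar> <= (\<Sum>b\<in>Basis. M b)" for x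
   unfolding divergence_def by (rule order_trans[OF sum_abs]) (intro sum_mono M)
  show "0 <= (\<Sum>b\<in>Basis. M b)" using order_trans[OF abs_ge_zero le] .
  show "divergence ph : borel_measurable borel"
   unfolding divergence_def[abs_def] by (intro borel_measurable_sum continuous_borel pc)
 qed
qed

lemma lborel_indicator_integrable:
 assumes "open U" "U : lmeasurable"
 shows "integrable lborel (%x. indicator U x :: real)"
proof -
 have Ub: "U : sets borel" using assms by auto
 then have "emeasure lebesgue U = emeasure lborel U" by simp
 then have "emeasure lborel U < \<infinity>"
  using fmeasurableD2[OF assms(2)] by (simp add: less_top)
 then show ?thesis using Ub by (intro integrable_real_indicator) auto
qed

lemma lborel_compose_integrable:
 fixes v :: "'a::euclidean_space => real" and et :: "real => real"
 assumes v: "v : borel_measurable borel" "integrable lborel v" and U: "open U" "U : lmeasurable"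
  and et: "!!s. (et has_real_derivative ka s) (at s)" and L: "!!s. \<bar>ka s\<bar> <= L"
 shows "integrable lborel (%x. indicator U x * et (v x))" "\<bar>et s\<bar> <= \<bar>et 0\<bar> + L * \<bar>s\<bar>" "et : borel_measurable borel"
proof -
 have L0: "L >= 0" using order_trans[OF abs_ge_zero L[of 0]] .
 have etc: "continuous_on UNIV et" using et by (meson DERIV_isCont continuous_at_imp_continuous_on)
 show etm: "et : borel_measurable borel" using etc by (rule borel_measurable_continuous_onI)
 have "\<bar>et s - et 0\<bar> <= L * \<bar>s - 0\<bar>" for s
  using field_differentiable_bound[of UNIV et ka L s 0] et L by auto
 then show *: "\<bar>et s\<bar> <= \<bar>et 0\<bar> + L * \<bar>s\<bar>" for s
  by (smt (verit))
 show "integrable lborel (%x. indicator U x * et (v x))"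
 proof (rule Bochner_Integration.integrable_bound)
  show "integrable lborel (%x. \<bar>et 0\<bar> * indicator U x + L * \<bar>v x\<bar>)"
   using v(2) lborel_indicator_integrable[OF U] by simp
  show "AE x in lborel. norm (indicator U x * et (v x)) <= norm (\<bar>et 0\<bar> * indicator U x + L * \<bar>v x\<bar>)"
  proof (intro AE_I2)
   fix x have "0 <= L * \<bar>v x\<bar>" using L0 by simp
   then show "norm (indicator U x * et (v x)) <= norm (\<bar>et 0\<bar> * indicator U x + L * \<bar>v x\<bar>)"
    using *[of "v x"] by (cases "x : U") auto
  qed
  show "(%x. indicator U x * et (v x)) : borel_measurable lborel"
   using U(1) measurable_compose[OF v(1) etm] by simp
 qed
qed

lemma borel_chain_rule_divergence:
 fixes v :: "'a::euclidean_space => real" and et ka :: "real => real"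
 assumes bv: "borel_H1 U v g" and U: "open U" "U : lmeasurable"
  and et: "!!s. (et has_real_derivative ka s) (at s)"
  and L: "!!s. \<bar>ka s\<bar> <= L" and L': "!!s t. \<bar>ka s - ka t\<bar> <= L' * \<bar>s - t\<bar>"
  and kam: "ka : borel_measurable borel"
  and ph: "ph : test_fields U"
 shows "(LINT x|lborel. indicator U x * et (v x) * divergence ph x) = - (LINT x|lborel. ka (v x) * (g x \<bullet> ph x))"
proof -
 note B = borel_H1D[OF bv U(2)]
 let ?p = "%b. partial_deriv b (%y. ph y \<bullet> b)"
 note fi = lborel_compose_integrable[OF B(1,8) U et L]
 have pc: "continuous_on UNIV (?p b)" if "b : Basis" for b
  using test_fieldD(1)[OF ph that] that by simp
 have i1: "integrable lborel (%x. indicator U x * et (v x) * ?p b x)" if b: "b : Basis" for b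
 proof -
  obtain M where "!!x. \<bar>?p b x\<bar> <= M"
   using compact_support_bounded_real[OF pc[OF b] partial_deriv_compact_support[OF test_fieldD(2)[OF ph]]] by metis
  then show ?thesis using lborel_bounded_mult_integrable[OF fi(1) continuous_borel[OF pc[OF b]]] by blast
 qed
 have i2: "integrable lborel (%x. ka (v x) * (g x \<bullet> b) * (ph x \<bullet> b))" if b: "b : Basis" for b
 proof -
  have m: "(%x. ka (v x) * (ph x \<bullet> b)) : borel_measurable borel"
   using measurable_compose[OF B(1) kam] test_fieldD(4)[OF ph] by simp
  have "\<bar>ph x \<bullet> b\<bar> <= 1" for x
   using Basis_le_norm[OF b, of "ph x"] test_fieldD(3)[OF ph, of x] by linarith
  then have bd: "\<bar>ka (v x) * (ph x \<bullet> b)\<bar> <= L * 1" for x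
   unfolding abs_mult using order_trans[OF abs_ge_zero L[of 0]] by (intro mult_mono L) auto
  have "integrable lborel (%x. g x \<bullet> b)" using B(9) by simp
  from lborel_bounded_mult_integrable[OF this m bd] show ?thesis by (simp add: mult_ac)
 qed
 have "(LINT x|lborel. indicator U x * et (v x) * divergence ph x)
   = (\<Sum>b\<in>Basis. (LINT x|lborel. indicator U x * et (v x) * ?p b x))"
  unfolding divergence_def sum_distrib_left using i1 by (subst Bochner_Integration.integral_sum) auto
 also have "... = (\<Sum>b\<in>Basis. - (LINT x|lborel. ka (v x) * (g x \<bullet> b) * (ph x \<bullet> b)))"
  by (rule sum.cong[OF refl], rule borel_chain_rule[OF bv U et L L'])
   (use test_fieldD[OF ph] in auto)
 also have "... = - (LINT x|lborel. (\<Sum>b\<in>Basis. ka (v x) * (g x \<bullet> b) * (ph x \<bullet> b)))"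
  using i2 by (subst Bochner_Integration.integral_sum) (auto simp: sum_negf)
 also have "(%x. \<Sum>b\<in>Basis. ka (v x) * (g x \<bullet> b) * (ph x \<bullet> b)) = (%x. ka (v x) * (g x \<bullet> ph x))"
 proof
  fix x show "(\<Sum>b\<in>Basis. ka (v x) * (g x \<bullet> b) * (ph x \<bullet> b)) = ka (v x) * (g x \<bullet> ph x)"
   unfolding euclidean_inner[of "g x" "ph x"] by (simp add: sum_distrib_left mult.assoc)
 qed
 finally show ?thesis .
qed

text \<open>The hypotheses on the slope make both the composition and its gradient square integrable, and
permit the passage from the whole-space representative back to the domain.\<close>

theorem has_weak_gradient_compose:
 fixes u :: "'a::euclidean_space => real" and et ka :: "real => real"
 assumes u: "u : L2_space U" "has_weak_gradient U u g" and U: "open U" "U : lmeasurable"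
  and et: "!!s. (et has_real_derivative ka s) (at s)"
  and L: "!!s. \<bar>ka s\<bar> <= L" and L': "!!s t. \<bar>ka s - ka t\<bar> <= L' * \<bar>s - t\<bar>"
  and kam: "ka : borel_measurable borel"
 shows "has_weak_gradient U (%x. et (u x)) (%x. ka (u x) *\<^sub>R g x)"
 unfolding has_weak_gradient_def
proof (intro conjI ballI)
 note g = has_weak_gradientD(1)[OF u(2)]
 have Us: "U : sets lebesgue" using U by auto
 have um: "u : borel_measurable (leb U)" using u(1) by (rule L2_measurable)
 have kau: "(%x. ka (u x)) : borel_measurable (leb U)"
  by (rule measurable_compose[OF um kam])
 show "(%x. ka (u x) *\<^sub>R g x) : L2_space U"
  by (rule L2_bounded_mult[OF g kau L])
 fix ph b assume ph: "ph : test_functions U" and b: "b : (Basis :: 'a set)"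
 obtain v h where bv: "borel_H1 U v h" and uv: "AE x in leb U. u x = v x" and gh: "AE x in leb U. g x = h x"
  using borel_H1_representative[OF U(1) u] by blast
 note B = borel_H1D[OF bv U(2)]
 note fi = lborel_compose_integrable[OF B(1,8) U et L]
 note phm = continuous_borel[OF test_functionD(3)[OF ph]] continuous_borel[OF test_functionD(3)[OF test_function_partial_deriv[OF ph b]]]
 note Lm = borel_measurable_lebesgue_on
 have z: "ph x = 0" "partial_deriv b ph x = 0" if "x \<notin> U" for x
  using compact_support_zero[OF test_functionD(2)[OF ph] that]
   compact_support_zero[OF test_functionD(2)[OF test_function_partial_deriv[OF ph b]] that] by auto
 have etu: "(%x. et (u x)) : borel_measurable (leb U)" by (rule measurable_compose[OF um fi(3)])
 have vm: "(%x. et (v x)) : borel_measurable borel" "(%x. ka (v x)) : borel_measurable borel"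
  using measurable_compose[OF B(1) fi(3)] measurable_compose[OF B(1) kam] by auto
 have m1: "(%x. indicator U x * et (v x) * partial_deriv b ph x) : borel_measurable borel"
  using vm phm U(1) by simp
 have m2: "(%x. ka (v x) * (h x \<bullet> b) * ph x) : borel_measurable borel"
  using vm phm B(2) by simp
 have "(LINT x|leb U. et (u x) * partial_deriv b ph x) = (LINT x|leb U. indicator U x * et (v x) * partial_deriv b ph x)"
 proof (rule integral_cong_AE)
  have "AE x in leb U. x : U" using AE_space[of "leb U"] by simp
  with uv show "AE x in leb U. et (u x) * partial_deriv b ph x = indicator U x * et (v x) * partial_deriv b ph x"
   by eventually_elim simp
 qed (use etu Lm[OF phm(2)] Lm[OF m1] in auto)
 also have "... = (LINT x|lborel. indicator U x * et (v x) * partial_deriv b ph x)"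
  using m1 z by (intro lebesgue_on_lborel(1) Us) auto
 also have "... = - (LINT x|lborel. ka (v x) * (h x \<bullet> b) * ph x)"
  by (rule borel_chain_rule[OF bv U et L L' test_functionD(1,2)[OF ph] b])
 also have "(LINT x|lborel. ka (v x) * (h x \<bullet> b) * ph x) = (LINT x|leb U. ka (v x) * (h x \<bullet> b) * ph x)"
  using m2 z by (intro lebesgue_on_lborel(1)[symmetric] Us) auto
 also have "... = (LINT x|leb U. ((ka (u x) *\<^sub>R g x) \<bullet> b) * ph x)"
 proof (rule integral_cong_AE)
  show "AE x in leb U. ka (v x) * (h x \<bullet> b) * ph x = ((ka (u x) *\<^sub>R g x) \<bullet> b) * ph x"
   using uv gh by eventually_elim simp
 qed (use kau L2_measurable[OF g] Lm[OF phm(1)] Lm[OF m2] in auto)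
 finally show "(LINT x|leb U. et (u x) * partial_deriv b ph x) = - (LINT x|leb U. ((ka (u x) *\<^sub>R g x) \<bullet> b) * ph x)" .
qed

lemma borel_H1_zero: "U : lmeasurable ==> borel_H1 U (%x. 0) (%x. 0)"
 by (auto simp: borel_H1_def has_weak_gradient_def L2_space_def)

lemma has_weak_gradient_const:
 assumes U: "open U" "U : lmeasurable"
 shows "has_weak_gradient U (%x. c) (%x. 0)" "(%x. c) : H1_space U"
proof -
 have z: "(%x. 0::real) : L2_space U" "has_weak_gradient U (%x. 0) (%x. 0)"
  using borel_H1_zero[OF U(2)] by (auto simp: borel_H1_def)
 show w: "has_weak_gradient U (%x. c) (%x. 0)"
  using has_weak_gradient_compose[OF z U, of "%_. c" "%_. 0" 0 0] by simp
 have "(%x. c) : L2_space U" by (rule L2_bounded[OF U(2), of _ "\<bar>c\<bar>"]) auto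
 then show "(%x. c) : H1_space U" using w by (rule H1I)
qed

text \<open>Apply the chain rule with a constant function to the zero function.\<close>

lemma test_field_divergence_integral:
 assumes U: "open U" "U : lmeasurable" and ph: "ph : test_fields U"
 shows "(LINT x|lborel. indicator U x * divergence ph x) = 0"
 using borel_chain_rule_divergence[OF borel_H1_zero[OF U(2)] U, of "%_. 1" "%_. 0" 0 0 ph] ph by simp

section \<open>Perimeters of sublevel sets and the coarea inequality\<close>

definition ramp :: "real => real" where "ramp t = max 0 t"

lemma ramp_square_derivative: "((%t. (ramp (t - a))\<^sup>2 / 2) has_real_derivative ramp (t - a)) (at t)"
proof -
 consider "t < a" | "t = a" | "t > a" by linarith
 then show ?thesis
 proof cases
  case 1
  have "((%t. 0) has_real_derivative 0) (at t)" by simp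
  then have "((%t. (ramp (t - a))\<^sup>2 / 2) has_real_derivative 0) (at t)"
   by (rule has_field_derivative_transform_within_open[where S = "{..<a}"]) (use 1 in \<open>auto simp: ramp_def max_def\<close>)
  with 1 show ?thesis by (simp add: ramp_def)
 next
  case 2
  have "((%h. ((ramp (t + h - a))\<^sup>2 / 2 - (ramp (t - a))\<^sup>2 / 2) / h) \<longlongrightarrow> 0) (at 0)"
  proof (rule Lim_null_comparison)
   show "\<forall>\<^sub>F h in at 0. norm (((ramp (t + h - a))\<^sup>2 / 2 - (ramp (t - a))\<^sup>2 / 2) / h) <= \<bar>h\<bar>"
    unfolding eventually_at_filter
    by (intro always_eventually) (auto simp: 2 ramp_def max_def power2_eq_square)
   show "((%h. \<bar>h\<bar>) \<longlongrightarrow> 0) (at (0::real))"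
    using tendsto_rabs[OF tendsto_ident_at[of 0 UNIV]] by simp
  qed
  then show ?thesis using 2 by (simp add: DERIV_def ramp_def)
 next
  case 3
  have "((%t. (t - a)\<^sup>2 / 2) has_real_derivative (t - a)) (at t)"
   by (auto intro!: derivative_eq_intros)
  then have "((%t. (ramp (t - a))\<^sup>2 / 2) has_real_derivative (t - a)) (at t)"
   by (rule has_field_derivative_transform_within_open[where S = "{a<..}"]) (use 3 in \<open>auto simp: ramp_def max_def\<close>)
  with 3 show ?thesis by (simp add: ramp_def)
 qed
qed

lemma ramp_lipschitz: "\<bar>ramp s - ramp t\<bar> <= \<bar>s - t\<bar>"
 by (auto simp: ramp_def)

lemma ramp_measurable: "ramp : borel_measurable borel"
 unfolding ramp_def[abs_def] by simp

text \<open>A piecewise linear kernel with integral one supported in the interval from 0 to 2; it is minus the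
derivative of the \<open>C\<^sup>1\<close> cut-off \<open>step_down\<close>.\<close>

definition tent :: "real => real" where "tent t = ramp t - 2 * ramp (t - 1) + ramp (t - 2)"

definition step_down :: "real => real" where
 "step_down t = 1 - ((ramp t)\<^sup>2 / 2 - 2 * ((ramp (t - 1))\<^sup>2 / 2) + (ramp (t - 2))\<^sup>2 / 2)"

lemma tent_bounds: "0 <= tent t" "tent t <= 1" "t <= 0 ==> tent t = 0" "t >= 2 ==> tent t = 0"
 by (auto simp: tent_def ramp_def max_def)

lemma second_difference_bound: "\<bar>a\<bar> <= d ==> \<bar>b\<bar> <= d ==> \<bar>c\<bar> <= d ==> \<bar>a - 2 * b + c\<bar> <= 4 * (d :: real)"
 by linarith

lemma tent_lipschitz: "\<bar>tent s - tent t\<bar> <= 4 * \<bar>s - t\<bar>"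
proof -
 define a where "a = ramp s - ramp t"
 define b where "b = ramp (s - 1) - ramp (t - 1)"
 define c where "c = ramp (s - 2) - ramp (t - 2)"
 have "\<bar>a\<bar> <= \<bar>s - t\<bar>" "\<bar>b\<bar> <= \<bar>s - t\<bar>" "\<bar>c\<bar> <= \<bar>s - t\<bar>"
  using ramp_lipschitz[of s t] ramp_lipschitz[of "s - 1" "t - 1"] ramp_lipschitz[of "s - 2" "t - 2"]
  by (simp_all add: a_def b_def c_def)
 then have "\<bar>a - 2 * b + c\<bar> <= 4 * \<bar>s - t\<bar>" by (rule second_difference_bound)
 moreover have "tent s - tent t = a - 2 * b + c" by (simp add: tent_def a_def b_def c_def)
 ultimately show ?thesis by simp
qed

lemma tent_measurable: "tent : borel_measurable borel"
proof -
 have "(%t. ramp (t - c)) : borel_measurable borel" for c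
  by (rule measurable_compose[OF _ ramp_measurable]) simp
 then show ?thesis unfolding tent_def[abs_def] using ramp_measurable by simp
qed

lemma step_down_derivative: "(step_down has_real_derivative - tent t) (at t)"
proof -
 have "((%t. 1 - ((ramp (t - 0))\<^sup>2 / 2 - 2 * ((ramp (t - 1))\<^sup>2 / 2) + (ramp (t - 2))\<^sup>2 / 2)) has_real_derivative
   0 - (ramp (t - 0) - 2 * ramp (t - 1) + ramp (t - 2))) (at t)"
  by (intro DERIV_diff DERIV_add DERIV_const DERIV_cmult ramp_square_derivative)
 then show ?thesis by (simp add: step_down_def[abs_def] tent_def)
qed

lemma step_down_low: "t <= 0 ==> step_down t = 1"
 by (simp add: step_down_def ramp_def)

lemma step_down_high: "t >= 2 ==> step_down t = 0"
proof -
 assume "t >= 2"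
 then have r: "ramp t = t" "ramp (t - 1) = t - 1" "ramp (t - 2) = t - 2" by (auto simp: ramp_def)
 show ?thesis unfolding step_down_def r by (simp add: power2_eq_square field_simps)
qed

lemma step_down_bounds: "0 <= step_down t" "step_down t <= 1"
proof -
 have dec: "step_down b <= step_down a" if "a <= b" for a b
  by (rule DERIV_nonpos_imp_nonincreasing[OF that]) (use step_down_derivative tent_bounds(1) in \<open>metis neg_le_0_iff_le\<close>)
 show "step_down t <= 1" using dec[of "min t 0" t] step_down_low[of "min t 0"] by simp
 show "0 <= step_down t" using dec[of t "max t 2"] step_down_high[of "max t 2"] by simp
qed

text \<open>The total variation of the cut-off \<open>step_down (n (v - s))\<close>, which converges to the indicator of the
sublevel set.\<close>

definition level_density :: "('a => real) => ('a::euclidean_space => 'a) => nat => real => ennreal" where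
 "level_density v g n s = (\<integral>\<^sup>+x. ennreal (real n * tent (real n * (v x - s)) * norm (g x)) \<partial>lborel)"

text \<open>The cut-offs converge to the indicator of the sublevel set pointwise, and the perimeter is a supremum of
functionals that pass to the limit, hence lower semicontinuous.\<close>

theorem perimeter_sublevel:
 assumes bv: "borel_H1 U v g" and U: "open U" "U : lmeasurable"
 shows "rel_perimeter {x\<in>U. v x <= s} U <= liminf (%n. level_density v g n s)"
 unfolding rel_perimeter_def
proof (rule SUP_least)
 note B = borel_H1D[OF bv U(2)]
 fix ph assume ph: "ph : test_fields U"
 let ?E = "{x\<in>U. v x <= s}"
 obtain M where M: "!!x. \<bar>divergence ph x\<bar> <= M" "M >= 0" and dm: "divergence ph : borel_measurable borel"
  using test_field_divergence[OF ph] by metis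
 have Eb: "?E : sets borel"
 proof -
  have "?E = U \<inter> {x. v x <= s}" by auto
  also have "... \<in> sets borel" using U(1) B(1) by (intro sets.Int) auto
  finally show ?thesis .
 qed
 then have Es: "?E : sets lebesgue" by auto
 have sm: "step_down : borel_measurable borel"
  using step_down_derivative by (meson DERIV_isCont continuous_at_imp_continuous_on borel_measurable_continuous_onI)
 define x where "x n = (LINT y|lborel. indicator U y * step_down (real n * (v y - s)) * divergence ph y)" for n
 define p where "p n = (LINT y|lborel. real n * tent (real n * (v y - s)) * norm (g y))" for n
 have vn: "(%y. real n * (v y - s)) : borel_measurable borel" for n using B(1) by simp
 have "x \<longlonglongrightarrow> (LINT y|lborel. indicator ?E y * divergence ph y)"
  unfolding x_def[abs_def]
 proof (rule integral_dominated_convergence[where w = "%y. M * indicator U y"])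
  show "(%y. indicator ?E y * divergence ph y) : borel_measurable lborel" using Eb dm by simp
  show "(%y. indicator U y * step_down (real n * (v y - s)) * divergence ph y) : borel_measurable lborel" for n
   using U(1) dm measurable_compose[OF vn sm] by simp
  show "integrable lborel (%y. M * indicator U y)" using lborel_indicator_integrable[OF U] by simp
  show "AE y in lborel. norm (indicator U y * step_down (real n * (v y - s)) * divergence ph y) <= M * indicator U y" for n
  proof (intro AE_I2)
   fix y
   have "\<bar>step_down (real n * (v y - s))\<bar> * \<bar>divergence ph y\<bar> <= 1 * M"
    using step_down_bounds by (intro mult_mono M) auto
   then show "norm (indicator U y * step_down (real n * (v y - s)) * divergence ph y) <= M * indicator U y"
    by (auto simp: indicator_def abs_mult)
  qed
  show "AE y in lborel. (%n. indicator U y * step_down (real n * (v y - s)) * divergence ph y) \<longlonglongrightarrow> indicator ?E y * divergence ph y"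
  proof (intro AE_I2)
   fix y
   show "(%n. indicator U y * step_down (real n * (v y - s)) * divergence ph y) \<longlonglongrightarrow> indicator ?E y * divergence ph y"
   proof (cases "v y <= s")
    case True
    then have "step_down (real n * (v y - s)) = 1" for n
     by (intro step_down_low) (simp add: mult_le_0_iff)
    with True show ?thesis by (simp add: indicator_def)
   next
    case False
    obtain N :: nat where N: "2 / (v y - s) < real N" using reals_Archimedean2 by blast
    have "eventually (%n. indicator U y * step_down (real n * (v y - s)) * divergence ph y = indicator ?E y * divergence ph y) sequentially"
     using eventually_ge_at_top[of N]
    proof eventually_elim
     case (elim n)
     have "2 / (v y - s) <= real n" using N elim by linarith
     then have "2 <= real n * (v y - s)" using False by (simp add: field_simps)
     then show ?case using False by (simp add: step_down_high)
    qed
    then show ?thesis by (rule tendsto_eventually)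
   qed
  qed
 qed
 moreover have "(LINT y|leb (?E \<inter> U). divergence ph y) = (LINT y|lborel. indicator ?E y * divergence ph y)"
 proof -
  have "?E \<inter> U = ?E" by auto
  then have "(LINT y|leb (?E \<inter> U). divergence ph y) = (LINT y|lebesgue. indicator ?E y *\<^sub>R divergence ph y)"
   by (simp only: lebesgue_on_integral(1)[OF Es])
  also have "... = (LINT y|lborel. indicator ?E y * divergence ph y)"
   using Eb dm by (simp add: integral_completion)
  finally show ?thesis .
 qed
 ultimately have lim: "x \<longlonglongrightarrow> (LINT y|leb (?E \<inter> U). divergence ph y)" by simp
 have xp: "x n <= p n" and pl: "ennreal (p n) = level_density v g n s" for n
 proof -
  let ?ka = "%t. - (real n * tent (real n * (t - s)))"
  have k1: "((%t. step_down (real n * (t - s))) has_real_derivative ?ka t) (at t)" for t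
  proof -
   have i: "((%t. real n * (t - s)) has_real_derivative real n) (at t)"
    by (auto intro!: derivative_eq_intros)
   show ?thesis using DERIV_chain2[OF step_down_derivative i] by (simp add: mult.commute)
  qed
  have k2: "\<bar>?ka t\<bar> <= real n" for t
   using tent_bounds(1,2)[of "real n * (t - s)"] by (simp add: abs_mult mult_left_le)
  have k3: "\<bar>?ka t - ?ka r\<bar> <= (4 * (real n)\<^sup>2) * \<bar>t - r\<bar>" for t r
  proof -
   have "\<bar>?ka t - ?ka r\<bar> = real n * \<bar>tent (real n * (t - s)) - tent (real n * (r - s))\<bar>"
    by (simp add: abs_mult abs_minus_commute flip: right_diff_distrib)
   also have "... <= real n * (4 * \<bar>real n * (t - s) - real n * (r - s)\<bar>)"
    by (intro mult_left_mono tent_lipschitz) simp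
   also have "... = (4 * (real n)\<^sup>2) * \<bar>t - r\<bar>"
    by (simp add: abs_mult power2_eq_square flip: right_diff_distrib)
   finally show ?thesis .
  qed
  have k4: "?ka : borel_measurable borel"
  proof -
   have "(%t. tent (real n * (t - s))) : borel_measurable borel"
    by (rule measurable_compose[OF _ tent_measurable]) simp
   then show ?thesis by simp
  qed
  have "(%y. tent (real n * (v y - s))) : borel_measurable borel"
   by (rule measurable_compose[OF vn tent_measurable])
  then have m: "(%y. real n * tent (real n * (v y - s))) : borel_measurable borel" by simp
  have k2': "\<bar>real n * tent (real n * (v y - s))\<bar> <= real n" for y using k2[of "v y"] by simp
  have "integrable lborel (%y. norm (g y))" using B(9) by simp
  from lborel_bounded_mult_integrable[OF this m k2']
  have i: "integrable lborel (%y. real n * tent (real n * (v y - s)) * norm (g y))"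
   by (simp add: mult.commute)
  show "ennreal (p n) = level_density v g n s"
   unfolding p_def level_density_def using i tent_bounds(1)
   by (intro nn_integral_eq_integral[symmetric]) auto
  have "x n = - (LINT y|lborel. ?ka (v y) * (g y \<bullet> ph y))"
   unfolding x_def by (rule borel_chain_rule_divergence[OF bv U k1 k2 k3 k4 ph])
  also have "... = (LINT y|lborel. - (?ka (v y) * (g y \<bullet> ph y)))" by simp
  also have "... <= (LINT y|lborel. real n * tent (real n * (v y - s)) * norm (g y))"
  proof (rule integral_mono')
   show "integrable lborel (%y. real n * tent (real n * (v y - s)) * norm (g y))" by (rule i)
   fix y
   have "g y \<bullet> ph y <= norm (g y) * norm (ph y)" by (rule norm_cauchy_schwarz)
   also have "... <= norm (g y) * 1" by (intro mult_left_mono test_fieldD(3)[OF ph]) auto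
   finally have "g y \<bullet> ph y <= norm (g y)" by simp
   then have "real n * tent (real n * (v y - s)) * (g y \<bullet> ph y) <= real n * tent (real n * (v y - s)) * norm (g y)"
    using tent_bounds(1) by (intro mult_left_mono) auto
   then show "- (?ka (v y) * (g y \<bullet> ph y)) <= real n * tent (real n * (v y - s)) * norm (g y)" by simp
   show "0 <= real n * tent (real n * (v y - s)) * norm (g y)" using tent_bounds(1) by simp
  qed
  finally show "x n <= p n" by (simp add: p_def)
 qed
 have "(%n. ennreal (x n)) \<longlonglongrightarrow> ennreal (LINT y|leb (?E \<inter> U). divergence ph y)"
  using lim by (rule tendsto_ennrealI)
 then have "ennreal (LINT y|leb (?E \<inter> U). divergence ph y) = liminf (%n. ennreal (x n))"
  using lim_imp_Liminf[OF sequentially_bot] by metis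
 also have "... <= liminf (%n. level_density v g n s)"
 proof (rule Liminf_mono, rule always_eventually, rule allI)
  fix n show "ennreal (x n) <= level_density v g n s"
   using ennreal_leI[OF xp[of n]] pl[of n] by simp
 qed
 finally show "ennreal (LINT y|leb (?E \<inter> U). divergence ph y) <= liminf (%n. level_density v g n s)" .
qed

lemma tent_kernel_mass: 
 assumes n: "n > 0"
 shows "(\<integral>\<^sup>+s. ennreal (real n * tent (real n * (t - s))) \<partial>lborel) = 1"
proof -
 have D: "((%s. step_down (real n * (t - s))) has_real_derivative real n * tent (real n * (t - s))) (at s)" for s
 proof -
  have i: "((%s. real n * (t - s)) has_real_derivative - real n) (at s)"
   by (auto intro!: derivative_eq_intros)
  show ?thesis using DERIV_chain2[OF step_down_derivative i] by (simp add: mult.commute)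
 qed
 have z: "tent (real n * (t - s)) = 0" if "s \<notin> {t - 2 / real n..t}" for s
 proof (cases "s > t")
  case True
  then show ?thesis using n by (intro tent_bounds(3)) (simp add: mult_le_0_iff)
 next
  case False
  with that have "t - s > 2 / real n" by auto
  then show ?thesis using n by (intro tent_bounds(4)) (simp add: field_simps)
 qed
 have "(%s. tent (real n * (t - s))) : borel_measurable borel"
  by (rule measurable_compose[OF _ tent_measurable]) simp
 then have m: "(%s. real n * tent (real n * (t - s))) : borel_measurable borel" by simp
 have "(\<integral>\<^sup>+s. ennreal (real n * tent (real n * (t - s))) \<partial>lborel)
   = (\<integral>\<^sup>+s. ennreal (real n * tent (real n * (t - s))) * indicator {t - 2 / real n..t} s \<partial>lborel)"
  using z by (intro nn_integral_cong) (auto simp: indicator_def)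
 also have "... = ennreal (step_down (real n * (t - t)) - step_down (real n * (t - (t - 2 / real n))))"
  using n m D tent_bounds(1) by (intro nn_integral_FTC_Icc) auto
 also have "... = 1" using n by (simp add: step_down_low step_down_high)
 finally show ?thesis .
qed

text \<open>Fatou's lemma in the levels, then Tonelli: the tent kernels integrate to one in \<open>s\<close>, so the limit
reproduces the weight at the value of the function.\<close>

theorem coarea_inequality:
 assumes bv: "borel_H1 U v g" and U: "open U" "U : lmeasurable"
  and w: "uniformly_continuous_on UNIV w" "!!s. 0 <= w s"
 shows "(\<integral>\<^sup>+s. ennreal (w s) * rel_perimeter {x\<in>U. v x <= s} U \<partial>lborel)
  <= (\<integral>\<^sup>+x. ennreal (w (v x) * norm (g x)) \<partial>lborel)"
proof -
 note B = borel_H1D[OF bv U(2)]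
 have wm: "w : borel_measurable borel"
  using uniformly_continuous_imp_continuous[OF w(1)] by (rule borel_measurable_continuous_onI)
 have joint: "(%p. ennreal (real n * tent (real n * (v (snd p) - fst p)) * norm (g (snd p)))) : borel_measurable (lborel \<Otimes>\<^sub>M lborel)" for n
 proof -
  have vm: "v : borel_measurable lborel" "g : borel_measurable lborel" using B(1,2) by simp_all
  have 1: "(%p::real \<times> 'a. v (snd p)) : borel_measurable (lborel \<Otimes>\<^sub>M lborel)"
   "(%p::real \<times> 'a. g (snd p)) : borel_measurable (lborel \<Otimes>\<^sub>M lborel)"
   "(%p::real \<times> 'a. fst p) : borel_measurable (lborel \<Otimes>\<^sub>M lborel)"
   using measurable_compose[OF measurable_snd vm(1)] measurable_compose[OF measurable_snd vm(2)] measurable_fst'[of id] by auto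
  have "(%p::real \<times> 'a. tent (real n * (v (snd p) - fst p))) : borel_measurable (lborel \<Otimes>\<^sub>M lborel)"
   by (rule measurable_compose[OF _ tent_measurable]) (use 1 in simp)
  with 1 show ?thesis by simp
 qed
 have ldm: "level_density v g n : borel_measurable lborel" for n
  unfolding level_density_def[abs_def]
  using lborel.borel_measurable_nn_integral[of "%s x. ennreal (real n * tent (real n * (v x - s)) * norm (g x))" lborel] joint
  by (simp add: case_prod_beta)
 have G: "(\<integral>\<^sup>+x. ennreal (norm (g x)) \<partial>lborel) = ennreal (LINT x|lborel. norm (g x))"
  using B(9) by (intro nn_integral_eq_integral) auto
 let ?I = "\<integral>\<^sup>+x. ennreal (w (v x) * norm (g x)) \<partial>lborel"
 let ?N = "\<integral>x. norm (g x) \<partial>lborel"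
 have step: "\<exists>N. \<forall>n\<ge>N. (\<integral>\<^sup>+s. ennreal (w s) * level_density v g n s \<partial>lborel) <= ?I + ennreal (e * ?N)" if e: "e > 0" for e
 proof -
  obtain d where d: "d > 0" "!!s t. \<bar>s - t\<bar> < d ==> \<bar>w s - w t\<bar> < e"
   using w(1) e unfolding uniformly_continuous_on_def dist_real_def by blast
  obtain N :: nat where N: "2 / d < real N" using reals_Archimedean2 by blast
  show ?thesis
  proof (intro exI[of _ "max 1 N"] allI impI)
   fix n assume "max 1 N <= n"
   then have n: "n > 0" "2 / d < real n" using N by (auto simp: less_le_trans)
   have n2: "2 / real n < d" using n d(1) by (simp add: field_simps)
   have kw: "ennreal (w s) * ennreal (real n * tent (real n * (t - s)) * c)
     <= ennreal ((w t + e) * c) * ennreal (real n * tent (real n * (t - s)))" if c: "c >= 0" for s t c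
   proof (cases "tent (real n * (t - s)) = 0")
    case False
    then have "0 < real n * (t - s)" "real n * (t - s) < 2" using tent_bounds(3,4) by (meson not_le)+
    then have "0 < t - s" "t - s < 2 / real n" using n by (auto simp: zero_less_mult_iff field_simps)
    then have "w s <= w t + e" using d(2)[of s t] n2 by (simp add: abs_if split: if_splits)
    then have "w s * (real n * tent (real n * (t - s)) * c) <= (w t + e) * (real n * tent (real n * (t - s)) * c)"
     using c tent_bounds(1) by (intro mult_right_mono) auto
    then show ?thesis
     using w(2) e c tent_bounds(1) by (simp add: ennreal_mult[symmetric] mult_ac ennreal_leI)
   qed simp
   have "(\<integral>\<^sup>+s. ennreal (w s) * level_density v g n s \<partial>lborel)
    = (\<integral>\<^sup>+s. (\<integral>\<^sup>+x. ennreal (w s) * ennreal (real n * tent (real n * (v x - s)) * norm (g x)) \<partial>lborel) \<partial>lborel)"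
   proof (rule nn_integral_cong)
    fix s :: real
    have "(%x. ennreal (real n * tent (real n * (v x - s)) * norm (g x))) : borel_measurable lborel"
    proof -
     have "(%x. tent (real n * (v x - s))) : borel_measurable borel"
      by (rule measurable_compose[OF _ tent_measurable]) (use B(1) in simp)
     then show ?thesis using B(2) by simp
    qed
    then show "ennreal (w s) * level_density v g n s = (\<integral>\<^sup>+x. ennreal (w s) * ennreal (real n * tent (real n * (v x - s)) * norm (g x)) \<partial>lborel)"
     unfolding level_density_def by (rule nn_integral_cmult[symmetric])
   qed
   also have "... <= (\<integral>\<^sup>+s. (\<integral>\<^sup>+x. ennreal ((w (v x) + e) * norm (g x)) * ennreal (real n * tent (real n * (v x - s))) \<partial>lborel) \<partial>lborel)"
    by (intro nn_integral_mono kw) simp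
   also have "... = (\<integral>\<^sup>+x. (\<integral>\<^sup>+s. ennreal ((w (v x) + e) * norm (g x)) * ennreal (real n * tent (real n * (v x - s))) \<partial>lborel) \<partial>lborel)"
   proof (rule lborel_pair.Fubini'[symmetric])
    have vm: "v : borel_measurable lborel" "g : borel_measurable lborel" using B(1,2) by simp_all
    have 1: "(%p::real \<times> 'a. v (snd p)) : borel_measurable (lborel \<Otimes>\<^sub>M lborel)"
     "(%p::real \<times> 'a. g (snd p)) : borel_measurable (lborel \<Otimes>\<^sub>M lborel)"
     "(%p::real \<times> 'a. fst p) : borel_measurable (lborel \<Otimes>\<^sub>M lborel)"
     using measurable_compose[OF measurable_snd vm(1)] measurable_compose[OF measurable_snd vm(2)] measurable_fst'[of id] by auto
    have "(%p::real \<times> 'a. tent (real n * (v (snd p) - fst p))) : borel_measurable (lborel \<Otimes>\<^sub>M lborel)"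
     by (rule measurable_compose[OF _ tent_measurable]) (use 1 in simp)
    moreover have "(%p::real \<times> 'a. w (v (snd p))) : borel_measurable (lborel \<Otimes>\<^sub>M lborel)"
     by (rule measurable_compose[OF 1(1) wm])
    ultimately show "(%(s, x). ennreal ((w (v x) + e) * norm (g x)) * ennreal (real n * tent (real n * (v x - s)))) : borel_measurable (lborel \<Otimes>\<^sub>M lborel)"
     using 1 by (simp add: case_prod_beta)
   qed
   also have "... = (\<integral>\<^sup>+x. ennreal ((w (v x) + e) * norm (g x)) \<partial>lborel)"
   proof (rule nn_integral_cong)
    fix x
    have "(%s. tent (real n * (v x - s))) : borel_measurable borel"
     by (rule measurable_compose[OF _ tent_measurable]) simp
    then have "(%s. ennreal (real n * tent (real n * (v x - s)))) : borel_measurable lborel" by simp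
    then show "(\<integral>\<^sup>+s. ennreal ((w (v x) + e) * norm (g x)) * ennreal (real n * tent (real n * (v x - s))) \<partial>lborel) = ennreal ((w (v x) + e) * norm (g x))"
     by (simp add: nn_integral_cmult tent_kernel_mass[OF n(1)])
   qed
   also have "... = (\<integral>\<^sup>+x. ennreal (w (v x) * norm (g x)) + ennreal e * ennreal (norm (g x)) \<partial>lborel)"
    using w(2) e by (intro nn_integral_cong) (simp add: distrib_right ennreal_mult)
   also have "... = ?I + (\<integral>\<^sup>+x. ennreal e * ennreal (norm (g x)) \<partial>lborel)"
    using measurable_compose[OF B(1) wm] B(2) by (intro nn_integral_add) auto
   also have "(\<integral>\<^sup>+x. ennreal e * ennreal (norm (g x)) \<partial>lborel) = ennreal (e * ?N)"
    using B(2) e G by (subst nn_integral_cmult) (auto simp: ennreal_mult)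
   finally show "(\<integral>\<^sup>+s. ennreal (w s) * level_density v g n s \<partial>lborel) <= ?I + ennreal (e * ?N)" .
  qed
 qed
 have "(\<integral>\<^sup>+s. ennreal (w s) * rel_perimeter {x\<in>U. v x <= s} U \<partial>lborel)
   <= (\<integral>\<^sup>+s. liminf (%n. ennreal (w s) * level_density v g n s) \<partial>lborel)"
 proof (rule nn_integral_mono)
  fix s :: real
  have "ennreal (w s) * rel_perimeter {x\<in>U. v x <= s} U <= ennreal (w s) * liminf (%n. level_density v g n s)"
   by (intro mult_left_mono perimeter_sublevel[OF bv U]) simp
  also have "... = liminf (%n. ennreal (w s) * level_density v g n s)"
   by (subst Liminf_compose_continuous_mono[where f = "%x. ennreal (w s) * x", symmetric])
    (auto intro!: ennreal_continuous_on_cmult continuous_on_id continuous_on_const monoI mult_left_mono)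
  finally show "ennreal (w s) * rel_perimeter {x\<in>U. v x <= s} U <= liminf (%n. ennreal (w s) * level_density v g n s)" .
 qed
 also have "... <= liminf (%n. \<integral>\<^sup>+s. ennreal (w s) * level_density v g n s \<partial>lborel)"
  using ldm wm by (intro nn_integral_liminf) simp
 also have "... <= ?I"
 proof (rule ennreal_le_epsilon)
  fix e' :: real assume e': "e' > 0"
  have N0: "?N >= 0" by (rule integral_nonneg_AE) simp
  define e where "e = e' / (?N + 1)"
  have "0 < e' / (q + 1) \<and> e' / (q + 1) * q <= e'" if "q >= 0" for q :: real
   using that e' by (auto simp: field_simps)
  from this[OF N0] have e: "e > 0" "e * ?N <= e'" unfolding e_def by blast+
  obtain N where N: "!!n. n >= N ==> (\<integral>\<^sup>+s. ennreal (w s) * level_density v g n s \<partial>lborel) <= ?I + ennreal (e * ?N)"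
   using step[OF e(1)] by blast
  have "liminf (%n. \<integral>\<^sup>+s. ennreal (w s) * level_density v g n s \<partial>lborel) <= liminf (%n::nat. ?I + ennreal e')"
  proof (rule Liminf_mono)
   show "\<forall>\<^sub>F n in sequentially. (\<integral>\<^sup>+s. ennreal (w s) * level_density v g n s \<partial>lborel) <= ?I + ennreal e'"
    using eventually_ge_at_top[of N]
   proof eventually_elim
    case (elim n)
    show ?case using N[OF elim] ennreal_leI[OF e(2)] by (meson add_left_mono order_trans)
   qed
  qed
  then show "liminf (%n. \<integral>\<^sup>+s. ennreal (w s) * level_density v g n s \<partial>lborel) <= ?I + ennreal e'"
   by (simp add: Liminf_const)
 qed
 finally show ?thesis .
qed

section \<open>The isoperimetric function\<close>

lemma coordinate_borel_H1:
 fixes U :: "'a::euclidean_space set"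
 assumes U: "open U" "U : lmeasurable" "bounded U"
 shows "borel_H1 U (%x. indicator U x * (x \<bullet> c)) (%x. indicator U x *\<^sub>R c)"
proof -
 let ?v = "%x. indicator U x * (x \<bullet> c) :: real" and ?g = "%x. indicator U x *\<^sub>R c"
 have Us: "U : sets lebesgue" using U by auto
 obtain R where R: "R > 0" "!!x. x : U ==> norm x <= R" using U(3) bounded_pos by metis
 have vm: "?v : borel_measurable borel" "?g : borel_measurable borel" using U(1) by simp_all
 have vB: "norm (?v x) <= R * norm c" for x
 proof (cases "x : U")
  case True
  have "\<bar>x \<bullet> c\<bar> <= norm x * norm c" by (rule Cauchy_Schwarz_ineq2)
  also have "... <= R * norm c" by (intro mult_right_mono R True) auto
  finally show ?thesis using True by simp
 qed (use R(1) in simp)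
 have v2: "?v : L2_space U"
  using vB by (intro L2_bounded[OF U(2), of _ "R * norm c"] borel_measurable_lebesgue_on vm) auto
 have g2: "?g : L2_space U"
  by (intro L2_bounded[OF U(2), of _ "norm c"] borel_measurable_lebesgue_on vm) (auto simp: indicator_def)
 have vi: "integrable lborel ?v"
  by (rule borel_L2_lborel(2)[OF U(2) vm(1) _ v2]) simp
 have "has_weak_gradient U ?v ?g"
  unfolding has_weak_gradient_def
 proof (intro conjI ballI g2)
  fix ph b assume ph: "ph : test_functions U" and b: "b : (Basis :: 'a set)"
  note phm = continuous_borel[OF test_functionD(3)[OF ph]] continuous_borel[OF test_functionD(3)[OF test_function_partial_deriv[OF ph b]]]
  have z: "ph x = 0" if "x \<notin> U" for x
   using compact_support_zero[OF test_functionD(2)[OF ph] that] .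
  obtain A de where A: "open A" "de > 0" "!!x. ph x ~= 0 ==> x : A" "!!x y. x : A ==> norm y <= de ==> x + y : U"
   using compact_support_room[OF test_functionD(2)[OF ph] U(1)] by blast
  define h where "h n = de / real (Suc n)" for n
  have h: "h \<longlonglongrightarrow> 0" "!!n. h n ~= 0" "!!n. \<bar>h n\<bar> <= de"
  proof -
   have "(%n. de * (1 / real (Suc n))) \<longlonglongrightarrow> de * 0"
    by (intro tendsto_mult_left) (use LIMSEQ_inverse_real_of_nat in \<open>simp add: inverse_eq_divide\<close>)
   then show "h \<longlonglongrightarrow> 0" by (simp add: h_def[abs_def])
   show "h n ~= 0" for n using A(2) by (simp add: h_def)
   show "\<bar>h n\<bar> <= de" for n using A(2) by (simp add: h_def field_simps)
  qed
  have "(?v x - ?v (x + h n *\<^sub>R b)) * ph x = - (h n * ((b \<bullet> c) * ph x))" for n x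
  proof (cases "ph x = 0")
   case False
   then have "x : A" by (rule A(3))
   then have "x : U" "x + h n *\<^sub>R b : U"
    using A(4)[of x 0] A(4)[of x "h n *\<^sub>R b"] A(2) h(3) b by auto
   then show ?thesis by (simp add: inner_add_left algebra_simps)
  qed simp
  then have q: "(LINT x|lborel. (?v x - ?v (x + h n *\<^sub>R b)) * ph x) / h n = - (LINT x|lborel. (b \<bullet> c) * ph x)" for n
   using h(2) by simp
  have "(%n. (LINT x|lborel. (?v x - ?v (x + h n *\<^sub>R b)) * ph x) / h n) \<longlonglongrightarrow> (LINT x|lborel. ?v x * partial_deriv b ph x)"
   by (rule integral_difference_quotient_limit[OF vi test_functionD(1,2)[OF ph] b h(1,2)])
  then have e: "(LINT x|lborel. ?v x * partial_deriv b ph x) = - (LINT x|lborel. (b \<bullet> c) * ph x)"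
   unfolding q LIMSEQ_const_iff by (rule sym)
  have "(LINT x|leb U. ?v x * partial_deriv b ph x) = (LINT x|lborel. ?v x * partial_deriv b ph x)"
   using vm(1) phm by (intro lebesgue_on_lborel(1) Us) auto
  also note e
  also have "(LINT x|lborel. (b \<bullet> c) * ph x) = (LINT x|lborel. (?g x \<bullet> b) * ph x)"
  proof (rule Bochner_Integration.integral_cong[OF refl])
   fix x show "(b \<bullet> c) * ph x = (?g x \<bullet> b) * ph x" using z[of x] by (cases "x : U") (auto simp: inner_commute)
  qed
  also have "... = (LINT x|leb U. (?g x \<bullet> b) * ph x)"
   using U(1) phm z by (intro lebesgue_on_lborel(1)[symmetric] Us) auto
  finally show "(LINT x|leb U. ?v x * partial_deriv b ph x) = - (LINT x|leb U. (?g x \<bullet> b) * ph x)" .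
 qed
 with vm v2 show ?thesis by (simp add: borel_H1_def)
qed

text \<open>Supplies the Lipschitz bound for the volume of a set cut by parallel hyperplanes.\<close>

lemma slab_measure:
 fixes c :: "'a::euclidean_space"
 assumes c: "c : Basis"
 obtains K where "K >= 0" "!!s t. s <= t ==> emeasure lborel {x\<in>cbox (- R *\<^sub>R One) (R *\<^sub>R One). s <= x \<bullet> c \<and> x \<bullet> c <= t} <= ennreal (K * (t - s))"
proof -
 define K where "K = (\<Prod>i\<in>Basis - {c}. 2 * \<bar>R\<bar>)"
 show thesis
 proof (rule that[of K])
  show "K >= 0" unfolding K_def by (rule prod_nonneg) simp
  fix s t :: real assume st: "s <= t"
  define a where "a = (\<Sum>i\<in>Basis. (if i = c then s else - \<bar>R\<bar>) *\<^sub>R (i::'a))"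
  define b where "b = (\<Sum>i\<in>Basis. (if i = c then t else \<bar>R\<bar>) *\<^sub>R (i::'a))"
  have ab: "a \<bullet> i = (if i = c then s else - \<bar>R\<bar>)" "b \<bullet> i = (if i = c then t else \<bar>R\<bar>)" if "i : Basis" for i
   using that by (simp_all add: a_def b_def)
  have "{x\<in>cbox (- R *\<^sub>R One) (R *\<^sub>R One). s <= x \<bullet> c \<and> x \<bullet> c <= t} \<subseteq> cbox a b"
  proof
   fix x :: 'a assume x: "x : {x\<in>cbox (- R *\<^sub>R One) (R *\<^sub>R One). s <= x \<bullet> c \<and> x \<bullet> c <= t}"
   have "- \<bar>R\<bar> <= x \<bullet> i \<and> x \<bullet> i <= \<bar>R\<bar>" if "i : Basis" for i
   proof -
    have "- R <= x \<bullet> i \<and> x \<bullet> i <= R" using x that by (auto simp: mem_box)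
    then show ?thesis by linarith
   qed
   then show "x : cbox a b" using x ab by (auto simp: mem_box)
  qed
  then have "emeasure lborel {x\<in>cbox (- R *\<^sub>R One) (R *\<^sub>R One). s <= x \<bullet> c \<and> x \<bullet> c <= t} <= emeasure lborel (cbox a b)"
   by (intro emeasure_mono) auto
  also have "... = ennreal (\<Prod>i\<in>Basis. (b - a) \<bullet> i)"
   using ab st by (intro emeasure_lborel_cbox) auto
  also have "(\<Prod>i\<in>Basis. (b - a) \<bullet> i) = ((b - a) \<bullet> c) * (\<Prod>i\<in>Basis - {c}. (b - a) \<bullet> i)"
   using c by (intro prod.remove) auto
  also have "(\<Prod>i\<in>Basis - {c}. (b - a) \<bullet> i) = K"
   unfolding K_def using ab by (intro prod.cong) (auto simp: inner_diff_left)
  also have "(b - a) \<bullet> c = t - s" using ab c by (simp add: inner_diff_left)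
  finally show "emeasure lborel {x\<in>cbox (- R *\<^sub>R One) (R *\<^sub>R One). s <= x \<bullet> c \<and> x \<bullet> c <= t} <= ennreal (K * (t - s))"
   by (simp add: mult.commute)
 qed
qed

text \<open>Some set of finite perimeter has the prescribed volume: cut the domain by a coordinate hyperplane, whose height is
found by the intermediate value theorem. The
perimeter of such a cut is estimated as that of a sublevel set of a coordinate function.\<close>

theorem isoperimetric_finite:
 fixes U :: "'a::euclidean_space set"
 assumes U: "open U" "U : lmeasurable" "bounded U" and r: "0 <= r" "r <= measure lebesgue U"
 shows "isoperimetric U r < \<infinity>"
proof -
 obtain c :: 'a where c: "c : Basis" using nonempty_Basis by blast
 obtain R0 where R0: "!!x. x : U ==> norm x <= R0" using U(3) bounded_iff by metis
 define R where "R = max R0 1"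
 have R: "norm x <= R" if "x : U" for x using R0[OF that] by (simp add: R_def)
 have coord: "\<bar>x \<bullet> i\<bar> <= R" if "x : U" "i : Basis" for x i
  using R[OF that(1)] Basis_le_norm[OF that(2), of x] by linarith
 have sub: "U \<subseteq> cbox (- R *\<^sub>R One) (R *\<^sub>R One)"
 proof
  fix x assume "x : U"
  then show "x : cbox (- R *\<^sub>R One) (R *\<^sub>R One)"
   using coord[of x] by (auto simp: mem_box abs_le_iff minus_le_iff)
 qed
 obtain K where K: "K >= 0" "!!s t. s <= t ==> emeasure lborel {x\<in>cbox (- R *\<^sub>R One) (R *\<^sub>R One). s <= x \<bullet> c \<and> x \<bullet> c <= t} <= ennreal (K * (t - s))"
  using slab_measure[OF c] by blast
 have slab: "{x\<in>U. s <= x \<bullet> c \<and> x \<bullet> c <= t} \<in> sets borel"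
  "emeasure lborel {x\<in>U. s <= x \<bullet> c \<and> x \<bullet> c <= t} <= ennreal (K * (t - s))" if "s <= t" for s t
 proof -
  have "closed {x::'a. s <= x \<bullet> c}" "closed {x::'a. x \<bullet> c <= t}"
   by (rule closed_halfspace_component_ge closed_halfspace_component_le)+
  moreover have "{x\<in>U. s <= x \<bullet> c \<and> x \<bullet> c <= t} = U \<inter> ({x. s <= x \<bullet> c} \<inter> {x. x \<bullet> c <= t})" by auto
  ultimately show "{x\<in>U. s <= x \<bullet> c \<and> x \<bullet> c <= t} \<in> sets borel" using U(1) by auto
  have "emeasure lborel {x\<in>U. s <= x \<bullet> c \<and> x \<bullet> c <= t}
   <= emeasure lborel {x\<in>cbox (- R *\<^sub>R One) (R *\<^sub>R One). s <= x \<bullet> c \<and> x \<bullet> c <= t}"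
  proof (rule emeasure_mono)
   have "{x\<in>cbox (- R *\<^sub>R One) (R *\<^sub>R One). s <= x \<bullet> c \<and> x \<bullet> c <= t}
    = cbox (- R *\<^sub>R One) (R *\<^sub>R One) \<inter> ({x. s <= x \<bullet> c} \<inter> {x. x \<bullet> c <= t})" by auto
   then show "{x\<in>cbox (- R *\<^sub>R One) (R *\<^sub>R One). s <= x \<bullet> c \<and> x \<bullet> c <= t} \<in> sets lborel"
    using \<open>closed {x::'a. s <= x \<bullet> c}\<close> \<open>closed {x::'a. x \<bullet> c <= t}\<close> by auto
  qed (use sub in auto)
  then show "emeasure lborel {x\<in>U. s <= x \<bullet> c \<and> x \<bullet> c <= t} <= ennreal (K * (t - s))"
   using K(2)[OF that] by (rule order_trans)
 qed
 define H where "H t = {x\<in>U. x \<bullet> c <= t}" for t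
 have Hb: "H t : sets borel" for t
 proof -
  have "closed {x::'a. x \<bullet> c <= t}" by (rule closed_halfspace_component_le)
  moreover have "H t = U \<inter> {x. x \<bullet> c <= t}" by (auto simp: H_def)
  ultimately show ?thesis using U(1) by auto
 qed
 have Hl: "H t : lmeasurable" for t
  by (rule fmeasurableI2[OF U(2)]) (use Hb in \<open>auto simp: H_def\<close>)
 define ro where "ro t = measure lebesgue (H t)" for t
 have inc: "ro s <= ro t \<and> ro t <= ro s + K * (t - s)" if st: "s <= t" for s t
 proof
  show "ro s <= ro t" unfolding ro_def
   by (rule measure_mono_fmeasurable) (use Hl st fmeasurableD[OF Hl] in \<open>auto simp: H_def\<close>)
  let ?S = "{x\<in>U. s <= x \<bullet> c \<and> x \<bullet> c <= t}"
  have "emeasure lebesgue ?S <= ennreal (K * (t - s))" using slab[OF st] by simp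
  moreover from this have S: "?S : lmeasurable"
   using slab(1)[OF st] by (intro fmeasurableI) (auto simp: less_top[symmetric] top_unique)
  ultimately have "measure lebesgue ?S <= K * (t - s)"
   using K(1) st by (simp add: emeasure_eq_measure2)
  moreover have "ro t <= measure lebesgue (H s \<union> ?S)"
   unfolding ro_def by (rule measure_mono_fmeasurable) (use Hl S fmeasurableD[OF Hl] in \<open>auto simp: H_def\<close>)
  moreover have "measure lebesgue (H s \<union> ?S) <= ro s + measure lebesgue ?S"
   unfolding ro_def using Hl S by (intro measure_Un_le) auto
  ultimately show "ro t <= ro s + K * (t - s)" by linarith
 qed
 have "continuous_on {- R - 1..R} ro"
 proof (rule lipschitz_on_continuous_on)
  show "K-lipschitz_on {- R - 1..R} ro"
  proof (rule lipschitz_onI[OF _ K(1)])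
   fix s t :: real
   show "dist (ro s) (ro t) <= K * dist s t"
    using inc[of s t] inc[of t s] by (cases "s <= t") (auto simp: dist_real_def)
  qed
 qed
 moreover have "ro (- R - 1) = 0"
 proof -
  have "H (- R - 1) = {}" using coord[OF _ c] by (fastforce simp: H_def abs_le_iff)
  then show ?thesis by (simp add: ro_def)
 qed
 moreover have "ro R = measure lebesgue U"
 proof -
  have "H R = U" using coord[OF _ c] by (fastforce simp: H_def abs_le_iff)
  then show ?thesis by (simp add: ro_def)
 qed
 moreover have "- R - 1 <= R" by (simp add: R_def)
 ultimately obtain t where t: "ro t = r"
  using IVT'[of ro "- R - 1" r R] r by auto
 let ?v = "%x. indicator U x * (x \<bullet> c) :: real" and ?g = "%x. indicator U x *\<^sub>R c"
 have He: "H t = {x\<in>U. ?v x <= t}" by (auto simp: H_def)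
 have "isoperimetric U r <= rel_perimeter (H t) U"
  unfolding isoperimetric_def using Hb t by (intro INF_lower) (auto simp: ro_def H_def)
 also have "... <= liminf (%n. level_density ?v ?g n t)"
  unfolding He by (rule perimeter_sublevel[OF coordinate_borel_H1[OF U] U(1,2)])
 also have "... <= liminf (%n::nat. ennreal (2 * K))"
 proof (rule Liminf_mono, rule always_eventually, rule allI)
  fix n :: nat
  show "level_density ?v ?g n t <= ennreal (2 * K)"
  proof (cases "n = 0")
   case True
   then show ?thesis by (simp add: level_density_def)
  next
   case False
   let ?S = "{x\<in>U. t <= x \<bullet> c \<and> x \<bullet> c <= t + 2 / real n}"
   have "level_density ?v ?g n t <= (\<integral>\<^sup>+x. ennreal (real n) * indicator ?S x \<partial>lborel)"
    unfolding level_density_def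
   proof (rule nn_integral_mono)
    fix x
    show "ennreal (real n * tent (real n * (?v x - t)) * norm (?g x)) <= ennreal (real n) * indicator ?S x"
    proof (cases "x : ?S")
     case True
     have "tent (real n * (?v x - t)) * norm (?g x) <= 1 * 1"
      using tent_bounds(1,2) c by (intro mult_mono) (auto simp: indicator_def)
     then have "real n * tent (real n * (?v x - t)) * norm (?g x) <= real n"
      using mult_left_mono[of "tent (real n * (?v x - t)) * norm (?g x)" 1 "real n"] by (simp add: mult.assoc)
     with True show ?thesis by (simp add: ennreal_leI)
    next
     case F: False
     have "tent (real n * (?v x - t)) * norm (?g x) = 0"
     proof (cases "x : U")
      case True
      with F consider "x \<bullet> c < t" | "x \<bullet> c > t + 2 / real n" by fastforce
      then have "tent (real n * (x \<bullet> c - t)) = 0"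
      proof cases
       case 1
       then show ?thesis by (intro tent_bounds(3)) (simp add: mult_le_0_iff)
      next
       case 2
       then show ?thesis using False by (intro tent_bounds(4)) (simp add: field_simps)
      qed
      then show ?thesis using True by simp
     qed simp
     then have "real n * tent (real n * (?v x - t)) * norm (?g x) = 0"
      by (simp only: mult.assoc mult_zero_right)
     then show ?thesis by (simp only: ennreal_0 zero_le)
    qed
   qed
   also have "... = ennreal (real n) * emeasure lborel ?S"
    using slab(1)[of t "t + 2 / real n"] by (subst nn_integral_cmult_indicator) auto
   also have "... <= ennreal (real n) * ennreal (K * (2 / real n))"
    using slab(2)[of t "t + 2 / real n"] by (intro mult_left_mono) auto
   also have "... = ennreal (2 * K)"
    using False K(1) by (simp add: ennreal_mult[symmetric] field_simps)
   finally show ?thesis .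
  qed
 qed
 also have "... = ennreal (2 * K)" by (simp add: Liminf_const)
 finally show ?thesis using ennreal_less_top by (simp add: le_less_trans)
qed

text \<open>Near \<open>r0\<close> differentiability gives the linear bound; away from \<open>r0\<close> a large slope makes the left-hand side
nonpositive. Infinite values are treated separately, because \<open>enn2real\<close> sends them to 0.\<close>

lemma isoperimetric_lower_bound:
 assumes d: "(%r. enn2real (isoperimetric U r)) differentiable (at r0)" and fin: "isoperimetric U r0 < \<infinity>"
 obtains L where "L >= 0" "!!r. ennreal (enn2real (isoperimetric U r0) - L * \<bar>r - r0\<bar>) <= isoperimetric U r"
proof -
 define f where "f r = enn2real (isoperimetric U r)" for r
 have f0: "f r >= 0" for r by (simp add: f_def)
 obtain D where D: "(f has_real_derivative D) (at r0)"
  using d real_differentiable_def unfolding f_def[abs_def] by blast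
 then have "((%h. (f (r0 + h) - f r0) / h) \<longlongrightarrow> D) (at 0)" by (simp add: DERIV_def)
 then have "\<forall>\<^sub>F h in at 0. dist ((f (r0 + h) - f r0) / h) D < 1"
  by (rule tendstoD) simp
 then obtain e where e: "e > 0" "!!h. h ~= 0 ==> \<bar>h\<bar> < e ==> \<bar>(f (r0 + h) - f r0) / h - D\<bar> < 1"
  unfolding eventually_at by (auto simp: dist_real_def)
 \<comment> \<open>The last summand makes the left-hand side nonpositive at distance e or more from r0.\<close>
 define L where "L = \<bar>D\<bar> + 1 + f r0 / e"
 have L0: "L >= 0" using f0[of r0] e(1) by (simp add: L_def)
 have main: "f r0 - L * \<bar>r - r0\<bar> <= f r \<or> f r0 - L * \<bar>r - r0\<bar> <= 0" for r
 proof (cases "\<bar>r - r0\<bar> < e")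
  case True
  show ?thesis
  proof (cases "r = r0")
   case False
   define h where "h = r - r0"
   have h: "h ~= 0" "\<bar>h\<bar> < e" "r = r0 + h" using True False by (auto simp: h_def)
   have "\<bar>(f r - f r0) / h\<bar> <= \<bar>D\<bar> + 1" using e(2)[OF h(1,2)] unfolding h(3) by linarith
   then have "\<bar>f r - f r0\<bar> <= (\<bar>D\<bar> + 1) * \<bar>h\<bar>" using h(1) by (simp add: abs_divide field_simps)
   also have "... <= L * \<bar>h\<bar>"
    unfolding L_def using f0[of r0] e(1) by (intro mult_right_mono) auto
   finally show ?thesis unfolding h_def by linarith
  qed simp
 next
  case False
  have "f r0 = f r0 / e * e" using e(1) by simp
  also have "... <= L * \<bar>r - r0\<bar>"
   using False f0[of r0] e(1) by (intro mult_mono) (auto simp: L_def)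
  finally show ?thesis by simp
 qed
 show thesis
 proof (rule that[OF L0])
  fix r
  show "ennreal (enn2real (isoperimetric U r0) - L * \<bar>r - r0\<bar>) <= isoperimetric U r"
  proof (cases "isoperimetric U r = \<infinity>")
   case False
   then have e: "isoperimetric U r = ennreal (f r)"
    by (simp add: f_def ennreal_enn2real less_top)
   from main[of r] show ?thesis
   proof
    assume "f r0 - L * \<bar>r - r0\<bar> <= f r"
    then show ?thesis unfolding e f_def[of r0, symmetric] by (rule ennreal_leI)
   next
    assume "f r0 - L * \<bar>r - r0\<bar> <= 0"
    then have "ennreal (f r0 - L * \<bar>r - r0\<bar>) = 0" by (rule ennreal_neg)
    then show ?thesis by (simp add: f_def)
   qed
  qed simp
 qed
qed

section \<open>The double well potential\<close>

lemma admissible_potentialD: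
 assumes "admissible_potential W"
 shows "W s >= 0" "(W has_real_derivative deriv W s) (at s)"
  "(deriv W has_real_derivative deriv (deriv W) s) (at s)"
  "continuous_on UNIV (deriv (deriv W))" "continuous_on UNIV (deriv W)" "continuous_on UNIV W"
  "W 1 = 0" "W (-1) = 0" "W s = 0 ==> s = -1 \<or> s = 1"
  "deriv W 1 = 0" "deriv W (-1) = 0" "deriv (deriv W) 1 > 0" "deriv (deriv W) (-1) > 0"
  "Liminf at_infinity (%s. ereal \<bar>deriv W s\<bar>) = \<infinity>"
proof -
 note A = assms[unfolded admissible_potential_def]
 show "W s >= 0" "continuous_on UNIV (deriv (deriv W))" "Liminf at_infinity (%s. ereal \<bar>deriv W s\<bar>) = \<infinity>"
  "deriv (deriv W) 1 > 0" "deriv (deriv W) (-1) > 0"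
  using A by auto
 show 1: "(W has_real_derivative deriv W s) (at s)" for s
  using A by (simp add: DERIV_deriv_iff_real_differentiable)
 show 2: "(deriv W has_real_derivative deriv (deriv W) s) (at s)" for s
  using A by (simp add: DERIV_deriv_iff_real_differentiable)
 show "continuous_on UNIV (deriv W)" "continuous_on UNIV W"
  using 1 2 by (meson DERIV_isCont continuous_at_imp_continuous_on)+
 have z: "W s = 0 \<longleftrightarrow> s = -1 \<or> s = 1" for s using A by blast
 then show "W 1 = 0" "W (-1) = 0" "W s = 0 ==> s = -1 \<or> s = 1" by blast+
 obtain c where "{s. deriv W s = 0} = {-1, c, 1}" using A by blast
 then show "deriv W 1 = 0" "deriv W (-1) = 0" by blast+
qed

lemma quadratic_near_minimum:
 fixes W :: "real => real"
 assumes W1: "!!s. (W has_real_derivative W1 s) (at s)" and W2: "!!s. (W1 has_real_derivative W2 s) (at s)"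
  and c: "continuous_on UNIV W2" and z: "W a = 0" "W1 a = 0" and p: "W2 a > 0"
 obtains d k where "d > 0" "k > 0" "!!s. \<bar>s - a\<bar> < d ==> k * (s - a)\<^sup>2 <= W s"
proof -
 have "isCont W2 a" using c by (simp add: continuous_on_eq_continuous_at)
 then have "(W2 \<longlongrightarrow> W2 a) (at a)" by (simp add: isCont_def)
 then have "\<forall>\<^sub>F s in at a. dist (W2 s) (W2 a) < W2 a / 2" by (rule tendstoD) (use p in simp)
 then obtain d where d: "d > 0" "!!s. s ~= a ==> \<bar>s - a\<bar> < d ==> \<bar>W2 s - W2 a\<bar> < W2 a / 2"
  unfolding eventually_at by (auto simp: dist_real_def)
 have lb: "W2 a / 2 <= W2 s" if "\<bar>s - a\<bar> < d" for s
 proof (cases "s = a")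
  case False
  have "\<bar>W2 s - W2 a\<bar> < W2 a / 2" by (rule d(2)[OF False that])
  then show ?thesis unfolding abs_less_iff by linarith
 qed (use p in simp)
 show thesis
 proof (rule that[of d "W2 a / 4"])
  fix s assume s: "\<bar>s - a\<bar> < d"
  show "W2 a / 4 * (s - a)\<^sup>2 <= W s"
  proof (cases "s = a")
   case False
   define diff where "diff m = (if m = 0 then W else if m = Suc 0 then W1 else W2)" for m :: nat
   have "\<exists>t. (if s < a then s < t \<and> t < a else a < t \<and> t < s) \<and>
     W s = (\<Sum>m<2. diff m a / fact m * (s - a) ^ m) + diff 2 t / fact 2 * (s - a) ^ 2"
   proof (rule Taylor[of 2 diff W "min s a" "max s a"])
    show "\<forall>m t. m < 2 \<and> min s a <= t \<and> t <= max s a --> (diff m has_real_derivative diff (Suc m) t) (at t)"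
     using W1 W2 by (auto simp: diff_def less_2_cases_iff)
   qed (use False in \<open>auto simp: diff_def\<close>)
   then obtain t where t: "if s < a then s < t \<and> t < a else a < t \<and> t < s"
    "W s = (\<Sum>m<2. diff m a / fact m * (s - a) ^ m) + diff 2 t / fact 2 * (s - a) ^ 2" by blast
   have "W s = W2 t / 2 * (s - a)\<^sup>2"
    using t(2) z by (simp add: diff_def numeral_2_eq_2)
   moreover have "\<bar>t - a\<bar> < d" using t(1) s by (auto split: if_splits)
   from lb[OF this] have "W2 a / 4 * (s - a)\<^sup>2 <= W2 t / 2 * (s - a)\<^sup>2"
    by (intro mult_right_mono) auto
   ultimately show ?thesis by simp
  qed (use z in simp)
 qed (use d p in auto)
qed

lemma linear_growth:
 fixes W :: "real => real"
 assumes W1: "!!s. (W has_real_derivative W1 s) (at s)" and c: "continuous_on UNIV W1"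
  and pos: "!!s. W s >= 0" and big: "!!s. s >= R ==> \<bar>W1 s\<bar> >= 1" and s: "s >= R"
 shows "W s >= W R + (s - R)"
proof -
 have same: "W1 b >= 1" if o: "W1 R >= 1" "b >= R" for b
 proof (rule ccontr)
  assume "\<not> W1 b >= 1"
  then have "W1 b <= -1" using big[OF o(2)] by (auto simp: abs_if split: if_splits)
  moreover have "continuous_on {R..b} W1" using c continuous_on_subset by blast
  moreover have "W1 b <= 0" "0 <= W1 R" using calculation(1) o(1) by linarith+
  ultimately obtain x where "R <= x" "x <= b" "W1 x = 0"
   using IVT2'[of W1 b 0 R] o(2) by metis
  then show False using big[of x] by simp
 qed
 have same': "W1 b <= -1" if o: "W1 R <= -1" "b >= R" for b
 proof (rule ccontr)
  assume "\<not> W1 b <= -1"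
  then have "W1 b >= 1" using big[OF o(2)] by (auto simp: abs_if split: if_splits)
  moreover have "continuous_on {R..b} W1" using c continuous_on_subset by blast
  moreover have "0 <= W1 b" "W1 R <= 0" using calculation(1) o(1) by linarith+
  ultimately obtain x where "R <= x" "x <= b" "W1 x = 0"
   using IVT'[of W1 R 0 b] o(2) by metis
  then show False using big[of x] by simp
 qed
 have "W1 R >= 1"
 proof (rule ccontr)
  assume "\<not> W1 R >= 1"
  then have n: "W1 R <= -1" using big[of R] by (auto simp: abs_if split: if_splits)
  define b where "b = R + W R + 1"
  have "R < b" using pos[of R] by (simp add: b_def)
  then obtain z where z: "z > R" "z < b" "W b - W R = (b - R) * W1 z"
   using MVT2[of R b W W1] W1 by auto
  have "(b - R) * W1 z <= (b - R) * (-1)" using z same'[OF n, of z] by (intro mult_left_mono) auto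
  then have "W b <= -1" using z(3) by (simp add: b_def)
  then show False using pos[of b] by linarith
 qed
 note up = same[OF this]
 show ?thesis
 proof (cases "s = R")
  case False
  then have "R < s" using s by simp
  then obtain z where z: "z > R" "z < s" "W s - W R = (s - R) * W1 z"
   using MVT2[of R s W W1] W1 by auto
  have "(s - R) * 1 <= (s - R) * W1 z" using z up[of z] by (intro mult_left_mono) auto
  then show ?thesis using z(3) by simp
 qed simp
qed

text \<open>Quadratic growth at the two wells comes from the second derivatives, linear growth at infinity from
the blow-up of \<open>W'\<close>, and compactness bridges the remaining range.\<close>

lemma potential_coercive:
 assumes W: "admissible_potential W"
 obtains c where "c > 0" "!!s. c * min ((\<bar>s\<bar> - 1)\<^sup>2) \<bar>\<bar>s\<bar> - 1\<bar> <= W s"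
proof -
 note D = admissible_potentialD[OF W]
 obtain d1 k1 where 1: "d1 > 0" "k1 > 0" "!!s. \<bar>s - 1\<bar> < d1 ==> k1 * (s - 1)\<^sup>2 <= W s"
  using quadratic_near_minimum[OF D(2) D(3) D(4) D(7) D(10) D(12)] by blast
 obtain d2 k2 where 2: "d2 > 0" "k2 > 0" "!!s. \<bar>s - (-1)\<bar> < d2 ==> k2 * (s - (-1))\<^sup>2 <= W s"
  using quadratic_near_minimum[OF D(2) D(3) D(4) D(8) D(11) D(13)] by blast
 define d where "d = min 1 (min d1 d2)"
 have d: "d > 0" "d <= 1" "d <= d1" "d <= d2" using 1 2 by (auto simp: d_def)
 have "\<forall>\<^sub>F s in at_infinity. ereal 1 < ereal \<bar>deriv W s\<bar>"
  using less_LiminfD[of "ereal 1" at_infinity "%s. ereal \<bar>deriv W s\<bar>"] D(14) by simp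
 then obtain R0 where R0: "!!s. \<bar>s\<bar> >= R0 ==> \<bar>deriv W s\<bar> > 1"
  unfolding eventually_at_infinity by auto
 define R where "R = max R0 2"
 have R: "R >= 2" "!!s. \<bar>s\<bar> >= R ==> \<bar>deriv W s\<bar> >= 1"
  using R0 by (auto simp: R_def less_imp_le)
 have right: "W s >= W R + (s - R)" if "s >= R" for s
  by (rule linear_growth[OF D(2) D(5) D(1) _ that]) (use R in auto)
 have left: "W (- s) >= W (- R) + (s - R)" if "s >= R" for s
 proof -
  have V: "((%s. W (- s)) has_real_derivative - deriv W (- s)) (at s)" for s
  proof -
   have "((%s. - s) has_real_derivative - 1) (at s)" for s :: real by (auto intro!: derivative_eq_intros)
   from DERIV_chain2[OF D(2) this] show ?thesis by simp
  qed
  have "continuous_on UNIV (%s. - deriv W (- s))"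
   by (intro continuous_on_minus continuous_on_compose2[OF D(5)] continuous_on_id) auto
  from linear_growth[OF V this, of R s] show ?thesis using D(1) R that by auto
 qed
 define S where "S = {s. \<bar>s\<bar> <= R \<and> d <= \<bar>\<bar>s\<bar> - 1\<bar>}"
 have "closed S"
  unfolding S_def Collect_conj_eq
  by (intro closed_Int closed_Collect_le continuous_on_rabs continuous_on_diff continuous_on_id continuous_on_const)
 moreover have "bounded S" by (rule bounded_subset[of "cball 0 R"]) (auto simp: S_def)
 ultimately have "compact S" by (simp add: compact_eq_bounded_closed)
 moreover have RS: "R : S" "- R : S" using R(1) d by (auto simp: S_def)
 ultimately obtain s0 where s0: "s0 : S" "!!s. s : S ==> W s0 <= W s"
  using continuous_attains_inf[of S W] continuous_on_subset[OF D(6)] by blast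
 define \<mu> where "\<mu> = W s0"
 have \<mu>: "\<mu> > 0"
 proof -
  have "s0 ~= 1 \<and> s0 ~= -1" using s0(1) d by (auto simp: S_def)
  then have "W s0 ~= 0" using D(9) by blast
  then show ?thesis using D(1)[of s0] by (simp add: \<mu>_def)
 qed
 define c where "c = min (min k1 k2) (min 1 (\<mu> / (R + 1)))"
 have c: "c > 0" "c <= k1" "c <= k2" "c <= 1" "c * (R + 1) <= \<mu>"
 proof -
  show "c > 0" using 1 2 \<mu> R(1) by (simp add: c_def)
  show "c <= k1" "c <= k2" "c <= 1" by (auto simp: c_def)
  have "c <= \<mu> / (R + 1)" by (simp add: c_def)
  then show "c * (R + 1) <= \<mu>" using R(1) by (simp add: field_simps)
 qed
 show thesis
 proof (rule that[OF c(1)])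
  fix s :: real
  let ?m = "min ((\<bar>s\<bar> - 1)\<^sup>2) \<bar>\<bar>s\<bar> - 1\<bar>"
  consider "\<bar>s\<bar> > R" | "s : S" | "\<bar>\<bar>s\<bar> - 1\<bar> < d" by (fastforce simp: S_def)
  then show "c * ?m <= W s"
  proof cases
   case 1
   have "\<bar>\<bar>s\<bar> - 1\<bar> = (\<bar>s\<bar> - R) + (R - 1)" using 1 R(1) by auto
   then have "c * ?m <= c * ((\<bar>s\<bar> - R) + (R - 1))" using c by (intro mult_left_mono) auto
   also have "... = c * (\<bar>s\<bar> - R) + c * (R - 1)" by (rule distrib_left)
   also have "... <= 1 * (\<bar>s\<bar> - R) + \<mu>"
   proof (rule add_mono)
    show "c * (\<bar>s\<bar> - R) <= 1 * (\<bar>s\<bar> - R)" using 1 c by (intro mult_right_mono) auto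
    have "c * (R - 1) <= c * (R + 1)" using c by (intro mult_left_mono) auto
    then show "c * (R - 1) <= \<mu>" using c(5) by linarith
   qed
   also have "... <= W s"
    using right[of s] left[of "- s"] 1 s0(2)[OF RS(1)] s0(2)[OF RS(2)]
    by (cases "s >= 0") (auto simp: \<mu>_def)
   finally show ?thesis .
  next
   case 2
   then have "\<bar>\<bar>s\<bar> - 1\<bar> <= R + 1" by (auto simp: S_def)
   then have "c * ?m <= c * (R + 1)" using c by (intro mult_left_mono) auto
   then show ?thesis using c(5) s0(2)[OF 2] by (simp add: \<mu>_def)
  next
   case 3
   have e: "c * ?m <= c * (\<bar>s\<bar> - 1)\<^sup>2" using c by (intro mult_left_mono) auto
   show ?thesis
   proof (cases "s >= 0")
    case True
    then have "\<bar>s - 1\<bar> < d1" using 3 d by auto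
    from 1(3)[OF this] have "k1 * (s - 1)\<^sup>2 <= W s" .
    moreover have "c * (\<bar>s\<bar> - 1)\<^sup>2 <= k1 * (s - 1)\<^sup>2" using True c by (intro mult_mono) auto
    ultimately show ?thesis using e by linarith
   next
    case False
    then have "\<bar>s - (-1)\<bar> < d2" using 3 d by auto
    from 2(3)[OF this] have "k2 * (s - (-1))\<^sup>2 <= W s" .
    moreover have "(\<bar>s\<bar> - 1)\<^sup>2 = (s - (-1))\<^sup>2" using False by (simp add: power2_eq_square algebra_simps)
    then have "c * (\<bar>s\<bar> - 1)\<^sup>2 <= k2 * (s - (-1))\<^sup>2" using c by (simp add: mult_right_mono)
    ultimately show ?thesis using e by linarith
   qed
  qed
 qed
qed

text \<open>The optimal weight \<open>sqrt (2 W)\<close> is lowered by \<open>de\<close>, which frees a multiple of \<open>||v| - 1|\<close> in the energy at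
a cost of order \<open>ep\<close> when \<open>de\<close> is of order \<open>ep\<close>. The cut-off at 0 keeps it a weight.\<close>

definition level_weight :: "(real => real) => real => real => real" where
 "level_weight W de s = max 0 (sqrt (2 * W (max (-1) (min 1 s))) - de)"

lemma level_weight_uniformly_continuous:
 assumes "continuous_on UNIV W"
 shows "uniformly_continuous_on UNIV (level_weight W de)"
proof -
 have "continuous_on {-1..1} (%s. max 0 (sqrt (2 * W s) - de))"
  by (intro continuous_on_max continuous_on_const continuous_on_diff continuous_on_real_sqrt
    continuous_on_mult_left continuous_on_subset[OF assms]) auto
 then have u: "uniformly_continuous_on {-1..1} (%s. max 0 (sqrt (2 * W s) - de))"
  by (intro compact_uniformly_continuous) auto
 show ?thesis
  unfolding uniformly_continuous_on_def dist_real_def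
 proof (intro allI impI)
  fix e :: real assume "e > 0"
  then obtain d where d: "d > 0" "!!x x'. x : {-1..1} ==> x' : {-1..1} ==> \<bar>x' - x\<bar> < d ==>
    \<bar>max 0 (sqrt (2 * W x') - de) - max 0 (sqrt (2 * W x) - de)\<bar> < e"
   using u unfolding uniformly_continuous_on_def dist_real_def by metis
  show "\<exists>d>0. \<forall>x\<in>UNIV. \<forall>x'\<in>UNIV. \<bar>x' - x\<bar> < d --> \<bar>level_weight W de x' - level_weight W de x\<bar> < e"
  proof (intro exI[of _ d] conjI ballI impI d(1))
   fix x x' :: real assume x: "\<bar>x' - x\<bar> < d"
   have cl: "max (-1) (min 1 y) : {-1..1}" for y :: real by auto
   have "\<bar>max (-1) (min 1 x') - max (-1) (min 1 x)\<bar> <= \<bar>x' - x\<bar>" by auto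
   then have "\<bar>max (-1) (min 1 x') - max (-1) (min 1 x)\<bar> < d" using x by (rule le_less_trans)
   then show "\<bar>level_weight W de x' - level_weight W de x\<bar> < e"
    unfolding level_weight_def by (intro d(2) cl)
  qed
 qed
qed

lemma level_weight_bounds:
 shows "0 <= level_weight W de s"
  and "W 1 = 0 ==> W (-1) = 0 ==> 0 <= de ==> s \<notin> {-1..1} ==> level_weight W de s = 0"
  and "s : {-1..1} ==> sqrt (2 * W s) - de <= level_weight W de s"
  and "s : {-1..1} ==> W s >= 0 ==> 0 <= de ==> level_weight W de s <= sqrt (2 * W s)"
proof -
 show "0 <= level_weight W de s" by (simp add: level_weight_def)
 have clamp: "level_weight W de s = max 0 (sqrt (2 * W s) - de)" if "s : {-1..1}"
  using that by (simp add: level_weight_def)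
 show "sqrt (2 * W s) - de <= level_weight W de s" if "s : {-1..1}"
  using clamp[OF that] by simp
 show "level_weight W de s <= sqrt (2 * W s)" if "s : {-1..1}" "W s >= 0" "0 <= de"
  using clamp[OF that(1)] that by simp
 show "level_weight W de s = 0" if "W 1 = 0" "W (-1) = 0" "0 <= de" "s \<notin> {-1..1}"
 proof -
  have "max (-1) (min 1 s) = 1 \<or> max (-1) (min 1 s) = -1" using that(4) by auto
  then have "W (max (-1) (min 1 s)) = 0" using that(1,2) by (elim disjE) simp_all
  then show ?thesis using that(3) by (simp add: level_weight_def)
 qed
qed

text \<open>Young's inequality with the lowered weight. Where \<open>|s| > 1\<close> the weight vanishes and the whole gradient
term survives; it is what later controls the initial data in \<open>L\<^sup>2\<close>.\<close>

lemma modica_mortola_pointwise: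
 assumes c: "c > 0" "!!s. c * min ((\<bar>s\<bar> - 1)\<^sup>2) \<bar>\<bar>s\<bar> - 1\<bar> <= W s" and W: "!!s. W s >= 0" "W 1 = 0" "W (-1) = 0"
  and K: "K >= 0" and ep: "0 < ep" "ep * K <= c" and p: "p >= 0"
 shows "level_weight W (K / sqrt (2 * c) * ep) s * p + (if \<bar>s\<bar> > 1 then ep / 2 * p\<^sup>2 else 0) + K * \<bar>\<bar>s\<bar> - 1\<bar>
  <= W s / ep + ep / 2 * p\<^sup>2 + K\<^sup>2 / (2 * c) * ep"
proof -
 define C where "C = K / sqrt (2 * c)"
 define d where "d = \<bar>\<bar>s\<bar> - 1\<bar>"
 have d0: "d >= 0" "(\<bar>s\<bar> - 1)\<^sup>2 = d\<^sup>2" by (auto simp: d_def)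
 have C: "C >= 0" "C * sqrt (2 * c) = K" "C\<^sup>2 = K\<^sup>2 / (2 * c)"
  using K c(1) by (auto simp: C_def power_divide)
 have sc: "sqrt (2 * c) > 0" using c(1) by simp
 show ?thesis
 proof (cases "\<bar>s\<bar> > 1")
  case True
  have w: "level_weight W (C * ep) s = 0" using True ep C W by (intro level_weight_bounds(2)) auto
  have "K * d <= W s / ep + K\<^sup>2 / (2 * c) * ep"
  proof (cases "d <= 1")
   case True
   then have "d\<^sup>2 <= d" using d0 by (simp add: power2_eq_square mult_left_le)
   then have "c * d\<^sup>2 <= W s" using c(2)[of s] d0(2) by (simp add: d_def[symmetric] min_def)
   then have 1: "c * d\<^sup>2 / ep <= W s / ep" using ep by (simp add: divide_right_mono)
   have "0 <= c / ep * (d - K * ep / (2 * c))\<^sup>2" using c(1) ep by simp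
   also have "... = c * d\<^sup>2 / ep - K * d + K\<^sup>2 / (4 * c) * ep"
    using c(1) ep by (simp add: power2_diff power_divide power_mult_distrib field_simps) (simp add: power2_eq_square algebra_simps)
   finally have "K * d <= c * d\<^sup>2 / ep + K\<^sup>2 / (4 * c) * ep" by simp
   moreover have "K\<^sup>2 / (4 * c) * ep <= K\<^sup>2 / (2 * c) * ep"
    using c(1) ep by (intro mult_right_mono divide_left_mono) auto
   ultimately show ?thesis using 1 by linarith
  next
   case False
   then have "d <= d\<^sup>2" by (simp add: power2_eq_square)
   then have "c * d <= W s" using c(2)[of s] d0(2) by (simp add: d_def[symmetric] min_absorb2)
   then have "c * d / ep <= W s / ep" using ep by (simp add: divide_right_mono)
   moreover have "K * d <= c * d / ep"
    using mult_right_mono[OF ep(2) d0(1)] ep(1) by (simp add: field_simps)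
   moreover have "0 <= K\<^sup>2 / (2 * c) * ep" using c(1) ep by simp
   ultimately show ?thesis by linarith
  qed
  then show ?thesis using w True by (simp add: C_def d_def)
 next
  case False
  then have s1: "s : {-1..1}" by auto
  have d1: "d <= 1" using False by (auto simp: d_def)
  then have "d\<^sup>2 <= d" using d0 by (simp add: power2_eq_square mult_left_le)
  then have cW: "c * d\<^sup>2 <= W s" using c(2)[of s] d0(2) by (simp add: d_def[symmetric] min_def)
  define q where "q = sqrt (2 * W s)"
  have q: "q >= 0" "q\<^sup>2 = 2 * W s" using W(1)[of s] by (auto simp: q_def)
  have dq: "sqrt (2 * c) * d <= q"
  proof (rule power2_le_imp_le)
   show "(sqrt (2 * c) * d)\<^sup>2 <= q\<^sup>2" using cW c(1) q by (simp add: power_mult_distrib)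
  qed (use q in auto)
  then have Kd: "K * d <= C * q"
   using mult_left_mono[OF dq C(1)] C(2) by (simp add: mult.assoc[symmetric])
  define a where "a = max 0 (q - C * ep)"
  have "0 <= (ep * p - a)\<^sup>2 / (2 * ep)" using ep by simp
  also have "... = ep / 2 * p\<^sup>2 - a * p + a\<^sup>2 / (2 * ep)"
   using ep by (simp add: power2_diff power_mult_distrib field_simps) (simp add: power2_eq_square algebra_simps)
  finally have ap: "a * p <= ep / 2 * p\<^sup>2 + a\<^sup>2 / (2 * ep)" by simp
  have "a\<^sup>2 / (2 * ep) + C * q <= W s / ep + C\<^sup>2 * ep"
  proof -
   have "a\<^sup>2 + 2 * C * ep * q <= q\<^sup>2 + 2 * C\<^sup>2 * ep\<^sup>2"
   proof (cases "q >= C * ep")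
    case True
    then have "a\<^sup>2 = q\<^sup>2 - 2 * C * ep * q + C\<^sup>2 * ep\<^sup>2"
     by (simp add: a_def power2_eq_square algebra_simps)
    then show ?thesis by simp
   next
    case False
    have "C * ep * q <= C * ep * (C * ep)" using False C(1) ep by (intro mult_left_mono) auto
    then have "2 * C * ep * q <= 2 * C\<^sup>2 * ep\<^sup>2" by (simp add: power2_eq_square mult_ac)
    moreover have "a = 0" using False by (simp add: a_def)
    ultimately have "a\<^sup>2 + 2 * C * ep * q <= 0 + 2 * C\<^sup>2 * ep\<^sup>2" by simp
    also have "... <= q\<^sup>2 + 2 * C\<^sup>2 * ep\<^sup>2" by (intro add_right_mono) simp
    finally show ?thesis .
   qed
   then have "(a\<^sup>2 + 2 * C * ep * q) / (2 * ep) <= (2 * W s + 2 * C\<^sup>2 * ep\<^sup>2) / (2 * ep)"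
    using ep q(2) by (intro divide_right_mono) auto
   then show ?thesis using ep by (simp add: add_divide_distrib power2_eq_square)
  qed
  then have "a * p + K * d <= W s / ep + ep / 2 * p\<^sup>2 + C\<^sup>2 * ep" using ap Kd by linarith
  moreover have "level_weight W (C * ep) s = a" unfolding level_weight_def a_def q_def using s1 by simp
  ultimately show ?thesis using False C(3) by (simp add: C_def d_def)
 qed
qed

section \<open>The lower bound for the energy\<close>

text \<open>For a function with values \<open>- 1\<close> and \<open>1\<close> all sublevel volumes equal \<open>r0\<close> by the mass constraint. In
general the layer cake formula bounds the integrated deviation by the distance of \<open>|v|\<close> from 1.\<close>

lemma sublevel_volume_deviation:
 fixes v :: "'a::euclidean_space => real"
 assumes U: "open U" "U : lmeasurable" "measure lebesgue U = 1"
  and v: "v : borel_measurable borel" "integrable lborel v"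
  and mass: "(LINT x|lborel. indicator U x * v x) = 1 - 2 * r0"
 defines "ro \<equiv> %s. measure lebesgue {x\<in>U. v x <= s}"
 shows "(\<integral>\<^sup>+s. ennreal \<bar>ro s - r0\<bar> * indicator {-1..1} s \<partial>lborel) <= ennreal (2 * (LINT x|lborel. indicator U x * \<bar>\<bar>v x\<bar> - 1\<bar>))"
  and "ro : borel_measurable borel"
proof -
 let ?E = "%s. {x\<in>U. v x <= s}"
 define D where "D = (LINT x|lborel. indicator U x * \<bar>\<bar>v x\<bar> - 1\<bar>)"
 have Ub: "U : sets borel" using U by auto
 note iU = lborel_indicator_integrable[OF U(1,2)]
 have Eb: "?E s : sets borel" for s
 proof -
  have "?E s = U \<inter> {x. v x <= s}" by auto
  also have "... \<in> sets borel" using U(1) v(1) by (intro sets.Int) auto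
  finally show ?thesis .
 qed
 have vi: "integrable lborel (%x. indicator U x * v x)"
  using integrable_real_mult_indicator[OF _ v(2), of U] Ub by (simp add: mult.commute)
 have iE: "integrable lborel (%x. indicator (?E s) x :: real)" for s
 proof (rule Bochner_Integration.integrable_bound[OF iU])
  show "AE x in lborel. norm (indicator (?E s) x :: real) <= norm (indicator U x :: real)"
   by (intro AE_I2) (auto simp: indicator_def)
 qed (use Eb in simp)
 have roi: "ro s = (LINT x|lborel. indicator (?E s) x)" for s
  using Eb by (simp add: ro_def)
 have one: "measure lborel U = 1" using Ub U(3) by simp
 have Di: "integrable lborel (%x. indicator U x * \<bar>\<bar>v x\<bar> - 1\<bar>)"
 proof (rule Bochner_Integration.integrable_bound)
  show "integrable lborel (%x. indicator U x + \<bar>indicator U x * v x\<bar>)" using iU vi by simp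
  show "AE x in lborel. norm (indicator U x * \<bar>\<bar>v x\<bar> - 1\<bar>) <= norm (indicator U x + \<bar>indicator U x * v x\<bar>)"
   by (intro AE_I2) (auto simp: indicator_def)
 qed (use Ub v(1) in simp)
 have D0: "D >= 0" unfolding D_def by (rule integral_nonneg_AE) simp
 have mono: "ro s <= ro t" if "s <= t" for s t
  unfolding roi by (rule integral_mono[OF iE iE]) (use that in \<open>auto simp: indicator_def\<close>)
 then show rom: "ro : borel_measurable borel" by (intro borel_measurable_mono monoI)
 have dev0: "2 * \<bar>ro 0 - r0\<bar> <= D"
 proof -
  have "2 * (r0 - ro 0) = (LINT x|lborel. indicator U x - 2 * indicator (?E 0) x - indicator U x * v x)"
   using iU iE vi by (simp add: mass one roi)
  then have "\<bar>2 * (r0 - ro 0)\<bar> <= (LINT x|lborel. \<bar>indicator U x - 2 * indicator (?E 0) x - indicator U x * v x\<bar>)"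
   using integral_norm_bound[of lborel "%x. indicator U x - 2 * indicator (?E 0) x - indicator U x * v x"] by simp
  also have "... <= D" unfolding D_def
  proof (rule integral_mono[OF _ Di])
   show "integrable lborel (%x. \<bar>indicator U x - 2 * indicator (?E 0) x - indicator U x * v x\<bar>)"
    using iU iE vi by simp
  qed (auto simp: indicator_def)
  finally show ?thesis by (simp only: abs_mult abs_minus_commute[of "ro 0"] abs_numeral)
 qed
 have dev: "ennreal \<bar>ro s - ro 0\<bar> <= (\<integral>\<^sup>+x. ennreal (indicator U x * \<bar>indicator {..s} (v x) - indicator {..0} (v x)\<bar>) \<partial>lborel)" for s
 proof -
  have e: "indicator (?E s) x - indicator (?E 0) x = (indicator U x * (indicator {..s} (v x) - indicator {..0} (v x)) :: real)" for x
   by (auto simp: indicator_def)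
  have i: "integrable lborel (%x. indicator U x * (indicator {..s} (v x) - indicator {..0} (v x)) :: real)"
   unfolding e[symmetric] using iE by simp
  have "ro s - ro 0 = (LINT x|lborel. indicator U x * (indicator {..s} (v x) - indicator {..0} (v x)))"
   unfolding e[symmetric] roi using iE by simp
  then have "ennreal \<bar>ro s - ro 0\<bar> <= (\<integral>\<^sup>+x. ennreal (norm (indicator U x * (indicator {..s} (v x) - indicator {..0} (v x)) :: real)) \<partial>lborel)"
   using integral_norm_bound_ennreal[OF i] by simp
  then show ?thesis by (simp add: abs_mult)
 qed
 have col: "(\<integral>\<^sup>+s. ennreal \<bar>indicator {..s} t - indicator {..0} t\<bar> * indicator {-1..1} s \<partial>lborel) <= ennreal \<bar>\<bar>t\<bar> - 1\<bar>" for t :: real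
 proof (cases "t <= 0")
  case True
  have "(\<integral>\<^sup>+s. ennreal \<bar>indicator {..s} t - indicator {..0} t\<bar> * indicator {-1..1} s \<partial>lborel) <= (\<integral>\<^sup>+s. indicator {-1..t} s \<partial>lborel)"
   using True by (intro nn_integral_mono) (auto simp: indicator_def)
  also have "... <= ennreal \<bar>\<bar>t\<bar> - 1\<bar>"
   using True by (cases "-1 <= t") (auto intro!: ennreal_leI)
  finally show ?thesis .
 next
  case False
  have "(\<integral>\<^sup>+s. ennreal \<bar>indicator {..s} t - indicator {..0} t\<bar> * indicator {-1..1} s \<partial>lborel) <= (\<integral>\<^sup>+s. indicator {t..1} s \<partial>lborel)"
   using False by (intro nn_integral_mono) (auto simp: indicator_def)
  also have "... <= ennreal \<bar>\<bar>t\<bar> - 1\<bar>"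
   using False by (cases "t <= 1") (auto intro!: ennreal_leI)
  finally show ?thesis .
 qed
 have vs: "(%p::real \<times> 'a. v (snd p)) : borel_measurable (lborel \<Otimes>\<^sub>M lborel)"
  using measurable_compose[OF measurable_snd, of v lborel borel lborel] v(1) by simp
 have fs: "(%p::real \<times> 'a. fst p) : borel_measurable (lborel \<Otimes>\<^sub>M lborel)"
  using measurable_fst'[of id] by auto
 have pm: "(%p::real \<times> 'a. indicator {..fst p} (v (snd p)) :: real) : borel_measurable (lborel \<Otimes>\<^sub>M lborel)"
 proof -
  have "(%p::real \<times> 'a. indicator {..fst p} (v (snd p)) :: real) = indicator {p \<in> space (lborel \<Otimes>\<^sub>M lborel). v (snd p) <= fst p}"
   by (auto simp: indicator_def space_pair_measure)
  moreover have "{p \<in> space (lborel \<Otimes>\<^sub>M lborel). v (snd p) <= fst p} \<in> sets (lborel \<Otimes>\<^sub>M lborel)"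
   using vs fs by (rule borel_measurable_le)
  ultimately show ?thesis by simp
 qed
 have jm: "(%(s, x). ennreal (indicator U x * \<bar>indicator {..s} (v x) - indicator {..0} (v x)\<bar>) * indicator {-1..1::real} s)
   \<in> borel_measurable (lborel \<Otimes>\<^sub>M lborel)"
 proof -
  have "(%p::real \<times> 'a. indicator U (snd p) :: real) : borel_measurable (lborel \<Otimes>\<^sub>M lborel)"
   using measurable_compose[OF measurable_snd, of "indicator U :: 'a => real" lborel borel lborel] Ub by simp
  moreover have "(%p::real \<times> 'a. indicator {..0} (v (snd p)) :: real) : borel_measurable (lborel \<Otimes>\<^sub>M lborel)"
   by (rule measurable_compose[OF vs]) simp
  moreover have "(%p::real \<times> 'a. indicator {-1..1} (fst p) :: ennreal) : borel_measurable (lborel \<Otimes>\<^sub>M lborel)"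
   by (rule measurable_compose[OF fs]) simp
  ultimately show ?thesis using pm by (simp add: case_prod_beta)
 qed
 have "(\<integral>\<^sup>+s. ennreal \<bar>ro s - ro 0\<bar> * indicator {-1..1} s \<partial>lborel)
  <= (\<integral>\<^sup>+s. (\<integral>\<^sup>+x. ennreal (indicator U x * \<bar>indicator {..s} (v x) - indicator {..0} (v x)\<bar>) \<partial>lborel) * indicator {-1..1} s \<partial>lborel)"
  by (intro nn_integral_mono mult_right_mono dev) simp
 also have "... = (\<integral>\<^sup>+s. (\<integral>\<^sup>+x. ennreal (indicator U x * \<bar>indicator {..s} (v x) - indicator {..0} (v x)\<bar>) * indicator {-1..1} s \<partial>lborel) \<partial>lborel)"
  by (intro nn_integral_cong) (simp add: indicator_def)
 also have "... = (\<integral>\<^sup>+x. (\<integral>\<^sup>+s. ennreal (indicator U x * \<bar>indicator {..s} (v x) - indicator {..0} (v x)\<bar>) * indicator {-1..1} s \<partial>lborel) \<partial>lborel)"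
  by (rule lborel_pair.Fubini'[symmetric, OF jm])
 also have "... <= (\<integral>\<^sup>+x. ennreal (indicator U x * \<bar>\<bar>v x\<bar> - 1\<bar>) \<partial>lborel)"
 proof (rule nn_integral_mono)
  fix x
  show "(\<integral>\<^sup>+s. ennreal (indicator U x * \<bar>indicator {..s} (v x) - indicator {..0} (v x)\<bar>) * indicator {-1..1} s \<partial>lborel) <= ennreal (indicator U x * \<bar>\<bar>v x\<bar> - 1\<bar>)"
   using col[of "v x"] by (cases "x : U") auto
 qed
 also have "... = ennreal D" unfolding D_def using Di by (intro nn_integral_eq_integral) auto
 finally have A: "(\<integral>\<^sup>+s. ennreal \<bar>ro s - ro 0\<bar> * indicator {-1..1} s \<partial>lborel) <= ennreal D" .
 have "(\<integral>\<^sup>+s. ennreal \<bar>ro s - r0\<bar> * indicator {-1..1} s \<partial>lborel)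
   <= (\<integral>\<^sup>+s. ennreal \<bar>ro s - ro 0\<bar> * indicator {-1..1} s + ennreal (D / 2) * indicator {-1..1} s \<partial>lborel)"
 proof (rule nn_integral_mono)
  fix s :: real
  have le: "\<bar>ro s - r0\<bar> <= \<bar>ro s - ro 0\<bar> + D / 2"
   using dev0 abs_triangle_ineq[of "ro s - ro 0" "ro 0 - r0"] by simp
  then have "ennreal \<bar>ro s - r0\<bar> <= ennreal \<bar>ro s - ro 0\<bar> + ennreal (D / 2)"
   using ennreal_leI[OF le] D0 by simp
  then show "ennreal \<bar>ro s - r0\<bar> * indicator {-1..1} s <= ennreal \<bar>ro s - ro 0\<bar> * indicator {-1..1} s + ennreal (D / 2) * indicator {-1..1} s"
   by (simp add: indicator_def)
 qed
 also have "... = (\<integral>\<^sup>+s. ennreal \<bar>ro s - ro 0\<bar> * indicator {-1..1} s \<partial>lborel) + (\<integral>\<^sup>+s. ennreal (D / 2) * indicator {-1..1::real} s \<partial>lborel)"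
  using rom by (intro nn_integral_add) auto
 also have "(\<integral>\<^sup>+s. ennreal (D / 2) * indicator {-1..1::real} s \<partial>lborel) = ennreal D"
 proof -
  have "(\<integral>\<^sup>+s. ennreal (D / 2) * indicator {-1..1::real} s \<partial>lborel) = ennreal (D / 2) * ennreal 2"
   by (subst nn_integral_cmult_indicator) auto
  also have "... = ennreal (D / 2 * 2)" using D0 by (subst ennreal_mult) auto
  finally show ?thesis by simp
 qed
 finally have "(\<integral>\<^sup>+s. ennreal \<bar>ro s - r0\<bar> * indicator {-1..1} s \<partial>lborel) <= ennreal D + ennreal D"
  using A by (meson add_right_mono order_trans)
 also have "... = ennreal (2 * D)" using D0 by (simp add: ennreal_plus[symmetric] del: ennreal_plus)
 finally show "(\<integral>\<^sup>+s. ennreal \<bar>ro s - r0\<bar> * indicator {-1..1} s \<partial>lborel) <= ennreal (2 * (LINT x|lborel. indicator U x * \<bar>\<bar>v x\<bar> - 1\<bar>))"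
  unfolding D_def .
qed

lemma borel_energy_lower_bound:
 fixes v :: "'a::euclidean_space => real"
 assumes bv: "borel_H1 U v h" and U: "open U" "U : lmeasurable" "measure lebesgue U = 1"
  and W: "admissible_potential W"
  and c: "c > 0" "!!s. c * min ((\<bar>s\<bar> - 1)\<^sup>2) \<bar>\<bar>s\<bar> - 1\<bar> <= W s"
  and lip: "!!r. ennreal (I0 - L * \<bar>r - r0\<bar>) <= isoperimetric U r" "L >= 0" "I0 >= 0"
  and Bw: "!!s. s : {-1..1} ==> sqrt (2 * W s) <= Bw" "Bw >= 0"
  and K: "K = 2 * L * Bw" and ep: "0 < ep" "ep * K <= c"
  and mass: "(LINT x|lborel. indicator U x * v x) = 1 - 2 * r0"
  and Wi: "integrable (leb U) (%x. W (v x))"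
 shows "sqrt 2 * c_W W * I0 + ep / 2 * (LINT x|leb U. (if \<bar>v x\<bar> > 1 then (norm (h x))\<^sup>2 else 0))
  <= (LINT x|leb U. W (v x) / ep + ep / 2 * (norm (h x))\<^sup>2) + (2 * (K / sqrt (2 * c)) * I0 + K\<^sup>2 / (2 * c)) * ep"
proof -
 note B = borel_H1D[OF bv U(2)] and P = admissible_potentialD[OF W]
 have Us: "U : sets lebesgue" and Ub: "U : sets borel" using U by auto
 interpret finite_measure "leb U" by (rule lebesgue_on_finite[OF U(2)])
 have K0: "K >= 0" using K lip Bw by simp
 define de where "de = K / sqrt (2 * c) * ep"
 have de0: "de >= 0" using K0 c ep by (simp add: de_def)
 let ?w = "level_weight W de"
 define ro where "ro s = measure lebesgue {x\<in>U. v x <= s}" for s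
 define D where "D = (LINT x|lborel. indicator U x * \<bar>\<bar>v x\<bar> - 1\<bar>)"
 note dev = sublevel_volume_deviation[OF U B(1) B(8) mass, folded ro_def D_def]
 have wu: "uniformly_continuous_on UNIV ?w" by (rule level_weight_uniformly_continuous[OF P(6)])
 have wm: "?w : borel_measurable borel"
  using uniformly_continuous_imp_continuous[OF wu] by (rule borel_measurable_continuous_onI)
 have w0: "0 <= ?w s" for s by (rule level_weight_bounds(1))
 have wz: "?w s = 0" if "s \<notin> {-1..1}" for s by (rule level_weight_bounds(2)[OF P(7,8) de0 that])
 have wB: "?w s <= Bw" for s
 proof (cases "s : {-1..1}")
  case True
  then have "?w s <= sqrt (2 * W s)" using P(1) de0 by (intro level_weight_bounds(4)) auto
  then show ?thesis using Bw(1)[OF True] by (rule order_trans)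
 qed (use wz Bw(2) in simp)
 have wB': "\<bar>?w s\<bar> <= Bw" for s using wB[of s] w0[of s] by simp
 have wvm: "(%x. ?w (v x)) : borel_measurable borel" by (rule measurable_compose[OF B(1) wm])
 have nh: "integrable lborel (%x. norm (h x))" using B(9) by simp
 have Ji: "integrable lborel (%x. ?w (v x) * norm (h x))"
  using lborel_bounded_mult_integrable[OF nh wvm wB'] by (simp add: mult.commute)
 define J where "J = (LINT x|lborel. ?w (v x) * norm (h x))"
 have J0: "J >= 0" unfolding J_def using w0 by (intro integral_nonneg_AE) simp
 define \<beta> where "\<beta> s = \<bar>ro s - r0\<bar> * indicator {-1..1} s" for s
 have \<beta>m: "\<beta> \<in> borel_measurable borel" using dev(2) by (simp add: \<beta>_def[abs_def])
 have D0: "D >= 0" unfolding D_def by (rule integral_nonneg_AE) simp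
 have \<beta>n: "(\<integral>\<^sup>+s. ennreal (\<beta> s) \<partial>lborel) <= ennreal (2 * D)"
 proof -
  have "(\<integral>\<^sup>+s. ennreal (\<beta> s) \<partial>lborel) = (\<integral>\<^sup>+s. ennreal \<bar>ro s - r0\<bar> * indicator {-1..1} s \<partial>lborel)"
   by (intro nn_integral_cong) (simp add: \<beta>_def indicator_def)
  then show ?thesis using dev(1) by simp
 qed
 have \<beta>0: "\<beta> s >= 0" for s by (simp add: \<beta>_def)
 have \<beta>i: "integrable lborel \<beta>"
  using \<beta>m \<beta>n \<beta>0 by (intro integrableI_bounded) (auto simp: le_less_trans)
 have I\<beta>: "(LINT s|lborel. \<beta> s) <= 2 * D"
 proof -
  have "ennreal (LINT s|lborel. \<beta> s) <= ennreal (2 * D)"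
   using \<beta>n nn_integral_eq_integral[OF \<beta>i] \<beta>0 by simp
  then show ?thesis using D0 by (simp add: ennreal_le_iff)
 qed
 have w_le: "\<bar>?w s\<bar> <= Bw * indicator {-1..1} s" for s
  using wB'[of s] wz[of s] by (auto simp: indicator_def)
 have wi: "integrable lborel ?w"
 proof (rule Bochner_Integration.integrable_bound)
  show "integrable lborel (%s. Bw * indicator {-1..1::real} s)" by simp
  show "AE s in lborel. norm (?w s) <= norm (Bw * indicator {-1..1::real} s)"
   using w_le Bw(2) by (intro AE_I2) (simp add: abs_mult)
 qed (use wm in simp)
 have w\<beta>: "integrable lborel (%s. ?w s * \<beta> s)" "(LINT s|lborel. ?w s * \<beta> s) <= Bw * (2 * D)"
 proof -
  show i: "integrable lborel (%s. ?w s * \<beta> s)"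
   using lborel_bounded_mult_integrable[OF \<beta>i wm wB'] by (simp add: mult.commute)
  have "(LINT s|lborel. ?w s * \<beta> s) <= (LINT s|lborel. Bw * \<beta> s)"
   using i \<beta>i wB \<beta>0 by (intro integral_mono mult_right_mono) auto
  also have "... <= Bw * (2 * D)" using I\<beta> Bw(2) by (simp add: mult_left_mono)
  finally show "(LINT s|lborel. ?w s * \<beta> s) <= Bw * (2 * D)" .
 qed
 have fw: "?w s * (I0 - L * \<bar>ro s - r0\<bar>) = I0 * ?w s - L * (?w s * \<beta> s)" for s
  using wz[of s] by (cases "s : {-1..1}") (auto simp: \<beta>_def algebra_simps)
 have fi: "integrable lborel (%s. ?w s * (I0 - L * \<bar>ro s - r0\<bar>))"
  unfolding fw using wi w\<beta>(1) by simp
 have "ennreal (LINT s|lborel. ?w s * (I0 - L * \<bar>ro s - r0\<bar>)) <= (\<integral>\<^sup>+s. ennreal (?w s * (I0 - L * \<bar>ro s - r0\<bar>)) \<partial>lborel)"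
 proof -
  have mi: "integrable lborel (%s. max 0 (?w s * (I0 - L * \<bar>ro s - r0\<bar>)))"
   using fi by simp
  have "(LINT s|lborel. ?w s * (I0 - L * \<bar>ro s - r0\<bar>)) <= (LINT s|lborel. max 0 (?w s * (I0 - L * \<bar>ro s - r0\<bar>)))"
   using fi mi by (intro integral_mono) auto
  then have "ennreal (LINT s|lborel. ?w s * (I0 - L * \<bar>ro s - r0\<bar>)) <= ennreal (LINT s|lborel. max 0 (?w s * (I0 - L * \<bar>ro s - r0\<bar>)))"
   by (rule ennreal_leI)
  also have "... = (\<integral>\<^sup>+s. ennreal (max 0 (?w s * (I0 - L * \<bar>ro s - r0\<bar>))) \<partial>lborel)"
   using mi by (intro nn_integral_eq_integral[symmetric]) auto
  also have "... = (\<integral>\<^sup>+s. ennreal (?w s * (I0 - L * \<bar>ro s - r0\<bar>)) \<partial>lborel)"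
  proof (rule nn_integral_cong)
   have "ennreal (max 0 y) = ennreal y" for y :: real by (cases "y >= 0") (auto simp: ennreal_neg)
   then show "ennreal (max 0 (?w s * (I0 - L * \<bar>ro s - r0\<bar>))) = ennreal (?w s * (I0 - L * \<bar>ro s - r0\<bar>))" for s .
  qed
  finally show ?thesis .
 qed
 also have "... <= (\<integral>\<^sup>+s. ennreal (?w s) * rel_perimeter {x\<in>U. v x <= s} U \<partial>lborel)"
 proof (rule nn_integral_mono)
  fix s
  have Eb: "{x\<in>U. v x <= s} \<in> sets borel"
  proof -
   have "{x\<in>U. v x <= s} = U \<inter> {x. v x <= s}" by auto
   also have "... \<in> sets borel" using Ub B(1) by (intro sets.Int) auto
   finally show ?thesis .
  qed
  have "isoperimetric U (ro s) <= rel_perimeter {x\<in>U. v x <= s} U"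
   unfolding isoperimetric_def using Eb by (intro INF_lower) (auto simp: ro_def)
  with lip(1)[of "ro s"] have "ennreal (I0 - L * \<bar>ro s - r0\<bar>) <= rel_perimeter {x\<in>U. v x <= s} U"
   by (rule order_trans)
  then have "ennreal (?w s) * ennreal (I0 - L * \<bar>ro s - r0\<bar>) <= ennreal (?w s) * rel_perimeter {x\<in>U. v x <= s} U"
   by (intro mult_left_mono) auto
  then show "ennreal (?w s * (I0 - L * \<bar>ro s - r0\<bar>)) <= ennreal (?w s) * rel_perimeter {x\<in>U. v x <= s} U"
   using w0[of s] by (simp add: ennreal_mult')
 qed
 also have "... <= (\<integral>\<^sup>+x. ennreal (?w (v x) * norm (h x)) \<partial>lborel)"
  by (rule coarea_inequality[OF bv U(1,2) wu w0])
 also have "... = ennreal J"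
  unfolding J_def using Ji w0 by (intro nn_integral_eq_integral) auto
 finally have "(LINT s|lborel. ?w s * (I0 - L * \<bar>ro s - r0\<bar>)) <= J"
  using J0 by (simp add: ennreal_le_iff)
 then have lev: "I0 * (LINT s|lborel. ?w s) - L * (LINT s|lborel. ?w s * \<beta> s) <= J"
  unfolding fw using wi w\<beta>(1) by simp
 have cW: "sqrt 2 * c_W W - 2 * de <= (LINT s|lborel. ?w s)"
 proof -
  have "continuous_on {-1..1} (%s. sqrt (W s))"
   by (intro continuous_on_real_sqrt continuous_on_subset[OF P(6)]) auto
  then have si: "set_integrable lborel {-1..1} (%s. sqrt (W s))"
   by (rule borel_integrable_atLeastAtMost')
  have sw: "(LINT s|lborel. indicator {-1..1} s * sqrt (W s)) = c_W W"
   using set_borel_integral_eq_integral(2)[OF si] by (simp add: set_lebesgue_integral_def c_W_def)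
  have si': "integrable lborel (%s. indicator {-1..1} s * sqrt (W s))"
   using si by (simp add: set_integrable_def)
  have "sqrt 2 * c_W W - 2 * de = (LINT s|lborel. sqrt 2 * (indicator {-1..1} s * sqrt (W s)) - de * indicator {-1..1::real} s)"
   using si' sw by simp
  also have "... <= (LINT s|lborel. ?w s)"
  proof (rule integral_mono[OF _ wi])
   show "integrable lborel (%s. sqrt 2 * (indicator {-1..1} s * sqrt (W s)) - de * indicator {-1..1::real} s)"
    using si' by simp
   fix s :: real
   show "sqrt 2 * (indicator {-1..1} s * sqrt (W s)) - de * indicator {-1..1::real} s <= ?w s"
    using level_weight_bounds(3)[of s W de] w0[of s]
    by (cases "s : {-1..1}") (auto simp: real_sqrt_mult)
  qed
  finally show ?thesis .
 qed
 have J_low: "sqrt 2 * c_W W * I0 - 2 * de * I0 - K * D <= J"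
 proof -
  have "(sqrt 2 * c_W W - 2 * de) * I0 <= I0 * (LINT s|lborel. ?w s)"
   using mult_left_mono[OF cW lip(3)] by (simp add: mult.commute)
  moreover have "L * (LINT s|lborel. ?w s * \<beta> s) <= L * (Bw * (2 * D))"
   by (intro mult_left_mono w\<beta>(2) lip(2))
  moreover have "L * (Bw * (2 * D)) = K * D" by (simp add: K)
  moreover have "(sqrt 2 * c_W W - 2 * de) * I0 = sqrt 2 * c_W W * I0 - 2 * de * I0"
   by (rule left_diff_distrib)
  ultimately show ?thesis using lev by linarith
 qed
 have hL: "h : L2_space U" by (rule B(6))
 note Lm = borel_measurable_lebesgue_on
 have hi: "integrable (leb U) (%x. (norm (h x))\<^sup>2)" by (rule L2_integrable_square[OF hL])
 have vi: "integrable (leb U) v" by (rule L2_integrable[OF U(2) B(5)])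
 have JM: "(LINT x|leb U. ?w (v x) * norm (h x)) = J" "integrable (leb U) (%x. ?w (v x) * norm (h x))"
  using lebesgue_on_lborel[of "%x. ?w (v x) * norm (h x)" U] wvm B(2,4) Us Ji by (auto simp: J_def)
 have DM: "(LINT x|leb U. \<bar>\<bar>v x\<bar> - 1\<bar>) = D"
 proof -
  have "(LINT x|leb U. \<bar>\<bar>v x\<bar> - 1\<bar>) = (LINT x|leb U. indicator U x * \<bar>\<bar>v x\<bar> - 1\<bar>)"
   by (rule Bochner_Integration.integral_cong) auto
  also have "... = D" unfolding D_def using B(1) Ub by (intro lebesgue_on_lborel(1) Us) auto
  finally show ?thesis .
 qed
 have dM: "integrable (leb U) (%x. \<bar>\<bar>v x\<bar> - 1\<bar>)" using vi by simp
 define T where "T x = (if \<bar>v x\<bar> > 1 then (norm (h x))\<^sup>2 else 0)" for x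
 have Tm: "T : borel_measurable borel"
  unfolding T_def[abs_def] using B(1,2) by (intro measurable_If) auto
 have Ti: "integrable (leb U) T"
  by (rule Bochner_Integration.integrable_bound[OF hi]) (use Lm[OF Tm] in \<open>auto simp: T_def\<close>)
 have one: "measure (leb U) (space (leb U)) = 1"
  using U(3) Us by (simp add: measure_restrict_space)
 have "J + ep / 2 * (LINT x|leb U. T x) + K * D
   = (LINT x|leb U. ?w (v x) * norm (h x) + ep / 2 * T x + K * \<bar>\<bar>v x\<bar> - 1\<bar>)"
  using JM Ti dM DM by simp
 also have "... <= (LINT x|leb U. (W (v x) / ep + ep / 2 * (norm (h x))\<^sup>2) + K\<^sup>2 / (2 * c) * ep)"
 proof (rule integral_mono)
  show "integrable (leb U) (%x. ?w (v x) * norm (h x) + ep / 2 * T x + K * \<bar>\<bar>v x\<bar> - 1\<bar>)"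
   using JM Ti dM by simp
  show "integrable (leb U) (%x. (W (v x) / ep + ep / 2 * (norm (h x))\<^sup>2) + K\<^sup>2 / (2 * c) * ep)"
   using Wi hi by simp
  fix x
  show "?w (v x) * norm (h x) + ep / 2 * T x + K * \<bar>\<bar>v x\<bar> - 1\<bar> <= (W (v x) / ep + ep / 2 * (norm (h x))\<^sup>2) + K\<^sup>2 / (2 * c) * ep"
   using modica_mortola_pointwise[OF c P(1) P(7,8) K0 ep, of "norm (h x)" "v x"]
   by (simp add: T_def de_def if_distrib cong: if_cong)
 qed
 also have "... = (LINT x|leb U. W (v x) / ep + ep / 2 * (norm (h x))\<^sup>2) + K\<^sup>2 / (2 * c) * ep"
  using Wi hi one by simp
 finally show ?thesis using J_low unfolding T_def[abs_def] de_def by (simp add: algebra_simps)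
qed

text \<open>Integrate the pointwise inequality. The coarea inequality turns the weighted gradient into perimeters of sublevel
sets, the isoperimetric function bounds these from below, and the linear loss \<open>L |r - r0|\<close> is paid by the \<open>||v| - 1|\<close> term
that the lowered weight set free.\<close>

theorem energy_lower_bound:
 fixes U :: "'a::euclidean_space set"
 assumes U: "open U" "U : lmeasurable" "measure lebesgue U = 1"
  and W: "admissible_potential W"
  and lip: "!!r. ennreal (I0 - L * \<bar>r - r0\<bar>) <= isoperimetric U r" "L >= 0" "I0 >= 0"
 obtains C ep1 where "C > 0" "ep1 > 0"
  "!!ep u g. 0 < ep ==> ep < ep1 ==> u : L2_space U ==> has_weak_gradient U u g ==>
   (LINT x|leb U. u x) = 1 - 2 * r0 ==> integrable (leb U) (%x. W (u x)) ==>
   sqrt 2 * c_W W * I0 + ep / 2 * (LINT x|leb U. (if \<bar>u x\<bar> > 1 then (norm (g x))\<^sup>2 else 0))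
   <= (LINT x|leb U. W (u x) / ep + ep / 2 * (norm (g x))\<^sup>2) + C * ep"
proof -
 note P = admissible_potentialD[OF W]
 have Us: "U : sets lebesgue" and Ub: "U : sets borel" using U by auto
 obtain c where c: "c > 0" "!!s. c * min ((\<bar>s\<bar> - 1)\<^sup>2) \<bar>\<bar>s\<bar> - 1\<bar> <= W s"
  using potential_coercive[OF W] by blast
 have "continuous_on {-1..1} (%s. sqrt (2 * W s))"
  by (intro continuous_on_real_sqrt continuous_on_mult_left continuous_on_subset[OF P(6)]) auto
 then obtain s0 where "s0 : {-1..1::real}" "!!s. s : {-1..1} ==> sqrt (2 * W s) <= sqrt (2 * W s0)"
  using continuous_attains_sup[of "{-1..1::real}" "%s. sqrt (2 * W s)"] by auto
 then obtain Bw where Bw: "!!s. s : {-1..1} ==> sqrt (2 * W s) <= Bw" "Bw >= 0"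
  using P(1) by (metis mult_nonneg_nonneg real_sqrt_ge_zero zero_le_numeral)
 define K where "K = 2 * L * Bw"
 have K0: "K >= 0" using lip Bw by (simp add: K_def)
 define C where "C = 2 * (K / sqrt (2 * c)) * I0 + K\<^sup>2 / (2 * c) + 1"
 show thesis
 proof (rule that[of C "c / (K + 1)"])
  show "C > 0" using K0 c(1) lip(3) by (simp add: C_def add_nonneg_pos)
  show "c / (K + 1) > 0" using K0 c(1) by simp
  fix ep and u :: "'a => real" and g
  assume ep: "0 < ep" "ep < c / (K + 1)" and u: "u : L2_space U" "has_weak_gradient U u g"
   and mass: "(LINT x|leb U. u x) = 1 - 2 * r0" and Wi: "integrable (leb U) (%x. W (u x))"
  have epK: "ep * K <= c"
  proof -
   have "ep * (K + 1) < c" using ep(2) K0 by (simp add: field_simps)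
   then show ?thesis using ep(1) by (simp add: distrib_left)
  qed
  obtain v h where bv: "borel_H1 U v h" and uv: "AE x in leb U. u x = v x" and gh: "AE x in leb U. g x = h x"
   using borel_H1_representative[OF U(1) u] by blast
  note B = borel_H1D[OF bv U(2)]
  note g = has_weak_gradientD(1)[OF u(2)]
  note um = L2_measurable[OF u(1)] and gm = L2_measurable[OF g]
  note vm = borel_measurable_lebesgue_on[OF B(1), of U] borel_measurable_lebesgue_on[OF B(2), of U]
  have Wm: "W : borel_measurable borel" using P(6) by (rule borel_measurable_continuous_onI)
  have Wvm: "(%x. W (v x)) : borel_measurable (leb U)" "(%x. W (u x)) : borel_measurable (leb U)"
   using measurable_compose[OF vm(1) Wm] measurable_compose[OF um Wm] by auto
  have mass': "(LINT x|lborel. indicator U x * v x) = 1 - 2 * r0"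
  proof -
   have "(LINT x|lborel. indicator U x * v x) = (LINT x|lborel. v x)"
    by (rule Bochner_Integration.integral_cong) (use B(3) in \<open>auto simp: indicator_def\<close>)
   also have "... = (LINT x|leb U. v x)" using B(1,3) by (intro lebesgue_on_lborel(1)[symmetric] Us) auto
   also have "... = (LINT x|leb U. u x)"
    using uv um vm by (intro integral_cong_AE) (auto simp: eq_commute)
   finally show ?thesis using mass by simp
  qed
  have Wi': "integrable (leb U) (%x. W (v x))"
   by (rule integrable_cong_AE_imp[OF Wi Wvm(1)]) (use uv in eventually_elim, simp)
  have e1: "(LINT x|leb U. (if \<bar>u x\<bar> > 1 then (norm (g x))\<^sup>2 else 0)) = (LINT x|leb U. (if \<bar>v x\<bar> > 1 then (norm (h x))\<^sup>2 else 0))"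
  proof (rule integral_cong_AE)
   show "AE x in leb U. (if \<bar>u x\<bar> > 1 then (norm (g x))\<^sup>2 else 0) = (if \<bar>v x\<bar> > 1 then (norm (h x))\<^sup>2 else 0)"
    using uv gh by eventually_elim simp
  qed (use um gm vm in \<open>auto intro!: measurable_If\<close>)
  have e2: "(LINT x|leb U. W (u x) / ep + ep / 2 * (norm (g x))\<^sup>2) = (LINT x|leb U. W (v x) / ep + ep / 2 * (norm (h x))\<^sup>2)"
  proof (rule integral_cong_AE)
   show "AE x in leb U. W (u x) / ep + ep / 2 * (norm (g x))\<^sup>2 = W (v x) / ep + ep / 2 * (norm (h x))\<^sup>2"
    using uv gh by eventually_elim simp
  qed (use Wvm gm vm in auto)
  have "(2 * (K / sqrt (2 * c)) * I0 + K\<^sup>2 / (2 * c)) * ep <= C * ep"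
   using ep(1) by (intro mult_right_mono) (auto simp: C_def)
  with borel_energy_lower_bound[OF bv U W c lip Bw K_def ep(1) epK mass' Wi']
  show "sqrt 2 * c_W W * I0 + ep / 2 * (LINT x|leb U. (if \<bar>u x\<bar> > 1 then (norm (g x))\<^sup>2 else 0))
   <= (LINT x|leb U. W (u x) / ep + ep / 2 * (norm (g x))\<^sup>2) + C * ep"
   unfolding e1 e2 by linarith
 qed
qed

section \<open>An Ehrling inequality\<close>

lemma translated_product_integral:
 fixes v :: "'a::euclidean_space => real"
 assumes v: "v : borel_measurable borel" "integrable lborel v"
 shows "(\<integral>\<^sup>+y. (\<integral>\<^sup>+x. ennreal (\<bar>v x\<bar> * \<bar>v (x + y)\<bar>) \<partial>lborel) \<partial>lborel) = ennreal ((LINT x|lborel. \<bar>v x\<bar>)\<^sup>2)"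
proof -
 define N where "N = (LINT x|lborel. \<bar>v x\<bar>)"
 have N0: "N >= 0" unfolding N_def by (rule integral_nonneg_AE) simp
 have Nn: "(\<integral>\<^sup>+x. ennreal \<bar>v x\<bar> \<partial>lborel) = ennreal N"
  unfolding N_def using v(2) by (intro nn_integral_eq_integral) auto
 have vt: "(\<integral>\<^sup>+y. ennreal \<bar>v (x + y)\<bar> \<partial>lborel) = ennreal N" for x
 proof -
  have "(\<integral>\<^sup>+y. ennreal \<bar>v (x + y)\<bar> \<partial>lborel) = ennreal (LINT y|lborel. \<bar>v (x + y)\<bar>)"
   using translate_integral(2)[OF v(1), of x] v by (intro nn_integral_eq_integral) (auto simp: add.commute)
  also have "(LINT y|lborel. \<bar>v (x + y)\<bar>) = N"
   using translate_integral(1)[of "%y. \<bar>v y\<bar>" x] v(1) by (simp add: N_def add.commute)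
  finally show ?thesis .
 qed
 have "(%p::'a \<times> 'a. fst p + snd p) : borel_measurable borel"
  by (intro borel_measurable_continuous_onI continuous_on_add continuous_on_fst continuous_on_snd continuous_on_id)
 then have "(%p::'a \<times> 'a. v (fst p + snd p)) : borel_measurable (lborel \<Otimes>\<^sub>M lborel)"
  using measurable_compose[OF _ v(1)] by (simp add: lborel_prod)
 moreover have "(%p::'a \<times> 'a. v (fst p)) : borel_measurable (lborel \<Otimes>\<^sub>M lborel)"
  using measurable_compose[OF measurable_fst, of v lborel borel lborel] v(1) by simp
 ultimately have m: "(%(x, y). ennreal (\<bar>v x\<bar> * \<bar>v (x + y)\<bar>)) : borel_measurable (lborel \<Otimes>\<^sub>M lborel)"
  by (simp add: case_prod_beta)
 have "(\<integral>\<^sup>+y. (\<integral>\<^sup>+x. ennreal (\<bar>v x\<bar> * \<bar>v (x + y)\<bar>) \<partial>lborel) \<partial>lborel)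
   = (\<integral>\<^sup>+x. (\<integral>\<^sup>+y. ennreal (\<bar>v x\<bar> * \<bar>v (x + y)\<bar>) \<partial>lborel) \<partial>lborel)"
  by (rule lborel_pair.Fubini'[OF m])
 also have "... = (\<integral>\<^sup>+x. ennreal \<bar>v x\<bar> * ennreal N \<partial>lborel)"
 proof (rule nn_integral_cong)
  fix x
  have "(%y. v (x + y)) : borel_measurable borel" using v(1) by simp
  then show "(\<integral>\<^sup>+y. ennreal (\<bar>v x\<bar> * \<bar>v (x + y)\<bar>) \<partial>lborel) = ennreal \<bar>v x\<bar> * ennreal N"
   by (simp add: ennreal_mult nn_integral_cmult vt)
 qed
 also have "... = ennreal N * ennreal N"
  using v(1) Nn by (simp add: nn_integral_multc)
 also have "... = ennreal (N\<^sup>2)" using N0 by (simp add: ennreal_mult power2_eq_square)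
 finally show ?thesis unfolding N_def .
qed

text \<open>A quantitative form of compactness of the embedding of \<open>H\<^sup>1\<close> into \<open>L\<^sup>2\<close> near a set, which passes to
finite unions and so can be checked locally.\<close>

definition locally_compact_embedding :: "'a::euclidean_space set => 'a set => bool" where
 "locally_compact_embedding U V \<longleftrightarrow> (\<forall>de>0. \<exists>C\<ge>0. \<forall>v g. borel_H1 U v g -->
  (LINT x|lborel. indicator (V \<inter> U) x * (v x)\<^sup>2)
  <= de * (LINT x|lborel. (norm (g x))\<^sup>2) + C * (LINT x|lborel. \<bar>v x\<bar>)\<^sup>2)"

text \<open>Split \<open>v\<^sup>2\<close> into differences of translates, which are small by the translation estimate, and products of
translates. Averaged over small vectors, the products contribute at most a multiple of the squared \<open>L\<^sup>1\<close> norm.\<close>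

lemma compact_embedding_interior:
 fixes U :: "'a::euclidean_space set"
 assumes U: "open U" "U : lmeasurable" and K: "compact K" "K \<subseteq> U"
 shows "locally_compact_embedding U K"
 unfolding locally_compact_embedding_def
proof (intro allI impI)
 fix de :: real assume de: "de > 0"
 obtain e where e: "e > 0" "(\<Union>x\<in>K. ball x e) \<subseteq> U"
  using compact_subset_open_imp_ball_epsilon_subset[OF K(1) U(1) K(2)] by blast
 define ro where "ro = min (e / 2) (sqrt de)"
 have ro: "ro > 0" "ro <= e / 2" "ro\<^sup>2 <= de"
 proof -
  show "ro > 0" "ro <= e / 2" using e de by (auto simp: ro_def)
  then have "ro\<^sup>2 <= (sqrt de)\<^sup>2" by (intro power_mono) (auto simp: ro_def)
  then show "ro\<^sup>2 <= de" using de by simp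
 qed
 define A where "A = (\<Union>x\<in>K. ball x (e / 2))"
 have A: "open A" "K \<subseteq> A" using e(1) by (auto simp: A_def)
 have AU: "x + z : U" if xz: "x : A" "norm z <= ro" for x z
 proof -
  obtain k where k: "k : K" "dist k x < e / 2" using xz(1) by (auto simp: A_def)
  have "dist k (x + z) <= dist k x + norm z"
   using dist_triangle[of k "x + z" x] by (simp add: dist_norm)
  also have "... < e" using k(2) xz(2) ro(2) by linarith
  finally have "x + z : ball k e" by simp
  with e(2) k(1) show ?thesis by blast
 qed
 define b where "b = measure lborel (ball (0::'a) ro)"
 have b: "b > 0" "emeasure lborel (ball (0::'a) ro) = ennreal b"
 proof -
  have "emeasure lborel (ball (0::'a) ro) ~= \<infinity>"
   using emeasure_bounded_finite[OF bounded_ball[of "0::'a" ro]] by simp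
  then show "emeasure lborel (ball (0::'a) ro) = ennreal b"
   unfolding b_def by (intro emeasure_eq_ennreal_measure) simp
  show "b > 0" unfolding b_def using ro(1) by (rule content_ball_pos)
 qed
 show "\<exists>C\<ge>0. \<forall>v g. borel_H1 U v g -->
  (LINT x|lborel. indicator (K \<inter> U) x * (v x)\<^sup>2)
  <= de * (LINT x|lborel. (norm (g x))\<^sup>2) + C * (LINT x|lborel. \<bar>v x\<bar>)\<^sup>2"
 proof (intro exI[of _ "2 / b"] conjI allI impI)
  show "2 / b >= 0" using b by simp
  fix v :: "'a => real" and g assume bv: "borel_H1 U v g"
  note B = borel_H1D[OF bv U(2)]
  define G where "G = (LINT x|lborel. (norm (g x))\<^sup>2)"
  have G0: "G >= 0" unfolding G_def by (rule integral_nonneg_AE) simp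
  define N where "N = (LINT x|lborel. \<bar>v x\<bar>)"
  define S where "S = (LINT x|lborel. indicator K x * (v x)\<^sup>2)"
  have Kb: "K : sets borel" using K(1) by (simp add: compact_imp_closed)
  have Si: "integrable lborel (%x. indicator K x * (v x)\<^sup>2)"
   using integrable_real_mult_indicator[OF _ B(10), of K] Kb by (simp add: mult.commute)
  have one: "ennreal (S - ro\<^sup>2 * G) <= 2 * (\<integral>\<^sup>+x. ennreal (\<bar>v x\<bar> * \<bar>v (x + y)\<bar>) \<partial>lborel)" if y: "norm y <= ro" for y
  proof -
   have seg: "x + s *\<^sub>R y : U" if "x : A" "s : {0..1}" for x s
   proof (rule AU[OF that(1)])
    have "\<bar>s\<bar> * norm y <= 1 * norm y" using that(2) by (intro mult_right_mono) auto
    then show "norm (s *\<^sub>R y) <= ro" using y by simp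
   qed
   note T = translation_estimate[OF bv U A(1) seg]
   have vy: "(%x. v (x + y)) : borel_measurable borel" using B(1) by simp
   have vy2: "integrable lborel (%x. (v (x + y))\<^sup>2)"
    using translate_integral(2)[of "%x. (v x)\<^sup>2" y] B(1,10) by simp
   have vvi: "integrable lborel (%x. \<bar>v x\<bar> * \<bar>v (x + y)\<bar>)"
   proof (rule Bochner_Integration.integrable_bound)
    show "integrable lborel (%x. (v x)\<^sup>2 + (v (x + y))\<^sup>2)" using B(10) vy2 by simp
    have "\<bar>a\<bar> * \<bar>c\<bar> <= a\<^sup>2 + c\<^sup>2" for a c :: real
    proof -
     have "2 * (\<bar>a\<bar> * \<bar>c\<bar>) <= a\<^sup>2 + c\<^sup>2"
      using sum_squares_bound[of "\<bar>a\<bar>" "\<bar>c\<bar>"] by (simp add: mult.assoc)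
     moreover have "0 <= \<bar>a\<bar> * \<bar>c\<bar>" by simp
     ultimately show ?thesis by linarith
    qed
    then show "AE x in lborel. norm (\<bar>v x\<bar> * \<bar>v (x + y)\<bar>) <= norm ((v x)\<^sup>2 + (v (x + y))\<^sup>2)" by (simp add: abs_mult)
   qed (use B(1) vy in simp)
   have "S <= (LINT x|lborel. indicator A x * (v (x + y) - v x)\<^sup>2 + 2 * (\<bar>v x\<bar> * \<bar>v (x + y)\<bar>))"
    unfolding S_def
   proof (rule integral_mono[OF Si])
    show "integrable lborel (%x. indicator A x * (v (x + y) - v x)\<^sup>2 + 2 * (\<bar>v x\<bar> * \<bar>v (x + y)\<bar>))"
     using T(1) vvi by simp
    fix x
    have key: "a\<^sup>2 <= (c - a)\<^sup>2 + 2 * (\<bar>a\<bar> * \<bar>c\<bar>)" for a c :: real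
    proof -
     have "a * c <= \<bar>a\<bar> * \<bar>c\<bar>" using abs_ge_self[of "a * c"] by (simp add: abs_mult)
     moreover have "(c - a)\<^sup>2 = c\<^sup>2 - 2 * (a * c) + a\<^sup>2" by (simp add: power2_diff)
     ultimately show ?thesis using zero_le_power2[of c] by linarith
    qed
    show "indicator K x * (v x)\<^sup>2 <= indicator A x * (v (x + y) - v x)\<^sup>2 + 2 * (\<bar>v x\<bar> * \<bar>v (x + y)\<bar>)"
    proof (cases "x : K")
     case True
     then have "x : A" using A(2) by blast
     with True show ?thesis using key[of "v x" "v (x + y)"] by simp
    next
     case False
     then show ?thesis by simp
    qed
   qed
   also have "... = (LINT x|lborel. indicator A x * (v (x + y) - v x)\<^sup>2) + 2 * (LINT x|lborel. \<bar>v x\<bar> * \<bar>v (x + y)\<bar>)"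
    using T(1) vvi by simp
   also have "(LINT x|lborel. indicator A x * (v (x + y) - v x)\<^sup>2) <= ro\<^sup>2 * G"
    using T(2) mult_right_mono[OF power_mono[OF y norm_ge_zero, of 2] G0] unfolding G_def by linarith
   finally have "S - ro\<^sup>2 * G <= 2 * (LINT x|lborel. \<bar>v x\<bar> * \<bar>v (x + y)\<bar>)" by simp
   then have "ennreal (S - ro\<^sup>2 * G) <= ennreal (2 * (LINT x|lborel. \<bar>v x\<bar> * \<bar>v (x + y)\<bar>))" by (rule ennreal_leI)
   also have "... = 2 * ennreal (LINT x|lborel. \<bar>v x\<bar> * \<bar>v (x + y)\<bar>)" by (simp add: ennreal_mult')
   also have "ennreal (LINT x|lborel. \<bar>v x\<bar> * \<bar>v (x + y)\<bar>) = (\<integral>\<^sup>+x. ennreal (\<bar>v x\<bar> * \<bar>v (x + y)\<bar>) \<partial>lborel)"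
    using vvi by (intro nn_integral_eq_integral[symmetric]) auto
   finally show ?thesis .
  qed
  have "ennreal ((S - ro\<^sup>2 * G) * b) = (\<integral>\<^sup>+y. ennreal (S - ro\<^sup>2 * G) * indicator (ball (0::'a) ro) y \<partial>lborel)"
   using b by (subst nn_integral_cmult_indicator) (auto simp: ennreal_mult'')
  also have "... <= (\<integral>\<^sup>+y. 2 * (\<integral>\<^sup>+x. ennreal (\<bar>v x\<bar> * \<bar>v (x + y)\<bar>) \<partial>lborel) \<partial>lborel)"
  proof (rule nn_integral_mono)
   fix y :: 'a
   show "ennreal (S - ro\<^sup>2 * G) * indicator (ball (0::'a) ro) y <= 2 * (\<integral>\<^sup>+x. ennreal (\<bar>v x\<bar> * \<bar>v (x + y)\<bar>) \<partial>lborel)"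
    using one[of y] by (cases "y : ball 0 ro") auto
  qed
  also have "... = 2 * (\<integral>\<^sup>+y. (\<integral>\<^sup>+x. ennreal (\<bar>v x\<bar> * \<bar>v (x + y)\<bar>) \<partial>lborel) \<partial>lborel)"
  proof (rule nn_integral_cmult)
   have "(%p::'a \<times> 'a. fst p + snd p) : borel_measurable borel"
    by (intro borel_measurable_continuous_onI continuous_on_add continuous_on_fst continuous_on_snd continuous_on_id)
   then have "(%p::'a \<times> 'a. v (fst p + snd p)) : borel_measurable (lborel \<Otimes>\<^sub>M lborel)"
    using measurable_compose[OF _ B(1)] by (simp add: lborel_prod)
   moreover have "(%p::'a \<times> 'a. v (snd p)) : borel_measurable (lborel \<Otimes>\<^sub>M lborel)"
    using measurable_compose[OF measurable_snd, of v lborel borel lborel] B(1) by simp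
   ultimately have "(%(y, x). ennreal (\<bar>v x\<bar> * \<bar>v (x + y)\<bar>)) : borel_measurable (lborel \<Otimes>\<^sub>M lborel)"
    by (simp add: case_prod_beta add.commute)
   then show "(%y. \<integral>\<^sup>+x. ennreal (\<bar>v x\<bar> * \<bar>v (x + y)\<bar>) \<partial>lborel) : borel_measurable lborel"
    by (rule lborel.borel_measurable_nn_integral)
  qed
  also have "... = ennreal (2 * N\<^sup>2)"
   unfolding translated_product_integral[OF B(1,8)] N_def by (simp add: ennreal_mult')
  finally have "(S - ro\<^sup>2 * G) * b <= 2 * N\<^sup>2" by (simp add: ennreal_le_iff)
  then have "S <= ro\<^sup>2 * G + 2 / b * N\<^sup>2" using b(1) by (simp add: field_simps)
  also have "ro\<^sup>2 * G <= de * G" using ro(3) G0 by (rule mult_right_mono)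
  finally have "S <= de * G + 2 / b * N\<^sup>2" by simp
  moreover have "K \<inter> U = K" using K(2) by blast
  ultimately show "(LINT x|lborel. indicator (K \<inter> U) x * (v x)\<^sup>2)
   <= de * (LINT x|lborel. (norm (g x))\<^sup>2) + 2 / b * (LINT x|lborel. \<bar>v x\<bar>)\<^sup>2"
   by (simp add: S_def G_def N_def)
 qed
qed

text \<open>Shifting by a small multiple of the inner direction \<open>\<nu>\<close> moves the part of the domain near the boundary point
into a compact subset of the domain, where the interior case applies; the shift itself costs little by the
translation estimate, because the upward segments stay inside.\<close>

lemma compact_embedding_boundary:
 fixes U :: "'a::euclidean_space set"
 assumes U: "open U" "U : lmeasurable" and r: "r > 0" and \<nu>: "norm \<nu> = 1"
  and \<gamma>: "!!x t. \<gamma> (x + t *\<^sub>R \<nu>) = \<gamma> x" "continuous_on UNIV \<gamma>"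
  and graph: "U \<inter> ball x0 r = {x \<in> ball x0 r. \<gamma> x < x \<bullet> \<nu>}"
 shows "locally_compact_embedding U (ball x0 (r / 2))"
 unfolding locally_compact_embedding_def
proof (intro allI impI)
 fix de :: real assume de: "de > 0"
 define t where "t = min (r / 4) (sqrt (de / 4))"
 have t: "t > 0" "t <= r / 4" "t\<^sup>2 <= de / 4"
 proof -
  show "t > 0" "t <= r / 4" using r de by (auto simp: t_def)
  then have "t\<^sup>2 <= (sqrt (de / 4))\<^sup>2" by (intro power_mono) (auto simp: t_def)
  then show "t\<^sup>2 <= de / 4" using de by simp
 qed
 define y where "y = t *\<^sub>R \<nu>"
 have ny: "norm y = t" using t(1) \<nu> by (simp add: y_def)
 define A where "A = ball x0 (r / 2) \<inter> U"
 have Ao: "open A" using U(1) by (simp add: A_def open_Int)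
 have up: "x + s *\<^sub>R \<nu> \<in> U" if "x : ball x0 r" "\<gamma> x <= x \<bullet> \<nu>" "\<gamma> x < x \<bullet> \<nu> + s" "x + s *\<^sub>R \<nu> \<in> ball x0 r" for x s
 proof -
  have "\<nu> \<bullet> \<nu> = 1" using \<nu> by (simp add: dot_square_norm)
  then have "\<gamma> (x + s *\<^sub>R \<nu>) < (x + s *\<^sub>R \<nu>) \<bullet> \<nu>" using that(3) by (simp add: \<gamma>(1) inner_add_left)
  then show ?thesis using that(4) graph by blast
 qed
 have seg: "x + s *\<^sub>R y : U" if x: "x : A" "s : {0..1}" for x s
 proof -
  have "norm (s *\<^sub>R y) <= t" using x(2) ny t(1) by (simp add: mult_left_le_one_le)
  then have "dist x0 (x + s *\<^sub>R y) <= dist x0 x + t"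
   using dist_triangle[of x0 "x + s *\<^sub>R y" x] by (simp add: dist_norm)
  then have b: "x + (s * t) *\<^sub>R \<nu> \<in> ball x0 r" using x(1) t(2) r by (simp add: A_def y_def)
  have "x : U \<inter> ball x0 r" using x(1) r by (simp add: A_def)
  then have "x : ball x0 r" "\<gamma> x < x \<bullet> \<nu>" using graph by blast+
  moreover have "s * t >= 0" using x(2) t(1) by simp
  ultimately show ?thesis using up[OF _ _ _ b] by (simp add: y_def)
 qed
 define K where "K = (+) y ` closure A"
 have Kc: "compact K"
 proof -
  have "bounded A" by (rule bounded_subset[OF bounded_ball[of x0 "r / 2"]]) (simp add: A_def)
  then have "compact (closure A)" by (simp add: compact_closure)
  then show ?thesis unfolding K_def by (rule compact_translation)
 qed
 have KU: "K \<subseteq> U"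
 proof
  fix z assume "z : K"
  then obtain x where x: "x : closure A" "z = x + t *\<^sub>R \<nu>" by (auto simp: K_def y_def add.commute)
  have "closure A \<subseteq> cball x0 (r / 2)" by (rule closure_minimal) (auto simp: A_def)
  then have xb: "dist x0 x <= r / 2" using x(1) by auto
  have "closed {x. \<gamma> x <= x \<bullet> \<nu>}"
   by (rule closed_Collect_le[OF \<gamma>(2)]) (intro continuous_on_inner continuous_on_id continuous_on_const)
  moreover have "A \<subseteq> {x. \<gamma> x <= x \<bullet> \<nu>}"
  proof
   fix x assume "x : A"
   then have "x : U \<inter> ball x0 r" using r by (simp add: A_def)
   then show "x : {x. \<gamma> x <= x \<bullet> \<nu>}" using graph by force
  qed
  ultimately have "closure A \<subseteq> {x. \<gamma> x <= x \<bullet> \<nu>}" by (rule closure_minimal[rotated])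
  then have g: "\<gamma> x <= x \<bullet> \<nu>" using x(1) by blast
  have "dist x0 (x + t *\<^sub>R \<nu>) <= dist x0 x + t"
   using dist_triangle[of x0 "x + t *\<^sub>R \<nu>" x] t(1) \<nu> by (simp add: dist_norm)
  then have "x + t *\<^sub>R \<nu> \<in> ball x0 r" using xb t r by simp
  then show "z : U" unfolding x(2) using g t(1) xb r by (intro up) auto
 qed
 have de4: "de / 4 > 0" using de by simp
 obtain C where C: "C >= 0" "!!v g. borel_H1 U v g ==>
  (LINT x|lborel. indicator (K \<inter> U) x * (v x)\<^sup>2)
  <= de / 4 * (LINT x|lborel. (norm (g x))\<^sup>2) + C * (LINT x|lborel. \<bar>v x\<bar>)\<^sup>2"
  using compact_embedding_interior[OF U Kc KU, unfolded locally_compact_embedding_def, rule_format, OF de4]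
  by blast
 have KU': "K \<inter> U = K" using KU by blast
 show "\<exists>C\<ge>0. \<forall>v g. borel_H1 U v g -->
  (LINT x|lborel. indicator (ball x0 (r / 2) \<inter> U) x * (v x)\<^sup>2)
  <= de * (LINT x|lborel. (norm (g x))\<^sup>2) + C * (LINT x|lborel. \<bar>v x\<bar>)\<^sup>2"
 proof (intro exI[of _ "2 * C"] conjI allI impI)
  show "2 * C >= 0" using C by simp
  fix v :: "'a => real" and g assume bv: "borel_H1 U v g"
  note B = borel_H1D[OF bv U(2)]
  define G where "G = (LINT x|lborel. (norm (g x))\<^sup>2)"
  have G0: "G >= 0" unfolding G_def by (rule integral_nonneg_AE) simp
  note T = translation_estimate[OF bv U Ao seg]
  have Kb: "K : sets borel" "A : sets borel" using Kc Ao by (auto simp: compact_imp_closed)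
  have ind: "integrable lborel (%x. indicator S x * (v x)\<^sup>2)" if "S : sets borel" for S
   using integrable_real_mult_indicator[OF _ B(10), of S] that by (simp add: mult.commute)
  have m: "(%x. indicator K x * (v x)\<^sup>2) : borel_measurable borel" using Kb B(1) by simp
  have Kt: "integrable lborel (%x. indicator K (x + y) * (v (x + y))\<^sup>2)"
   "(LINT x|lborel. indicator K (x + y) * (v (x + y))\<^sup>2) = (LINT x|lborel. indicator K x * (v x)\<^sup>2)"
   using translate_integral[OF m, of y] ind[OF Kb(1)] by auto
  have "(LINT x|lborel. indicator A x * (v x)\<^sup>2)
   <= (LINT x|lborel. 2 * (indicator A x * (v (x + y) - v x)\<^sup>2) + 2 * (indicator K (x + y) * (v (x + y))\<^sup>2))"
  proof (rule integral_mono[OF ind[OF Kb(2)]])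
   show "integrable lborel (%x. 2 * (indicator A x * (v (x + y) - v x)\<^sup>2) + 2 * (indicator K (x + y) * (v (x + y))\<^sup>2))"
    using T(1) Kt(1) by simp
   fix x
   have key: "a\<^sup>2 <= 2 * (c - a)\<^sup>2 + 2 * c\<^sup>2" for a c :: real
    using zero_le_power2[of "2 * c - a"] by (simp add: power2_eq_square algebra_simps)
   show "indicator A x * (v x)\<^sup>2 <= 2 * (indicator A x * (v (x + y) - v x)\<^sup>2) + 2 * (indicator K (x + y) * (v (x + y))\<^sup>2)"
   proof (cases "x : A")
    case True
    then have "x + y : K" using subsetD[OF closure_subset True] by (auto simp: K_def add.commute)
    with True show ?thesis using key[of "v x" "v (x + y)"] by simp
   qed simp
  qed
  also have "... = 2 * (LINT x|lborel. indicator A x * (v (x + y) - v x)\<^sup>2) + 2 * (LINT x|lborel. indicator K x * (v x)\<^sup>2)"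
   using T(1) Kt by simp
  also have "... <= 2 * (de / 4 * G) + 2 * (de / 4 * G + C * (LINT x|lborel. \<bar>v x\<bar>)\<^sup>2)"
  proof -
   have "(LINT x|lborel. indicator A x * (v (x + y) - v x)\<^sup>2) <= de / 4 * G"
    using T(2) mult_right_mono[OF t(3) G0] unfolding G_def ny by linarith
   moreover have "(LINT x|lborel. indicator K x * (v x)\<^sup>2) <= de / 4 * G + C * (LINT x|lborel. \<bar>v x\<bar>)\<^sup>2"
    using C(2)[OF bv] by (simp add: KU' G_def)
   ultimately show ?thesis by (intro add_mono mult_left_mono) auto
  qed
  also have "... = de * G + 2 * C * (LINT x|lborel. \<bar>v x\<bar>)\<^sup>2" by (simp add: algebra_simps)
  finally show "(LINT x|lborel. indicator (ball x0 (r / 2) \<inter> U) x * (v x)\<^sup>2)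
  <= de * (LINT x|lborel. (norm (g x))\<^sup>2) + 2 * C * (LINT x|lborel. \<bar>v x\<bar>)\<^sup>2"
   by (simp add: A_def G_def)
 qed
qed

lemma compact_embedding_Union:
 fixes U :: "'a::euclidean_space set"
 assumes U: "open U" "U : lmeasurable" and D: "finite D" "!!V. V : D ==> open V \<and> locally_compact_embedding U V"
 shows "locally_compact_embedding U (\<Union>D)"
 using D
proof (induction D rule: finite_induct)
 case empty
 then show ?case by (auto simp: locally_compact_embedding_def intro!: exI[of _ 0])
next
 case (insert V D)
 have V: "open V" "locally_compact_embedding U V" and IH: "locally_compact_embedding U (\<Union>D)" "open (\<Union>D)"
  using insert by auto
 show ?case
  unfolding locally_compact_embedding_def
 proof (intro allI impI)
  fix de :: real assume "de > 0"
  then have de2: "de / 2 > 0" by simp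
  obtain C1 where C1: "C1 >= 0" "!!v g. borel_H1 U v g ==> (LINT x|lborel. indicator (V \<inter> U) x * (v x)\<^sup>2)
   <= de / 2 * (LINT x|lborel. (norm (g x))\<^sup>2) + C1 * (LINT x|lborel. \<bar>v x\<bar>)\<^sup>2"
   using V(2) de2 unfolding locally_compact_embedding_def by blast
  obtain C2 where C2: "C2 >= 0" "!!v g. borel_H1 U v g ==> (LINT x|lborel. indicator (\<Union>D \<inter> U) x * (v x)\<^sup>2)
   <= de / 2 * (LINT x|lborel. (norm (g x))\<^sup>2) + C2 * (LINT x|lborel. \<bar>v x\<bar>)\<^sup>2"
   using IH(1) de2 unfolding locally_compact_embedding_def by blast
  show "\<exists>C\<ge>0. \<forall>v g. borel_H1 U v g --> (LINT x|lborel. indicator (\<Union>(insert V D) \<inter> U) x * (v x)\<^sup>2)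
   <= de * (LINT x|lborel. (norm (g x))\<^sup>2) + C * (LINT x|lborel. \<bar>v x\<bar>)\<^sup>2"
  proof (intro exI[of _ "C1 + C2"] conjI allI impI)
   show "C1 + C2 >= 0" using C1 C2 by simp
   fix v :: "'a => real" and g assume bv: "borel_H1 U v g"
   note B = borel_H1D[OF bv U(2)]
   have ind: "integrable lborel (%x. indicator (S \<inter> U) x * (v x)\<^sup>2)" if "open S" for S
    using integrable_real_mult_indicator[OF _ B(10), of "S \<inter> U"] that U(1) by (simp add: mult.commute)
   have "(LINT x|lborel. indicator (\<Union>(insert V D) \<inter> U) x * (v x)\<^sup>2)
    <= (LINT x|lborel. indicator (V \<inter> U) x * (v x)\<^sup>2 + indicator (\<Union>D \<inter> U) x * (v x)\<^sup>2)"
   proof (rule integral_mono)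
    show "integrable lborel (%x. indicator (\<Union>(insert V D) \<inter> U) x * (v x)\<^sup>2)"
     by (rule ind) (use V IH in auto)
    show "integrable lborel (%x. indicator (V \<inter> U) x * (v x)\<^sup>2 + indicator (\<Union>D \<inter> U) x * (v x)\<^sup>2)"
     using ind[OF V(1)] ind[OF IH(2)] by simp
   qed (auto simp: indicator_def)
   also have "... = (LINT x|lborel. indicator (V \<inter> U) x * (v x)\<^sup>2) + (LINT x|lborel. indicator (\<Union>D \<inter> U) x * (v x)\<^sup>2)"
    using ind[OF V(1)] ind[OF IH(2)] by simp
   also have "... <= de * (LINT x|lborel. (norm (g x))\<^sup>2) + (C1 + C2) * (LINT x|lborel. \<bar>v x\<bar>)\<^sup>2"
    using C1(2)[OF bv] C2(2)[OF bv] by (simp add: algebra_simps)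
   finally show "(LINT x|lborel. indicator (\<Union>(insert V D) \<inter> U) x * (v x)\<^sup>2)
   <= de * (LINT x|lborel. (norm (g x))\<^sup>2) + (C1 + C2) * (LINT x|lborel. \<bar>v x\<bar>)\<^sup>2" .
  qed
 qed
qed

lemma C_holder_on_Suc_continuous: "C_holder_on (Suc k) \<sigma> \<gamma> UNIV ==> continuous_on UNIV \<gamma>"
 by (simp add: continuous_at_imp_continuous_on differentiable_imp_continuous_within)

text \<open>The closure of the domain is compact, so finitely many of the local neighbourhoods cover it.\<close>

theorem ehrling_inequality:
 fixes U :: "'a::euclidean_space set"
 assumes U: "open U" "U : lmeasurable" "bounded U" and bd: "C_holder_boundary (Suc k) \<sigma> U" and de: "de > 0"
 obtains C where "C >= 0" "!!v g. borel_H1 U v g ==>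
  (LINT x|lborel. (v x)\<^sup>2) <= de * (LINT x|lborel. (norm (g x))\<^sup>2) + C * (LINT x|lborel. \<bar>v x\<bar>)\<^sup>2"
proof -
 have nbhd: "\<exists>V. open V \<and> x : V \<and> locally_compact_embedding U V" if x: "x : closure U" for x
 proof (cases "x : U")
  case True
  then obtain e where e: "e > 0" "cball x e \<subseteq> U" using U(1) open_contains_cball by blast
  have c: "locally_compact_embedding U (cball x e)"
   by (rule compact_embedding_interior[OF U(1,2)]) (use e in auto)
  have "locally_compact_embedding U (ball x e)"
   unfolding locally_compact_embedding_def
  proof (intro allI impI)
   fix de :: real assume "de > 0"
   then obtain C where C: "C >= 0" "!!v g. borel_H1 U v g ==> (LINT z|lborel. indicator (cball x e \<inter> U) z * (v z)\<^sup>2)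
    <= de * (LINT x|lborel. (norm (g x))\<^sup>2) + C * (LINT x|lborel. \<bar>v x\<bar>)\<^sup>2"
    using c unfolding locally_compact_embedding_def by blast
   show "\<exists>C\<ge>0. \<forall>v g. borel_H1 U v g --> (LINT z|lborel. indicator (ball x e \<inter> U) z * (v z)\<^sup>2)
    <= de * (LINT x|lborel. (norm (g x))\<^sup>2) + C * (LINT x|lborel. \<bar>v x\<bar>)\<^sup>2"
   proof (intro exI[of _ C] conjI C(1) allI impI)
    fix v :: "'a => real" and g assume bv: "borel_H1 U v g"
    note B = borel_H1D[OF bv U(2)]
    have ind: "integrable lborel (%x. indicator S x * (v x)\<^sup>2)" if "S : sets borel" for S
     using integrable_real_mult_indicator[OF _ B(10), of S] that by (simp add: mult.commute)
    have "(LINT z|lborel. indicator (ball x e \<inter> U) z * (v z)\<^sup>2) <= (LINT z|lborel. indicator (cball x e \<inter> U) z * (v z)\<^sup>2)"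
     by (rule integral_mono[OF ind ind]) (use U(1) in \<open>auto simp: indicator_def\<close>)
    then show "(LINT z|lborel. indicator (ball x e \<inter> U) z * (v z)\<^sup>2)
    <= de * (LINT x|lborel. (norm (g x))\<^sup>2) + C * (LINT x|lborel. \<bar>v x\<bar>)\<^sup>2"
     using C(2)[OF bv] by (rule order_trans)
   qed
  qed
  then show ?thesis using e(1) by (intro exI[of _ "ball x e"]) auto
 next
  case False
  then have "x : frontier U" using x U(1) by (simp add: frontier_def interior_open)
  then obtain r \<nu> \<gamma> where g: "r > 0" "norm \<nu> = 1" "!!x t. \<gamma> (x + t *\<^sub>R \<nu>) = \<gamma> x" "C_holder_on (Suc k) \<sigma> \<gamma> UNIV"
    "U \<inter> ball x r = {z \<in> ball x r. \<gamma> z < z \<bullet> \<nu>}"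
   using bd unfolding C_holder_boundary_def by blast
  have "locally_compact_embedding U (ball x (r / 2))"
   by (rule compact_embedding_boundary[OF U(1,2) g(1,2,3) C_holder_on_Suc_continuous[OF g(4)] g(5)])
  then show ?thesis using g(1) by (intro exI[of _ "ball x (r / 2)"]) auto
 qed
 have "compact (closure U)" using U(3) by (simp add: compact_closure)
 moreover have "closure U \<subseteq> \<Union>{V. open V \<and> locally_compact_embedding U V}" using nbhd by blast
 ultimately obtain D where D: "D \<subseteq> {V. open V \<and> locally_compact_embedding U V}" "finite D" "closure U \<subseteq> \<Union>D"
  by (rule compactE) blast
 have "locally_compact_embedding U (\<Union>D)"
  by (rule compact_embedding_Union[OF U(1,2) D(2)]) (use D(1) in blast)
 then obtain C where C: "C >= 0" "!!v g. borel_H1 U v g ==> (LINT x|lborel. indicator (\<Union>D \<inter> U) x * (v x)\<^sup>2)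
   <= de * (LINT x|lborel. (norm (g x))\<^sup>2) + C * (LINT x|lborel. \<bar>v x\<bar>)\<^sup>2"
  using de unfolding locally_compact_embedding_def by blast
 show thesis
 proof (rule that[OF C(1)])
  fix v :: "'a => real" and g assume bv: "borel_H1 U v g"
  note B = borel_H1D[OF bv U(2)]
  have "\<Union>D \<inter> U = U" using D(3) closure_subset[of U] by blast
  then have "(LINT x|lborel. indicator (\<Union>D \<inter> U) x * (v x)\<^sup>2) = (LINT x|lborel. (v x)\<^sup>2)"
   by (intro Bochner_Integration.integral_cong) (use B(3) in \<open>auto simp: indicator_def\<close>)
  then show "(LINT x|lborel. (v x)\<^sup>2) <= de * (LINT x|lborel. (norm (g x))\<^sup>2) + C * (LINT x|lborel. \<bar>v x\<bar>)\<^sup>2"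
   using C(2)[OF bv] by simp
 qed
qed

section \<open>Evolution variational inequalities on the real line\<close>

lemma integral_le_negligible:
 fixes f g :: "real => real"
 assumes "f integrable_on S" "g integrable_on S" "negligible N" "!!x. x : S - N ==> f x <= g x"
 shows "integral S f <= integral S g"
proof -
 define f' where "f' x = (if x : N then g x else f x)" for x
 have i: "f' integrable_on S"
  by (rule integrable_spike[OF assms(1,3)]) (simp add: f'_def)
 have "integral S f = integral S f'"
  by (rule integral_spike[OF assms(3)]) (simp add: f'_def)
 also have "... <= integral S g"
  using i assms(2,4) by (intro integral_le) (auto simp: f'_def)
 finally show ?thesis .
qed

lemma integrable_cmult_real:
 fixes f :: "real => real"
 assumes "f integrable_on S"
 shows "(%x. c * f x) integrable_on S" "(%x. f x * c) integrable_on S"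
 using integrable_cmul[OF assms, of c] by (simp_all add: mult.commute)

lemma shift_integral:
 fixes f :: "real => real"
 shows "integral {a..b} (%x. f (x + c)) = integral {a + c..b + c} f"
 using integral_shift_real_ivl[of "a + c" c "b + c" f] by simp

lemma shift_integrable:
 fixes f :: "real => real"
 assumes "f integrable_on {a + c..b + c}"
 shows "(%x. f (x + c)) integrable_on {a..b}"
proof -
 obtain y where "(f has_integral y) {a + c..b + c}" using assms by blast
 then have "((%x. f (1 *\<^sub>R x + c)) has_integral (1 / \<bar>1\<bar> ^ DIM(real)) *\<^sub>R y) ((%x. (1 / 1) *\<^sub>R x + - ((1 / 1) *\<^sub>R c)) ` cbox (a + c) (b + c))"
  by (intro has_integral_affinity) auto
 moreover have "(%x. (1 / 1) *\<^sub>R x + - ((1 / 1) *\<^sub>R c)) ` cbox (a + c) (b + c) = {a..b}"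
 proof -
  have "(%x. (1 / 1) *\<^sub>R x + - ((1 / 1) *\<^sub>R c)) ` cbox (a + c) (b + c) = (+) (- c) ` {a + c..b + c}"
   by (intro image_cong) auto
  then show ?thesis by simp
 qed
 ultimately show ?thesis by (auto simp: integrable_on_def)
qed

lemma short_integral_bounds:
 fixes n :: "real => real"
 assumes c: "continuous_on {a..b} n" and s: "a <= s" "s < b" and e: "e > 0"
 shows "\<exists>h0>0. \<forall>h. 0 < h \<and> h < h0 --> s + h <= b \<and> h * (n s - e) <= integral {s..s + h} n \<and> integral {s..s + h} n <= h * (n s + e)"
proof -
 obtain d where d: "d > 0" "!!r. r : {a..b} ==> dist r s < d ==> dist (n r) (n s) < e"
  using c s e unfolding continuous_on_iff by (metis atLeastAtMost_iff less_eq_real_def)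
 show ?thesis
 proof (intro exI[of _ "min d (b - s)"] conjI allI impI)
  show "min d (b - s) > 0" using d s by simp
  fix h assume h: "0 < h \<and> h < min d (b - s)"
  then show "s + h <= b" by simp
  have i: "n integrable_on {s..s + h}"
   using c h s by (intro integrable_continuous_real continuous_on_subset[OF c]) auto
  have nb: "\<bar>n r - n s\<bar> < e" if "r : {s..s + h}" for r
   using d(2)[of r] that h s by (auto simp: dist_real_def)
  have "integral {s..s + h} (%_. n s - e) <= integral {s..s + h} n"
  proof (intro integral_le i)
   fix r assume "r : {s..s + h}"
   then show "n s - e <= n r" using nb[of r] unfolding abs_less_iff by auto
  qed auto
  then show "h * (n s - e) <= integral {s..s + h} n" using h by simp
  have "integral {s..s + h} n <= integral {s..s + h} (%_. n s + e)"
  proof (intro integral_le i)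
   fix r assume "r : {s..s + h}"
   then show "n r <= n s + e" using nb[of r] by (auto simp: abs_less_iff)
  qed auto
  then show "integral {s..s + h} n <= h * (n s + e)" using h by simp
 qed
qed

lemma integral_increment:
 fixes n :: "real => real"
 assumes c: "continuous_on {0..T} n" and st: "0 <= s" "s <= t" "0 < h" "t + h <= T"
 shows "integral {s..t} (%r. n (r + h) - n r) = integral {t..t + h} n - integral {s..s + h} n"
  and "(%r. n (r + h) - n r) integrable_on {s..t}"
proof -
 have i: "n integrable_on {a..b}" if "0 <= a" "b <= T" for a b
  using that by (intro integrable_continuous_real continuous_on_subset[OF c]) auto
 have i2: "(%r. n (r + h)) integrable_on {s..t}" using i st by (intro shift_integrable) auto
 have "integral {s..t} (%r. n (r + h) - n r) = integral {s + h..t + h} n - integral {s..t} n"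
  using i2 i[of s t] st by (simp add: Henstock_Kurzweil_Integration.integral_diff shift_integral)
 moreover have "integral {s..s + h} n + integral {s + h..t + h} n = integral {s..t + h} n"
  by (rule Henstock_Kurzweil_Integration.integral_combine) (use st i in auto)
 moreover have "integral {s..t} n + integral {t..t + h} n = integral {s..t + h} n"
  by (rule Henstock_Kurzweil_Integration.integral_combine) (use st i in auto)
 ultimately show "integral {s..t} (%r. n (r + h) - n r) = integral {t..t + h} n - integral {s..s + h} n" by simp
 show "(%r. n (r + h) - n r) integrable_on {s..t}"
  using i2 i[of s t] st by (intro integrable_diff) auto
qed

lemma primitive_facts:
 fixes F :: "real => real"
 assumes "F integrable_on {0..T}"
 shows "continuous_on {0..T} (%t. integral {0..t} F)"
  and "!!a b. 0 <= a ==> a <= b ==> b <= T ==> integral {a..b} F = integral {0..b} F - integral {0..a} F"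
  and "!!a b. 0 <= a ==> b <= T ==> F integrable_on {a..b}"
proof -
 show "continuous_on {0..T} (%t. integral {0..t} F)" by (rule indefinite_integral_continuous_1[OF assms])
 show i: "F integrable_on {a..b}" if "0 <= a" "b <= T" for a b
  using that by (intro integrable_on_subinterval[OF assms]) auto
 show "integral {a..b} F = integral {0..b} F - integral {0..a} F" if "0 <= a" "a <= b" "b <= T" for a b
  using Henstock_Kurzweil_Integration.integral_combine[OF that(1,2) i[of 0 b]] that by simp
qed

text \<open>An inequality for increments with error term sampled at the endpoint. Integrating it over the starting
point turns the sampled values into integrals; then the step \<open>h\<close> tends to 0.\<close>

theorem increment_inequality:
 fixes n P Q :: "real => real"
 assumes n: "continuous_on {0..T} n" and P: "P integrable_on {0..T}" and Q: "Q integrable_on {0..T}"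
  and N: "negligible N" and st: "0 <= s" "s <= t" "t < T" and h1: "h1 > 0"
  and H: "!!h r. 0 < h ==> h < h1 ==> r : {s..t} ==> r + h <= T ==> r + h \<notin> N ==>
   n (r + h) - n r <= integral {r..r + h} P + h * Q (r + h)"
 shows "n t - n s <= integral {s..t} P + integral {s..t} Q"
proof (rule field_le_epsilon)
 fix e' :: real assume "e' > 0"
 define e where "e = e' / 6"
 have e: "e > 0" using \<open>e' > 0\<close> by (simp add: e_def)
 let ?P = "%t. integral {0..t} P" and ?Q = "%t. integral {0..t} Q"
 note p = primitive_facts[OF P] and q = primitive_facts[OF Q]
 have sT: "s < T" and t0: "0 <= t" using st by auto
 obtain a1 where a1: "a1 > 0" "!!h. 0 < h ==> h < a1 ==> t + h <= T \<and> h * (n t - e) <= integral {t..t + h} n"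
  using short_integral_bounds[OF n t0 st(3) e] by blast
 obtain a2 where a2: "a2 > 0" "!!h. 0 < h ==> h < a2 ==> integral {s..s + h} n <= h * (n s + e)"
  using short_integral_bounds[OF n st(1) sT e] by blast
 obtain a3 where a3: "a3 > 0" "!!h. 0 < h ==> h < a3 ==> integral {t..t + h} ?P <= h * (?P t + e)"
  using short_integral_bounds[OF p(1) t0 st(3) e] by blast
 obtain a4 where a4: "a4 > 0" "!!h. 0 < h ==> h < a4 ==> h * (?P s - e) <= integral {s..s + h} ?P"
  using short_integral_bounds[OF p(1) st(1) sT e] by blast
 obtain a5 where a5: "a5 > 0" "!!r. r : {0..T} ==> \<bar>r - t\<bar> < a5 ==> \<bar>?Q r - ?Q t\<bar> < e"
 proof -
  have "t : {0..T}" using st by simp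
  then show thesis using q(1) e that unfolding continuous_on_iff dist_real_def by blast
 qed
 obtain a6 where a6: "a6 > 0" "!!r. r : {0..T} ==> \<bar>r - s\<bar> < a6 ==> \<bar>?Q r - ?Q s\<bar> < e"
 proof -
  have "s : {0..T}" using st by simp
  then show thesis using q(1) e that unfolding continuous_on_iff dist_real_def by blast
 qed
 define h where "h = min h1 (min (min a1 a2) (min (min a3 a4) (min a5 a6))) / 2"
 have h: "0 < h" "h < h1" "h < a1" "h < a2" "h < a3" "h < a4" "h < a5" "h < a6"
  using h1 a1(1) a2(1) a3(1) a4(1) a5(1) a6(1) by (auto simp: h_def min_less_iff_disj)
 have thT: "t + h <= T" using a1(2)[OF h(1,3)] by simp
 have shift: "negligible {r. r + h : N}"
 proof -
  have "{r. r + h : N} = (+) (- h) ` N" by (auto intro!: image_eqI[of _ _ "_ + h"])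
  then show ?thesis using negligible_translation[OF N, of "- h"] by simp
 qed
 have Qs: "(%r. Q (r + h)) integrable_on {s..t}"
  using q(3) st h(1) thT by (intro shift_integrable) auto
 note nI = integral_increment[OF n st(1,2) h(1) thT] and PI = integral_increment[OF p(1) st(1,2) h(1) thT]
 have "integral {s..t} (%r. n (r + h) - n r) <= integral {s..t} (%r. (?P (r + h) - ?P r) + h * Q (r + h))"
 proof (rule integral_le_negligible[OF nI(2) _ shift])
  show "(%r. (?P (r + h) - ?P r) + h * Q (r + h)) integrable_on {s..t}"
   using PI(2) Qs by (intro integrable_add integrable_cmult_real(1)) auto
  fix r assume r: "r : {s..t} - {r. r + h : N}"
  then have "n (r + h) - n r <= integral {r..r + h} P + h * Q (r + h)"
   using H[OF h(1,2), of r] thT by auto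
  moreover have "integral {r..r + h} P = ?P (r + h) - ?P r"
   using r st h(1) thT by (intro p(2)) auto
  ultimately show "n (r + h) - n r <= (?P (r + h) - ?P r) + h * Q (r + h)" by simp
 qed
 also have "... = integral {t..t + h} ?P - integral {s..s + h} ?P + h * integral {s + h..t + h} Q"
  using PI Qs by (simp add: Henstock_Kurzweil_Integration.integral_add integrable_cmult_real(1) shift_integral)
 also have "integral {s + h..t + h} Q = ?Q (t + h) - ?Q (s + h)"
  using st h(1) thT by (intro q(2)) auto
 finally have "integral {t..t + h} n - integral {s..s + h} n
   <= integral {t..t + h} ?P - integral {s..s + h} ?P + h * (?Q (t + h) - ?Q (s + h))"
  unfolding nI(1) .
 moreover have "h * (?Q (t + h) - ?Q (s + h)) <= h * (?Q t - ?Q s + 2 * e)"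
 proof (rule mult_left_mono)
  have "\<bar>?Q (t + h) - ?Q t\<bar> < e" "\<bar>?Q (s + h) - ?Q s\<bar> < e"
   using a5(2)[of "t + h"] a6(2)[of "s + h"] h st thT by auto
  then show "?Q (t + h) - ?Q (s + h) <= ?Q t - ?Q s + 2 * e" unfolding abs_less_iff by linarith
 qed (use h in simp)
 moreover note a1(2)[OF h(1,3)] a2(2)[OF h(1,4)] a3(2)[OF h(1,5)] a4(2)[OF h(1,6)]
 ultimately have "h * (n t - e) - h * (n s + e) <= h * (?P t + e) - h * (?P s - e) + h * (?Q t - ?Q s + 2 * e)"
  by linarith
 then have "h * (n t - n s) <= h * ((?P t - ?P s) + (?Q t - ?Q s) + 6 * e)"
  by (simp add: algebra_simps)
 then have "n t - n s <= (?P t - ?P s) + (?Q t - ?Q s) + 6 * e"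
  using h(1) by (simp only: mult_le_cancel_left_pos)
 moreover have "integral {s..t} P = ?P t - ?P s" "integral {s..t} Q = ?Q t - ?Q s"
  using st by (auto intro!: p(2) q(2))
 ultimately show "n t - n s <= integral {s..t} P + integral {s..t} Q + e'" by (simp add: e_def)
qed

text \<open>Optimise over the parameter \<open>th\<close>.\<close>

lemma young_family_bound:
 assumes "0 <= d" "0 < T" "0 <= A" "!!th. th > 0 ==> 2 * d <= th * T + A / th"
 shows "d\<^sup>2 <= T * (A::real)"
proof (cases "d = 0")
 case False
 then have "2 * d <= (d / T) * T + A / (d / T)" using assms by (intro assms(4)) simp
 then have "d <= A * T / d" using assms(2) by simp
 then show ?thesis using False assms(1) by (simp add: power2_eq_square field_simps)
qed (use assms in simp)

lemma pseudometric_continuous: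
 fixes d :: "real => real => real"
 assumes d: "!!s t. d s t = d t s" "!!s. d s s = 0"
   "!!r s t. r : I ==> s : I ==> t : I ==> d r t <= d r s + d s t"
  and cont: "!!t0. t0 : I ==> ((%t. d t t0) \<longlongrightarrow> 0) (at t0 within I)"
  and fg: "continuous_on S f" "continuous_on S g" "!!x. x : S ==> f x : I \<and> g x : I"
 shows "continuous_on S (%x. d (f x) (g x))"
proof -
 have jc: "continuous_on (I \<times> I) (%(s, t). d s t)"
  unfolding continuous_on_def
 proof
  fix z assume z: "z : I \<times> I"
  obtain s0 t0 where st: "z = (s0, t0)" "s0 : I" "t0 : I" using z by auto
  have f: "((%w. fst w) \<longlongrightarrow> s0) (at z within I \<times> I)" "((%w. snd w) \<longlongrightarrow> t0) (at z within I \<times> I)"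
   using tendsto_fst[OF tendsto_ident_at, of z] tendsto_snd[OF tendsto_ident_at, of z] st(1) by auto
  have g: "((%w. d (h w) c) \<longlongrightarrow> 0) (at z within I \<times> I)"
   if h: "(h \<longlongrightarrow> c) (at z within I \<times> I)" "c : I" "!!w. w : I \<times> I ==> h w : I" for h c
  proof -
   have cl: "((%t. d t c) \<longlongrightarrow> d c c) (at c within I)" using cont[OF h(2)] d(2) by simp
   have ci: "continuous (at c within I) (%t. d t c)" using cl by (simp add: continuous_within)
   have "((%w. d (h w) c) \<longlongrightarrow> d c c) (at z within I \<times> I)"
    by (rule continuous_within_tendsto_compose[OF ci _ h(1)])
     (use h(3) in \<open>auto simp: eventually_at_filter intro!: always_eventually\<close>)
   then show ?thesis using d(2) by simp
  qed
  have lim0: "((%w. d (fst w) s0 + d (snd w) t0) \<longlongrightarrow> 0) (at z within I \<times> I)"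
   using tendsto_add[OF g[OF f(1) st(2)] g[OF f(2) st(3)]] by force
  have bnd: "norm (d (fst w) (snd w) - d s0 t0) <= d (fst w) s0 + d (snd w) t0"
   if "w : I \<times> I" for w
  proof -
   have w: "fst w : I" "snd w : I" using that by auto
   have "d (fst w) (snd w) <= d (fst w) s0 + (d s0 t0 + d t0 (snd w))"
    using d(3)[OF w(1) st(2) w(2)] d(3)[OF st(2,3) w(2)] by linarith
   moreover have "d s0 t0 <= d s0 (fst w) + (d (fst w) (snd w) + d (snd w) t0)"
    using d(3)[OF st(2) w(1) st(3)] d(3)[OF w(1,2) st(3)] by linarith
   ultimately show ?thesis using d(1)[of t0 "snd w"] d(1)[of s0 "fst w"] by (simp add: abs_le_iff)
  qed
  have "\<forall>\<^sub>F w in at z within I \<times> I. norm (d (fst w) (snd w) - d s0 t0) <= d (fst w) s0 + d (snd w) t0"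
   unfolding eventually_at_filter by (intro always_eventually allI impI bnd)
  from Lim_null_comparison[OF this lim0]
  have "((%w. d (fst w) (snd w)) \<longlongrightarrow> d s0 t0) (at z within I \<times> I)"
   by (rule LIM_zero_cancel)
  then show "((%(s, t). d s t) \<longlongrightarrow> (case z of (s, t) => d s t)) (at z within I \<times> I)"
   using st(1) by (simp add: case_prod_beta')
 qed
 have "continuous_on S (%x. (%(s, t). d s t) (f x, g x))"
  by (rule continuous_on_compose2[OF jc continuous_on_Pair[OF fg(1,2)]]) (use fg(3) in auto)
 then show ?thesis by simp
qed

text \<open>Put \<open>D(h) = \<integral> d(s, s + h)\<^sup>2\<close> over \<open>s\<close> in \<open>[0, T]\<close>. Integrating the variational inequality in \<open>s\<close> and comparing the
primitives of \<open>F\<close> at the two ends gives \<open>D(h) \<le> h\<^sup>2 (F0 - Fi + o(1)) + La \<integral> D\<close>, so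
\<open>D(h) \<le> h\<^sup>2 (F0 - Fi + o(1))\<close>: the semiconvexity constant disappears as \<open>h\<close> tends to 0. Chaining \<open>T / h\<close> steps with
the triangle inequality and Young's inequality yields the distance from 0 to \<open>T\<close>.\<close>

theorem evi_displacement:
 fixes d :: "real => real => real" and F :: "real => real"
 assumes T: "0 < T" "T < T1"
  and d: "!!s t. 0 <= d s t" "!!s t. d s t = d t s" "!!s. d s s = 0"
   "!!r s t. r : {0..T1} ==> s : {0..T1} ==> t : {0..T1} ==> d r t <= d r s + d s t"
  and cont: "!!t0. t0 : {0..T1} ==> ((%t. d t t0) \<longlongrightarrow> 0) (at t0 within {0..T1})"
  and F: "F integrable_on {0..T1}" and N: "negligible N" and low: "!!t. t : {0..T1} - N ==> Fi <= F t"
  and La: "La >= 0"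
  and evi: "!!s t. s : {0..T1} - N ==> s <= t ==> t < T1 ==>
   (d s t)\<^sup>2 / 2 <= (t - s) * F s - integral {s..t} F + La / 2 * integral {s..t} (%r. (d s r)\<^sup>2)"
  and evi0: "!!t. 0 <= t ==> t < T1 ==> integral {0..t} F <= t * F0 + La / 2 * integral {0..t} (%r. (d 0 r)\<^sup>2)"
 shows "(d 0 T)\<^sup>2 <= T * (F0 - Fi)"
proof -
 let ?\<Phi> = "%t. integral {0..t} F"
 note p = primitive_facts[OF F]
 have dc: "continuous_on S (%x. d (f x) (g x))"
  if "continuous_on S f" "continuous_on S g" "!!x. x : S ==> f x : {0..T1} \<and> g x : {0..T1}" for S f g
  by (rule pseudometric_continuous[where I = "{0..T1}", OF d(2,3,4) cont that])
 define H where "H = T1 - T"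
 have H: "H > 0" using T by (simp add: H_def)
 define D where "D h = integral {0..T} (%s. (d s (s + h))\<^sup>2)" for h
 have Ic: "continuous_on {0..T} (%s. d s (s + h))" if "0 <= h" "h <= H" for h
  by (rule dc) (use that T in \<open>auto simp: H_def intro!: continuous_on_add continuous_on_id continuous_on_const\<close>)
 have Ii: "(%s. (d s (s + h))\<^sup>2) integrable_on {0..T}" if "0 <= h" "h <= H" for h
  using Ic[OF that] by (intro integrable_continuous_real continuous_on_power)
 have D0: "D h >= 0" if "0 <= h" "h <= H" for h
  unfolding D_def using Ii[OF that] by (rule Henstock_Kurzweil_Integration.integral_nonneg) simp
 have joint: "continuous_on ({0..T} \<times> {0..h}) (%(s, y). (d s (s + y))\<^sup>2)" if "h <= H" for h
  unfolding case_prod_beta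
  by (intro continuous_on_power dc continuous_on_add continuous_on_fst continuous_on_snd continuous_on_id)
   (use that T in \<open>auto simp: H_def\<close>)
 have joint': "continuous_on ({0..h} \<times> {0..T}) (%(y, s). (d s (s + y))\<^sup>2)" if "h <= H" for h
  unfolding case_prod_beta
  by (intro continuous_on_power dc continuous_on_add continuous_on_fst continuous_on_snd continuous_on_id)
   (use that T in \<open>auto simp: H_def\<close>)
 have Dc: "continuous_on {0..h} D" if "h <= H" for h
  using integral_continuous_on_param[of "{0..h}" 0 T "%y s. (d s (s + y))\<^sup>2"] joint'[OF that]
  by (simp add: D_def[abs_def])
 have swap: "integral {0..T} (%s. integral {0..h} (%y. (d s (s + y))\<^sup>2)) = integral {0..h} D"
  and inner: "(%s. integral {0..h} (%y. (d s (s + y))\<^sup>2)) integrable_on {0..T}" if "0 <= h" "h <= H" for h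
 proof -
  have "continuous_on (cbox (0, 0) (T, h)) (%(s, y). (d s (s + y))\<^sup>2)"
   using joint[OF that(2)] by (simp add: cbox_Pair_eq)
  from integral_swap_continuous[OF this]
  show "integral {0..T} (%s. integral {0..h} (%y. (d s (s + y))\<^sup>2)) = integral {0..h} D"
   by (simp add: D_def[abs_def])
  have "continuous_on {0..T} (%s. integral (cbox 0 h) (%y. (d s (s + y))\<^sup>2))"
   using integral_continuous_on_param[of "{0..T}" 0 h "%s y. (d s (s + y))\<^sup>2"] joint[OF that(2)] by simp
  then show "(%s. integral {0..h} (%y. (d s (s + y))\<^sup>2)) integrable_on {0..T}"
   by (simp add: integrable_continuous_real)
 qed
 have integrated: "D h / 2 <= h * ?\<Phi> T - (integral {T..T + h} ?\<Phi> - integral {0..h} ?\<Phi>) + La / 2 * integral {0..h} D"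
  if h: "0 < h" "h < H" for h
 proof -
  have hT: "T + h <= T1" "T + h < T1" "0 <= T" "0 <= h" "h <= H" using h T by (auto simp: H_def)
  note PI = integral_increment[OF p(1) order_refl hT(3) h(1) hT(1)]
  have FT: "F integrable_on {0..T}" using p(3)[of 0 T] T by simp
  note i1 = integrable_diff[OF integrable_cmult_real(1)[OF FT, of h] PI(2)]
  note i2 = integrable_cmult_real(1)[OF inner[OF hT(4,5)], of "La / 2"]
  have "D h / 2 = integral {0..T} (%s. (d s (s + h))\<^sup>2 / 2)" by (simp add: D_def)
  also have "... <= integral {0..T} (%s. h * F s - (?\<Phi> (s + h) - ?\<Phi> s) + La / 2 * integral {0..h} (%y. (d s (s + y))\<^sup>2))"
  proof (rule integral_le_negligible[OF _ _ N])
   show "(%s. (d s (s + h))\<^sup>2 / 2) integrable_on {0..T}" using Ii[OF hT(4,5)] by simp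
   show "(%s. h * F s - (?\<Phi> (s + h) - ?\<Phi> s) + La / 2 * integral {0..h} (%y. (d s (s + y))\<^sup>2)) integrable_on {0..T}"
    using integrable_add[OF i1 i2] .
   fix s assume s: "s : {0..T} - N"
   then have s': "s : {0..T1} - N" "s <= s + h" "s + h < T1" using T hT h by auto
   have "integral {s..s + h} F = ?\<Phi> (s + h) - ?\<Phi> s" using s' by (intro p(2)) auto
   moreover have "integral {s..s + h} (%r. (d s r)\<^sup>2) = integral {0..h} (%y. (d s (s + y))\<^sup>2)"
    using shift_integral[of 0 h "%r. (d s r)\<^sup>2" s] by (simp add: add.commute)
   ultimately show "(d s (s + h))\<^sup>2 / 2 <= h * F s - (?\<Phi> (s + h) - ?\<Phi> s) + La / 2 * integral {0..h} (%y. (d s (s + y))\<^sup>2)"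
    using evi[OF s'] by simp
  qed
  also have "... = h * ?\<Phi> T - (integral {T..T + h} ?\<Phi> - integral {0..0 + h} ?\<Phi>) + La / 2 * integral {0..h} D"
  proof -
   have "integral {0..T} (%s. (h * F s - (?\<Phi> (s + h) - ?\<Phi> s)) + La / 2 * integral {0..h} (%y. (d s (s + y))\<^sup>2))
    = integral {0..T} (%s. h * F s - (?\<Phi> (s + h) - ?\<Phi> s)) + integral {0..T} (%s. La / 2 * integral {0..h} (%y. (d s (s + y))\<^sup>2))"
    by (rule Henstock_Kurzweil_Integration.integral_add[OF i1 i2])
   also have "integral {0..T} (%s. h * F s - (?\<Phi> (s + h) - ?\<Phi> s)) = integral {0..T} (%s. h * F s) - integral {0..T} (%s. ?\<Phi> (s + h) - ?\<Phi> s)"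
    by (rule Henstock_Kurzweil_Integration.integral_diff[OF integrable_cmult_real(1)[OF FT] PI(2)])
   finally show ?thesis using PI(1) swap[OF hT(4,5)] by simp
  qed
  finally show ?thesis by simp
 qed
 have lowT: "Fi * h\<^sup>2 / 2 <= integral {T..T + h} ?\<Phi> - h * ?\<Phi> T" if h: "0 < h" "h < H" for h
 proof -
  have hT: "T + h <= T1" using h by (simp add: H_def)
  have Pi: "(%y. ?\<Phi> (y + T)) integrable_on {0..h}"
   by (rule shift_integrable)
    (use hT T in \<open>auto intro!: integrable_continuous_real continuous_on_subset[OF p(1)]\<close>)
  have idi: "((%y. y) has_integral ((h\<^sup>2 - 0\<^sup>2) / 2)) {0..h}" using h by (intro ident_has_integral) simp
  have "integral {0..h} (%y. Fi * y) <= integral {0..h} (%y. ?\<Phi> (y + T) - ?\<Phi> T)"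
  proof (rule integral_le)
   show "(%y. Fi * y) integrable_on {0..h}" using idi by (intro integrable_cmult_real(1)) auto
   show "(%y. ?\<Phi> (y + T) - ?\<Phi> T) integrable_on {0..h}" using Pi by (intro integrable_diff) auto
   fix y assume y: "y : {0..h}"
   have "Fi * y = integral {T..y + T} (%_. Fi)" using y by simp
   also have "... <= integral {T..y + T} F"
    using y hT T low by (intro integral_le_negligible[OF _ _ N] p(3)) auto
   also have "... = ?\<Phi> (y + T) - ?\<Phi> T" using y hT T by (intro p(2)) auto
   finally show "Fi * y <= ?\<Phi> (y + T) - ?\<Phi> T" .
  qed
  also have "... = integral {0..h} (%y. ?\<Phi> (y + T)) - integral {0..h} (%y. ?\<Phi> T)"
   using Pi by (intro Henstock_Kurzweil_Integration.integral_diff) auto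
  also have "... = integral {T..T + h} ?\<Phi> - h * ?\<Phi> T"
   using h shift_integral[of 0 h ?\<Phi> T] by (simp add: add.commute)
  finally show ?thesis using idi by (simp add: integral_unique)
 qed
 have quad: "\<exists>h0>0. h0 <= H \<and> 0 <= F0 - Fi + La * e / 2 \<and> (\<forall>h. 0 < h --> h < h0 --> (1 - La * h) * D h <= h\<^sup>2 * (F0 - Fi + La * e / 2))"
  if e: "e > 0" for e
 proof -
  let ?A = "F0 - Fi + La * e / 2"
  have "0 : {0..T1}" using T by simp
  from cont[OF this] e have "\<forall>\<^sub>F t in at 0 within {0..T1}. dist (d t 0) 0 < sqrt e"
   by (intro tendstoD) auto
  then obtain h2 where h2: "h2 > 0" "!!t. t : {0..T1} ==> t ~= 0 ==> \<bar>t\<bar> < h2 ==> \<bar>d t 0\<bar> < sqrt e"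
   unfolding eventually_at by (auto simp: dist_real_def)
  have small: "(d 0 r)\<^sup>2 <= e" if "r : {0..T1}" "r < h2" for r
  proof (cases "r = 0")
   case False
   then have "\<bar>d 0 r\<bar> < sqrt e" using h2(2)[of r] that d(2)[of 0 r] by simp
   then have "\<bar>d 0 r\<bar>\<^sup>2 <= (sqrt e)\<^sup>2" by (intro power_mono) auto
   then show ?thesis using e by simp
  qed (use d(3) e in simp)
  define h0 where "h0 = min (min H h2) T1"
  have h0: "h0 > 0" "h0 <= H" "h0 <= h2" "h0 <= T1" using H h2 T by (auto simp: h0_def)
  have \<Phi>up: "?\<Phi> y <= y * (F0 + La * e / 2)" if y: "0 <= y" "y < h0" for y
  proof -
   have "integral {0..y} (%r. (d 0 r)\<^sup>2) <= integral {0..y} (%_. e)"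
   proof (rule integral_le)
    show "(%r. (d 0 r)\<^sup>2) integrable_on {0..y}"
     by (intro integrable_continuous_real continuous_on_power dc continuous_on_const continuous_on_id)
      (use y h0 T in auto)
   qed (use small y h0 in auto)
   also have "... = y * e" using y by simp
   finally have "La / 2 * integral {0..y} (%r. (d 0 r)\<^sup>2) <= La / 2 * (y * e)"
    using La by (intro mult_left_mono) auto
   then show ?thesis using evi0[of y] y h0 by (simp add: algebra_simps)
  qed
  have \<Phi>low: "Fi * y <= ?\<Phi> y" if y: "0 <= y" "y <= T1" for y
  proof -
   have "Fi * y = integral {0..y} (%_. Fi)" using y by simp
   also have "... <= ?\<Phi> y"
    using y low by (intro integral_le_negligible[OF _ _ N] p(3)) auto
   finally show ?thesis .
  qed
  have A0: "0 <= ?A"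
  proof -
   have "Fi * (h0 / 2) <= h0 / 2 * (F0 + La * e / 2)"
    by (rule order_trans[OF \<Phi>low[of "h0 / 2"] \<Phi>up[of "h0 / 2"]]) (use h0 in auto)
   then have "0 <= h0 / 2 * ?A" by (simp add: algebra_simps)
   then show ?thesis using h0(1) by (simp add: zero_le_mult_iff)
  qed
  have Dh: "D h <= h\<^sup>2 * ?A + La * integral {0..h} D" if h: "0 < h" "h < h0" for h
  proof -
   have hH: "h < H" using h h0 by simp
   have idi: "((%y. y) has_integral ((h\<^sup>2 - 0\<^sup>2) / 2)) {0..h}" using h by (intro ident_has_integral) simp
   have "integral {0..h} ?\<Phi> <= integral {0..h} (%y. y * (F0 + La * e / 2))"
   proof (rule integral_le)
    show "?\<Phi> integrable_on {0..h}"
     by (intro integrable_continuous_real continuous_on_subset[OF p(1)]) (use h h0 in auto)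
    show "(%y. y * (F0 + La * e / 2)) integrable_on {0..h}" using idi by (intro integrable_cmult_real(2)) auto
   qed (use \<Phi>up h in auto)
   also have "... = h\<^sup>2 / 2 * (F0 + La * e / 2)" using idi by (simp add: integral_unique)
   finally have up: "integral {0..h} ?\<Phi> <= h\<^sup>2 / 2 * (F0 + La * e / 2)" .
   have "D h <= 2 * (h\<^sup>2 / 2 * (F0 + La * e / 2) - Fi * h\<^sup>2 / 2) + La * integral {0..h} D"
   proof -
    have ar: "a <= 2 * (u - f) + 2 * q" if "a / 2 <= c - (x - y) + q" "f <= x - c" "y <= u" for a c x y q u f :: real
     using that by argo
    show ?thesis using ar[OF integrated[OF h(1) hH] lowT[OF h(1) hH] up] by simp
   qed
   also have "2 * (h\<^sup>2 / 2 * (F0 + La * e / 2) - Fi * h\<^sup>2 / 2) = h\<^sup>2 * ?A" by (simp add: field_simps)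
   finally show ?thesis .
  qed
  have "(1 - La * h) * D h <= h\<^sup>2 * ?A" if h: "0 < h" "h < h0" for h
  proof -
   have hH: "h <= H" using h h0 by simp
   obtain ym where ym: "ym : {0..h}" "!!y. y : {0..h} ==> D y <= D ym"
    using continuous_attains_sup[OF compact_Icc _ Dc[OF hH]] h by force
   have "D ym <= h\<^sup>2 * ?A + La * (h * D ym)"
   proof (cases "ym = 0")
    case True
    have "D ym = 0" unfolding True D_def using d(3) by simp
    then show ?thesis using A0 by simp
   next
    case False
    then have y: "0 < ym" "ym < h0" "ym <= h" using ym(1) h by auto
    have "integral {0..ym} D <= integral {0..ym} (%_. D ym)"
     using y ym by (intro integral_le integrable_continuous_real continuous_on_subset[OF Dc[OF hH]]) auto
    also have "... = ym * D ym" using y by simp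
    also have "... <= h * D ym" using y hH by (intro mult_right_mono D0) auto
    finally have "La * integral {0..ym} D <= La * (h * D ym)" using La by (rule mult_left_mono)
    moreover have "ym\<^sup>2 * ?A <= h\<^sup>2 * ?A" using y A0 by (intro mult_right_mono power_mono) auto
    ultimately show ?thesis using Dh[OF y(1,2)] by linarith
   qed
   then have m: "(1 - La * h) * D ym <= h\<^sup>2 * ?A" by (simp add: algebra_simps)
   show ?thesis
   proof (cases "1 - La * h >= 0")
    case True
    then have "(1 - La * h) * D h <= (1 - La * h) * D ym" using ym h by (intro mult_left_mono) auto
    then show ?thesis using m by linarith
   next
    case False
    then have "(1 - La * h) * D h <= 0" using D0[of h] h hH by (simp add: mult_le_0_iff)
    also have "0 <= h\<^sup>2 * ?A" using A0 by simp
    finally show ?thesis .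
   qed
  qed
  then show ?thesis using h0 A0 by blast
 qed
 have chain: "integral {0..h} (%s. d s (s + real j * h)) <= integral {0..real j * h} (%s. d s (s + h))"
  if h: "0 < h" "h <= H" and j: "real j * h <= T" for h j
  using j
 proof (induction j)
  case 0
  then show ?case by (simp add: d(3))
 next
  case (Suc j)
  have jT: "real j * h <= T" "real j * h + h <= T" using Suc.prems h by (auto simp: distrib_right)
  have jn: "0 <= real j * h" using h by simp
  have b: "s : {0..T1}" "s + real j * h : {0..T1}" "s + real j * h + h : {0..T1}" if "s : {0..h}" for s
   using that jT jn h T by (auto simp: H_def)
  have i1: "(%s. d s (s + real j * h)) integrable_on {0..h}"
   by (intro integrable_continuous_real dc continuous_on_add continuous_on_id continuous_on_const) (use b in auto)
  have i2: "(%s. d (s + real j * h) (s + real j * h + h)) integrable_on {0..h}"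
   by (intro integrable_continuous_real dc continuous_on_add continuous_on_id continuous_on_const) (use b in auto)
  have i3: "(%s. d s (s + real j * h + h)) integrable_on {0..h}"
   by (intro integrable_continuous_real dc continuous_on_add continuous_on_id continuous_on_const) (use b in auto)
  have "integral {0..h} (%s. d s (s + real (Suc j) * h)) = integral {0..h} (%s. d s (s + real j * h + h))"
   by (simp add: distrib_right add_ac)
  also have "... <= integral {0..h} (%s. d s (s + real j * h) + d (s + real j * h) (s + real j * h + h))"
   using i1 i2 i3 b by (intro integral_le integrable_add d(4)) auto
  also have "... = integral {0..h} (%s. d s (s + real j * h)) + integral {0..h} (%s. d (s + real j * h) (s + real j * h + h))"
   using i1 i2 by (rule Henstock_Kurzweil_Integration.integral_add)
  also have "integral {0..h} (%s. d (s + real j * h) (s + real j * h + h)) = integral {real j * h..real j * h + h} (%s. d s (s + h))"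
   using shift_integral[of 0 h "%s. d s (s + h)" "real j * h"] by (simp add: add.commute)
  also have "integral {0..h} (%s. d s (s + real j * h)) + ...
    <= integral {0..real j * h} (%s. d s (s + h)) + integral {real j * h..real j * h + h} (%s. d s (s + h))"
   using Suc.IH[OF jT(1)] by simp
  also have "... = integral {0..real j * h + h} (%s. d s (s + h))"
  proof (rule Henstock_Kurzweil_Integration.integral_combine)
   show "(%s. d s (s + h)) integrable_on {0..real j * h + h}"
    by (intro integrable_continuous_real continuous_on_subset[OF Ic[of h]]) (use h jT in auto)
  qed (use jn h in auto)
  finally show ?case by (simp add: distrib_right add_ac)
 qed
 have young: "2 * d 0 T <= 4 * e + th * T + (F0 - Fi + La * e / 2) * (1 + e) / th"
  if e: "e > 0" and th: "th > 0" for e th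
 proof -
  let ?A = "F0 - Fi + La * e / 2"
  obtain h0 where h0: "h0 > 0" "h0 <= H" "0 <= ?A"
   "!!h. 0 < h ==> h < h0 ==> (1 - La * h) * D h <= h\<^sup>2 * ?A" using quad[OF e] by blast
  have near: "\<exists>h1>0. \<forall>t\<in>{0..T1}. \<bar>t - t0\<bar> < h1 --> d t t0 <= e" if t0: "t0 : {0..T1}" for t0
  proof -
   have "\<forall>\<^sub>F t in at t0 within {0..T1}. dist (d t t0) 0 < e" using cont[OF t0] e by (rule tendstoD)
   then obtain h1 where "h1 > 0" "!!t. t : {0..T1} ==> t ~= t0 ==> \<bar>t - t0\<bar> < h1 ==> \<bar>d t t0\<bar> < e"
    unfolding eventually_at by (auto simp: dist_real_def)
   moreover have "d t0 t0 <= e" using d(3) e by simp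
   ultimately show ?thesis by (metis abs_ge_self less_imp_le order.trans)
  qed
  have in1: "0 : {0..T1}" "T : {0..T1}" using T by auto
  obtain h1 where h1: "h1 > 0" "!!t. t : {0..T1} ==> \<bar>t - 0\<bar> < h1 ==> d t 0 <= e" using near[OF in1(1)] by blast
  obtain h2 where h2: "h2 > 0" "!!t. t : {0..T1} ==> \<bar>t - T\<bar> < h2 ==> d t T <= e" using near[OF in1(2)] by blast
  \<comment> \<open>The last bound ensures that (1 + e) (1 - La h) is at least 1 for steps h below m.\<close>
  define m where "m = min (min h0 h1) (min h2 (e / ((1 + e) * (La + 1))))"
  have m: "m > 0" "m <= h0" "m <= h1" "m <= h2" "m <= e / ((1 + e) * (La + 1))"
   using h0 h1 h2 e La by (auto simp: m_def)
  obtain K :: nat where K: "T / m < real K" using reals_Archimedean2 by blast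
  have K0: "real K > 0" using K T m(1) by (smt (verit) divide_pos_pos)
  define h where "h = T / real K"
  have h: "0 < h" "h < m" "real K * h = T"
   using K0 T K m(1) by (auto simp: h_def field_simps)
  have hH: "h <= H" "h < h0" using h m h0 by auto
  have Lah: "1 <= (1 + e) * (1 - La * h)"
  proof -
   have "h * ((1 + e) * (La + 1)) <= e" 
   proof -
    have p: "0 < (1 + e) * (La + 1)" using e La by (intro mult_pos_pos) auto
    have "h <= e / ((1 + e) * (La + 1))" using h(2) m(5) by linarith
    then show ?thesis by (simp only: pos_le_divide_eq[OF p])
   qed
   moreover have "h * ((1 + e) * La) <= h * ((1 + e) * (La + 1))" using h(1) e by (intro mult_left_mono) auto
   ultimately show ?thesis by (simp add: algebra_simps)
  qed
  have DA: "D h <= h\<^sup>2 * (?A * (1 + e))"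
  proof -
   have "1 * D h <= ((1 + e) * (1 - La * h)) * D h" using h(1) hH by (intro mult_right_mono Lah D0) auto
   also have "... = (1 + e) * ((1 - La * h) * D h)" by simp
   also have "... <= (1 + e) * (h\<^sup>2 * ?A)" using e h0(4)[OF h(1) hH(2)] by (intro mult_left_mono) auto
   finally show ?thesis by (simp add: mult_ac)
  qed
  have "h * (d 0 T - 2 * e) = integral {0..h} (%_. d 0 T - 2 * e)" using h by simp
  also have "... <= integral {0..h} (%s. d s (s + real K * h))"
  proof (rule integral_le)
   show "(%s. d s (s + real K * h)) integrable_on {0..h}"
    by (intro integrable_continuous_real dc continuous_on_add continuous_on_id continuous_on_const)
     (use h hH T in \<open>auto simp: H_def\<close>)
   fix s assume s: "s : {0..h}"
   then have b: "s : {0..T1}" "s + T : {0..T1}" using h hH T by (auto simp: H_def)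
   have 1: "d s 0 <= e" using s h m b by (intro h1(2)) auto
   have 2: "d (s + T) T <= e" using s h m b by (intro h2(2)) auto
   have "d 0 T <= d 0 s + (d s (s + T) + d (s + T) T)"
    using d(4)[OF in1(1) b(1) in1(2)] d(4)[OF b in1(2)] by linarith
   then show "d 0 T - 2 * e <= d s (s + real K * h)" using 1 2 d(2)[of 0 s] h(3) by simp
  qed auto
  also have "... <= integral {0..real K * h} (%s. d s (s + h))"
   using chain[OF h(1) hH(1), of K] h(3) by simp
  also have "... <= integral {0..T} (%s. (th * h) / 2 + (d s (s + h))\<^sup>2 * (1 / (2 * (th * h))))"
   unfolding h(3)
  proof (rule integral_le)
   show "(%s. d s (s + h)) integrable_on {0..T}" using Ic[of h] h hH by (intro integrable_continuous_real) auto
   show "(%s. (th * h) / 2 + (d s (s + h))\<^sup>2 * (1 / (2 * (th * h)))) integrable_on {0..T}"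
    using Ii[of h] h hH by (intro integrable_add integrable_cmult_real(2)) auto
   have "x <= c / 2 + x\<^sup>2 * (1 / (2 * c))" if "c > 0" for x c :: real
   proof -
    have "0 <= (x - c)\<^sup>2 / (2 * c)" using that by simp
    also have "... = c / 2 + x\<^sup>2 * (1 / (2 * c)) - x" using that by (simp add: power2_eq_square field_simps)
    finally show ?thesis by simp
   qed
   then show "d s (s + h) <= (th * h) / 2 + (d s (s + h))\<^sup>2 * (1 / (2 * (th * h)))" for s
    using th h(1) by simp
  qed
  also have "... = T * ((th * h) / 2) + D h * (1 / (2 * (th * h)))"

  proof -
   have I: "(%s. (d s (s + h))\<^sup>2) integrable_on {0..T}" using Ii[of h] h hH by simp
   show ?thesis unfolding D_def
    by (subst Henstock_Kurzweil_Integration.integral_add[OF _ integrable_cmult_real(2)[OF I]]) (use T in auto)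
  qed
  also have "... <= T * ((th * h) / 2) + h\<^sup>2 * (?A * (1 + e)) * (1 / (2 * (th * h)))"
   using DA th h(1) by (intro add_left_mono mult_right_mono) auto
  also have "... = h * ((th * T + ?A * (1 + e) / th) / 2)"
   using th h(1) by (simp add: field_simps power2_eq_square)
  finally have "d 0 T - 2 * e <= (th * T + ?A * (1 + e) / th) / 2"
   using h(1) by (simp only: mult_le_cancel_left_pos)
  then show ?thesis by simp
 qed
 have lim: "((%e. 4 * e + th * T + (F0 - Fi + La * e / 2) * (1 + e) / th) \<longlongrightarrow> 4 * 0 + th * T + (F0 - Fi + La * 0 / 2) * (1 + 0) / th) (at_right 0)"
  if "th > 0" for th
  using that by (intro tendsto_intros) auto
 show ?thesis
 proof (rule young_family_bound[OF d(1) T(1)])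
  have "((%e. F0 - Fi + La * e / 2) \<longlongrightarrow> F0 - Fi + La * 0 / 2) (at_right 0)" by (intro tendsto_intros) auto
  moreover have "\<forall>\<^sub>F e in at_right 0. 0 <= F0 - Fi + La * e / 2"
   unfolding eventually_at_right_field using quad by (intro exI[of _ 1]) auto
  ultimately have "0 <= F0 - Fi + La * 0 / 2" by (intro tendsto_lowerbound) auto
  then show "0 <= F0 - Fi" by simp
  fix th :: real assume th: "th > 0"
  have "\<forall>\<^sub>F e in at_right 0. 2 * d 0 T <= 4 * e + th * T + (F0 - Fi + La * e / 2) * (1 + e) / th"
   unfolding eventually_at_right_field using young[OF _ th] by (intro exI[of _ 1]) auto
  then have "2 * d 0 T <= 4 * 0 + th * T + (F0 - Fi + La * 0 / 2) * (1 + 0) / th"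
   by (intro tendsto_lowerbound[OF lim[OF th]]) auto
  then show "2 * d 0 T <= th * T + (F0 - Fi) / th" by simp
 qed
qed

section \<open>Paths in spaces with a semi-inner product\<close>

lemma lebesgue_on_cong_AE_measurable:
 fixes f g :: "'a::euclidean_space => 'b::euclidean_space"
 assumes f: "f : borel_measurable (leb S)" and S: "S : sets lebesgue" and ae: "AE x in leb S. f x = g x"
 shows "g : borel_measurable (leb S)"
proof -
 have "AE x in lebesgue. (if x : S then f x else 0) = (if x : S then g x else 0)"
  using ae S by (auto simp: AE_restrict_space_iff elim: eventually_mono)
 from borel_measurable_AE[OF borel_measurable_if_I[OF f S] this] show ?thesis by (rule borel_measurable_if_D)
qed

lemma lebesgue_on_limit_measurable:
 fixes f :: "nat => 'a::euclidean_space => real"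
 assumes f: "!!k. f k : borel_measurable (leb S)" and S: "S : sets lebesgue"
  and lim: "AE x in leb S. (%k. f k x) \<longlonglongrightarrow> g x"
 shows "g : borel_measurable (leb S)"
proof (rule lebesgue_on_cong_AE_measurable[OF _ S])
 show "(%x. lim (%k. f k x)) : borel_measurable (leb S)" using f by (rule borel_measurable_lim_metric)
 show "AE x in leb S. lim (%k. f k x) = g x" using lim by eventually_elim (rule limI)
qed

lemma sum_squares_bound_twice: "(x + y)\<^sup>2 <= 2 * x\<^sup>2 + 2 * (y::real)\<^sup>2"
 using zero_le_power2[of "x - y"] by (simp add: power2_diff power2_sum)

text \<open>If the leading coefficient vanishes, the linear term has to vanish as well.\<close>

lemma quadratic_nonneg_discriminant:
 fixes A B D :: real
 assumes q: "!!c d. 0 <= c\<^sup>2 * A + 2 * c * d * B + d\<^sup>2 * D"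
 shows "\<bar>B\<bar> <= sqrt A * sqrt D"
proof -
 have A: "A >= 0" and D: "D >= 0" using q[of 1 0] q[of 0 1] by auto
 have "B\<^sup>2 <= A * D"
 proof (cases "D = 0")
  case True
  have "0 <= (- B)\<^sup>2 * A + 2 * (- B) * (A + 1) * B" using q[of "- B" "A + 1"] True by simp
  also have "... = - (B\<^sup>2 * (A + 2))" by (simp add: power2_eq_square algebra_simps)
  finally have "B\<^sup>2 * (A + 2) <= 0" by simp
  then show ?thesis using A True by (simp add: mult_le_0_iff)
 next
  case False
  have "0 <= D\<^sup>2 * A + 2 * D * (- B) * B + (- B)\<^sup>2 * D" by (rule q)
  also have "... = D * (A * D - B\<^sup>2)" by (simp add: power2_eq_square algebra_simps)
  finally show ?thesis using False D by (simp add: zero_le_mult_iff)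
 qed
 then have "sqrt (B\<^sup>2) <= sqrt (A * D)" by (rule real_sqrt_le_mono)
 then show ?thesis by (simp add: real_sqrt_mult)
qed

text \<open>The \<open>L\<^sup>2\<close> product and the Dirichlet form are both used as semi-inner products on spaces of
functions that are not quotiented by null sets.\<close>

locale semi_inner_product =
 fixes V :: "('b => real) set" and a :: "('b => real) => ('b => real) => real"
 assumes lin: "x : V ==> y : V ==> (%p. c * x p + d * y p) : V"
  and form_lin: "x : V ==> y : V ==> z : V ==> a (%p. c * x p + d * y p) z = c * a x z + d * a y z"
  and form_sym: "a x y = a y x" and form_nonneg: "0 <= a x x" and zero: "(%_. 0) : V"
begin

definition N :: "('b => real) => real" where "N x = sqrt (a x x)"

lemma N_nonneg: "0 <= N x" and N_square: "(N x)\<^sup>2 = a x x"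
 using form_nonneg by (auto simp: N_def)

lemma form_square:
 assumes "x : V" "y : V"
 shows "a (%p. c * x p + d * y p) (%p. c * x p + d * y p) = c\<^sup>2 * a x x + 2 * c * d * a x y + d\<^sup>2 * a y y"
proof -
 let ?z = "%p. c * x p + d * y p"
 have "a ?z ?z = c * a ?z x + d * a ?z y"
  using assms lin form_lin by (simp add: form_sym[of x ?z] form_sym[of y ?z])
 also have "... = c * (c * a x x + d * a x y) + d * (c * a x y + d * a y y)"
  using assms form_lin by (simp add: form_sym[of y x])
 finally show ?thesis by (simp add: power2_eq_square algebra_simps)
qed

lemma cauchy_schwarz:
 assumes "x : V" "y : V" shows "\<bar>a x y\<bar> <= N x * N y"
 unfolding N_def
 by (rule quadratic_nonneg_discriminant) (use form_square[OF assms] form_nonneg in metis)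

lemma N_lin:
 assumes "x : V" "y : V" shows "N (%p. c * x p + d * y p) <= \<bar>c\<bar> * N x + \<bar>d\<bar> * N y"
proof (rule power2_le_imp_le)
 have "c * d * a x y <= \<bar>c * d\<bar> * (N x * N y)"
  using mult_mono[OF order_refl cauchy_schwarz[OF assms], of "\<bar>c * d\<bar>"] by (simp add: abs_mult[symmetric])
 then show "(N (%p. c * x p + d * y p))\<^sup>2 <= (\<bar>c\<bar> * N x + \<bar>d\<bar> * N y)\<^sup>2"
  using form_square[OF assms, of c d] by (simp add: N_square power2_sum power_mult_distrib abs_mult mult_ac)
qed (simp add: N_nonneg)

lemma diff: "x : V ==> y : V ==> (%p. x p - y p) : V"
 using lin[of x y 1 "- 1"] by simp

lemma form_diff: "x : V ==> y : V ==> z : V ==> a (%p. x p - y p) z = a x z - a y z"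
 using form_lin[of x y z 1 "- 1"] by simp

lemma N_diff_sym: "x : V ==> y : V ==> N (%p. x p - y p) = N (%p. y p - x p)"
 using form_square[of x y 1 "- 1"] form_square[of y x 1 "- 1"] by (simp add: N_def form_sym[of x y])

lemma N_triangle:
 assumes "x : V" "y : V" "z : V"
 shows "N (%p. x p - z p) <= N (%p. x p - y p) + N (%p. y p - z p)"
 using N_lin[OF diff[OF assms(1,2)] diff[OF assms(2,3)], of 1 1] by simp

lemma N_zero: "N (%_. 0) = 0"
 using form_square[OF zero zero, of 0 0] by (simp add: N_def)

lemma form_young:
 assumes "x : V" "y : V" "et > 0"
 shows "\<bar>a x y\<bar> <= et / 2 * a x x + a y y / (2 * et)"
proof -
 have "0 <= (et * N x - N y)\<^sup>2 / (2 * et)" using assms by simp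
 also have "... = et / 2 * a x x + a y y / (2 * et) - N x * N y"
  using assms(3) by (simp add: power2_diff N_square power_mult_distrib field_simps) (simp add: power2_eq_square algebra_simps N_square)
 finally show ?thesis using cauchy_schwarz[OF assms(1,2)] by linarith
qed

end

lemma indicator_continuous_approximation:
 fixes A :: "real set" and de :: real
 assumes A: "A : sets lebesgue" and de: "de > 0"
 obtains c where "continuous_on UNIV c"
  "integrable (leb {0<..<T}) (%t. (indicator A t - c t)\<^sup>2)" "(LINT t|leb {0<..<T::real}. (indicator A t - c t)\<^sup>2) <= de"
proof -
 let ?M = "leb {0<..<T}"
 have im: "(indicator A :: real => real) : borel_measurable lebesgue" using A by simp
 have "(indicator A :: real => real) measurable_on UNIV"
  using lebesgue_measurable_imp_measurable_on_real[OF im, of UNIV] by simp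
 then obtain N g where N: "negligible N" and g: "!!n. continuous_on UNIV (g n)"
  "!!x. x \<notin> N ==> (%n. g n x) \<longlonglongrightarrow> (indicator A x :: real)" unfolding measurable_on_def by auto
 define c where "c n t = max 0 (min 1 (g n t))" for n :: nat and t
 have cc: "continuous_on UNIV (c n)" for n unfolding c_def using g(1) by (intro continuous_intros)
 have c01: "0 <= c n t" "c n t <= 1" for n t by (auto simp: c_def)
 have bd: "\<bar>(indicator A t - c n t)\<^sup>2\<bar> <= 1" for n t
  using c01[of n t] by (simp add: abs_square_le_1 abs_le_iff indicator_def)
 have m: "(%t. (indicator A t - c n t)\<^sup>2) : borel_measurable ?M" for n
  by (intro borel_measurable_power borel_measurable_diff measurable_restrict_space1[OF im] continuous_measurable_lebesgue_on[OF cc])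
 have ae: "AE t in ?M. (%n. (indicator A t - c n t)\<^sup>2) \<longlonglongrightarrow> 0"
 proof -
  have "AE t in lebesgue. t \<notin> N" using N by (intro AE_not_in) (simp add: negligible_iff_null_sets)
  then have "AE t in ?M. t \<notin> N" by (auto simp: AE_restrict_space_iff elim: eventually_mono)
  then show ?thesis
  proof eventually_elim
   case (elim t)
   have "(%n. (indicator A t - c n t)\<^sup>2) \<longlonglongrightarrow> (indicator A t - max 0 (min 1 (indicator A t)))\<^sup>2"
    unfolding c_def using g(2)[OF elim] by (intro tendsto_intros)
   then show ?case by (simp add: indicator_def split: if_splits)
  qed
 qed
 have one: "integrable ?M (%_. 1::real)"
  using finite_measure.integrable_const[OF lebesgue_on_finite[of "{0<..<T}"]] by simp
 have lim: "(%n. \<integral>t. (indicator A t - c n t)\<^sup>2 \<partial>?M) \<longlonglongrightarrow> (LINT t|?M. 0)"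
  by (rule integral_dominated_convergence[OF _ m one ae]) (use bd in auto)
 have int: "integrable ?M (%t. (indicator A t - c n t)\<^sup>2)" for n
  by (rule Bochner_Integration.integrable_bound[OF one m]) (use bd in auto)
 obtain n where "(LINT t|?M. (indicator A t - c n t)\<^sup>2) < de"
  using order_tendstoD(2)[OF lim, of de] de by (auto simp: eventually_sequentially)
 then show thesis by (intro that[OF cc int[of n]]) simp
qed


text \<open>A path that is Bochner measurable with respect to the seminorm \<open>N\<close>, witnessed by the simple functions \<open>s k\<close>, and
square integrable.\<close>

locale bochner_path = semi_inner_product V a for V :: "('b => real) set" and a +
 fixes T :: real and s :: "nat => real => 'b => real" and u :: "real => 'b => real"
 assumes fin: "finite (s k ` {0<..<T})" and sV: "s k ` {0<..<T} \<subseteq> V"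
  and s_meas: "{t\<in>{0<..<T}. s k t = v} \<in> sets lebesgue"
  and s_lim: "AE t in leb {0<..<T}. (%k. N (%x. s k t x - u t x)) \<longlonglongrightarrow> 0"
  and uV: "AE t in leb {0<..<T}. u t : V"
  and u_fin: "(\<integral>\<^sup>+ t. ennreal ((N (u t))\<^sup>2) \<partial>leb {0<..<T}) < \<infinity>"
begin

abbreviation (input) "MT \<equiv> leb {0<..<T}"

lemma s_measurable: "s k : measurable MT (count_space (s k ` {0<..<T}))"
proof -
 have "s k -` {v} \<inter> space MT : sets MT" for v
 proof -
  have e: "s k -` {v} \<inter> space MT = {t\<in>{0<..<T}. s k t = v}" by auto
  show ?thesis unfolding e using s_meas[of k v] by (subst sets_restrict_space_iff) auto
 qed
 then show ?thesis using fin by (simp add: measurable_count_space_eq2)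
qed

lemma s_compose:
 "(!!v. v : V ==> f v : borel_measurable MT) ==> (%t. f (s k t) t :: real) : borel_measurable MT"
 by (rule measurable_compose_countable'[OF _ s_measurable]) (use sV fin in \<open>auto intro: countable_finite\<close>)

lemma AE_MT: "AE t in MT. t : {0<..<T}"
 by (rule AE_I2) auto

lemma N_distance_measurable:
 assumes ph: "ph : V" shows "(%t. N (%x. u t x - ph x)) : borel_measurable MT"
proof (rule lebesgue_on_limit_measurable)
 show "(%t. N (%x. s k t x - ph x)) : borel_measurable MT" for k by (rule s_compose) simp
 show "AE t in MT. (%k. N (%x. s k t x - ph x)) \<longlonglongrightarrow> N (%x. u t x - ph x)"
  using s_lim uV AE_MT
 proof eventually_elim
  case (elim t)
  have sk: "s k t : V" for k using sV[of k] elim(3) by auto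
  have "norm (N (%x. s k t x - ph x) - N (%x. u t x - ph x)) <= N (%x. s k t x - u t x)" for k
   using N_triangle[OF sk elim(2) ph, of k] N_triangle[OF elim(2) sk ph, of k] N_diff_sym[OF sk elim(2), of k]
   by (simp add: abs_le_iff)
  from Lim_null_comparison[OF always_eventually[OF allI[OF this]] elim(1)] show ?case by (rule LIM_zero_cancel)
 qed
qed simp

lemma N_measurable: "(%t. N (u t)) : borel_measurable MT"
 using N_distance_measurable[OF zero] by simp

text \<open>Polarisation reduces the form to distances.\<close>

lemma form_measurable:
 assumes ph: "ph : V" shows "(%t. a (u t) ph) : borel_measurable MT"
proof (rule lebesgue_on_cong_AE_measurable)
 show "(%t. ((N (u t))\<^sup>2 + (N ph)\<^sup>2 - (N (%x. u t x - ph x))\<^sup>2) / 2) : borel_measurable MT"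
  using N_measurable N_distance_measurable[OF ph] by simp
 show "AE t in MT. ((N (u t))\<^sup>2 + (N ph)\<^sup>2 - (N (%x. u t x - ph x))\<^sup>2) / 2 = a (u t) ph"
  using uV
 proof eventually_elim
  case (elim t)
  then show ?case using form_square[OF elim ph, of 1 "- 1"] by (simp add: N_square)
 qed
qed simp

lemma form_integrable: "integrable MT (%t. a (u t) (u t))"
proof -
 have "integrable MT (%t. (N (u t))\<^sup>2)"
  by (rule integrableI_bounded) (use N_measurable u_fin in auto)
 then show ?thesis by (simp add: N_square)
qed

lemma N_simple_distance_measurable: "(%t. N (%x. s k t x - u t x)) : borel_measurable MT"
proof (rule lebesgue_on_cong_AE_measurable)
 show "(%t. N (%x. u t x - s k t x)) : borel_measurable MT"
  by (rule s_compose[of "%v t. N (%x. u t x - v x)"]) (rule N_distance_measurable)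
 show "AE t in MT. N (%x. u t x - s k t x) = N (%x. s k t x - u t x)"
  using uV AE_MT
 proof eventually_elim
  case (elim t)
  then show ?case using sV[of k] by (intro N_diff_sym) auto
 qed
qed simp

text \<open>The simple functions need not be dominated. Replacing them by 0 wherever their error exceeds \<open>N (u t)\<close> turns
the error into the minimum below, which is dominated.\<close>

lemma simple_approximation:
 assumes de: "de > 0"
 obtains k where "integrable MT (%t. (min (N (%x. s k t x - u t x)) (N (u t)))\<^sup>2)"
  "(LINT t|MT. (min (N (%x. s k t x - u t x)) (N (u t)))\<^sup>2) <= de"
proof -
 let ?D = "%k t. (min (N (%x. s k t x - u t x)) (N (u t)))\<^sup>2"
 have m: "?D k : borel_measurable MT" for k
  using N_simple_distance_measurable N_measurable by (intro borel_measurable_power borel_measurable_min)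
 have w: "integrable MT (%t. (N (u t))\<^sup>2)" using form_integrable by (simp add: N_square)
 have b: "\<bar>?D k t\<bar> <= (N (u t))\<^sup>2" for k t using N_nonneg by (simp add: power_mono)
 have lim: "(%k. \<integral>t. ?D k t \<partial>MT) \<longlonglongrightarrow> (LINT t|MT. 0)"
 proof (rule integral_dominated_convergence[OF _ m w])
  show "AE t in MT. (%k. ?D k t) \<longlonglongrightarrow> 0"
   using s_lim
  proof eventually_elim
   case (elim t)
   have "(%k. ?D k t) \<longlonglongrightarrow> (min 0 (N (u t)))\<^sup>2" using elim by (intro tendsto_intros)
   then show ?case using N_nonneg[of "u t"] by (simp add: min_def)
  qed
 qed (use b in auto)
 have i: "integrable MT (?D k)" for k
  by (rule Bochner_Integration.integrable_bound[OF w m]) (use b in auto)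
 obtain k where "(LINT t|MT. ?D k t) < de"
  using order_tendstoD(2)[OF lim, of de] de by (auto simp: eventually_sequentially)
 then show thesis by (intro that[OF i[of k]]) simp
qed

definition uniformly_continuous_path :: "(real => 'b => real) => bool" where
 "uniformly_continuous_path w \<longleftrightarrow> (\<forall>t. w t : V) \<and>
  (\<forall>et>0. \<exists>h>0. \<forall>r\<in>{0..T}. \<forall>t\<in>{0..T}. \<bar>r - t\<bar> < h --> N (%x. w r x - w t x) <= et)"

text \<open>Indicators of measurable sets of times are approximated by continuous functions, one value of the simple function at a
time.\<close>

lemma step_path_approximation:
 assumes "finite J" "J \<subseteq> V" "!!v. v : J ==> A v : sets lebesgue" "de > 0"
 shows "\<exists>w G. uniformly_continuous_path w \<and> integrable MT G \<and> (LINT t|MT. G t) <= de \<and>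
  (\<forall>t. (%x. \<Sum>v\<in>J. indicator (A v) t * v x) : V \<and> (N (%x. (\<Sum>v\<in>J. indicator (A v) t * v x) - w t x))\<^sup>2 <= G t)"
 using assms
proof (induction arbitrary: de rule: finite_induct)
 case empty
 have "uniformly_continuous_path (%_ _. 0)"
  using zero N_zero by (auto simp: uniformly_continuous_path_def intro!: exI[of _ 1])
 then show ?case using zero N_zero empty.prems(3) by (intro exI[of _ "%_ _. 0"] exI[of _ "%_. 0"]) simp
next
 case (insert v J)
 let ?S = "%t x. \<Sum>v\<in>J. indicator (A v) t * v x"
 have vV: "v : V" using insert.prems by auto
 obtain w G where w: "uniformly_continuous_path w" "integrable MT G" "(LINT t|MT. G t) <= de / 4"
  "!!t. ?S t : V" "!!t. (N (%x. ?S t x - w t x))\<^sup>2 <= G t"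
  using insert.IH[of "de / 4"] insert.prems by auto
 have wV: "w t : V" for t using w(1) by (simp add: uniformly_continuous_path_def)
 have p: "4 * (a v v + 1) > 0" using form_nonneg[of v] by (simp add: add_nonneg_pos)
 have "de / (4 * (a v v + 1)) > 0" using p insert.prems(3) by simp
 from indicator_continuous_approximation[OF _ this, of "A v" T] insert.prems(2)
 obtain c where c: "continuous_on UNIV c" "integrable MT (%t. (indicator (A v) t - c t)\<^sup>2)"
  "(LINT t|MT. (indicator (A v) t - c t)\<^sup>2) <= de / (4 * (a v v + 1))" by blast
 define w' where "w' t x = 1 * w t x + c t * v x" for t x
 define G' where "G' t = 2 * G t + 2 * a v v * (indicator (A v) t - c t)\<^sup>2" for t
 have S: "(\<Sum>v\<in>insert v J. indicator (A v) t * v x) = 1 * ?S t x + indicator (A v) t * v x" for t x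
  unfolding sum.insert[OF insert.hyps] mult_1 by (rule add.commute)
 have 1: "uniformly_continuous_path w'"
  unfolding uniformly_continuous_path_def
 proof (intro conjI allI impI)
  show "w' t : V" for t unfolding w'_def by (rule lin[OF wV vV])
  fix et :: real assume et: "et > 0"
  obtain h1 where h1: "h1 > 0" "!!r t. r : {0..T} ==> t : {0..T} ==> \<bar>r - t\<bar> < h1 ==> N (%x. w r x - w t x) <= et / 2"
   using w(1) et unfolding uniformly_continuous_path_def by (metis half_gt_zero)
  have "uniformly_continuous_on {0..T} c"
   using c(1) by (intro compact_uniformly_continuous) (auto intro: continuous_on_subset)
  moreover have "et / (2 * (N v + 1)) > 0" using et N_nonneg[of v] by (simp add: add_nonneg_pos)
  ultimately obtain h2 where h2: "h2 > 0" "!!r t. r : {0..T} ==> t : {0..T} ==> \<bar>r - t\<bar> < h2 ==> \<bar>c r - c t\<bar> < et / (2 * (N v + 1))"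
   unfolding uniformly_continuous_on_def dist_real_def by blast
  have "N (%x. w' r x - w' t x) <= et" if rt: "r : {0..T}" "t : {0..T}" "\<bar>r - t\<bar> < min h1 h2" for r t
  proof -
   have e: "(%x. w' r x - w' t x) = (%x. 1 * (w r x - w t x) + (c r - c t) * v x)"
    by (simp add: w'_def algebra_simps)
   have "N (%x. w' r x - w' t x) <= N (%x. w r x - w t x) + \<bar>c r - c t\<bar> * N v"
    unfolding e using N_lin[OF diff[OF wV wV] vV, of 1 r t "c r - c t"] by simp
   also have "... <= et / 2 + et / (2 * (N v + 1)) * (N v + 1)"
    using h1(2)[of r t] h2(2)[of r t] rt N_nonneg[of v] by (intro add_mono mult_mono) auto
   also have "... = et" using N_nonneg[of v] by (simp add: field_simps add_nonneg_eq_0_iff)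
   finally show ?thesis .
  qed
  then show "\<exists>h>0. \<forall>r\<in>{0..T}. \<forall>t\<in>{0..T}. \<bar>r - t\<bar> < h --> N (%x. w' r x - w' t x) <= et"
   using h1(1) h2(1) by (intro exI[of _ "min h1 h2"]) auto
 qed
 have 2: "integrable MT G'" unfolding G'_def using w(2) c(2) by simp
 have "(LINT t|MT. G' t) = 2 * (LINT t|MT. G t) + 2 * a v v * (LINT t|MT. (indicator (A v) t - c t)\<^sup>2)"
  unfolding G'_def using w(2) c(2) by simp
 also have "... <= 2 * (de / 4) + 2 * (a v v + 1) * (de / (4 * (a v v + 1)))"
  using c(3) form_nonneg[of v] by (intro add_mono mult_left_mono[OF w(3)] mult_mono) auto
 also have "... = de" using p by (simp add: field_simps)
 finally have 3: "(LINT t|MT. G' t) <= de" .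
 have 4: "(N (%x. (1 * ?S t x + indicator (A v) t * v x) - w' t x))\<^sup>2 <= G' t" for t
 proof -
  have "(%x. (1 * ?S t x + indicator (A v) t * v x) - w' t x) = (%x. 1 * (?S t x - w t x) + (indicator (A v) t - c t) * v x)"
   by (simp add: w'_def algebra_simps)
  then have "(N (%x. (1 * ?S t x + indicator (A v) t * v x) - w' t x))\<^sup>2 <= (N (%x. ?S t x - w t x) + \<bar>indicator (A v) t - c t\<bar> * N v)\<^sup>2"
   using N_lin[OF diff[OF w(4) wV] vV, of 1 t t "indicator (A v) t - c t"] N_nonneg by (intro power_mono) auto
  also have "... <= 2 * (N (%x. ?S t x - w t x))\<^sup>2 + 2 * (\<bar>indicator (A v) t - c t\<bar> * N v)\<^sup>2"
   by (rule sum_squares_bound_twice)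
  also have "... <= G' t" using w(5)[of t] by (simp add: G'_def power_mult_distrib N_square mult_ac)
  finally show ?thesis .
 qed
 show ?case
  unfolding S using 1 2 3 4 lin[OF w(4) vV] by blast
qed

text \<open>This is what makes translations in time continuous in mean, with a uniform modulus for the
approximating path and an integrable error \<open>G\<close>.\<close>

lemma continuous_path_approximation:
 assumes de: "de > 0"
 obtains w G where "uniformly_continuous_path w" "!!t. 0 <= G t" "integrable MT G" "(LINT t|MT. G t) <= de"
  "AE t in MT. a (%x. u t x - w t x) (%x. u t x - w t x) <= G t"
proof -
 let ?D = "%k t. (min (N (%x. s k t x - u t x)) (N (u t)))\<^sup>2"
 obtain k where k: "integrable MT (?D k)" "(LINT t|MT. ?D k t) <= de / 4" using simple_approximation[of "de / 4"] de by auto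
 define J where "J = s k ` {0<..<T}"
 define B where "B = {t\<in>{0<..<T}. N (%x. s k t x - u t x) <= N (u t)}"
 define A where "A v = B \<inter> {t\<in>{0<..<T}. s k t = v}" for v
 have J: "finite J" "J \<subseteq> V" using fin sV by (auto simp: J_def)
 have Am: "A v : sets lebesgue" for v
 proof -
  have "{t \<in> space MT. N (%x. s k t x - u t x) <= N (u t)} \<in> sets MT"
   using N_simple_distance_measurable N_measurable by (rule borel_measurable_le)
  moreover have "{t \<in> space MT. N (%x. s k t x - u t x) <= N (u t)} = B" by (auto simp: B_def)
  ultimately have "B : sets lebesgue" by (simp add: sets_restrict_space_iff)
  then show ?thesis using s_meas[of k v] unfolding A_def by (rule sets.Int)
 qed
 obtain w G where w: "uniformly_continuous_path w" "integrable MT G" "(LINT t|MT. G t) <= de / 4"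
  "!!t. (%x. \<Sum>v\<in>J. indicator (A v) t * v x) : V" "!!t. (N (%x. (\<Sum>v\<in>J. indicator (A v) t * v x) - w t x))\<^sup>2 <= G t"
  using step_path_approximation[OF J Am, of "de / 4" "%v. v"] de by auto
 have wV: "w t : V" for t using w(1) by (simp add: uniformly_continuous_path_def)
 have step: "(%x. \<Sum>v\<in>J. indicator (A v) t * v x) = (if t : B then s k t else (%_. 0))" if t: "t : {0<..<T}" for t
 proof -
  have "(\<Sum>v\<in>J. indicator (A v) t * v x) = (\<Sum>v\<in>J. if v = s k t then (if t : B then v x else 0) else 0)" for x
   using t by (intro sum.cong) (auto simp: A_def indicator_def)
  also have "... x = (if t : B then s k t x else 0)" for x using J(1) t by (simp add: sum.delta J_def)
  finally show ?thesis by auto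
 qed
 have "AE t in MT. a (%x. u t x - w t x) (%x. u t x - w t x) <= 2 * ?D k t + 2 * G t"
  using uV AE_MT
 proof eventually_elim
  case (elim t)
  let ?z = "if t : B then s k t else (%_. 0)"
  have sk: "s k t : V" using sV[of k] elim(2) by auto
  have zV: "?z : V" using sk zero by simp
  have 1: "N (%x. u t x - ?z x) = min (N (%x. s k t x - u t x)) (N (u t))"
   using N_diff_sym[OF elim(1) sk] elim(2) by (auto simp: B_def min_def)
  have 2: "(N (%x. ?z x - w t x))\<^sup>2 <= G t" using w(5)[of t] unfolding step[OF elim(2)] fun_cong[OF step[OF elim(2)]] .
  have "(N (%x. u t x - w t x))\<^sup>2 <= (N (%x. u t x - ?z x) + N (%x. ?z x - w t x))\<^sup>2"
   by (intro power_mono N_triangle[OF elim(1) zV wV] N_nonneg)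
  also have "... <= 2 * (N (%x. u t x - ?z x))\<^sup>2 + 2 * (N (%x. ?z x - w t x))\<^sup>2" by (rule sum_squares_bound_twice)
  also have "... <= 2 * ?D k t + 2 * G t" using 2 by (simp add: 1)
  finally show ?case by (simp add: N_square)
 qed
 moreover have "(LINT t|MT. 2 * ?D k t + 2 * G t) <= de"
  using k w(2,3) by simp
 moreover have "0 <= 2 * ?D k t + 2 * G t" for t using order_trans[OF zero_le_power2 w(5)[of t]] by simp
 ultimately show thesis using that[OF w(1), of "%t. 2 * ?D k t + 2 * G t"] k(1) w(2) by simp
qed

end

section \<open>Weak derivatives in time\<close>

lemma lebesgue_open_interval_integral:
 fixes f :: "real => real"
 assumes "integrable (leb {0<..<T}) f"
 shows "f integrable_on {0..T}" "integral {0..T} f = (LINT t|leb {0<..<T}. f t)"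
proof -
 have "f integrable_on {0<..<T}" using assms by (intro integrable_on_lebesgue_on) auto
 then show "f integrable_on {0..T}" by (simp add: integrable_on_open_interval_real)
 show "integral {0..T} f = (LINT t|leb {0<..<T}. f t)"
  using lebesgue_integral_eq_integral[OF assms] by (simp add: integral_open_interval_real)
qed

lemma AE_lebesgue_on_negligible:
 assumes "AE x in leb S. P x" "S : sets lebesgue"
 obtains N where "negligible N" "!!x. x : S ==> x \<notin> N ==> P x"
proof -
 have "AE x in lebesgue. x : S --> P x" using assms by (simp add: AE_restrict_space_iff)
 then obtain N where "{x \<in> space lebesgue. \<not> (x : S --> P x)} \<subseteq> N" "N : null_sets lebesgue"
  unfolding eventually_ae_filter by blast
 then show thesis by (intro that[of N]) (auto simp: negligible_iff_null_sets)
qed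

lemma continuous_zero_off_negligible:
 fixes F :: "real => real"
 assumes c: "continuous_on {a..b} F" and ab: "a < b" and N: "negligible N"
  and z: "!!x. x : {a<..<b} ==> x \<notin> N ==> F x = 0" and x: "x : {a..b}"
 shows "F x = 0"
proof -
 have c': "continuous_on {a..b} (%x. \<bar>F x\<bar>)" using c by (intro continuous_intros)
 have "integral {a..b} (%x. \<bar>F x\<bar>) = integral {a..b} (%_. 0)"
  by (rule integral_spike[of "N \<union> {a, b}"]) (use N z in auto)
 then have "integral {a..b} (%x. \<bar>F x\<bar>) = 0" by simp
 then have "\<forall>x\<in>{a..b}. \<bar>F x\<bar> = 0" using integral_eq_0_iff[OF c' ab] by simp
 then show ?thesis using x by simp
qed

lemma borel_segment_integral:
 fixes g :: "real => real"
 assumes g: "integrable lborel g" and h: "h > 0"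
 shows "(LINT s|lborel. indicator {0..1} s * (g (x + s * h) * h)) = integral {x..x + h} g"
proof -
 have i: "set_integrable lborel {x..x + h} g"
  unfolding set_integrable_def by (rule integrable_mult_indicator[OF _ g]) simp
 have "integral {x..x + h} g = (LINT z|lborel. indicator {x..x + h} z * g z)"
  using set_borel_integral_eq_integral(2)[OF i] by (simp add: set_lebesgue_integral_def)
 also have "... = h * (LINT s|lborel. indicator {x..x + h} (x + h * s) * g (x + h * s))"
  using lborel_integral_real_affine[of h "%z. indicator {x..x + h} z * g z" x] h by simp
 also have "... = (LINT s|lborel. indicator {0..1} s * (g (x + s * h) * h))"
  unfolding integral_mult_right_zero[symmetric]
 proof (intro Bochner_Integration.integral_cong refl)
  fix s :: real
  have "0 <= h * s \<longleftrightarrow> 0 <= s" "h * s <= h * 1 \<longleftrightarrow> s <= 1"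
   using h by (simp add: zero_le_mult_iff, intro mult_le_cancel_left_pos)
  then have "indicator {x..x + h} (x + h * s) = (indicator {0..1} s :: real)" by (simp add: indicator_def)
  then show "h * (indicator {x..x + h} (x + h * s) * g (x + h * s)) = indicator {0..1} s * (g (x + s * h) * h)"
   by (simp add: mult_ac)
 qed
 finally show ?thesis by simp
qed

text \<open>A weak derivative in time is a weak gradient in dimension one, so the translation identity applies to
almost all starting points; continuity of both sides covers the others.\<close>

lemma weak_derivative_increment:
 fixes f q :: "real => real"
 assumes T: "T > 0" and f: "continuous_on {0..T} f" and q: "q : L2_space {0<..<T}"
  and w: "!!ps. ps : test_functions {0<..<T} ==>
   (LINT t|leb {0<..<T}. deriv ps t * f t) = - (LINT t|leb {0<..<T}. ps t * q t)"
 shows "q integrable_on {0..T}"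
  and "0 <= s ==> s <= t ==> t <= T ==> f t - f s = integral {s..t} q"
proof -
 let ?I = "{0<..<T}"
 have I: "open ?I" "?I : lmeasurable" "?I : sets lebesgue" by auto
 have dd: "deriv ps t = partial_deriv 1 ps t" if "ps : test_functions ?I" for ps :: "real => real" and t
 proof -
  have "ps differentiable (at t)" using test_functionD(1)[OF that, of 1] by simp
  then have "(ps has_real_derivative deriv ps t) (at t)" by (simp add: DERIV_deriv_iff_real_differentiable)
  then have "(*) (deriv ps t) = frechet_derivative ps (at t)"
   unfolding has_field_derivative_def by (rule frechet_derivative_at)
  then have "frechet_derivative ps (at t) 1 = deriv ps t * 1" by (rule fun_cong[OF sym])
  then show ?thesis by (simp add: partial_deriv_def)
 qed
 obtain B where B: "!!t. t : {0..T} ==> \<bar>f t\<bar> <= B"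
  using compact_imp_bounded[OF compact_continuous_image[OF f compact_Icc]] unfolding bounded_iff by fastforce
 have fm: "f : borel_measurable (leb ?I)"
  by (rule continuous_imp_measurable_on_sets_lebesgue) (use f in \<open>auto intro: continuous_on_subset\<close>)
 have fL: "f : L2_space ?I"
  by (rule L2_bounded[OF I(2) fm, of B]) (rule AE_I2, use B in auto)
 have wg: "has_weak_gradient ?I f q"
  unfolding has_weak_gradient_def using q w by (auto simp: dd mult.commute)
 obtain v g where b: "borel_H1 ?I v g" and fv: "AE t in leb ?I. f t = v t" and qg: "AE t in leb ?I. q t = g t"
  using borel_H1_representative[OF I(1) fL wg] by blast
 note B1 = borel_H1D[OF b I(2)]
 obtain N1 where N1: "negligible N1" "!!t. t : ?I ==> t \<notin> N1 ==> f t = v t" using AE_lebesgue_on_negligible[OF fv I(3)] by blast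
 obtain N2 where N2: "negligible N2" "!!t. t : ?I ==> t \<notin> N2 ==> q t = g t" using AE_lebesgue_on_negligible[OF qg I(3)] by blast
 have N2': "negligible (N2 \<union> {0, T})" using N2(1) by simp
 have gi: "g integrable_on {0..T}"
  using integrable_on_subinterval[OF integrable_on_lborel[OF B1(9)]] by simp
 show qi: "q integrable_on {0..T}"
  by (rule integrable_spike[OF gi N2']) (use N2(2) in auto)
 have qg': "integral {x..y} g = integral {x..y} q" if "0 <= x" "y <= T" for x y
  by (rule integral_spike[OF N2']) (use N2(2) that in auto)
 note p = primitive_facts[OF qi]
 let ?Q = "%t. integral {0..t} q"
 have main: "f (x + h) - f x = integral {x..x + h} q" if h: "0 < h" "h < T" and x: "x : {0..T - h}" for x h
 proof -
  let ?A = "{0<..<T - h}"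
  have "AE x in leb ?A. v (x + h) - v x = (LINT s|lborel. indicator {0..1} s * (g (x + s *\<^sub>R h) \<bullet> h))"
  proof (rule translation_identity[OF B1(1,8,3) B1(2,9,4,7) I(1)])
   fix x s :: real assume x: "x : ?A" "s : {0..1}"
   have "s * h <= h" "0 <= s * h" using x h by (auto simp: mult_le_cancel_right1)
   then show "x + s *\<^sub>R h : ?I" using x by auto
  qed auto
  then have "AE x in leb ?A. v (x + h) - v x = integral {x..x + h} g"
   using borel_segment_integral[OF B1(9) h(1)] by simp
  then obtain N3 where N3: "negligible N3" "!!x. x : ?A ==> x \<notin> N3 ==> v (x + h) - v x = integral {x..x + h} g"
   by (rule AE_lebesgue_on_negligible) auto
  define N where "N = N1 \<union> N3 \<union> (+) (- h) ` N1"
  have N: "negligible N" unfolding N_def by (intro negligible_Un negligible_translation N1(1) N3(1))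
  have "(f (x + h) - f x) - (?Q (x + h) - ?Q x) = 0"
  proof (rule continuous_zero_off_negligible[OF _ _ N _ x])
   show "continuous_on {0..T - h} (%x. (f (x + h) - f x) - (?Q (x + h) - ?Q x))"
    by (intro continuous_on_diff continuous_on_compose2[OF f] continuous_on_compose2[OF p(1)] continuous_on_add continuous_on_id continuous_on_const)
     (use h in auto)
   fix y assume y: "y : ?A" "y \<notin> N"
   have "y + h \<notin> N1"
   proof
    assume "y + h : N1"
    then have "- h + (y + h) : (+) (- h) ` N1" by (rule imageI)
    then show False using y(2) by (simp add: N_def)
   qed
   then have "f (y + h) - f y = integral {y..y + h} g"
    using N1(2)[of "y + h"] N1(2)[of y] N3(2)[of y] y h by (auto simp: N_def)
   also have "... = ?Q (y + h) - ?Q y" using qg'[of y "y + h"] p(2)[of y "y + h"] y h by auto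
   finally show "(f (y + h) - f y) - (?Q (y + h) - ?Q y) = 0" by simp
  qed (use h in simp)
  then show ?thesis using p(2)[of x "x + h"] x h by simp
 qed
 show "f t - f s = integral {s..t} q" if st: "0 <= s" "s <= t" "t <= T"
 proof -
  have lt: "f t - f s = integral {s..t} q" if "0 <= s" "s <= t" "t <= T" "t - s < T" for s t
   using main[of "t - s" s] that by (cases "s = t") auto
  let ?m = "(s + t) / 2"
  have "(f ?m - f s) + (f t - f ?m) = integral {s..?m} q + integral {?m..t} q"
   using lt[of s ?m] lt[of ?m t] st T by (simp add: field_simps)
  also have "... = integral {s..t} q"
   by (rule Henstock_Kurzweil_Integration.integral_combine) (use p(3)[of s t] st in auto)
  finally show ?thesis by simp
 qed
qed

section \<open>The mass constrained gradient flow\<close>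

lemma L2_semi_inner_product:
 "semi_inner_product (L2_space U) (%f g. \<integral>x. f x * g x \<partial>leb U)"
proof
 fix x y z :: "'a => real" and c d
 assume xy: "x : L2_space U" "y : L2_space U"
 then show "(%p. c * x p + d * y p) : L2_space U" by (intro L2_add L2_mult)
 assume z: "z : L2_space U"
 have "(LINT p|leb U. (c * x p + d * y p) * z p) = (LINT p|leb U. c * (x p * z p) + d * (y p * z p))"
  by (intro Bochner_Integration.integral_cong) (auto simp: algebra_simps)
 also have "... = c * (LINT p|leb U. x p * z p) + d * (LINT p|leb U. y p * z p)"
  using L2_integrable_mult[OF xy(1) z] L2_integrable_mult[OF xy(2) z] by simp
 finally show "(LINT p|leb U. (c * x p + d * y p) * z p) = c * (LINT p|leb U. x p * z p) + d * (LINT p|leb U. y p * z p)" .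
qed (auto simp: mult.commute L2_space_def)

lemma H1_semi_inner_product:
 assumes "open U" "U : lmeasurable"
 shows "semi_inner_product (H1_space U) (dirichlet_form U)"
 by standard (use H1_lin[OF assms(2)] dirichlet_form_lin[OF assms] dirichlet_form_sym dirichlet_form_nonneg
   has_weak_gradient_const(2)[OF assms, of 0] in auto)

lemma L2_norm_semi_inner_product:
 "semi_inner_product.N (%f g. \<integral>x. f x * g x \<partial>leb U) f = L2_norm U (f :: 'a::euclidean_space => real)"
 unfolding semi_inner_product.N_def[OF L2_semi_inner_product] L2_norm_def by (simp add: power2_eq_square)

text \<open>A solution on a finite time interval. The bound \<open>R\<close> holds for every time, so only the values of the potential on
\<open>[- R, R]\<close> matter, where it is semiconvex and Lipschitz.\<close>

locale constrained_flow =
 fixes U :: "'a::euclidean_space set" and W :: "real => real" and ep T R K La :: real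
  and s :: "nat => real => 'a => real" and u :: "real => 'a => real"
 assumes U: "open U" "U : lmeasurable" "measure lebesgue U = 1"
  and pos: "0 < T" "0 <= R" "0 <= K" "0 <= La"
  and Wc: "continuous_on UNIV W" "continuous_on UNIV (deriv W)"
  and W_bd: "\<bar>p\<bar> <= R ==> \<bar>deriv W p\<bar> <= K"
  and W_lip: "\<bar>p\<bar> <= R ==> \<bar>p'\<bar> <= R ==> \<bar>W p - W p'\<bar> <= K * \<bar>p - p'\<bar>"
  and W'_lip: "\<bar>p\<bar> <= R ==> \<bar>p'\<bar> <= R ==> \<bar>deriv W p - deriv W p'\<bar> <= La * \<bar>p - p'\<bar>"
  and W_semiconvex: "\<bar>p\<bar> <= R ==> \<bar>p'\<bar> <= R ==> W p + deriv W p * (p' - p) <= W p' + La / 2 * (p - p')\<^sup>2"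
  and u_L2: "t : {0..T} ==> u t : L2_space U"
  and u_cont: "t0 : {0..T} ==> ((%t. L2_norm U (%x. u t x - u t0 x)) \<longlongrightarrow> 0) (at t0 within {0..T})"
  and u_bd: "t : {0..T} ==> AE x in leb U. \<bar>u t x\<bar> <= R"
  and path: "bochner_path (H1_space U) (dirichlet_form U) T s u"
  and weak: "ph : H1_space U ==> ps : test_functions {0<..<T} ==>
   (LINT t|leb {0<..<T}. deriv ps t * (LINT x|leb U. u t x * ph x)) =
   - (LINT t|leb {0<..<T}. ps t * (- ep\<^sup>2 * dirichlet_form U (u t) ph - (LINT x|leb U. deriv W (u t x) * ph x)
     + (LINT x|leb U. deriv W (u t x)) * (LINT x|leb U. ph x)))"
begin

sublocale L: semi_inner_product "L2_space U" "%f g. \<integral>x. f x * g x \<partial>leb U"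
 by (rule L2_semi_inner_product)
sublocale H: bochner_path "H1_space U" "dirichlet_form U" T s u
 by (rule path)

text \<open>The time derivative of \<open>u\<close> as a functional. The last summand is the Lagrange multiplier for a domain of unit volume.\<close>

definition force :: "('a => real) => real => real" where
 "force ph t = - ep\<^sup>2 * dirichlet_form U (u t) ph - (LINT x|leb U. deriv W (u t x) * ph x)
  + (LINT x|leb U. deriv W (u t x)) * (LINT x|leb U. ph x)"

definition energy :: "('a => real) => real" where
 "energy v = ep\<^sup>2 / 2 * dirichlet_form U v v + (LINT x|leb U. W (v x))"

definition range_lipschitz :: "(real => real) => real => bool" where
 "range_lipschitz h c \<longleftrightarrow> continuous_on UNIV h \<and> c >= 0 \<and>
  (\<forall>p p'. \<bar>p\<bar> <= R --> \<bar>p'\<bar> <= R --> \<bar>h p - h p'\<bar> <= c * \<bar>p - p'\<bar>)"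

lemma range_lipschitz_W: "range_lipschitz W K" and range_lipschitz_W': "range_lipschitz (deriv W) La"
 and range_lipschitz_id: "range_lipschitz (%p. p) 1"
 using Wc W_lip W'_lip pos by (auto simp: range_lipschitz_def)

lemma one: "(%_. 1 :: real) : L2_space U" "(%_. 1) : H1_space U"
 using has_weak_gradient_const(2)[OF U(1,2), of 1] H1_L2[OF has_weak_gradient_const(2)[OF U(1,2), of 1]] by auto

lemma Lnorm: "L.N = L2_norm U"
 by (rule ext) (rule L2_norm_semi_inner_product)

lemma compose_L2:
 assumes h: "range_lipschitz h c"
  and v: "v : L2_space U" "AE x in leb U. \<bar>v x\<bar> <= R"
 shows "(%x. h (v x) :: real) : L2_space U"
proof -
 have hc: "continuous_on UNIV h" using h by (simp add: range_lipschitz_def)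
 obtain B where B: "!!p. p : {- R..R} ==> \<bar>h p\<bar> <= B"
  using compact_imp_bounded[OF compact_continuous_image[OF continuous_on_subset[OF hc subset_UNIV] compact_Icc]]
  unfolding bounded_iff by fastforce
 show ?thesis
 proof (rule L2_bounded[OF U(2)])
 show "(%x. h (v x)) : borel_measurable (leb U)"
  using continuous_borel[OF hc] L2_measurable[OF v(1)] by simp
 show "AE x in leb U. norm (h (v x)) <= B"
  using v(2) by eventually_elim (use B in \<open>simp add: abs_le_iff\<close>)
qed
qed

lemma compose_distance:
 assumes h: "range_lipschitz h c"
  and v: "v : L2_space U" "AE x in leb U. \<bar>v x\<bar> <= R"
  and w: "w : L2_space U" "AE x in leb U. \<bar>w x\<bar> <= R"
 shows "L2_norm U (%x. h (v x) - h (w x) :: real) <= c * L2_norm U (%x. v x - w x)"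
proof -
 have "(LINT x|leb U. (norm (h (v x) - h (w x)))\<^sup>2) <= (LINT x|leb U. c\<^sup>2 * (norm (v x - w x))\<^sup>2)"
 proof (rule integral_mono_AE)
  show "integrable (leb U) (%x. (norm (h (v x) - h (w x)))\<^sup>2)"
   by (intro L2_integrable_square L2_diff compose_L2[OF h] v w)
  show "integrable (leb U) (%x. c\<^sup>2 * (norm (v x - w x))\<^sup>2)"
   by (intro Bochner_Integration.integrable_mult_right L2_integrable_square L2_diff v w)
  show "AE x in leb U. (norm (h (v x) - h (w x)))\<^sup>2 <= c\<^sup>2 * (norm (v x - w x))\<^sup>2"
   using v(2) w(2)
  proof eventually_elim
   case (elim x)
   then have "\<bar>h (v x) - h (w x)\<bar> <= c * \<bar>v x - w x\<bar>" using h by (simp add: range_lipschitz_def)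
   from power_mono[OF this, of 2] show ?case by (simp add: power_mult_distrib)
  qed
 qed
 then have "sqrt (LINT x|leb U. (norm (h (v x) - h (w x)))\<^sup>2) <= sqrt (c\<^sup>2 * (LINT x|leb U. (norm (v x - w x))\<^sup>2))"
  by (intro real_sqrt_le_mono) simp
 then show ?thesis using h by (simp add: L2_norm_def real_sqrt_mult range_lipschitz_def)
qed

lemma pairing_continuous:
 assumes h: "range_lipschitz h c"
  and ph: "ph : L2_space U"
 shows "continuous_on {0..T} (%t. \<integral>x. h (u t x) * ph x \<partial>leb U)"
 unfolding continuous_on_def
proof
 fix t0 assume t0: "t0 : {0..T}"
 note hL = compose_L2[OF h u_L2 u_bd]
 have bnd: "norm ((LINT x|leb U. h (u t x) * ph x) - (LINT x|leb U. h (u t0 x) * ph x))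
   <= c * L2_norm U (%x. u t x - u t0 x) * L2_norm U ph" if t: "t : {0..T}" for t
 proof -
  have "norm ((LINT x|leb U. h (u t x) * ph x) - (LINT x|leb U. h (u t0 x) * ph x))
    = \<bar>\<integral>x. (h (u t x) - h (u t0 x)) * ph x \<partial>leb U\<bar>"
   using L.form_diff[OF hL[OF t t] hL[OF t0 t0] ph] by simp
  also have "... <= L.N (%x. h (u t x) - h (u t0 x)) * L.N ph"
   by (rule L.cauchy_schwarz[OF L2_diff[OF hL[OF t t] hL[OF t0 t0]] ph])
  also have "... <= c * L2_norm U (%x. u t x - u t0 x) * L.N ph"
   unfolding Lnorm using compose_distance[OF h u_L2[OF t] u_bd[OF t] u_L2[OF t0] u_bd[OF t0]] L.N_nonneg[of ph]
   by (intro mult_right_mono) (simp_all add: Lnorm)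
  finally show ?thesis by (simp add: Lnorm)
 qed
 have "((%t. c * L2_norm U (%x. u t x - u t0 x) * L2_norm U ph) \<longlongrightarrow> c * 0 * L2_norm U ph) (at t0 within {0..T})"
  by (intro tendsto_intros u_cont[OF t0])
 then have lim0: "((%t. c * L2_norm U (%x. u t x - u t0 x) * L2_norm U ph) \<longlongrightarrow> 0) (at t0 within {0..T})" by simp
 have "\<forall>\<^sub>F t in at t0 within {0..T}. norm ((LINT x|leb U. h (u t x) * ph x) - (LINT x|leb U. h (u t0 x) * ph x))
   <= c * L2_norm U (%x. u t x - u t0 x) * L2_norm U ph"
  unfolding eventually_at_filter by (intro always_eventually allI impI bnd)
 from LIM_zero_cancel[OF Lim_null_comparison[OF this lim0]]
 show "((%t. \<integral>x. h (u t x) * ph x \<partial>leb U) \<longlongrightarrow> (LINT x|leb U. h (u t0 x) * ph x)) (at t0 within {0..T})" .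
qed

lemmas W'_pairing_continuous = pairing_continuous[OF range_lipschitz_W']
lemmas W_pairing_continuous = pairing_continuous[OF range_lipschitz_W]
lemmas u_pairing_continuous = pairing_continuous[OF range_lipschitz_id]

lemma continuous_L2_interval: "continuous_on {0..T} (f :: real => real) ==> f : L2_space {0<..<T}"
proof -
 assume f: "continuous_on {0..T} f"
 obtain B where "!!t. t : {0..T} ==> \<bar>f t\<bar> <= B"
  using compact_imp_bounded[OF compact_continuous_image[OF f compact_Icc]] unfolding bounded_iff by fastforce
 then show ?thesis
  using continuous_imp_measurable_on_sets_lebesgue[OF continuous_on_subset[OF f greaterThanLessThan_subseteq_atLeastAtMost_iff[THEN iffD2]]]
  by (intro L2_bounded[of _ _ B] AE_I2) auto
qed

lemma force_L2:
 assumes ph: "ph : H1_space U" shows "force ph : L2_space {0<..<T}"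
proof -
 note m = H.form_measurable[OF ph]
 have "integrable H.MT (%t. (norm (dirichlet_form U (u t) ph))\<^sup>2)"
 proof (rule Bochner_Integration.integrable_bound)
  show "integrable H.MT (%t. dirichlet_form U (u t) (u t) * dirichlet_form U ph ph)"
   using H.form_integrable by simp
  show "AE t in H.MT. norm ((norm (dirichlet_form U (u t) ph))\<^sup>2) <= norm (dirichlet_form U (u t) (u t) * dirichlet_form U ph ph)"
   using H.uV
  proof eventually_elim
   case (elim t)
   show ?case using power_mono[OF H.cauchy_schwarz[OF elim ph] abs_ge_zero, of 2]
    by (simp add: power_mult_distrib H.N_square H.form_nonneg)
  qed
 qed (use m in simp)
 then have "(%t. dirichlet_form U (u t) ph) : L2_space {0<..<T}" using m by (simp add: L2_space_def)
 moreover have "(%t. \<integral>x. deriv W (u t x) * ph x \<partial>leb U) : L2_space {0<..<T}"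
  "(%t. \<integral>x. deriv W (u t x) \<partial>leb U) : L2_space {0<..<T}"
  using W'_pairing_continuous[OF H1_L2[OF ph]] W'_pairing_continuous[OF one(1)] by (auto intro!: continuous_L2_interval)
 ultimately have "(%t. (- ep\<^sup>2 * dirichlet_form U (u t) ph - (LINT x|leb U. deriv W (u t x) * ph x))
  + (LINT x|leb U. ph x) * (LINT x|leb U. deriv W (u t x))) : L2_space {0<..<T}"
  by (intro L2_add L2_diff L2_mult)
 then show ?thesis by (simp add: force_def[abs_def] mult.commute)
qed

lemma increment:
 assumes ph: "ph : H1_space U"
 shows "force ph integrable_on {0..T}"
  and "0 <= r ==> r <= t ==> t <= T ==>
   (LINT x|leb U. u t x * ph x) - (LINT x|leb U. u r x * ph x) = integral {r..t} (force ph)"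
 using weak_derivative_increment[OF pos(1) u_pairing_continuous[OF H1_L2[OF ph]] force_L2[OF ph]]
  weak[OF ph, folded force_def] by blast+

lemma dirichlet_one: "dirichlet_form U v (%_. 1) = 0"
proof -
 have "AE x in leb U. weak_gradient U (%_. 1) x = 0"
  by (rule weak_gradient_AE[OF U(1,2) has_weak_gradient_const(1)[OF U(1,2)]])
 then show ?thesis unfolding dirichlet_form_def
  by (intro integral_eq_zero_AE) (auto elim: eventually_mono)
qed

text \<open>Test with the constant function 1: its gradient vanishes and the multiplier cancels the reaction term.\<close>

lemma mass_conserved:
 assumes t: "t : {0..T}"
 shows "(LINT x|leb U. u t x) = (LINT x|leb U. u 0 x)"
proof -
 have "force (%_. 1) r = 0" for r
  using U(3) U(1) by (simp add: force_def dirichlet_one measure_restrict_space)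
 then show ?thesis using increment(2)[OF one(2), of 0 t] t by (simp cong: integral_cong)
qed

end

lemma le_of_small_multiples:
 fixes x y C :: real
 assumes "!!th. th > 0 ==> x <= y + th * C"
 shows "x <= y"
proof (rule field_le_epsilon)
 fix e :: real assume e: "e > 0"
 have p: "0 < \<bar>C\<bar> + 1" by simp
 have "x <= y + e / (\<bar>C\<bar> + 1) * C" using e p by (intro assms) simp
 also have "e / (\<bar>C\<bar> + 1) * C <= e / (\<bar>C\<bar> + 1) * (\<bar>C\<bar> + 1)" using e p by (intro mult_left_mono) auto
 also have "... = e" using p by simp
 finally show "x <= y + e" by simp
qed

lemma integral_subinterval_le:
 fixes f :: "real => real"
 assumes "f integrable_on {0..T}" "!!r. 0 <= f r" "0 <= s" "t <= T"
 shows "integral {s..t} f <= integral {0..T} f"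
 using assms primitive_facts(3)[OF assms(1,3,4)] by (intro integral_subset_le) auto

context constrained_flow begin

lemma potential_convexity:
 assumes v: "v : L2_space U" "AE x in leb U. \<bar>v x\<bar> <= R"
  and w: "w : L2_space U" "AE x in leb U. \<bar>w x\<bar> <= R"
 shows "(LINT x|leb U. W (w x)) + (LINT x|leb U. deriv W (w x) * (v x - w x))
  <= (LINT x|leb U. W (v x)) + La / 2 * (L2_norm U (%x. w x - v x))\<^sup>2"
proof -
 note i = L2_integrable[OF U(2) compose_L2[OF range_lipschitz_W w]] L2_integrable[OF U(2) compose_L2[OF range_lipschitz_W v]]
  L2_integrable_mult[OF compose_L2[OF range_lipschitz_W' w] L2_diff[OF v(1) w(1)]]
  L2_integrable_square[OF L2_diff[OF w(1) v(1)]]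
 have "(LINT x|leb U. W (w x) + deriv W (w x) * (v x - w x)) <= (LINT x|leb U. W (v x) + La / 2 * (norm (w x - v x))\<^sup>2)"
 proof (rule integral_mono_AE)
  show "AE x in leb U. W (w x) + deriv W (w x) * (v x - w x) <= W (v x) + La / 2 * (norm (w x - v x))\<^sup>2"
   using v(2) w(2) by eventually_elim (use W_semiconvex in simp)
 qed (use i in simp_all)
 then show ?thesis using i by (simp add: L2_norm_def)
qed

text \<open>Convexity of the Dirichlet energy and semiconvexity of the potential at time \<open>r\<close>, tested with the value of \<open>u\<close> at
the later time \<open>t\<close>. The error \<open>a (u r) (u r - u t)\<close> is not small pointwise; it is split through the
continuous approximation \<open>w\<close>, which leaves terms that are small after integration in time.\<close>

lemma force_bound:
 assumes r: "r : {0..T}" "u r : H1_space U" and t: "t : {0..T}" "u t : H1_space U"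
  and v: "v : H1_space U" "AE x in leb U. \<bar>v x\<bar> <= R" "(LINT x|leb U. v x) = (LINT x|leb U. u 0 x)"
  and w: "w r : H1_space U" "w t : H1_space U" "H.N (%x. w r x - w t x) <= th" and th: "th > 0"
  and G: "dirichlet_form U (%x. u r x - w r x) (%x. u r x - w r x) <= G r"
   "dirichlet_form U (%x. u t x - w t x) (%x. u t x - w t x) <= G t"
  and close: "L2_norm U (%x. u t x - u r x) <= th"
 shows "force (%x. u t x - v x) r <= energy v - energy (u r) + La / 2 * (L2_norm U (%x. u r x - v x))\<^sup>2 + K * th
  + ep\<^sup>2 * (3 * th / 2 * dirichlet_form U (u r) (u r) + G r / (2 * th) + th / 2) + ep\<^sup>2 * (G t / (2 * th))"
proof -
 let ?a = "dirichlet_form U"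
 have vL: "v : L2_space U" by (rule H1_L2[OF v(1)])
 have mass: "(LINT x|leb U. u t x - v x) = 0"
  using L2_integrable[OF U(2) u_L2[OF t(1)]] L2_integrable[OF U(2) vL] v(3) mass_conserved[OF t(1)] by simp
 have b: "(%x. u r x - w r x) : H1_space U" "(%x. u t x - w t x) : H1_space U" "(%x. w r x - w t x) : H1_space U"
  by (intro H.diff r t w)+
 have fd: "?a (u r) (%p. x p - y p) = ?a (u r) x - ?a (u r) y" if "x : H1_space U" "y : H1_space U" for x y
  using H.form_diff[OF that r(2)]
  by (simp only: H.form_sym[of x "u r"] H.form_sym[of y "u r"] H.form_sym[of "%p. x p - y p" "u r"])
 have sp: "?a (u r) (u r) - ?a (u r) (u t) = ?a (u r) (%x. u r x - w r x) - ?a (u r) (%x. u t x - w t x) + ?a (u r) (%x. w r x - w t x)"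
  unfolding fd[OF r(2) w(1)] fd[OF t(2) w(2)] fd[OF w(1,2)] by simp
 have y1: "?a (u r) (%x. u r x - w r x) <= th / 2 * ?a (u r) (u r) + G r / (2 * th)"
  using H.form_young[OF r(2) b(1) th] divide_right_mono[OF G(1), of "2 * th"] th by simp
 have y2: "- ?a (u r) (%x. u t x - w t x) <= th / 2 * ?a (u r) (u r) + G t / (2 * th)"
  using H.form_young[OF r(2) b(2) th] divide_right_mono[OF G(2), of "2 * th"] th by simp
 have "(H.N (%x. w r x - w t x))\<^sup>2 <= th\<^sup>2" using w(3) H.N_nonneg by (intro power_mono) auto
 then have "?a (%x. w r x - w t x) (%x. w r x - w t x) / (2 * th) <= th\<^sup>2 / (2 * th)"
  using th by (intro divide_right_mono) (simp_all add: H.N_square)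
 also have "... = th / 2" using th by (simp add: power2_eq_square)
 finally have y3: "?a (u r) (%x. w r x - w t x) <= th / 2 * ?a (u r) (u r) + th / 2"
  using H.form_young[OF r(2) b(3) th] by simp
 have y4: "?a (u r) v <= ?a (u r) (u r) / 2 + ?a v v / 2"
  using H.form_young[OF r(2) v(1), of 1] by simp
 have "- ?a (u r) (%x. u t x - v x) = ?a (u r) v - ?a (u r) (u t)"
  unfolding fd[OF t(2) v(1)] by simp
 also have "... <= ?a v v / 2 - ?a (u r) (u r) / 2 + (3 * th / 2 * ?a (u r) (u r) + G r / (2 * th) + th / 2) + G t / (2 * th)"
  using sp y1 y2 y3 y4 by argo
 finally have dir: "ep\<^sup>2 * (- ?a (u r) (%x. u t x - v x)) <= ep\<^sup>2 * ..." by (rule mult_left_mono) simp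
 note W'L = compose_L2[OF range_lipschitz_W' u_L2[OF r(1)] u_bd[OF r(1)]]
 have d: "(%x. u t x - u r x) : L2_space U" "(%x. v x - u r x) : L2_space U" by (intro L2_diff u_L2 r t vL)+
 have "(LINT x|leb U. deriv W (u r x) * (u t x - v x))
   = (LINT x|leb U. deriv W (u r x) * (u t x - u r x) - deriv W (u r x) * (v x - u r x))"
  by (intro Bochner_Integration.integral_cong) (auto simp: algebra_simps)
 also have "... = (LINT x|leb U. deriv W (u r x) * (u t x - u r x)) - (LINT x|leb U. deriv W (u r x) * (v x - u r x))"
  by (intro Bochner_Integration.integral_diff L2_integrable_mult W'L d)
 finally have split: "- (LINT x|leb U. deriv W (u r x) * (u t x - v x))
   = - (LINT x|leb U. deriv W (u r x) * (u t x - u r x)) + (LINT x|leb U. deriv W (u r x) * (v x - u r x))" by simp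
 have "L2_norm U (%x. deriv W (u r x)) <= K"
 proof -
  have "(LINT x|leb U. (norm (deriv W (u r x)))\<^sup>2) <= (LINT x|leb U. K\<^sup>2)"
  proof (rule integral_mono_AE)
   show "AE x in leb U. (norm (deriv W (u r x)))\<^sup>2 <= K\<^sup>2"
    using u_bd[OF r(1)]
   proof eventually_elim
    case (elim x)
    show ?case using W_bd[OF elim] by (intro power_mono) auto
   qed
   show "integrable (leb U) (%_. K\<^sup>2)" using finite_measure.integrable_const[OF lebesgue_on_finite[OF U(2)]] .
  qed (rule L2_integrable_square[OF W'L])
  then have "sqrt (LINT x|leb U. (norm (deriv W (u r x)))\<^sup>2) <= sqrt (K\<^sup>2)"
   using U(1,3) by (intro real_sqrt_le_mono) (simp add: measure_restrict_space)
  then show ?thesis using pos by (simp add: L2_norm_def)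
 qed
 then have "- (LINT x|leb U. deriv W (u r x) * (u t x - u r x)) <= K * th"
  using L.cauchy_schwarz[OF W'L d(1)] mult_mono[OF _ close, of "L2_norm U (%x. deriv W (u r x))" K] pos(3) L.N_nonneg
  by (simp add: Lnorm abs_le_iff)
 moreover have "(LINT x|leb U. deriv W (u r x) * (v x - u r x)) <=
   (LINT x|leb U. W (v x)) - (LINT x|leb U. W (u r x)) + La / 2 * (L2_norm U (%x. u r x - v x))\<^sup>2"
  using potential_convexity[OF vL v(2) u_L2[OF r(1)] u_bd[OF r(1)]] by argo
 ultimately have pot: "- (LINT x|leb U. deriv W (u r x) * (u t x - v x)) <= K * th +
   ((LINT x|leb U. W (v x)) - (LINT x|leb U. W (u r x)) + La / 2 * (L2_norm U (%x. u r x - v x))\<^sup>2)"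
  unfolding split by (rule add_mono)
 have "force (%x. u t x - v x) r = ep\<^sup>2 * (- ?a (u r) (%x. u t x - v x)) + (- (LINT x|leb U. deriv W (u r x) * (u t x - v x)))"
  unfolding force_def mass by simp
 also note add_mono[OF dir pot]
 finally show ?thesis unfolding energy_def by (simp add: algebra_simps)
qed

lemma distance_continuous:
 assumes "continuous_on S f" "continuous_on S g" "!!x. x : S ==> f x : {0..T} \<and> g x : {0..T}"
 shows "continuous_on S (%x. L2_norm U (%y. u (f x) y - u (g x) y))"
 by (rule pseudometric_continuous[where I = "{0..T}" and d = "%r t. L2_norm U (%y. u r y - u t y)", OF _ _ _ u_cont assms])
  (use L.N_triangle[OF u_L2 u_L2 u_L2] in \<open>simp_all add: Lnorm L2_norm_def power2_commute\<close>)

lemma distance_to_continuous: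
 assumes v: "v : L2_space U"
 shows "continuous_on {0..T} (%t. L2_norm U (%x. u t x - v x))"
 unfolding continuous_on_def
proof
 fix t0 assume t0: "t0 : {0..T}"
 have bnd: "norm (L2_norm U (%x. u t x - v x) - L2_norm U (%x. u t0 x - v x)) <= L2_norm U (%x. u t x - u t0 x)"
  if t: "t : {0..T}" for t
  using L.N_triangle[OF u_L2[OF t] u_L2[OF t0] v] L.N_triangle[OF u_L2[OF t0] u_L2[OF t] v] L.N_diff_sym[OF u_L2[OF t] u_L2[OF t0]]
  by (simp add: Lnorm abs_le_iff)
 have "\<forall>\<^sub>F t in at t0 within {0..T}. norm (L2_norm U (%x. u t x - v x) - L2_norm U (%x. u t0 x - v x)) <= L2_norm U (%x. u t x - u t0 x)"
  unfolding eventually_at_filter by (intro always_eventually allI impI bnd)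
 from LIM_zero_cancel[OF Lim_null_comparison[OF this u_cont[OF t0]]]
 show "((%t. L2_norm U (%x. u t x - v x)) \<longlongrightarrow> L2_norm U (%x. u t0 x - v x)) (at t0 within {0..T})" .
qed

lemma energy_integrable: "(%t. energy (u t)) integrable_on {0..T}"
proof -
 have "(%t. \<integral>x. W (u t x) \<partial>leb U) integrable_on {0..T}"
  using W_pairing_continuous[OF one(1)] by (intro integrable_continuous_real) simp
 then show ?thesis unfolding energy_def
  by (intro integrable_add integrable_cmult_real(1) lebesgue_open_interval_integral(1)[OF H.form_integrable])
qed

text \<open>Uniform continuity of the distance on the compact time square.\<close>

lemma uniform_closeness:
 assumes "th > 0"
 obtains h where "h > 0" "!!r t. r : {0..T} ==> t : {0..T} ==> \<bar>r - t\<bar> < h ==> L2_norm U (%x. u t x - u r x) <= th"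
proof -
 let ?d = "%z. L2_norm U (%x. u (fst z) x - u (snd z) x)"
 have "continuous_on ({0..T} \<times> {0..T}) ?d"
  by (rule distance_continuous) (auto intro: continuous_on_fst continuous_on_snd continuous_on_id)
 then have "uniformly_continuous_on ({0..T} \<times> {0..T}) ?d"
  by (intro compact_uniformly_continuous compact_Times) auto
 then obtain h where h: "h > 0"
  "!!z z'. z : {0..T} \<times> {0..T} ==> z' : {0..T} \<times> {0..T} ==> dist z' z < h ==> dist (?d z') (?d z) < th"
  using assms unfolding uniformly_continuous_on_def by blast
 have z: "L2_norm U (%x. u t x - u t x) = 0" for t by (simp add: L2_norm_def)
 show thesis
 proof (rule that[OF h(1)])
  fix r t assume rt: "r : {0..T}" "t : {0..T}" "\<bar>r - t\<bar> < h"
  have "dist (t, r) (t, t) < h" using rt(3) by (simp add: dist_prod_def dist_real_def)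
  then have "dist (?d (t, r)) (?d (t, t)) < th" using rt by (intro h(2)) auto
  then show "L2_norm U (%x. u t x - u r x) <= th" unfolding dist_real_def fst_conv snd_conv z by simp
 qed
qed

text \<open>The increment of half the squared distance over a step is at most the pairing of the displacement with
\<open>u - v\<close> at the end of the step, which by the weak equation is the integral of the force. Summing up with
the increment inequality leaves an error proportional to \<open>th\<close>, which is arbitrary. The approximation error
\<open>th\<^sup>2\<close> of the path is chosen because it is divided by \<open>th\<close> in Young's inequality.\<close>

theorem evolution_variational_inequality:
 assumes v: "v : H1_space U" "AE x in leb U. \<bar>v x\<bar> <= R" "(LINT x|leb U. v x) = (LINT x|leb U. u 0 x)"
  and st: "0 <= z" "z <= t" "t < T"
 shows "(L2_norm U (%x. u t x - v x))\<^sup>2 / 2 - (L2_norm U (%x. u z x - v x))\<^sup>2 / 2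
  <= (t - z) * energy v - integral {z..t} (%r. energy (u r)) + La / 2 * integral {z..t} (%r. (L2_norm U (%x. u r x - v x))\<^sup>2)"
proof -
 let ?a = "dirichlet_form U"
 let ?n = "%t. (L2_norm U (%x. u t x - v x))\<^sup>2 / 2" and ?\<alpha> = "%r. ?a (u r) (u r)"
 define I0 where "I0 r = energy v - energy (u r) + La / 2 * (L2_norm U (%x. u r x - v x))\<^sup>2" for r
 define A where "A = integral {0..T} ?\<alpha>"
 have vL: "v : L2_space U" by (rule H1_L2[OF v(1)])
 have dc: "continuous_on {0..T} (%r. (L2_norm U (%x. u r x - v x))\<^sup>2)"
  by (intro continuous_on_power distance_to_continuous[OF vL])
 have di: "(%r. (L2_norm U (%x. u r x - v x))\<^sup>2) integrable_on {0..T}" by (rule integrable_continuous_real[OF dc])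
 have I0: "I0 integrable_on {0..T}" unfolding I0_def
  by (intro integrable_add integrable_diff integrable_cmult_real(1) energy_integrable di integrable_const_ivl)
 have \<alpha>: "?\<alpha> integrable_on {0..T}" by (rule lebesgue_open_interval_integral(1)[OF H.form_integrable])
 obtain N1 where N1: "negligible N1" "!!t. t : {0<..<T} ==> t \<notin> N1 ==> u t : H1_space U"
  using AE_lebesgue_on_negligible[OF H.uV] by auto
 have cst: "((%_. c) has_integral (t - z) * c) {z..t}" for c :: real using has_integral_const_real[of c z t] st by simp
 have main: "?n t - ?n z <= integral {z..t} I0 + th * (K * T + ep\<^sup>2 * (3 / 2 * A + T / 2 + 1))" if th: "th > 0" for th
 proof -
  have t2: "th\<^sup>2 > 0" using th by simp
  obtain w G where w: "H.uniformly_continuous_path w" "!!t. 0 <= G t" "integrable H.MT G" "(LINT t|H.MT. G t) <= th\<^sup>2"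
   "AE t in H.MT. ?a (%x. u t x - w t x) (%x. u t x - w t x) <= G t"
   by (rule H.continuous_path_approximation[OF t2]) (rule that)
  have wH: "w t : H1_space U" for t using w(1) by (simp add: H.uniformly_continuous_path_def)
  obtain h1 where h1: "h1 > 0" "!!r t. r : {0..T} ==> t : {0..T} ==> \<bar>r - t\<bar> < h1 ==> H.N (%x. w r x - w t x) <= th"
   using w(1) th unfolding H.uniformly_continuous_path_def by blast
  obtain h2 where h2: "h2 > 0" "!!r t. r : {0..T} ==> t : {0..T} ==> \<bar>r - t\<bar> < h2 ==> L2_norm U (%x. u t x - u r x) <= th"
   by (rule uniform_closeness[OF th]) blast
  obtain N2 where N2: "negligible N2" "!!t. t : {0<..<T} ==> t \<notin> N2 ==> ?a (%x. u t x - w t x) (%x. u t x - w t x) <= G t"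
   using AE_lebesgue_on_negligible[OF w(5)] by auto
  have G: "G integrable_on {0..T}" "integral {0..T} G <= th\<^sup>2"
   using lebesgue_open_interval_integral[OF w(3)] w(4) by auto
  define N where "N = N1 \<union> N2 \<union> {0, T}"
  have N: "negligible N" unfolding N_def by (intro negligible_Un N1(1) N2(1)) simp
  define P where "P r = I0 r + K * th + ep\<^sup>2 * (3 * th / 2 * ?\<alpha> r + 1 / (2 * th) * G r + th / 2)" for r
  define Q where "Q r = ep\<^sup>2 * (1 / (2 * th) * G r)" for r
  have P: "P integrable_on {0..T}" and Q: "Q integrable_on {0..T}"
   unfolding P_def Q_def by (intro integrable_add integrable_cmult_real(1) I0 \<alpha> G(1) integrable_const_ivl)+
  have "?n t - ?n z <= integral {z..t} P + integral {z..t} Q"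
  proof (rule increment_inequality[OF _ P Q N st, of _ "min h1 h2"])
   show "continuous_on {0..T} ?n" by (intro continuous_on_divide dc continuous_on_const) simp
   fix h r assume h: "0 < h" "h < min h1 h2" "r : {z..t}" "r + h <= T" "r + h \<notin> N"
   let ?ph = "%x. u (r + h) x - v x"
   have rh: "r : {0..T}" "r + h : {0..T}" "r + h : {0<..<T}" using h st by (auto simp: N_def)
   have uH: "u (r + h) : H1_space U" using N1(2)[OF rh(3)] h(5) by (simp add: N_def)
   have ph: "?ph : H1_space U" by (rule H.diff[OF uH v(1)])
   have "?n (r + h) - ?n r <= (LINT x|leb U. u (r + h) x * ?ph x) - (LINT x|leb U. u r x * ?ph x)"
   proof -
    note d = L2_diff[OF u_L2[OF rh(2)] vL] L2_diff[OF u_L2[OF rh(1)] vL]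
    note i = L2_integrable_square[OF d(1)] L2_integrable_square[OF d(2)]
    have e: "(LINT x|leb U. u (r + h) x * ?ph x) - (LINT x|leb U. u r x * ?ph x) = (LINT x|leb U. (u (r + h) x - u r x) * ?ph x)"
     using L.form_diff[OF u_L2[OF rh(2)] u_L2[OF rh(1)] H1_L2[OF ph]] by simp
    have "?n (r + h) - ?n r = (LINT x|leb U. (norm (u (r + h) x - v x))\<^sup>2 / 2 - (norm (u r x - v x))\<^sup>2 / 2)"
     using i by (simp add: L2_norm_def)
    also have "... <= (LINT x|leb U. (u (r + h) x - u r x) * ?ph x)"
    proof (rule integral_mono)
     fix x
     have "(p - q) * (p - c) - (p - c)\<^sup>2 / 2 + (q - c)\<^sup>2 / 2 = (p - q)\<^sup>2 / 2" for p q c :: real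
      by (simp add: power2_eq_square field_simps)
     from this[of "u (r + h) x" "u r x" "v x"] zero_le_power2[of "u (r + h) x - u r x"]
     show "(norm (u (r + h) x - v x))\<^sup>2 / 2 - (norm (u r x - v x))\<^sup>2 / 2 <= (u (r + h) x - u r x) * ?ph x"
      by (simp only: real_norm_def power2_abs)
    next
     show "integrable (leb U) (%x. (u (r + h) x - u r x) * ?ph x)"
      by (intro L2_integrable_mult L2_diff u_L2 rh vL)
    qed (use i in simp)
    finally show ?thesis unfolding e .
   qed
   also have "... = integral {r..r + h} (force ?ph)"
    by (rule increment(2)[OF ph]) (use rh h in auto)
   also have "... <= integral {r..r + h} (%ro. P ro + Q (r + h))"
   proof (rule integral_le_negligible[OF _ _ N])
    show "force ?ph integrable_on {r..r + h}" by (rule primitive_facts(3)[OF increment(1)[OF ph]]) (use rh in auto)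
    show "(%ro. P ro + Q (r + h)) integrable_on {r..r + h}"
     by (intro integrable_add primitive_facts(3)[OF P] integrable_const_ivl) (use rh in auto)
    fix ro assume ro: "ro : {r..r + h} - N"
    have ro': "ro : {0..T}" "ro : {0<..<T}" "ro \<notin> N1" "ro \<notin> N2" "\<bar>ro - (r + h)\<bar> < h1" "\<bar>ro - (r + h)\<bar> < h2"
     using ro rh h by (auto simp: N_def)
    have hN: "r + h \<notin> N2" using h(5) by (simp add: N_def)
    from force_bound[OF ro'(1) N1(2)[OF ro'(2,3)] rh(2) uH v wH wH h1(2)[OF ro'(1) rh(2) ro'(5)] th
      N2(2)[OF ro'(2,4)] N2(2)[OF rh(3) hN] h2(2)[OF ro'(1) rh(2) ro'(6)]]
    show "force ?ph ro <= P ro + Q (r + h)" by (simp add: P_def Q_def I0_def)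
   qed
   also have "... = integral {r..r + h} P + h * Q (r + h)"
    using primitive_facts(3)[OF P, of r "r + h"] rh h
    by (subst Henstock_Kurzweil_Integration.integral_add) auto
   finally show "?n (r + h) - ?n r <= integral {r..r + h} P + h * Q (r + h)" .
  qed (use h1(1) h2(1) in simp)
  also have "integral {z..t} P = integral {z..t} I0 + (t - z) * (K * th) + ep\<^sup>2 * (3 * th / 2 * integral {z..t} ?\<alpha> + 1 / (2 * th) * integral {z..t} G + (t - z) * (th / 2))"
  proof -
   note i = primitive_facts(3)[OF I0, of z t] primitive_facts(3)[OF \<alpha>, of z t] primitive_facts(3)[OF G(1), of z t]
   have "(P has_integral (integral {z..t} I0 + (t - z) * (K * th) + ep\<^sup>2 * (3 * th / 2 * integral {z..t} ?\<alpha> + 1 / (2 * th) * integral {z..t} G + (t - z) * (th / 2)))) {z..t}"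
    unfolding P_def
    by (intro has_integral_add has_integral_mult_right integrable_integral i cst) (use st in auto)
   then show ?thesis by (rule integral_unique)
  qed
  also have "integral {z..t} Q = ep\<^sup>2 * (1 / (2 * th) * integral {z..t} G)" unfolding Q_def by simp
  finally have *: "?n t - ?n z <= integral {z..t} I0 + (t - z) * (K * th) +
    ep\<^sup>2 * (3 * th / 2 * integral {z..t} ?\<alpha> + 1 / (2 * th) * integral {z..t} G + (t - z) * (th / 2)) + ep\<^sup>2 * (1 / (2 * th) * integral {z..t} G)" .
  have "integral {z..t} G <= th\<^sup>2" using integral_subinterval_le[OF G(1) w(2), of z t] G(2) st by simp
  then have g: "1 / (2 * th) * integral {z..t} G <= th / 2"
   using mult_left_mono[of "integral {z..t} G" "th\<^sup>2" "1 / (2 * th)"] th by (simp add: power2_eq_square)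
  have al: "3 * th / 2 * integral {z..t} ?\<alpha> <= 3 * th / 2 * A" unfolding A_def
   using th st by (intro mult_left_mono integral_subinterval_le[OF \<alpha>] H.form_nonneg) auto
  have tt: "(t - z) * c <= T * c" if "c >= 0" for c using st that by (intro mult_right_mono) auto
  have "?n t - ?n z <= integral {z..t} I0 + T * (K * th) + ep\<^sup>2 * (3 * th / 2 * A + th / 2 + T * (th / 2)) + ep\<^sup>2 * (th / 2)"
   by (rule order_trans[OF *]) (intro add_mono mult_left_mono order_refl g al tt; use th pos in simp)
  also have "... = integral {z..t} I0 + th * (K * T + ep\<^sup>2 * (3 / 2 * A + T / 2 + 1))"
   by (simp add: algebra_simps)
  finally show ?thesis .
 qed
 have "?n t - ?n z <= integral {z..t} I0" by (rule le_of_small_multiples[OF main])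
 also have "... = (t - z) * energy v - integral {z..t} (%r. energy (u r)) + La / 2 * integral {z..t} (%r. (L2_norm U (%x. u r x - v x))\<^sup>2)"
 proof (rule integral_unique)
  note i = primitive_facts(3)[OF energy_integrable, of z t] primitive_facts(3)[OF di, of z t]
  show "(I0 has_integral (t - z) * energy v - integral {z..t} (%r. energy (u r)) + La / 2 * integral {z..t} (%r. (L2_norm U (%x. u r x - v x))\<^sup>2)) {z..t}"
   unfolding I0_def
   by (intro has_integral_add has_integral_diff has_integral_mult_right integrable_integral i cst) (use st in auto)
 qed
 finally show ?thesis .
qed

end

text \<open>The variational inequality with \<open>v = u r\<close> is the hypothesis of the abstract displacement estimate.\<close>

theorem (in constrained_flow) displacement_bound:
 assumes T0: "0 < T0" "T0 < T" and u0: "u 0 : H1_space U"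
  and low: "!!v. v : H1_space U ==> AE x in leb U. \<bar>v x\<bar> <= R ==>
   (LINT x|leb U. v x) = (LINT x|leb U. u 0 x) ==> Fi <= energy v"
 shows "(L2_norm U (%x. u T0 x - u 0 x))\<^sup>2 <= T0 * (energy (u 0) - Fi)"
proof -
 let ?d = "%r t. L2_norm U (%x. u t x - u r x)"
 obtain N1 where N1: "negligible N1" "!!t. t : {0<..<T} ==> t \<notin> N1 ==> u t : H1_space U"
  using AE_lebesgue_on_negligible[OF H.uV] by auto
 define N where "N = N1 \<union> {0, T}"
 have N: "negligible N" "!!t. t : {0..T} - N ==> u t : H1_space U"
  using N1 by (auto simp: N_def)
 have sym: "?d r t = ?d t r" for r t by (simp add: L2_norm_def power2_commute)
 have self: "?d t t = 0" for t by (simp add: L2_norm_def)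
 have evi: "(?d r t)\<^sup>2 / 2 <= (t - r) * energy (u r) - integral {r..t} (%t. energy (u t)) + La / 2 * integral {r..t} (%t. (?d r t)\<^sup>2)"
  if "r : {0..T}" "u r : H1_space U" "r <= t" "t < T" for r t
  using evolution_variational_inequality[OF that(2) u_bd[OF that(1)] mass_conserved[OF that(1)] _ that(3,4)] that(1)
  by (simp only: self) simp
 show ?thesis
 proof (rule evi_displacement[where d = ?d and N = N, OF T0])
  show "0 <= ?d r t" for r t unfolding Lnorm[symmetric] by (rule L.N_nonneg)
  show "?d r t <= ?d r q + ?d q t" if "r : {0..T}" "q : {0..T}" "t : {0..T}" for r q t
   using L.N_triangle[OF u_L2[OF that(3)] u_L2[OF that(2)] u_L2[OF that(1)]] by (simp add: Lnorm)
  show "((%t. ?d t t0) \<longlongrightarrow> 0) (at t0 within {0..T})" if "t0 : {0..T}" for t0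
   using u_cont[OF that] by (simp add: sym[of _ t0])
  show "Fi <= energy (u t)" if "t : {0..T} - N" for t
   using that by (intro low N u_bd mass_conserved) auto
  show "(?d r t)\<^sup>2 / 2 <= (t - r) * energy (u r) - integral {r..t} (%t. energy (u t)) + La / 2 * integral {r..t} (%t. (?d r t)\<^sup>2)"
   if "r : {0..T} - N" "r <= t" "t < T" for r t
   using that by (intro evi N) auto
  show "integral {0..t} (%t. energy (u t)) <= t * energy (u 0) + La / 2 * integral {0..t} (%t. (?d 0 t)\<^sup>2)" if "0 <= t" "t < T" for t
  proof -
   have "0 <= (?d 0 t)\<^sup>2 / 2" by simp
   also have "... <= (t - 0) * energy (u 0) - integral {0..t} (%t. energy (u t)) + La / 2 * integral {0..t} (%t. (?d 0 t)\<^sup>2)"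
    using pos by (intro evi u0 that) auto
   finally show ?thesis by simp
  qed
 qed (use N energy_integrable pos sym self in simp_all)
qed

text \<open>Completeness of Lebesgue measure makes non-measurability invariant as well, and then both integrals are 0.\<close>

lemma lebesgue_on_integral_cong_AE:
 fixes f g :: "'a::euclidean_space => real"
 assumes S: "S : sets lebesgue" and ae: "AE x in leb S. f x = g x"
 shows "(LINT x|leb S. f x) = (LINT x|leb S. g x)"
proof (cases "f : borel_measurable (leb S)")
 case True
 then show ?thesis using lebesgue_on_cong_AE_measurable[OF True S ae] ae by (intro integral_cong_AE)
next
 case False
 have "AE x in leb S. g x = f x" using ae by eventually_elim simp
 then have "g \<notin> borel_measurable (leb S)" using False lebesgue_on_cong_AE_measurable[OF _ S] by blast
 then show ?thesis using False by (metis borel_measurable_integrable not_integrable_integral_eq)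
qed

text \<open>Null sets for the Lebesgue measure of a product are contained in Borel null sets, to which Fubini
applies.\<close>

lemma AE_product_slices:
 fixes P :: "real => 'a::euclidean_space => bool"
 assumes I: "open I" and U: "open U" and ae: "AE z in leb (I \<times> U). case z of (t, x) => P t x"
 shows "AE t in leb I. AE x in leb U. P t x"
proof -
 have s: "I \<times> U : sets lebesgue" "I : sets lebesgue" "U : sets lebesgue" using I U open_Times[OF I U] by (auto intro: lborelD)
 have "AE z in lborel. z : I \<times> U --> (case z of (t, x) => P t x)"
  using ae s(1) by (simp add: AE_restrict_space_iff AE_completion_iff)
 then have "AE z in lborel \<Otimes>\<^sub>M lborel. z : I \<times> U --> (case z of (t, x) => P t x)"
  unfolding lborel_prod .
 from lborel_pair.AE_pair[OF this]
 have "AE t in lborel. t : I --> (AE x in lborel. x : U --> P t x)"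
 proof eventually_elim
  case (elim t)
  show ?case by (intro impI, use elim in eventually_elim) auto
 qed
 then show ?thesis using s by (simp add: AE_restrict_space_iff AE_completion_iff)
qed

text \<open>The part of \<open>v\<close> exceeding \<open>R\<close> is dominated by the distance to any function bounded by \<open>R\<close>.\<close>

lemma L2_limit_bounded:
 fixes v :: "'a::euclidean_space => real"
 assumes U: "U : lmeasurable" and v: "v : L2_space U" and R: "R >= 0"
  and approx: "!!de. de > 0 ==> \<exists>w\<in>L2_space U. (AE x in leb U. \<bar>w x\<bar> <= R) \<and> L2_norm U (%x. w x - v x) <= de"
 shows "AE x in leb U. \<bar>v x\<bar> <= R"
proof -
 let ?e = "%x. (max 0 (\<bar>v x\<bar> - R))\<^sup>2"
 have i: "integrable (leb U) ?e"
 proof (rule Bochner_Integration.integrable_bound[OF L2_integrable_square[OF v]])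
  show "AE x in leb U. norm (?e x) <= norm ((norm (v x))\<^sup>2)"
  proof (intro AE_I2)
   fix x
   have "(max 0 (\<bar>v x\<bar> - R))\<^sup>2 <= \<bar>v x\<bar>\<^sup>2" using R by (intro power_mono) auto
   then show "norm (?e x) <= norm ((norm (v x))\<^sup>2)" by simp
  qed
 qed (use L2_measurable[OF v] in simp)
 have le: "(LINT x|leb U. ?e x) <= 0 + de" if de: "de > 0" for de :: real
 proof -
  have sd: "sqrt de > 0" using de by simp
  obtain w where w: "w : L2_space U" "AE x in leb U. \<bar>w x\<bar> <= R" "L2_norm U (%x. w x - v x) <= sqrt de"
   using approx[OF sd] by blast
  have "(LINT x|leb U. ?e x) <= (LINT x|leb U. (norm (w x - v x))\<^sup>2)"
  proof (rule integral_mono_AE[OF i L2_integrable_square[OF L2_diff[OF w(1) v]]])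
   show "AE x in leb U. ?e x <= (norm (w x - v x))\<^sup>2"
    using w(2) by eventually_elim (rule power_mono, auto)
  qed
  also have "... <= de" using w(3) by (simp add: L2_norm_def)
  finally show ?thesis by simp
 qed
 have "(LINT x|leb U. ?e x) = 0"
  using field_le_epsilon[OF le] by (intro antisym Bochner_Integration.integral_nonneg) auto
 then have "AE x in leb U. ?e x = 0"
  using integral_nonneg_eq_0_iff_AE[OF i] by simp
 then show ?thesis by eventually_elim (simp add: max_def split: if_splits)
qed

lemma admissible_potential_constants:
 assumes W: "admissible_potential W" and R: "R >= 0"
 obtains K La where "K >= 0" "La >= 0"
  "!!p. \<bar>p\<bar> <= R ==> \<bar>deriv W p\<bar> <= K"
  "!!p p'. \<bar>p\<bar> <= R ==> \<bar>p'\<bar> <= R ==> \<bar>W p - W p'\<bar> <= K * \<bar>p - p'\<bar>"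
  "!!p p'. \<bar>p\<bar> <= R ==> \<bar>p'\<bar> <= R ==> \<bar>deriv W p - deriv W p'\<bar> <= La * \<bar>p - p'\<bar>"
  "!!p p'. \<bar>p\<bar> <= R ==> \<bar>p'\<bar> <= R ==> W p + deriv W p * (p' - p) <= W p' + La / 2 * (p - p')\<^sup>2"
proof -
 note w = admissible_potentialD[OF W]
 have bd: "\<exists>B\<ge>0. \<forall>p\<in>{- R..R}. \<bar>f p\<bar> <= B" if "continuous_on UNIV f" for f :: "real => real"
 proof -
  have "bounded (f ` {- R..R})"
   by (rule compact_imp_bounded[OF compact_continuous_image[OF continuous_on_subset[OF that subset_UNIV] compact_Icc]])
  then obtain B where B: "\<forall>p\<in>{- R..R}. \<bar>f p\<bar> <= B" unfolding bounded_iff by auto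
  then have "0 <= B" using R abs_ge_zero[of "f 0"] by (meson atLeastAtMost_iff neg_le_0_iff_le order_trans)
  then show ?thesis using B by blast
 qed
 obtain K where K: "K >= 0" "!!p. p : {- R..R} ==> \<bar>deriv W p\<bar> <= K" using bd[OF w(5)] by blast
 obtain L where L: "L >= 0" "!!p. p : {- R..R} ==> \<bar>deriv (deriv W) p\<bar> <= L" using bd[OF w(4)] by blast
 have mv: "\<bar>f p - f p'\<bar> <= B * \<bar>p - p'\<bar>"
  if f: "!!q. (f has_real_derivative g q) (at q)" "!!q. q : S ==> \<bar>g q\<bar> <= B" and p: "p : S" "p' : S" "convex S"
  for f g B p p' S
  using field_differentiable_bound[OF p(3), of f g B p' p] that(1,2) p
  by (simp add: has_field_derivative_at_within abs_minus_commute)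
 show thesis
 proof (rule that[of K "2 * L"])
  fix p p' assume p: "\<bar>p\<bar> <= R" "\<bar>p'\<bar> <= R"
  then have pI: "p : {- R..R}" "p' : {- R..R}" by auto
  show "\<bar>W p - W p'\<bar> <= K * \<bar>p - p'\<bar>" by (rule mv[OF w(2) K(2) pI]) auto
  have l: "\<bar>deriv W p - deriv W p'\<bar> <= L * \<bar>p - p'\<bar>" by (rule mv[OF w(3) L(2) pI]) auto
  also have "... <= 2 * L * \<bar>p - p'\<bar>" using L(1) by (intro mult_right_mono) auto
  finally show "\<bar>deriv W p - deriv W p'\<bar> <= 2 * L * \<bar>p - p'\<bar>" .
  let ?S = "closed_segment p p'"
  have S: "?S \<subseteq> {- R..R}" using pI by (intro closed_segment_subset) auto
  have "\<bar>(W p' - deriv W p * p') - (W p - deriv W p * p)\<bar> <= L * \<bar>p - p'\<bar> * \<bar>p' - p\<bar>"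
  proof (rule mv[where S = ?S and g = "%q. deriv W q - deriv W p"])
   show "((%q. W q - deriv W p * q) has_real_derivative deriv W q - deriv W p) (at q)" for q
    using DERIV_diff[OF w(2)[of q] DERIV_cmult[OF DERIV_ident, of "deriv W p"]] by simp
   fix q assume q: "q : ?S"
   have "\<bar>deriv W q - deriv W p\<bar> <= L * \<bar>q - p\<bar>" by (rule mv[OF w(3) L(2)]) (use q S pI in auto)
   also have "... <= L * \<bar>p - p'\<bar>" using segment_bound1[OF q] L(1) by (intro mult_left_mono) (auto simp: abs_minus_commute)
   finally show "\<bar>deriv W q - deriv W p\<bar> <= L * \<bar>p - p'\<bar>" .
  qed auto
  also have "L * \<bar>p - p'\<bar> * \<bar>p' - p\<bar> = 2 * L / 2 * (p - p')\<^sup>2"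
   by (simp add: abs_minus_commute[of p' p] power2_eq_square abs_mult_self_eq mult.assoc)
  finally show "W p + deriv W p * (p' - p) <= W p' + 2 * L / 2 * (p - p')\<^sup>2"
   by (simp add: abs_le_iff algebra_simps)
 qed (use K L in \<open>simp_all add: abs_le_iff\<close>)
qed

text \<open>The essential bound in space and time gives a bound at almost every time, and continuity in \<open>L\<^sup>2\<close> extends it to all
times.\<close>

lemma solution_constrained_flow:
 fixes U :: "'a::euclidean_space set"
 assumes U: "open U" "U : lmeasurable" "measure lebesgue U = 1" and W: "admissible_potential W"
  and sol: "nonlocal_AC_solution U W ep u0 u" and ep: "ep > 0" and T: "T > 0"
 obtains R K La s where "constrained_flow U W ep T R K La s u"
proof -
 let ?I = "{0<..<T}"
 have L2: "u t : L2_space U" if "t >= 0" for t using sol that by (simp add: nonlocal_AC_solution_def)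
 have cont: "((%t. L2_norm U (%x. u t x - u t0 x)) \<longlongrightarrow> 0) (at t0 within {0..T})" if "t0 >= 0" for t0
  by (rule tendsto_within_subset[of _ _ _ "{0..}"]) (use sol that in \<open>auto simp: nonlocal_AC_solution_def\<close>)
 note sT = sol[unfolded nonlocal_AC_solution_def, THEN conjunct2, THEN conjunct2, THEN conjunct2, THEN spec[of _ T], THEN mp, OF T]
 note Linf = sT[THEN conjunct1] and boch = sT[THEN conjunct2, THEN conjunct1]
 obtain F where F: "has_time_derivative U T u F" "AE t in leb ?I. \<forall>ph\<in>H1_space U.
       F t ph = - ep\<^sup>2 * dirichlet_form U (u t) ph - (LINT x|leb U. deriv W (u t x) * ph x)
        + ep * lagrange_multiplier U W ep (u t) * (LINT x|leb U. ph x)"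
  using sT[THEN conjunct2, THEN conjunct2, folded dirichlet_form_def] by (elim exE conjE) (rule that)
 have lag: "ep * lagrange_multiplier U W ep v = (LINT x|leb U. deriv W (v x))" for v
  using ep U(3) by (simp add: lagrange_multiplier_def)
 obtain K0 where "AE z in leb (?I \<times> U). case z of (t, x) => \<bar>u t x\<bar> <= K0"
  using Linf by (auto simp: Linf_space_def case_prod_beta)
 from AE_product_slices[OF _ U(1) this] have "AE t in leb ?I. AE x in leb U. \<bar>u t x\<bar> <= K0" by simp
 then obtain N where N: "negligible N" "!!t. t : ?I ==> t \<notin> N ==> AE x in leb U. \<bar>u t x\<bar> <= K0"
  by (rule AE_lebesgue_on_negligible) auto
 define R where "R = max K0 0"
 have bd: "AE x in leb U. \<bar>u t0 x\<bar> <= R" if t0: "t0 : {0..T}" for t0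
 proof (rule L2_limit_bounded[OF U(2) L2])
  fix de :: real assume de: "de > 0"
  have "\<forall>\<^sub>F t in at t0 within {0..T}. dist (L2_norm U (%x. u t x - u t0 x)) 0 < de"
   using cont[of t0] t0 de by (intro tendstoD) auto
  then obtain h where h: "h > 0" "\<forall>t\<in>{0..T}. t ~= t0 \<and> dist t t0 < h --> dist (L2_norm U (%x. u t x - u t0 x)) 0 < de"
   unfolding eventually_at by (elim exE conjE) (rule that)
  define p q where "p = max 0 (t0 - h)" and "q = min T (t0 + h)"
  have pq: "p < q" "0 <= p" "q <= T" "t0 - h <= p" "q <= t0 + h" using t0 T h(1) by (auto simp: p_def q_def)
  have "\<not> {p<..<q} \<subseteq> N \<union> {t0}"
  proof
   assume "{p<..<q} \<subseteq> N \<union> {t0}"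
   then have n: "negligible {p<..<q}" by (rule negligible_subset[rotated]) (use N(1) in simp)
   have "(p + q) / 2 : {p<..<q}" using pq(1) by simp
   then have "{p<..<q} ~= {}" by (metis empty_iff)
   from open_not_negligible[OF open_greaterThanLessThan this] n show False by (rule notE)
  qed
  then obtain t where t: "t : {p<..<q}" "t \<notin> N" "t ~= t0" by blast
  have tI: "t : ?I" "t : {0..T}" "dist t t0 < h" using t(1) pq by (auto simp: dist_real_def)
  have "AE x in leb U. \<bar>u t x\<bar> <= R"
   using N(2)[OF tI(1) t(2)] by eventually_elim (simp add: R_def)
  moreover have "L2_norm U (%x. u t x - u t0 x) <= de"
   using bspec[OF h(2) tI(2)] t(3) tI(3) by (simp add: dist_real_def abs_less_iff)
  ultimately show "\<exists>w\<in>L2_space U. (AE x in leb U. \<bar>w x\<bar> <= R) \<and> L2_norm U (%x. w x - u t0 x) <= de"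
   using L2[of t] tI(2) by auto
 qed (use t0 in \<open>auto simp: R_def\<close>)
 have R0: "R >= 0" by (simp add: R_def)
 obtain K La where c: "K >= 0" "La >= 0"
  "!!p. \<bar>p\<bar> <= R ==> \<bar>deriv W p\<bar> <= K"
  "!!p p'. \<bar>p\<bar> <= R ==> \<bar>p'\<bar> <= R ==> \<bar>W p - W p'\<bar> <= K * \<bar>p - p'\<bar>"
  "!!p p'. \<bar>p\<bar> <= R ==> \<bar>p'\<bar> <= R ==> \<bar>deriv W p - deriv W p'\<bar> <= La * \<bar>p - p'\<bar>"
  "!!p p'. \<bar>p\<bar> <= R ==> \<bar>p'\<bar> <= R ==> W p + deriv W p * (p' - p) <= W p' + La / 2 * (p - p')\<^sup>2"
  by (rule admissible_potential_constants[OF W R0]) blast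
 obtain s where s: "!!k. finite (s k ` ?I)" "!!k. s k ` ?I \<subseteq> H1_space U" "!!k v. {t\<in>?I. s k t = v} \<in> sets lebesgue"
  "AE t in leb ?I. (%k. H1_norm U (%x. s k t x - u t x)) \<longlonglongrightarrow> 0"
  "AE t in leb ?I. u t : H1_space U" "(\<integral>\<^sup>+ t. ennreal ((H1_norm U (u t))\<^sup>2) \<partial>leb ?I) < \<infinity>"
  using boch unfolding bochner_L2_def by blast
 interpret H: semi_inner_product "H1_space U" "dirichlet_form U" by (rule H1_semi_inner_product[OF U(1,2)])
 have NH: "H.N v <= H1_norm U v" for v
 proof -
  have "dirichlet_form U v v = (L2_norm U (weak_gradient U v))\<^sup>2"
   by (simp add: dirichlet_form_def L2_norm_def power2_norm_eq_inner)
  then show ?thesis unfolding H.N_def H1_norm_def by (intro real_sqrt_le_mono) simp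
 qed
 have path: "bochner_path (H1_space U) (dirichlet_form U) T s u"
 proof
  show "AE t in leb ?I. (%k. H.N (%x. s k t x - u t x)) \<longlonglongrightarrow> 0"
   using s(4)
  proof eventually_elim
   case (elim t)
   show ?case by (rule Lim_null_comparison[OF always_eventually elim]) (use NH H.N_nonneg in simp)
  qed
  have "(\<integral>\<^sup>+ t. ennreal ((H.N (u t))\<^sup>2) \<partial>leb ?I) <= (\<integral>\<^sup>+ t. ennreal ((H1_norm U (u t))\<^sup>2) \<partial>leb ?I)"
   using NH H.N_nonneg by (intro nn_integral_mono ennreal_leI power_mono)
  also note s(6)
  finally show "(\<integral>\<^sup>+ t. ennreal ((H.N (u t))\<^sup>2) \<partial>leb ?I) < \<infinity>" .
 qed (use s in auto)
 have weak: "(LINT t|leb ?I. deriv ps t * (LINT x|leb U. u t x * ph x)) =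
   - (LINT t|leb ?I. ps t * (- ep\<^sup>2 * dirichlet_form U (u t) ph - (LINT x|leb U. deriv W (u t x) * ph x)
     + (LINT x|leb U. deriv W (u t x)) * (LINT x|leb U. ph x)))"
  if ph: "ph : H1_space U" and ps: "ps : test_functions ?I" for ph ps
 proof -
  have "(LINT t|leb ?I. deriv ps t * (LINT x|leb U. u t x * ph x)) = - (LINT t|leb ?I. ps t * F t ph)"
   using F(1) ph ps by (simp add: has_time_derivative_def)
  also have "(LINT t|leb ?I. ps t * F t ph) = (LINT t|leb ?I. ps t * (- ep\<^sup>2 * dirichlet_form U (u t) ph - (LINT x|leb U. deriv W (u t x) * ph x)
     + (LINT x|leb U. deriv W (u t x)) * (LINT x|leb U. ph x)))"
  proof (rule lebesgue_on_integral_cong_AE)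
   show "AE t in leb ?I. ps t * F t ph = ps t * (- ep\<^sup>2 * dirichlet_form U (u t) ph - (LINT x|leb U. deriv W (u t x) * ph x)
     + (LINT x|leb U. deriv W (u t x)) * (LINT x|leb U. ph x))"
    using F(2)
   proof eventually_elim
    case (elim t)
    show ?case using bspec[OF elim ph] by (simp only: lag)
   qed
  qed simp
  finally show ?thesis .
 qed
 have "constrained_flow U W ep T R K La s u"
  by (rule constrained_flow.intro[OF U T R0 c(1,2) admissible_potentialD(6,5)[OF W] c(3-6) _ _ bd path weak])
   (use L2 cont in simp_all)
 then show thesis by (rule that)
qed

section \<open>From convergence in L1 to convergence in L2\<close>

text \<open>A \<open>C\<^sup>1\<close> truncation of \<open>|s| - 1\<close>: it vanishes for \<open>|s| \<le> 1\<close> and equals \<open>|s| - 3/2\<close> for \<open>|s| \<ge> 2\<close>, and its slope is bounded and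
Lipschitz, so that the chain rule for weak gradients applies.\<close>

definition excess :: "real => real" where
 "excess s = (ramp (s - 1))\<^sup>2 / 2 - (ramp (s - 2))\<^sup>2 / 2 + ((ramp (- s - 1))\<^sup>2 / 2 - (ramp (- s - 2))\<^sup>2 / 2)"

definition excess_slope :: "real => real" where
 "excess_slope s = ramp (s - 1) - ramp (s - 2) + (ramp (- s - 2) - ramp (- s - 1))"

lemma excess_derivative: "(excess has_real_derivative excess_slope s) (at s)"
proof -
 have m: "((%t. (ramp (- t - a))\<^sup>2 / 2) has_real_derivative ramp (- s - a) * (- 1)) (at s)" for a
  using DERIV_chain2[OF ramp_square_derivative[of a "- s"] DERIV_minus[OF DERIV_ident]] by simp
 have "(excess has_real_derivative ramp (s - 1) - ramp (s - 2) + (ramp (- s - 1) * (- 1) - ramp (- s - 2) * (- 1))) (at s)"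
  unfolding excess_def[abs_def] by (intro DERIV_add DERIV_diff ramp_square_derivative m)
 then show ?thesis by (simp add: excess_slope_def algebra_simps)
qed

lemma excess_slope_bound: "\<bar>excess_slope s\<bar> <= (if \<bar>s\<bar> > 1 then 1 else 0)"
 by (simp add: excess_slope_def ramp_def max_def)

lemma excess_slope_lipschitz: "\<bar>excess_slope s - excess_slope t\<bar> <= 4 * \<bar>s - t\<bar>"
proof -
 have "\<bar>a - b + (c - d)\<bar> <= 4 * e" if "\<bar>a\<bar> <= e" "\<bar>b\<bar> <= e" "\<bar>c\<bar> <= e" "\<bar>d\<bar> <= e" for a b c d e :: real
  using that by argo
 from this[OF ramp_lipschitz[of "s - 1" "t - 1", simplified] ramp_lipschitz[of "s - 2" "t - 2", simplified]
   ramp_lipschitz[of "- s - 2" "- t - 2", simplified, unfolded abs_minus_commute[of t]]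
   ramp_lipschitz[of "- s - 1" "- t - 1", simplified, unfolded abs_minus_commute[of t]]]
 show ?thesis by (simp add: excess_slope_def algebra_simps)
qed

lemma excess_values:
 "\<bar>s\<bar> <= 1 ==> excess s = 0"
 "1 <= \<bar>s\<bar> ==> \<bar>s\<bar> <= 2 ==> excess s = (\<bar>s\<bar> - 1)\<^sup>2 / 2"
 "2 <= \<bar>s\<bar> ==> excess s = \<bar>s\<bar> - 3 / 2"
 by (cases "s >= 0"; force simp: excess_def ramp_def max_def power2_eq_square field_simps)+

lemma excess_bounds: "0 <= excess s" "\<bar>s\<bar> >= 1 ==> excess s <= \<bar>s\<bar> - 1" "excess s <= \<bar>s\<bar>"
proof -
 have *: "(p - 1)\<^sup>2 / 2 <= p - 1" if "1 <= p" "p <= 2" for p :: real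
  using mult_left_mono[of "p - 1" 1 "p - 1"] that by (simp add: power2_eq_square)
 show "0 <= excess s"
  by (cases "\<bar>s\<bar> <= 1"; cases "\<bar>s\<bar> <= 2") (simp_all add: excess_values)
 show 1: "excess s <= \<bar>s\<bar> - 1" if "\<bar>s\<bar> >= 1" for s
  by (cases "\<bar>s\<bar> <= 2") (use that *[of "\<bar>s\<bar>"] excess_values(2,3)[of s] in simp_all)
 show "excess s <= \<bar>s\<bar>" using 1[of s] excess_values(1)[of s] by (cases "\<bar>s\<bar> >= 1") auto
qed

text \<open>A large \<open>L\<^sup>2\<close> distance at small \<open>L\<^sup>1\<close> distance comes only from values far outside \<open>[- 1, 1]\<close>,
and these are seen by \<open>excess\<close>. The threshold 3 separates the two regimes.\<close>

lemma phase_distance_bounds: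
 assumes f: "f = - 1 \<or> f = (1::real)"
 shows "\<bar>excess s\<bar> <= \<bar>s - f\<bar>" "(s - f)\<^sup>2 <= 4 * \<bar>s - f\<bar> + 9 * (excess s)\<^sup>2"
proof -
 have f1: "\<bar>f\<bar> = 1" using f by auto
 have "\<bar>s\<bar> - 1 <= \<bar>s - f\<bar>" using abs_triangle_ineq2[of s f] f1 by simp
 then show "\<bar>excess s\<bar> <= \<bar>s - f\<bar>"
  using excess_bounds(1)[of s] excess_bounds(2)[of s] excess_values(1)[of s] by (cases "\<bar>s\<bar> >= 1") auto
 have up: "\<bar>s - f\<bar> <= \<bar>s\<bar> + 1" using abs_triangle_ineq4[of s f] f1 by simp
 show "(s - f)\<^sup>2 <= 4 * \<bar>s - f\<bar> + 9 * (excess s)\<^sup>2"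
 proof (cases "\<bar>s\<bar> <= 3")
  case True
  then have "\<bar>s - f\<bar> * \<bar>s - f\<bar> <= 4 * \<bar>s - f\<bar>" using up by (intro mult_right_mono) auto
  then have "(s - f)\<^sup>2 <= 4 * \<bar>s - f\<bar>" by (simp add: power2_eq_square)
  then show ?thesis by (rule order_trans) simp
 next
  case False
  then have "\<bar>s - f\<bar> <= 3 * excess s" using up excess_values(3)[of s] by simp
  then have "\<bar>s - f\<bar>\<^sup>2 <= (3 * excess s)\<^sup>2" by (intro power_mono) auto
  then have "(s - f)\<^sup>2 <= 9 * (excess s)\<^sup>2" by (simp add: power_mult_distrib)
  then show ?thesis by (rule order_trans) simp
 qed
qed

text \<open>Apply the Ehrling inequality to \<open>excess u\<close>, whose gradient is supported where \<open>|u| > 1\<close>.\<close>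

theorem L2_distance_from_L1:
 fixes U :: "'a::euclidean_space set"
 assumes U: "open U" "U : lmeasurable" "bounded U" and bd: "C_holder_boundary (Suc k) \<sigma> U" and de: "de > 0"
 obtains C where "C >= 0" "!!u g f. u : L2_space U ==> has_weak_gradient U u g ==> f : L2_space U ==>
  (!!x. x : U ==> f x = - 1 \<or> f x = 1) ==>
  (LINT x|leb U. (norm (u x - f x))\<^sup>2) <= 4 * (LINT x|leb U. \<bar>u x - f x\<bar>)
   + 9 * (de * (LINT x|leb U. (if \<bar>u x\<bar> > 1 then (norm (g x))\<^sup>2 else 0)) + C * (LINT x|leb U. \<bar>u x - f x\<bar>)\<^sup>2)"
proof -
 obtain C where C: "C >= 0" "!!v g. borel_H1 U v g ==>
  (LINT x|lborel. (v x)\<^sup>2) <= de * (LINT x|lborel. (norm (g x))\<^sup>2) + C * (LINT x|lborel. \<bar>v x\<bar>)\<^sup>2"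
  using ehrling_inequality[OF U bd de] by blast
 show thesis
 proof (rule that[OF C(1)])
  fix u f :: "'a => real" and g
  assume u: "u : L2_space U" "has_weak_gradient U u g" and f: "f : L2_space U" "!!x. x : U ==> f x = - 1 \<or> f x = 1"
  let ?M = "leb U"
  let ?z = "%x. excess (u x)" and ?h = "%x. excess_slope (u x) *\<^sub>R g x"
  note um = L2_measurable[OF u(1)]
  have Us: "U : sets lebesgue" using U by auto
  have em: "excess : borel_measurable borel"
   using DERIV_isCont[OF excess_derivative] by (intro continuous_borel continuous_at_imp_continuous_on) blast
  have sm: "excess_slope : borel_measurable borel"
   unfolding excess_slope_def[abs_def] using ramp_measurable by simp
  have zm: "?z : borel_measurable ?M" by (rule measurable_compose[OF um em])
  have zL: "?z : L2_space U"
  proof -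
   have "integrable ?M (%x. (norm (?z x))\<^sup>2)"
   proof (rule Bochner_Integration.integrable_bound[OF L2_integrable_square[OF u(1)]])
    show "AE x in ?M. norm ((norm (?z x))\<^sup>2) <= norm ((norm (u x))\<^sup>2)"
    proof (rule AE_I2)
     fix x
     have "\<bar>?z x\<bar>\<^sup>2 <= \<bar>u x\<bar>\<^sup>2" using excess_bounds(1,3)[of "u x"] by (intro power_mono) auto
     then show "norm ((norm (?z x))\<^sup>2) <= norm ((norm (u x))\<^sup>2)" by simp
    qed
   qed (use zm in simp)
   then show ?thesis using zm by (simp add: L2_space_def)
  qed
  have "\<bar>excess_slope s\<bar> <= 1" for s using excess_slope_bound[of s] by (simp split: if_splits)
  then have wz: "has_weak_gradient U ?z ?h"
   using has_weak_gradient_compose[OF u U(1,2) excess_derivative _ excess_slope_lipschitz sm] by blast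
  obtain v h where vh: "borel_H1 U v h" "AE x in ?M. ?z x = v x" "AE x in ?M. ?h x = h x"
   using borel_H1_representative[OF U(1) zL wz] by blast
  note B = borel_H1D[OF vh(1) U(2)]
  note gL = has_weak_gradientD(1)[OF u(2)] and hL = has_weak_gradientD(1)[OF wz]
  have uf: "(%x. u x - f x) : L2_space U" by (rule L2_diff[OF u(1) f(1)])
  have ufi: "integrable ?M (%x. \<bar>u x - f x\<bar>)" using L2_integrable[OF U(2) uf] by simp
  have "(LINT x|lborel. (v x)\<^sup>2) = (LINT x|?M. (norm (v x))\<^sup>2)" using borel_L2_lborel(3)[OF U(2) B(1,3,5)] by simp
  also have "... = (LINT x|?M. (?z x)\<^sup>2)"
   using vh(2) by (intro lebesgue_on_integral_cong_AE[OF Us]) (auto elim: eventually_mono)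
  finally have 1: "(LINT x|lborel. (v x)\<^sup>2) = (LINT x|?M. (?z x)\<^sup>2)" .
  have "(LINT x|lborel. (norm (h x))\<^sup>2) = (LINT x|?M. (norm (?h x))\<^sup>2)"
   unfolding B(12)[symmetric]
  proof (rule lebesgue_on_integral_cong_AE[OF Us])
   show "AE x in ?M. (norm (h x))\<^sup>2 = (norm (?h x))\<^sup>2" using vh(3) by eventually_elim (simp only:)
  qed
  also have "... <= (LINT x|?M. (if \<bar>u x\<bar> > 1 then (norm (g x))\<^sup>2 else 0))"
  proof (rule integral_mono_AE[OF L2_integrable_square[OF hL]])
   show "integrable ?M (%x. if \<bar>u x\<bar> > 1 then (norm (g x))\<^sup>2 else 0)"
   proof (rule Bochner_Integration.integrable_bound[OF L2_integrable_square[OF gL]])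
    have "{x \<in> space ?M. 1 < \<bar>u x\<bar>} \<in> sets ?M" by (rule borel_measurable_less) (use um in simp_all)
    then show "(%x. if \<bar>u x\<bar> > 1 then (norm (g x))\<^sup>2 else 0) : borel_measurable ?M"
     using L2_measurable[OF gL] by (intro measurable_If) simp_all
   qed (auto intro!: AE_I2)
   show "AE x in ?M. (norm (?h x))\<^sup>2 <= (if \<bar>u x\<bar> > 1 then (norm (g x))\<^sup>2 else 0)"
   proof (rule AE_I2)
    fix x
    have "\<bar>excess_slope (u x)\<bar> * norm (g x) <= (if \<bar>u x\<bar> > 1 then 1 else 0) * norm (g x)"
     by (rule mult_right_mono[OF excess_slope_bound]) simp
    from power_mono[OF this, of 2] show "(norm (?h x))\<^sup>2 <= (if \<bar>u x\<bar> > 1 then (norm (g x))\<^sup>2 else 0)"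
     using excess_slope_bound[of "u x"] by (simp split: if_splits)
   qed
  qed
  finally have 2: "(LINT x|lborel. (norm (h x))\<^sup>2) <= (LINT x|?M. (if \<bar>u x\<bar> > 1 then (norm (g x))\<^sup>2 else 0))" .
  have "(LINT x|lborel. \<bar>v x\<bar>) = (LINT x|?M. \<bar>v x\<bar>)"
   by (rule lebesgue_on_lborel(1)[symmetric]) (use B Us in auto)
  also have "... = (LINT x|?M. \<bar>?z x\<bar>)"
   using vh(2) by (intro lebesgue_on_integral_cong_AE[OF Us]) (auto elim: eventually_mono)
  also have "... <= (LINT x|?M. \<bar>u x - f x\<bar>)"
   by (rule integral_mono_AE[OF _ ufi]) (use L2_integrable[OF U(2) zL] phase_distance_bounds(1) f(2) in \<open>auto intro!: AE_I2\<close>)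
  finally have "(LINT x|lborel. \<bar>v x\<bar>)\<^sup>2 <= (LINT x|?M. \<bar>u x - f x\<bar>)\<^sup>2" by (rule power_mono) simp
  then have "de * (LINT x|lborel. (norm (h x))\<^sup>2) + C * (LINT x|lborel. \<bar>v x\<bar>)\<^sup>2 <=
    de * (LINT x|?M. (if \<bar>u x\<bar> > 1 then (norm (g x))\<^sup>2 else 0)) + C * (LINT x|?M. \<bar>u x - f x\<bar>)\<^sup>2"
   using 2 de C(1) by (intro add_mono mult_left_mono) auto
  with C(2)[OF vh(1)] have 3: "(LINT x|?M. (?z x)\<^sup>2) <= ..." unfolding 1 by (rule order_trans)
  have zi: "integrable ?M (%x. (?z x)\<^sup>2)" using L2_integrable_square[OF zL] by simp
  have "(LINT x|?M. (norm (u x - f x))\<^sup>2) <= (LINT x|?M. 4 * \<bar>u x - f x\<bar> + 9 * (?z x)\<^sup>2)"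
   using L2_integrable_square[OF uf] ufi zi phase_distance_bounds(2) f(2) by (intro integral_mono_AE AE_I2) auto
  also have "... = 4 * (LINT x|?M. \<bar>u x - f x\<bar>) + 9 * (LINT x|?M. (?z x)\<^sup>2)" using ufi zi by simp
  also have "... <= 4 * (LINT x|?M. \<bar>u x - f x\<bar>)
   + 9 * (de * (LINT x|?M. (if \<bar>u x\<bar> > 1 then (norm (g x))\<^sup>2 else 0)) + C * (LINT x|?M. \<bar>u x - f x\<bar>)\<^sup>2)"
   using 3 by (intro add_mono mult_left_mono order_refl) auto
  finally show "(LINT x|?M. (norm (u x - f x))\<^sup>2) <= 4 * (LINT x|?M. \<bar>u x - f x\<bar>)
   + 9 * (de * (LINT x|?M. (if \<bar>u x\<bar> > 1 then (norm (g x))\<^sup>2 else 0)) + C * (LINT x|?M. \<bar>u x - f x\<bar>)\<^sup>2)" .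
 qed
qed

lemma phase_function_L2:
 fixes E0 :: "'a::euclidean_space set"
 assumes U: "open U" "U : lmeasurable" and E: "E0 : sets borel" "E0 \<subseteq> U"
 shows "phase_function U E0 : L2_space U" "x : U ==> phase_function U E0 x = - 1 \<or> phase_function U E0 x = 1"
  "{x\<in>U. phase_function U E0 x = - 1} = E0" "phase_function U E0 x = indicator U x - 2 * indicator E0 x"
proof -
 show "x : U ==> phase_function U E0 x = - 1 \<or> phase_function U E0 x = 1" by (auto simp: phase_function_def indicator_def)
 show "{x\<in>U. phase_function U E0 x = - 1} = E0" using E(2) by (auto simp: phase_function_def indicator_def)
 show e: "phase_function U E0 x = indicator U x - 2 * indicator E0 x" for x
  using E(2) by (auto simp: phase_function_def indicator_def)
 have "(%x. indicator U x - 2 * indicator E0 x :: real) : borel_measurable borel" using U(1) E(1) by simp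
 then have "phase_function U E0 : borel_measurable (leb U)"
  by (intro borel_measurable_lebesgue_on) (simp add: e[abs_def])
 then show "phase_function U E0 : L2_space U"
  by (rule L2_bounded[OF U(2), of _ 1]) (auto simp: phase_function_def indicator_def intro!: AE_I2)
qed

text \<open>The variation of the phase function and the perimeter of its negative phase pair with opposite fields.\<close>

lemma test_field_uminus:
 assumes ph: "ph : test_fields U"
 shows "(%x. - ph x) : test_fields U" "divergence (%x. - ph x) x = - divergence ph x"
proof -
 have d: "(%x. ph x \<bullet> b) differentiable (at x)" if "b : Basis" for b x
  using ph that by (auto simp: test_fields_def)
 have p: "partial_deriv c (%y. - ph y \<bullet> b) x = - partial_deriv c (%y. ph y \<bullet> b) x" if "b : Basis" for b c x
 proof -
  have "((%y. - (ph y \<bullet> b)) has_derivative (%h. - frechet_derivative (%y. ph y \<bullet> b) (at x) h)) (at x)"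
   using d[OF that, of x] by (intro has_derivative_minus) (simp add: frechet_derivative_works)
  from frechet_derivative_at[OF this, symmetric] show ?thesis by (simp add: partial_deriv_def)
 qed
 show "divergence (%x. - ph x) x = - divergence ph x"
  unfolding divergence_def sum_negf[symmetric] by (intro sum.cong refl p)
 have "C_k_on 1 (%x. - ph x \<bullet> b) UNIV" if b: "b : Basis" for b
 proof -
  have "continuous_on UNIV (partial_deriv c (%y. - ph y \<bullet> b))" if c: "c : Basis" for c
  proof -
   have e: "partial_deriv c (%y. - ph y \<bullet> b) = (%x. - partial_deriv c (%y. ph y \<bullet> b) x)" using p[OF b] by (rule ext)
   show ?thesis unfolding e by (rule continuous_on_minus) (use ph b c in \<open>simp add: test_fields_def\<close>)
  qed
  then show ?thesis using d[OF b] by simp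
 qed
 then show "(%x. - ph x) : test_fields U" using ph by (simp add: test_fields_def compactly_supported_in_def)
qed

text \<open>The divergence of a test field has integral 0 over the domain, so the variation of the phase function
is at most twice the perimeter.\<close>

lemma phase_function_energy:
 fixes E0 :: "'a::euclidean_space set"
 assumes U: "open U" "U : lmeasurable" "measure lebesgue U = 1" and E: "E0 : sets borel" "E0 \<subseteq> U"
  and m: "m = 1 - 2 * measure lebesgue E0" and fin: "rel_perimeter E0 U < \<infinity>"
 shows "G_zero U W m (phase_function U E0) = ennreal (sqrt 2 * c_W W) * rel_perimeter E0 U"
proof -
 let ?f = "phase_function U E0"
 note f = phase_function_L2[OF U(1,2) E]
 have s: "U : sets lebesgue" "E0 : sets lebesgue" using U E by auto
 have El: "E0 : lmeasurable" using fmeasurable_Int_fmeasurable[OF U(2) s(2)] E(2) by (simp add: Int_absorb1)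
 have int: "integrable (leb U) ?f" by (rule L2_integrable[OF U(2) f(1)])
 have i: "integrable lebesgue (indicator U :: 'a => real)" "integrable lebesgue (indicator E0 :: 'a => real)"
  using U(2) El by (auto intro!: integrable_real_indicator simp: fmeasurable_def)
 have "(LINT x|leb U. ?f x) = (LINT x|lebesgue. indicator U x * ?f x)"
  using lebesgue_on_integral(1)[OF s(1), of ?f] by simp
 also have "... = (LINT x|lebesgue. indicator U x - 2 * indicator E0 x)"
  unfolding f(4) using E(2) by (intro Bochner_Integration.integral_cong) (auto simp: indicator_def)
 also have "... = m" using i U(3) m by simp
 finally have mass: "(LINT x|leb U. ?f x) = m" .
 have "variation ?f U <= 2 * rel_perimeter E0 U"
  unfolding variation_def
 proof (rule SUP_least)
  fix ph assume ph: "ph : test_fields U"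
  let ?D = "divergence ph"
  obtain M where M: "!!x. \<bar>?D x\<bar> <= M" "?D : borel_measurable borel" by (rule test_field_divergence[OF ph]) blast
  have di: "integrable lborel (%x. indicator A x * ?D x)" if A: "A : sets borel" "A : lmeasurable" for A
  proof (rule lborel_bounded_mult_integrable[OF _ M(2,1)])
   show "integrable lborel (indicator A :: 'a => real)"
    using A by (simp add: fmeasurable_def emeasure_completion integrable_indicator_iff)
  qed
  have Ub: "U : sets borel" using U(1) by simp
  have I: "(LINT x|leb E0. ?D x) = (LINT x|lborel. indicator E0 x * ?D x)"
   using lebesgue_on_integral(1)[OF s(2), of ?D] M(2) E(1) by (simp add: integral_completion)
  have "(LINT x|leb U. ?f x * ?D x) = (LINT x|lborel. ?f x * ?D x)"
   by (rule lebesgue_on_lborel(1)[OF _ _ s(1)]) (use M(2) E Ub in \<open>auto simp: f(4)[abs_def] indicator_def\<close>)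
  also have "... = (LINT x|lborel. indicator U x * ?D x - 2 * (indicator E0 x * ?D x))"
   unfolding f(4) by (intro Bochner_Integration.integral_cong) (auto simp: algebra_simps)
  also have "... = - 2 * (LINT x|leb E0. ?D x)"
   using di[OF Ub U(2)] di[OF E(1) El] test_field_divergence_integral[OF U(1,2) ph] by (simp add: I)
  also have "... = 2 * (LINT x|leb (E0 \<inter> U). divergence (%x. - ph x) x)"
   using E(2) by (simp add: test_field_uminus(2)[OF ph] Int_absorb2)
  finally have "ennreal (LINT x|leb U. ?f x * ?D x) = 2 * ennreal (LINT x|leb (E0 \<inter> U). divergence (%x. - ph x) x)"
   by (simp add: ennreal_mult')
  also have "... <= 2 * rel_perimeter E0 U"
   unfolding rel_perimeter_def by (intro mult_left_mono SUP_upper test_field_uminus(1)[OF ph]) simp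
  finally show "ennreal (LINT x|leb U. ?f x * ?D x) <= 2 * rel_perimeter E0 U" .
 qed
 also have "... < \<infinity>" using fin by (simp add: ennreal_mult_less_top)
 finally have "?f : BV U" using int by (simp add: BV_def)
 moreover have "AE x in leb U. ?f x : {-1, 1}" using f(2) by (intro AE_I2) auto
 ultimately show ?thesis using mass f(3) by (simp add: G_zero_def)
qed

section \<open>The slow motion estimate\<close>

text \<open>The factor \<open>ep\<close> comes from rescaling the energy.\<close>

lemma flow_displacement:
 fixes U :: "'a::euclidean_space set"
 assumes U: "open U" "U : lmeasurable" "measure lebesgue U = 1" and W: "admissible_potential W"
  and sol: "nonlocal_AC_solution U W ep u0 u" and ep: "ep > 0" and t: "t >= 0"
  and low: "!!v g. v : L2_space U ==> has_weak_gradient U v g ==> (LINT x|leb U. v x) = m ==>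
   integrable (leb U) (%x. W (v x)) ==> S <= (LINT x|leb U. W (v x) / ep + ep / 2 * (norm (g x))\<^sup>2)"
  and u0: "u0 : H1_space U" "(LINT x|leb U. u0 x) = m" "integrable (leb U) (%x. W (u0 x))"
  and up: "(LINT x|leb U. W (u0 x) / ep + ep / 2 * (norm (weak_gradient U u0 x))\<^sup>2) <= S'"
 shows "L2_norm U (%x. u t x - u0 x) <= sqrt (t * ep * (S' - S))"
proof -
 let ?M = "leb U"
 have Us: "U : sets lebesgue" using U by auto
 have init: "AE x in ?M. u 0 x = u0 x" and uL: "u t : L2_space U" "u 0 : L2_space U"
  using sol t by (auto simp: nonlocal_AC_solution_def)
 have init': "AE x in ?M. u0 x = u 0 x" using init by eventually_elim simp
 have norm0: "L2_norm U (%x. u t x - u0 x) = L2_norm U (%x. u t x - u 0 x)"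
 proof -
  have "(LINT x|?M. (norm (u t x - u0 x))\<^sup>2) = (LINT x|?M. (norm (u t x - u 0 x))\<^sup>2)"
   by (rule lebesgue_on_integral_cong_AE[OF Us], use init' in eventually_elim) (simp only:)
  then show ?thesis by (simp add: L2_norm_def)
 qed
 have SS: "S <= S'" using order_trans[OF low[OF H1_L2[OF u0(1)] weak_gradient_works[OF u0(1)] u0(2,3)] up] .
 show ?thesis
 proof (cases "t = 0")
  case True
  then show ?thesis unfolding norm0 by (simp add: L2_norm_def)
 next
  case False
  then have t0: "t > 0" "t + 1 > 0" using t by auto
  \<comment> \<open>The displacement estimate needs some time beyond t, hence the horizon t + 1.\<close>
  obtain R K La s where "constrained_flow U W ep (t + 1) R K La s u"
   by (rule solution_constrained_flow[OF U W sol ep t0(2)])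
  then interpret constrained_flow U W ep "t + 1" R K La s u .
  have energy_eq: "energy v = ep * (LINT x|?M. W (v x) / ep + ep / 2 * (norm (g x))\<^sup>2)"
   if v: "v : H1_space U" "has_weak_gradient U v g" "integrable ?M (%x. W (v x))" for v g
  proof -
   have "dirichlet_form U v v = (LINT x|?M. (norm (g x))\<^sup>2)"
    unfolding dirichlet_form_def power2_norm_eq_inner
    by (rule lebesgue_on_integral_cong_AE[OF Us], use weak_gradient_AE[OF U(1,2) v(2)] in eventually_elim) (simp only:)
   then show ?thesis using ep v(3) L2_integrable_square[OF has_weak_gradientD(1)[OF v(2)]]
    by (simp add: energy_def algebra_simps power2_eq_square)
  qed
  have wg: "has_weak_gradient U (u 0) (weak_gradient U u0)"
   by (rule has_weak_gradient_cong_AE[OF weak_gradient_works[OF u0(1)] L2_measurable[OF H1_L2[OF u0(1)]] init' L2_measurable[OF uL(2)]])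
    (use L2_measurable[OF weak_gradient_L2[OF u0(1)]] in auto)
  have u0H: "u 0 : H1_space U" by (rule H1I[OF uL(2) wg])
  have mass: "(LINT x|?M. u 0 x) = m" using lebesgue_on_integral_cong_AE[OF Us init] u0(2) by simp
  have W0: "integrable ?M (%x. W (u 0 x))"
   by (rule L2_integrable[OF U(2) compose_L2[OF range_lipschitz_W uL(2) u_bd]]) (use t in auto)
  have "(LINT x|?M. W (u 0 x) / ep + ep / 2 * (norm (weak_gradient U u0 x))\<^sup>2) = (LINT x|?M. W (u0 x) / ep + ep / 2 * (norm (weak_gradient U u0 x))\<^sup>2)"
   by (rule lebesgue_on_integral_cong_AE[OF Us], use init in eventually_elim) (simp only:)
  then have e0: "energy (u 0) <= ep * S'"
   unfolding energy_eq[OF u0H wg W0] using up ep by (intro mult_left_mono) auto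
  have "(L2_norm U (%x. u t x - u 0 x))\<^sup>2 <= t * (energy (u 0) - ep * S)"
  proof (rule displacement_bound[OF t0(1) _ u0H])
   fix v assume v: "v : H1_space U" "AE x in ?M. \<bar>v x\<bar> <= R" "(LINT x|?M. v x) = (LINT x|?M. u 0 x)"
   have Wv: "integrable ?M (%x. W (v x))"
    by (rule L2_integrable[OF U(2) compose_L2[OF range_lipschitz_W H1_L2[OF v(1)] v(2)]])
   show "ep * S <= energy v"
    unfolding energy_eq[OF v(1) weak_gradient_works[OF v(1)] Wv]
    using low[OF H1_L2[OF v(1)] weak_gradient_works[OF v(1)] _ Wv] v(3) mass ep by (intro mult_left_mono) auto
  qed simp
  also have "... <= t * (ep * S' - ep * S)" using e0 t by (intro mult_left_mono) auto
  finally have "(L2_norm U (%x. u t x - u 0 x))\<^sup>2 <= t * ep * (S' - S)" by (simp add: algebra_simps)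
  then show ?thesis unfolding norm0 by (rule real_le_rsqrt)
 qed
qed

lemma G_eps_real_bound:
 assumes W: "admissible_potential W" and ep: "ep > 0" and S: "S >= 0"
  and G: "G_eps U W m ep u <= ennreal S"
 shows "u : H1_space U" "(LINT x|leb U. u x) = m" "integrable (leb U) (%x. W (u x))"
  "(LINT x|leb U. W (u x) / ep + ep / 2 * (norm (weak_gradient U u x))\<^sup>2) <= S"
proof -
 let ?M = "leb U" and ?e = "%x. W (u x) / ep + ep / 2 * (norm (weak_gradient U u x))\<^sup>2"
 have fin: "G_eps U W m ep u < \<infinity>" using G by (rule order.strict_trans1) simp
 show u: "u : H1_space U" and m: "(LINT x|?M. u x) = m"
  using fin by (auto simp: G_eps_def split: if_splits)
 have G': "(\<integral>\<^sup>+x. ennreal (?e x) \<partial>?M) <= ennreal S" using G u m by (simp add: G_eps_def)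
 have Wm: "(%x. W (u x)) : borel_measurable ?M"
  by (rule measurable_compose[OF L2_measurable[OF H1_L2[OF u]] continuous_borel[OF admissible_potentialD(6)[OF W]]])
 have em: "?e : borel_measurable ?M" using Wm L2_measurable[OF weak_gradient_L2[OF u]] by simp
 have e0: "0 <= ?e x" for x using admissible_potentialD(1)[OF W] ep by simp
 have int: "integrable ?M ?e"
  by (rule integrableI_nonneg[OF em]) (use e0 order.strict_trans1[OF G'] in auto)
 have "ennreal (LINT x|?M. ?e x) <= ennreal S" using G' nn_integral_eq_integral[OF int] e0 by simp
 then show "(LINT x|?M. ?e x) <= S" using S by (simp add: ennreal_le_iff)
 have "integrable ?M (%x. W (u x) / ep)"
  by (rule Bochner_Integration.integrable_bound[OF int])
   (use Wm admissible_potentialD(1)[OF W] ep in \<open>auto intro!: AE_I2\<close>)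
 then have "integrable ?M (%x. ep * (W (u x) / ep))" by (rule Bochner_Integration.integrable_mult_right)
 then show "integrable ?M (%x. W (u x))" using ep by simp
qed

theorem theorem1p2:
  fixes \<Omega> E0 :: "(real ^ 'n) set"
    and W :: "real \<Rightarrow> real"
    and m \<sigma> \<epsilon>0 C r0 :: real
    and u0 :: "real \<Rightarrow> real ^ 'n \<Rightarrow> real"
    and u :: "real \<Rightarrow> real \<Rightarrow> real ^ 'n \<Rightarrow> real"
  assumes dim: "2 \<le> CARD('n)" "CARD('n) \<le> 7"
    and \<Omega>: "open \<Omega>" "bounded \<Omega>" "connected \<Omega>" "measure lebesgue \<Omega> = 1"
    and \<sigma>: "0 < \<sigma>" "\<sigma> \<le> 1"
    and boundary: "C_holder_boundary 4 \<sigma> \<Omega>"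
    and W: "admissible_potential W"
    and m: "-1 < m" "m < 1"
    and r0: "r0 = (1 - m) / 2"
    and E0: "E0 \<in> sets borel" "E0 \<subseteq> \<Omega>" "measure lebesgue E0 = r0"
    and minimizer: "rel_perimeter E0 \<Omega> = isoperimetric \<Omega> r0"
    and taylor: "taylor_order_two (\<lambda>r. enn2real (isoperimetric \<Omega> r)) r0"
    and \<epsilon>0: "0 < \<epsilon>0"
    and C: "0 < C"
    and u0_Linf: "\<And>\<epsilon>. 0 < \<epsilon> \<Longrightarrow> \<epsilon> < \<epsilon>0 \<Longrightarrow> u0 \<epsilon> \<in> Linf_space \<Omega>"
    and u0_mass: "\<And>\<epsilon>. 0 < \<epsilon> \<Longrightarrow> \<epsilon> < \<epsilon>0 \<Longrightarrow> (\<integral>x. u0 \<epsilon> x \<partial>lebesgue_on \<Omega>) = m"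
    and u0_conv: "((\<lambda>\<epsilon>. \<integral>x. \<bar>u0 \<epsilon> x - phase_function \<Omega> E0 x\<bar> \<partial>lebesgue_on \<Omega>) \<longlongrightarrow> 0) (at_right 0)"
    and u0_energy: "\<And>\<epsilon>. 0 < \<epsilon> \<Longrightarrow> \<epsilon> < \<epsilon>0 \<Longrightarrow>
        G_eps \<Omega> W m \<epsilon> (u0 \<epsilon>) \<le> G_zero \<Omega> W m (phase_function \<Omega> E0) + ennreal (C * \<epsilon>)"
    and u_solution: "\<And>\<epsilon>. 0 < \<epsilon> \<Longrightarrow> \<epsilon> < \<epsilon>0 \<Longrightarrow> nonlocal_AC_solution \<Omega> W \<epsilon> (u0 \<epsilon>) (u \<epsilon>)"
  shows "\<forall>M>0. ((\<lambda>\<epsilon>. SUP t\<in>{0..M / \<epsilon>}.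
            ennreal (L2_norm \<Omega> (\<lambda>x. u \<epsilon> t x - phase_function \<Omega> E0 x))) \<longlongrightarrow> 0) (at_right 0)"
proof (intro allI impI)
 fix M :: real assume M: "M > 0"
 let ?f = "phase_function \<Omega> E0" and ?M = "lebesgue_on \<Omega>"
 have \<Omega>l: "\<Omega> \<in> lmeasurable" using \<Omega>(1,2) by (rule lmeasurable_open[rotated])
 note f = phase_function_L2[OF \<Omega>(1) \<Omega>l E0(1,2)]
 have fin: "isoperimetric \<Omega> r0 < \<infinity>"
  by (rule isoperimetric_finite[OF \<Omega>(1) \<Omega>l \<Omega>(2)]) (use m r0 \<Omega>(4) in auto)
 define I0 where "I0 = enn2real (isoperimetric \<Omega> r0)"
 have I0: "I0 >= 0" "isoperimetric \<Omega> r0 = ennreal I0" using fin by (auto simp: I0_def)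
 obtain L where L: "L >= 0" "!!r. ennreal (I0 - L * \<bar>r - r0\<bar>) <= isoperimetric \<Omega> r"
  unfolding I0_def using isoperimetric_lower_bound[OF _ fin] taylor unfolding taylor_order_two_def by blast
 define S where "S = sqrt 2 * c_W W * I0"
 have cW: "c_W W >= 0" unfolding c_W_def
  by (rule Henstock_Kurzweil_Integration.integral_nonneg[OF integrable_continuous_real])
   (use admissible_potentialD(1)[OF W] continuous_on_subset[OF admissible_potentialD(6)[OF W] subset_UNIV] in \<open>auto intro!: continuous_on_real_sqrt\<close>)
 have S: "S >= 0" using cW I0 by (simp add: S_def)
 obtain C1 \<epsilon>1 where C1: "C1 > 0" "\<epsilon>1 > 0"
  "!!\<epsilon> u g. 0 < \<epsilon> ==> \<epsilon> < \<epsilon>1 ==> u \<in> L2_space \<Omega> ==> has_weak_gradient \<Omega> u g ==>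
   (LINT x|?M. u x) = 1 - 2 * r0 ==> integrable ?M (%x. W (u x)) ==>
   S + \<epsilon> / 2 * (LINT x|?M. (if \<bar>u x\<bar> > 1 then (norm (g x))\<^sup>2 else 0))
   <= (LINT x|?M. W (u x) / \<epsilon> + \<epsilon> / 2 * (norm (g x))\<^sup>2) + C1 * \<epsilon>"
  unfolding S_def using energy_lower_bound[OF \<Omega>(1) \<Omega>l \<Omega>(4) W L(2,1) I0(1)] by blast
 have mr: "1 - 2 * r0 = m" using r0 by simp
 have G0: "G_zero \<Omega> W m ?f = ennreal S"
  using phase_function_energy[OF \<Omega>(1) \<Omega>l \<Omega>(4) E0(1,2), of m W] fin minimizer E0(3) mr I0 cW
  by (simp add: S_def ennreal_mult')
 define \<epsilon>2 where "\<epsilon>2 = min \<epsilon>0 \<epsilon>1"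
 have \<epsilon>2: "\<epsilon>2 > 0" using \<epsilon>0 C1(2) by (simp add: \<epsilon>2_def)
 define A where "A \<epsilon> = (LINT x|?M. \<bar>u0 \<epsilon> x - ?f x\<bar>)" for \<epsilon>
 define D where "D \<epsilon> = L2_norm \<Omega> (%x. u0 \<epsilon> x - ?f x)" for \<epsilon>
 have initial: "u0 \<epsilon> \<in> H1_space \<Omega>" "(LINT x|?M. u0 \<epsilon> x) = m" "integrable ?M (%x. W (u0 \<epsilon> x))"
  "(LINT x|?M. W (u0 \<epsilon> x) / \<epsilon> + \<epsilon> / 2 * (norm (weak_gradient \<Omega> (u0 \<epsilon>) x))\<^sup>2) <= S + C * \<epsilon>"
  if \<epsilon>: "0 < \<epsilon>" "\<epsilon> < \<epsilon>2" for \<epsilon>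
 proof -
  have "G_eps \<Omega> W m \<epsilon> (u0 \<epsilon>) <= ennreal S + ennreal (C * \<epsilon>)" using u0_energy[of \<epsilon>] \<epsilon> G0 by (simp add: \<epsilon>2_def)
  also have "... = ennreal (S + C * \<epsilon>)" using S C \<epsilon> by (intro ennreal_plus[symmetric]) auto
  finally have G: "G_eps \<Omega> W m \<epsilon> (u0 \<epsilon>) <= ennreal (S + C * \<epsilon>)" .
  have "S + C * \<epsilon> >= 0" using S C \<epsilon> by simp
  from G_eps_real_bound[OF W \<epsilon>(1) this G]
  show "u0 \<epsilon> \<in> H1_space \<Omega>" "(LINT x|?M. u0 \<epsilon> x) = m" "integrable ?M (%x. W (u0 \<epsilon> x))"
   "(LINT x|?M. W (u0 \<epsilon> x) / \<epsilon> + \<epsilon> / 2 * (norm (weak_gradient \<Omega> (u0 \<epsilon>) x))\<^sup>2) <= S + C * \<epsilon>" by blast+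
 qed
 have D0: "D \<epsilon> >= 0" for \<epsilon> by (simp add: D_def L2_norm_def)
 have lim_D: "(D \<longlongrightarrow> 0) (at_right 0)"
 proof (rule tendstoI)
  fix e :: real assume e: "e > 0"
  define B where "B = 2 * (C + C1)"
  have B: "B > 0" using C C1 by (simp add: B_def)
  \<comment> \<open>The factor 18 turns the term with the gradient into half of the squared tolerance.\<close>
  define \<delta> where "\<delta> = e\<^sup>2 / (18 * B)"
  have \<delta>: "\<delta> > 0" using e B by (simp add: \<delta>_def)
  have bd: "C_holder_boundary (Suc 3) \<sigma> \<Omega>" using boundary by simp
  obtain C2 where C2: "C2 >= 0" "!!u g f. u \<in> L2_space \<Omega> ==> has_weak_gradient \<Omega> u g ==> f \<in> L2_space \<Omega> ==>
   (!!x. x \<in> \<Omega> ==> f x = - 1 \<or> f x = 1) ==>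
   (LINT x|?M. (norm (u x - f x))\<^sup>2) <= 4 * (LINT x|?M. \<bar>u x - f x\<bar>)
    + 9 * (\<delta> * (LINT x|?M. (if \<bar>u x\<bar> > 1 then (norm (g x))\<^sup>2 else 0)) + C2 * (LINT x|?M. \<bar>u x - f x\<bar>)\<^sup>2)"
   by (rule L2_distance_from_L1[OF \<Omega>(1) \<Omega>l \<Omega>(2) bd \<delta>]) blast
  have A: "(A \<longlongrightarrow> 0) (at_right 0)" using u0_conv by (simp add: A_def[abs_def])
  have "((%\<epsilon>. 4 * A \<epsilon> + 9 * (C2 * (A \<epsilon>)\<^sup>2)) \<longlongrightarrow> 4 * 0 + 9 * (C2 * 0\<^sup>2)) (at_right 0)" by (intro tendsto_intros A)
  then have "\<forall>\<^sub>F \<epsilon> in at_right 0. 4 * A \<epsilon> + 9 * (C2 * (A \<epsilon>)\<^sup>2) < e\<^sup>2 / 2"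
   using e by (intro order_tendstoD(2)[of _ 0]) auto
  moreover have "\<forall>\<^sub>F \<epsilon> in at_right 0. 0 < \<epsilon> \<and> \<epsilon> < \<epsilon>2"
   unfolding eventually_at_right_field using \<epsilon>2 by blast
  ultimately show "\<forall>\<^sub>F \<epsilon> in at_right 0. dist (D \<epsilon>) 0 < e"
  proof eventually_elim
   case (elim \<epsilon>)
   then have \<epsilon>: "0 < \<epsilon>" "\<epsilon> < \<epsilon>2" "\<epsilon> < \<epsilon>1" by (auto simp: \<epsilon>2_def)
   note i = initial[OF \<epsilon>(1,2)]
   let ?g = "weak_gradient \<Omega> (u0 \<epsilon>)"
   let ?J = "\<integral>x. (if \<bar>u0 \<epsilon> x\<bar> > 1 then (norm (?g x))\<^sup>2 else 0) \<partial>?M"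
   note w = H1_L2[OF i(1)] weak_gradient_works[OF i(1)]
   have "S + \<epsilon> / 2 * ?J <= (S + C * \<epsilon>) + C1 * \<epsilon>"
    using order_trans[OF C1(3)[OF \<epsilon>(1,3) w _ i(3)] add_right_mono[OF i(4)]] i(2) mr by simp
   then have "\<epsilon> * ?J <= \<epsilon> * B" by (simp add: B_def algebra_simps)
   then have J: "?J <= B" using \<epsilon>(1) by simp
   have "(D \<epsilon>)\<^sup>2 = (LINT x|?M. (norm (u0 \<epsilon> x - ?f x))\<^sup>2)" by (simp add: D_def L2_norm_def)
   also have "... <= 4 * A \<epsilon> + 9 * (\<delta> * ?J + C2 * (A \<epsilon>)\<^sup>2)"
    unfolding A_def by (rule C2(2)[OF w f(1,2)])
   also have "... <= 4 * A \<epsilon> + 9 * (\<delta> * B + C2 * (A \<epsilon>)\<^sup>2)"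
    using \<delta> J by (intro add_mono mult_left_mono order_refl) auto
   also have "... = e\<^sup>2 / 2 + (4 * A \<epsilon> + 9 * (C2 * (A \<epsilon>)\<^sup>2))" using B by (simp add: \<delta>_def algebra_simps)
   also have "... < e\<^sup>2" using elim(1) by simp
   finally have "D \<epsilon> < e" by (rule power2_less_imp_less) (use e in simp)
   then show ?case using D0[of \<epsilon>] by simp
  qed
 qed
 have bound: "L2_norm \<Omega> (%x. u \<epsilon> t x - ?f x) <= sqrt (M * \<epsilon> * (C + C1)) + D \<epsilon>"
  if \<epsilon>: "0 < \<epsilon>" "\<epsilon> < \<epsilon>2" and t: "t \<in> {0..M / \<epsilon>}" for \<epsilon> t
 proof -
  note i = initial[OF \<epsilon>]
  have \<epsilon>': "\<epsilon> < \<epsilon>1" "\<epsilon> < \<epsilon>0" using \<epsilon> by (auto simp: \<epsilon>2_def)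
  note sol = u_solution[OF \<epsilon>(1) \<epsilon>'(2)]
  have low: "S - C1 * \<epsilon> <= (LINT x|?M. W (v x) / \<epsilon> + \<epsilon> / 2 * (norm (g x))\<^sup>2)"
   if v: "v \<in> L2_space \<Omega>" "has_weak_gradient \<Omega> v g" "(LINT x|?M. v x) = m" "integrable ?M (%x. W (v x))" for v g
  proof -
   have "0 <= \<epsilon> / 2 * (LINT x|?M. (if \<bar>v x\<bar> > 1 then (norm (g x))\<^sup>2 else 0))"
    using \<epsilon> by (intro mult_nonneg_nonneg Bochner_Integration.integral_nonneg) auto
   then show ?thesis using C1(3)[OF \<epsilon>(1) \<epsilon>'(1) v(1,2) _ v(4)] v(3) mr by linarith
  qed
  have "L2_norm \<Omega> (%x. u \<epsilon> t x - u0 \<epsilon> x) <= sqrt (t * \<epsilon> * ((S + C * \<epsilon>) - (S - C1 * \<epsilon>)))"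
   by (rule flow_displacement[OF \<Omega>(1) \<Omega>l \<Omega>(4) W sol \<epsilon>(1) _ low i]) (use t in auto)
  also have "... <= sqrt (M * \<epsilon> * (C + C1))"
  proof (rule real_sqrt_le_mono)
   have "t * \<epsilon> <= M" using t \<epsilon>(1) by (simp add: pos_le_divide_eq)
   then have "t * \<epsilon> * (\<epsilon> * (C + C1)) <= M * (\<epsilon> * (C + C1))" using \<epsilon> C C1(1) by (intro mult_right_mono) auto
   then show "t * \<epsilon> * ((S + C * \<epsilon>) - (S - C1 * \<epsilon>)) <= M * \<epsilon> * (C + C1)" by (simp add: algebra_simps)
  qed
  finally have 1: "L2_norm \<Omega> (%x. u \<epsilon> t x - u0 \<epsilon> x) <= sqrt (M * \<epsilon> * (C + C1))" .
  have uL: "u \<epsilon> t \<in> L2_space \<Omega>" using sol t by (simp add: nonlocal_AC_solution_def)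
  from semi_inner_product.N_triangle[OF L2_semi_inner_product uL H1_L2[OF i(1)] f(1)]
  show ?thesis using 1 by (simp add: L2_norm_semi_inner_product D_def)
 qed
 show "((%\<epsilon>. SUP t\<in>{0..M / \<epsilon>}. ennreal (L2_norm \<Omega> (%x. u \<epsilon> t x - ?f x))) \<longlongrightarrow> 0) (at_right 0)"
 proof (rule tendsto_sandwich[of "%_. 0"])
  show "\<forall>\<^sub>F \<epsilon> in at_right 0. (SUP t\<in>{0..M / \<epsilon>}. ennreal (L2_norm \<Omega> (%x. u \<epsilon> t x - ?f x)))
    <= ennreal (sqrt (M * \<epsilon> * (C + C1)) + D \<epsilon>)"
   unfolding eventually_at_right_field
   by (rule exI[of _ \<epsilon>2]) (use \<epsilon>2 bound in \<open>auto intro!: SUP_least ennreal_leI\<close>)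
  have "((%\<epsilon>. sqrt (M * \<epsilon> * (C + C1)) + D \<epsilon>) \<longlongrightarrow> sqrt (M * 0 * (C + C1)) + 0) (at_right 0)"
   by (intro tendsto_intros lim_D)
  from tendsto_ennrealI[OF this]
  show "((%\<epsilon>. ennreal (sqrt (M * \<epsilon> * (C + C1)) + D \<epsilon>)) \<longlongrightarrow> 0) (at_right 0)" by simp
 qed auto
qed

end
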